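(* Let $n\ge2$ and $\Omega=\mathbb{R}^{n-1}\times(0,\infty)\subset\mathbb{R}^n$. For $1\le p<n$ let $T:W^{1,p}(\Omega)\to L^p(\partial\Omega)=L^p(\mathbb{R}^{n-1})$ denote the trace map. Then the following holds. (i) For any $1\le q<\infty$, the images $T\bigl(W^{1,1}(\Omega)\cap L^q(\Omega)\bigr)$ and $T\bigl(W^{1,1}(\Omega)\bigr)=L^1(\mathbb{R}^{n-1})$ coincide. (ii) For $1<p<n$ and $\frac{np}{n-p}<q<\infty$, the image $T\bigl(W^{1,p}(\Omega)\cap L^q(\Omega)\bigr)$ is a proper subspace of $T\bigl(W^{1,p}(\Omega)\bigr)=W^{1-1/p,\,p}(\mathbb{R}^{n-1})$.
   Context: Functions are real-valued. $T$ is the usual Sobolev trace operator, i.e. the continuous extension to $W^{1,p}(\Omega)$ of the restriction map $u\mapsto u|_{\partial\Omega}$ defined on $C^\infty(\overline\Omega)\cap W^{1,p}(\Omega)$; $\partial\Omega$ is identified with $\mathbb{R}^{n-1}$. $W^{s,p}(\mathbb{R}^{n-1})$ for $0<s<1$ is the fractional Sobolev (Sobolev–Slobodeckij) space. *)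

theory Defs
  imports "HOL-Analysis.Analysis" "HOL-Library.Function_Algebras"
begin

text \<open>
  Elements of \<open>L\<^sup>p\<close>, \<open>W\<close> etc. are represented by Lebesgue measurable functions on the whole type
  whose values outside the domain \<open>\<Omega>\<close> play no role. The sets below are saturated under equality
  almost everywhere in \<open>\<Omega>\<close>, so equalities, intersections and inclusions between them are the same
  as for the corresponding sets of equivalence classes.
\<close>

definition Lp :: "'a::euclidean_space set \<Rightarrow> real \<Rightarrow> ('a \<Rightarrow> real) set" where
  "Lp \<Omega> p = {u \<in> borel_measurable (lebesgue_on \<Omega>).
               integrable (lebesgue_on \<Omega>) (\<lambda>x. \<bar>u x\<bar> powr p)}"

definition Lp_norm :: "'a::euclidean_space set \<Rightarrow> real \<Rightarrow> ('a \<Rightarrow> real) \<Rightarrow> real" where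
  "Lp_norm \<Omega> p u = (LINT x|lebesgue_on \<Omega>. \<bar>u x\<bar> powr p) powr (1 / p)"

definition partial_deriv :: "'a::euclidean_space \<Rightarrow> ('a \<Rightarrow> real) \<Rightarrow> 'a \<Rightarrow> real" where
  "partial_deriv b f x = frechet_derivative f (at x) b"

primrec C_k :: "nat \<Rightarrow> ('a::euclidean_space \<Rightarrow> real) \<Rightarrow> bool" where
  "C_k 0 f \<longleftrightarrow> continuous_on UNIV f"
| "C_k (Suc k) f \<longleftrightarrow> (\<forall>x. f differentiable (at x)) \<and> (\<forall>b\<in>Basis. C_k k (partial_deriv b f))"

definition C_infinity :: "('a::euclidean_space \<Rightarrow> real) set" where
  "C_infinity = {f. \<forall>k. C_k k f}"

definition test_functions :: "'a::euclidean_space set \<Rightarrow> ('a \<Rightarrow> real) set" where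
  "test_functions \<Omega> = {\<phi> \<in> C_infinity. compact (closure {x. \<phi> x \<noteq> 0}) \<and> closure {x. \<phi> x \<noteq> 0} \<subseteq> \<Omega>}"

text \<open>Smooth functions up to the boundary: on \<open>closure \<Omega>\<close> they agree with a smooth function on
  the whole space.\<close>

definition C_infinity_closure :: "'a::euclidean_space set \<Rightarrow> ('a \<Rightarrow> real) set" where
  "C_infinity_closure \<Omega> = {u. \<exists>f\<in>C_infinity. \<forall>x\<in>closure \<Omega>. u x = f x}"

definition locally_integrable :: "'a::euclidean_space set \<Rightarrow> ('a \<Rightarrow> real) \<Rightarrow> bool" where
  "locally_integrable \<Omega> u \<longleftrightarrow> (\<forall>K. compact K \<and> K \<subseteq> \<Omega> \<longrightarrow> u absolutely_integrable_on K)"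

definition has_weak_deriv ::
  "'a::euclidean_space set \<Rightarrow> 'a \<Rightarrow> ('a \<Rightarrow> real) \<Rightarrow> ('a \<Rightarrow> real) \<Rightarrow> bool" where
  "has_weak_deriv \<Omega> b u v \<longleftrightarrow> locally_integrable \<Omega> u \<and> locally_integrable \<Omega> v \<and>
     (\<forall>\<phi>\<in>test_functions \<Omega>.
        (LINT x|lebesgue_on \<Omega>. u x * partial_deriv b \<phi> x) = - (LINT x|lebesgue_on \<Omega>. v x * \<phi> x))"

definition W1p :: "'a::euclidean_space set \<Rightarrow> real \<Rightarrow> ('a \<Rightarrow> real) set" where
  "W1p \<Omega> p = {u \<in> Lp \<Omega> p. \<forall>b\<in>Basis. \<exists>v\<in>Lp \<Omega> p. has_weak_deriv \<Omega> b u v}"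

text \<open>Weak derivatives are unique up to null sets, so the choice does not affect the norm.\<close>

definition weak_deriv :: "'a::euclidean_space set \<Rightarrow> 'a \<Rightarrow> ('a \<Rightarrow> real) \<Rightarrow> 'a \<Rightarrow> real" where
  "weak_deriv \<Omega> b u = (SOME v. has_weak_deriv \<Omega> b u v)"

definition W1p_norm :: "'a::euclidean_space set \<Rightarrow> real \<Rightarrow> ('a \<Rightarrow> real) \<Rightarrow> real" where
  "W1p_norm \<Omega> p u =
     (Lp_norm \<Omega> p u powr p + (\<Sum>b\<in>Basis. Lp_norm \<Omega> p (weak_deriv \<Omega> b u) powr p)) powr (1 / p)"

text \<open>The Sobolev--Slobodeckij space on the whole space \<open>'a\<close>. The integrand is \<open>0\<close> on the
  diagonal, which is a null set.\<close>

definition Wsp :: "real \<Rightarrow> real \<Rightarrow> ('a::euclidean_space \<Rightarrow> real) set" where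
  "Wsp s p = {g \<in> Lp UNIV p.
     integrable lebesgue
       (\<lambda>(x, y). \<bar>g x - g y\<bar> powr p / norm (x - y) powr (real DIM('a) + s * p))}"

definition half_space :: "('a::euclidean_space \<times> real) set" where
  "half_space = UNIV \<times> {0<..}"

text \<open>The boundary of the half space is identified with \<open>'a\<close> through \<open>y \<mapsto> (y, 0)\<close>. As the
  functions stand for classes, \<open>T u\<close> is only determined almost everywhere; continuity forces \<open>T\<close>
  to respect equality almost everywhere.\<close>

definition is_trace_operator ::
  "real \<Rightarrow> (('a::euclidean_space \<times> real \<Rightarrow> real) \<Rightarrow> ('a \<Rightarrow> real)) \<Rightarrow> bool" where
  "is_trace_operator p T \<longleftrightarrow>
     (\<forall>u\<in>W1p half_space p. T u \<in> Lp UNIV p) \<and>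
     (\<forall>u\<in>C_infinity_closure half_space \<inter> W1p half_space p.
        AE y in lebesgue. T u y = u (y, 0)) \<and>
     (\<forall>u\<in>W1p half_space p. \<forall>e>0. \<exists>d>0. \<forall>v\<in>W1p half_space p.
        W1p_norm half_space p (v - u) < d \<longrightarrow> Lp_norm UNIV p (T v - T u) < e)"

definition trace_operator ::
  "real \<Rightarrow> ('a::euclidean_space \<times> real \<Rightarrow> real) \<Rightarrow> ('a \<Rightarrow> real)" where
  "trace_operator p = (SOME T. is_trace_operator p T)"

text \<open>The image of a set under the trace operator, as a saturated set of functions.\<close>

definition trace_image ::
  "real \<Rightarrow> ('a::euclidean_space \<times> real \<Rightarrow> real) set \<Rightarrow> ('a \<Rightarrow> real) set" where
  "trace_image p X =
     {g \<in> borel_measurable lebesgue. \<exists>u\<in>X. AE y in lebesgue. g y = trace_operator p u y}"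

text \<open>Linear subspaces of spaces of functions with the pointwise operations.\<close>

abbreviation fun_subspace :: "('a \<Rightarrow> real) set \<Rightarrow> bool" where
  "fun_subspace \<equiv> module.subspace (\<lambda>(c::real) f x. c * f x)"

end

theory Submission
  imports Defs
begin

text \<open>
  Write \<open>m\<close> for the dimension of the boundary, so that \<open>n = m + 1\<close>.

  The trace has an explicit form. The derivative of \<open>t \<mapsto> - (1 - t) * u (y, t)\<close> is
  \<open>u - (1 - t) * \<partial>u/\<partial>t\<close>, so for smooth \<open>u\<close> the integral of the latter over \<open>0 < t < 1\<close> is
  \<open>u (y, 0)\<close>. This integral, \<open>etr\<close>, makes sense for \<open>u\<close> and its weak normal derivative and is
  bounded in \<open>L\<^sup>p\<close> by the Sobolev norm, so it defines a trace operator
  (\<open>explicit_trace_is_trace\<close>). A mollifier supported inside the half space averages only over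
  points above its argument; mollifying with it therefore gives functions that are smooth up to
  the boundary, commutes with weak derivatives on the closed half space, and converges in the
  Sobolev norm. This density makes the trace unique (\<open>trace_operator_unique\<close>), and membership
  in a trace image becomes a statement about \<open>etr\<close> (\<open>trace_image_iff\<close>).

  For \<open>p > 1\<close> the Slobodeckij integral of \<open>g\<close> is, by Fubini, a multiple of the integral over
  \<open>r > 0\<close> of \<open>r powr - (m + p)\<close> times the integral over \<open>norm h < r\<close> of the \<open>p\<close>-th power
  of the \<open>L\<^sup>p\<close> norm of \<open>g (x + h) - g x\<close> (\<open>gag_eq_Slobodeckij\<close>). To bound it for a trace,
  connect \<open>(y, 0)\<close> and \<open>(y + h, 0)\<close> by going up to height \<open>r\<close>, across by \<open>h\<close> and down again:
  Hardy's inequality controls the vertical pieces and the fundamental theorem of calculus the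
  horizontal one (\<open>gagliardo_smooth\<close>). Conversely, \<open>g\<close> is extended by letting the value at height
  \<open>t\<close> be its mollification at scale \<open>t\<close>, cut off above height \<open>1\<close>. Apart from the derivative of
  the cutoff, every first derivative is \<open>1 / t\<close> times a convolution with a kernel of mean zero, so
  its mass at height \<open>t\<close> is bounded by the inner integral at \<open>r = t\<close> (\<open>moll_mean_zero_mass\<close>), and
  integration over \<open>t\<close> gives back the energy (\<open>gagliardo_extension\<close>).

  For \<open>p = 1\<close> choose smooth \<open>G k\<close> that converge to \<open>g\<close> geometrically fast in \<open>L\<^sup>1\<close> and extend by
  the sum over \<open>k\<close> of \<open>(G k - G (k - 1)) (y) * cutoff (t / \<tau> k)\<close>. The normal derivative of the
  \<open>k\<close>-th term is of size \<open>1 / \<tau> k\<close> on a layer of width \<open>\<tau> k\<close>, so that its \<open>L\<^sup>1\<close> norm is a multiple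
  of that of \<open>G k - G (k - 1)\<close> whatever \<open>\<tau> k\<close> is. The horizontal derivatives and the \<open>L\<^sup>q\<close> mass of
  the term carry a factor \<open>\<tau> k\<close>, so they are summable once \<open>\<tau>\<close> decreases fast enough. Hence every
  integrable \<open>g\<close> is the trace of a function in \<open>L\<^sup>q\<close> (\<open>L1_extension\<close>).

  For \<open>p > 1\<close> this fails. The fundamental theorem of calculus for \<open>\<bar>u\<bar> powr r\<close> and Young's
  inequality show that traces of functions that also lie in \<open>L\<^sup>q\<close> are in \<open>L\<^sup>r\<close> for
  \<open>r = 1 + q * (p - 1) / p\<close> (\<open>trace_power_integrable\<close>). The condition \<open>n * p / (n - p) < q\<close> says
  precisely that \<open>r\<close> exceeds the Sobolev trace exponent \<open>p * m / (n - p)\<close>. For \<open>\<alpha> = m / r\<close> this means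
  \<open>(\<alpha> + 1) * p < n\<close>, so the function \<open>norm x powr - \<alpha>\<close>, cut off away from the origin, has a gradient in
  \<open>L\<^sup>p\<close>, while the \<open>r\<close>-th power of its trace is the borderline function \<open>norm y powr - m\<close>, which is not
  integrable (\<open>spike_trace\<close>, \<open>spike_not_Lr\<close>).
\<close>


section \<open>Smooth functions\<close>

lemma exp_ge_power_over_fact:
  fixes x :: real
  assumes "x \<ge> 0"
  shows "x ^ n / fact n \<le> exp x"
proof -
  have "(\<Sum>i\<in>{n}. x ^ i /\<^sub>R fact i) \<le> (\<Sum>i. x ^ i /\<^sub>R fact i)"
    using assms sums_summable[OF exp_converges[of x]] by (intro sum_le_suminf) auto
  then show ?thesis
    by (simp add: exp_def scaleR_conv_of_real field_simps)
qed

text \<open>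
  Up to linear combinations this family is closed under differentiation (\<open>DERIV_flat\<close>), which
  gives smoothness of the standard bump, the case \<open>j = 0\<close>, without formulas for its higher
  derivatives.
\<close>

definition flat :: "nat \<Rightarrow> real \<Rightarrow> real" where
  "flat j t = (if t > 0 then exp (- (1 / t)) / t ^ j else 0)"

text \<open>Quadratic decay at the origin yields the derivative \<open>0\<close> there.\<close>

lemma flat_bound: "\<bar>flat j t\<bar> \<le> fact (j + 2) * t\<^sup>2"
proof (cases "t > 0")
  case True
  have "(1 / t) ^ (j + 2) / fact (j + 2) \<le> exp (1 / t)"
    using True by (intro exp_ge_power_over_fact) auto
  then have "1 \<le> exp (1 / t) * (fact (j + 2) * t ^ (j + 2))"
    using True by (simp add: field_simps del: fact_Suc)
  then have "exp (- (1 / t)) \<le> fact (j + 2) * t ^ (j + 2)"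
    by (simp add: exp_minus field_simps del: fact_Suc power_Suc)
  then show ?thesis
    using True by (simp add: flat_def power_add field_simps power2_eq_square del: fact_Suc)
qed (simp add: flat_def)

lemma DERIV_flat: "(flat j has_real_derivative flat (j + 2) t - real j * flat (j + 1) t) (at t)"
proof -
  consider "t > 0" | "t < 0" | "t = 0" by linarith
  then show ?thesis
  proof cases
    case 1
    have "((\<lambda>t. exp (- (1 / t)) / t ^ j) has_real_derivative flat (j + 2) t - real j * flat (j + 1) t) (at t)"
      using 1 by (auto intro!: derivative_eq_intros simp: flat_def field_simps power2_eq_square)
        (cases j; simp add: field_simps)
    then show ?thesis
      by (rule DERIV_cong_ev[THEN iffD1, rotated -1])
        (auto simp: flat_def intro!: eventually_mono[OF eventually_gt_at_top[of 0]]
          eventually_nhds_in_open[of "{0<..}" t, THEN eventually_mono] 1)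
  next
    case 2
    have "((\<lambda>t. 0) has_real_derivative flat (j + 2) t - real j * flat (j + 1) t) (at t)"
      using 2 by (simp add: flat_def)
    then show ?thesis
      by (rule DERIV_cong_ev[THEN iffD1, rotated -1])
        (auto simp: flat_def 2 intro!: eventually_nhds_in_open[of "{..<0}" t, THEN eventually_mono])
  next
    case 3
    have "((\<lambda>h. (flat j (0 + h) - flat j 0) / h) \<longlongrightarrow> 0) (at 0)"
    proof (rule Lim_null_comparison)
      show "eventually (\<lambda>h. norm ((flat j (0 + h) - flat j 0) / h) \<le> fact (j + 2) * \<bar>h\<bar>) (at 0)"
        using flat_bound[of j]
        by (auto simp: eventually_at_filter flat_def[of j 0] divide_simps power2_eq_square abs_mult
            intro!: always_eventually simp del: fact_Suc) (simp add: abs_mult_self_eq mult.assoc)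
      show "((\<lambda>h. fact (j + 2) * \<bar>h\<bar>) \<longlongrightarrow> (0::real)) (at 0)"
        by (rule tendsto_eq_intros refl | simp)+
    qed
    then show ?thesis
      using 3 by (simp add: DERIV_def flat_def)
  qed
qed

text \<open>
  The class contains the bump \<open>exp (- 1 / (1 - x \<bullet> x))\<close> on the unit ball and is closed under
  partial derivatives, which makes its members smooth by coinduction.
\<close>

inductive bump_algebra :: "('a::euclidean_space \<Rightarrow> real) \<Rightarrow> bool" where
  base: "bump_algebra (\<lambda>x. flat j (1 - x \<bullet> x))"
| add: "bump_algebra f \<Longrightarrow> bump_algebra g \<Longrightarrow> bump_algebra (\<lambda>x. f x + g x)"
| scale: "bump_algebra f \<Longrightarrow> bump_algebra (\<lambda>x. c * f x)"
| coord: "bump_algebra f \<Longrightarrow> bump_algebra (\<lambda>x. (x \<bullet> b) * f x)"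

lemma partial_deriv_eq:
  "(f has_derivative f') (at x) \<Longrightarrow> partial_deriv b f x = f' b"
  unfolding partial_deriv_def by (metis frechet_derivative_at)

lemma bump_algebra_diff:
  assumes "bump_algebra f"
  shows "f differentiable (at x)" "bump_algebra (partial_deriv b f)"
proof -
  have "\<exists>D. (\<forall>x. (f has_derivative D x) (at x)) \<and> (\<forall>b. bump_algebra (\<lambda>x. D x b))"
    using assms
  proof induction
    case (base j)
    have 1: "((\<lambda>x::'a. flat j (1 - x \<bullet> x)) has_derivative
        (\<lambda>h. (-2 * (h \<bullet> x)) * (flat (j + 2) (1 - x \<bullet> x) - real j * flat (j + 1) (1 - x \<bullet> x)))) (at x)" for x
    proof -
      have "((\<lambda>x::'a. 1 - x \<bullet> x) has_derivative (\<lambda>h. -2 * (h \<bullet> x))) (at x)"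
        by (auto intro!: derivative_eq_intros simp: inner_commute)
      from DERIV_compose_FDERIV[OF DERIV_flat this] show ?thesis by simp
    qed
    have 2: "bump_algebra (\<lambda>x::'a. (-2 * (b \<bullet> x)) * (flat (j + 2) (1 - x \<bullet> x) - real j * flat (j + 1) (1 - x \<bullet> x)))" for b
    proof -
      have "bump_algebra (\<lambda>x::'a. -2 * ((x \<bullet> b) * (flat (j + 2) (1 - x \<bullet> x) + (- real j) * flat (j + 1) (1 - x \<bullet> x))))"
        by (intro bump_algebra.intros)
      then show ?thesis by (simp add: algebra_simps inner_commute)
    qed
    show ?case
      by (rule exI[of _ "\<lambda>x h. (-2 * (h \<bullet> x)) * (flat (j + 2) (1 - x \<bullet> x) - real j * flat (j + 1) (1 - x \<bullet> x))"])
        (use 1 2 in blast)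
  next
    case (add f g)
    then obtain D E where "\<And>x. (f has_derivative D x) (at x)" "\<And>b. bump_algebra (\<lambda>x. D x b)"
      "\<And>x. (g has_derivative E x) (at x)" "\<And>b. bump_algebra (\<lambda>x. E x b)" by auto
    then show ?case
      by (intro exI[of _ "\<lambda>x h. D x h + E x h"] conjI allI has_derivative_add bump_algebra.intros)
  next
    case (scale f c)
    then obtain D where "\<And>x. (f has_derivative D x) (at x)" "\<And>b. bump_algebra (\<lambda>x. D x b)" by auto
    then show ?case
      by (intro exI[of _ "\<lambda>x h. c * D x h"] conjI allI has_derivative_mult_right bump_algebra.intros)
  next
    case (coord f c)
    then obtain D where *: "\<And>x. (f has_derivative D x) (at x)" "\<And>b. bump_algebra (\<lambda>x. D x b)" by auto
    have "((\<lambda>x. (x \<bullet> c) * f x) has_derivative (\<lambda>h. (x \<bullet> c) * D x h + (h \<bullet> c) * f x)) (at x)" for x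
      by (auto intro!: derivative_eq_intros *)
    moreover have "bump_algebra (\<lambda>x. (x \<bullet> c) * D x b + (b \<bullet> c) * f x)" for b
      by (intro bump_algebra.intros * coord)
    ultimately show ?case
      by (intro exI[of _ "\<lambda>x h. (x \<bullet> c) * D x h + (h \<bullet> c) * f x"]) auto
  qed
  then obtain D where *: "\<And>x. (f has_derivative D x) (at x)" "\<And>b. bump_algebra (\<lambda>x. D x b)" by auto
  then show "f differentiable (at x)" by (auto simp: differentiable_def)
  have "partial_deriv b f = (\<lambda>x. D x b)"
    using partial_deriv_eq[OF *(1)] by auto
  then show "bump_algebra (partial_deriv b f)" using *(2) by simp
qed

lemma C_infinityD:
  assumes "f \<in> C_infinity"
  shows "f differentiable (at x)" "b \<in> Basis \<Longrightarrow> partial_deriv b f \<in> C_infinity"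
    "continuous_on UNIV f"
proof -
  have *: "C_k k f" for k using assms by (auto simp: C_infinity_def)
  show "f differentiable (at x)" using *[of 1] by simp
  show "b \<in> Basis \<Longrightarrow> partial_deriv b f \<in> C_infinity"
    using *[of "Suc _"] by (auto simp: C_infinity_def)
  show "continuous_on UNIV f" using *[of 0] by simp
qed

text \<open>
  Membership in a class of differentiable functions that is closed under partial derivatives
  replaces any induction over the order of differentiation.
\<close>

lemma C_infinity_coinduct:
  assumes "f \<in> X" "\<And>f x. f \<in> X \<Longrightarrow> f differentiable (at x)"
    "\<And>f b. f \<in> X \<Longrightarrow> b \<in> Basis \<Longrightarrow> partial_deriv b f \<in> X"
  shows "f \<in> C_infinity"
proof -
  have "C_k k f" for k
    using assms(1)
  proof (induction k arbitrary: f)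
    case 0
    then show ?case
      using assms(2) by (auto simp: continuous_on_eq_continuous_at differentiable_imp_continuous_within)
  qed (use assms in auto)
  then show ?thesis by (auto simp: C_infinity_def)
qed

lemma bump_algebra_C_infinity: "bump_algebra f \<Longrightarrow> f \<in> C_infinity"
  by (rule C_infinity_coinduct[of _ "Collect bump_algebra"]) (auto simp: bump_algebra_diff)

lemma C_infinity_affine:
  fixes f :: "'a::euclidean_space \<Rightarrow> real"
  assumes "f \<in> C_infinity"
  shows "(\<lambda>x. c * f (r *\<^sub>R (x - a))) \<in> C_infinity"
proof (rule C_infinity_coinduct[of _ "{(\<lambda>x. c * f (r *\<^sub>R (x - a))) |c f. f \<in> C_infinity}"])
  fix g :: "'a \<Rightarrow> real" and x
  assume "g \<in> {(\<lambda>x. c * f (r *\<^sub>R (x - a))) |c f. f \<in> C_infinity}"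
  then obtain c f where g: "g = (\<lambda>x. c * f (r *\<^sub>R (x - a)))" and f: "f \<in> C_infinity" by auto
  have D: "(g has_derivative (\<lambda>h. c * frechet_derivative f (at (r *\<^sub>R (x - a))) (r *\<^sub>R h))) (at x)" for x
  proof -
    have "(f has_derivative frechet_derivative f (at (r *\<^sub>R (x - a)))) (at (r *\<^sub>R (x - a)))"
      using C_infinityD(1)[OF f] frechet_derivative_works by blast
    moreover have "((\<lambda>x. r *\<^sub>R (x - a)) has_derivative (\<lambda>h. r *\<^sub>R h)) (at x)"
      by (auto intro!: derivative_eq_intros)
    ultimately have "((\<lambda>x. f (r *\<^sub>R (x - a))) has_derivative (\<lambda>h. frechet_derivative f (at (r *\<^sub>R (x - a))) (r *\<^sub>R h))) (at x)"
      by (rule has_derivative_compose[rotated])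
    then show ?thesis unfolding g by (rule has_derivative_mult_right)
  qed
  then show "g differentiable at x" by (auto simp: differentiable_def)
  fix b :: 'a assume b: "b \<in> Basis"
  have "partial_deriv b g = (\<lambda>x. (c * r) * partial_deriv b f (r *\<^sub>R (x - a)))"
  proof
    fix x
    have "linear (frechet_derivative f (at (r *\<^sub>R (x - a))))"
      using C_infinityD(1)[OF f] by (rule linear_frechet_derivative)
    then show "partial_deriv b g x = (c * r) * partial_deriv b f (r *\<^sub>R (x - a))"
      by (subst partial_deriv_eq[OF D]) (simp add: partial_deriv_def linear_cmul)
  qed
  then show "partial_deriv b g \<in> {(\<lambda>x. c * f (r *\<^sub>R (x - a))) |c f. f \<in> C_infinity}"
    using C_infinityD(2)[OF f b] by blast
qed (use assms in blast)

lemma partial_deriv_affine: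
  fixes f :: "'a::euclidean_space \<Rightarrow> real"
  assumes "f \<in> C_infinity"
  shows "partial_deriv b (\<lambda>x. c * f (r *\<^sub>R (x - a))) x = c * r * partial_deriv b f (r *\<^sub>R (x - a))"
proof -
  have "(f has_derivative frechet_derivative f (at (r *\<^sub>R (x - a)))) (at (r *\<^sub>R (x - a)))"
    using C_infinityD(1)[OF assms] frechet_derivative_works by blast
  moreover have "((\<lambda>x. r *\<^sub>R (x - a)) has_derivative (\<lambda>h. r *\<^sub>R h)) (at x)"
    by (auto intro!: derivative_eq_intros)
  ultimately have "((\<lambda>x. f (r *\<^sub>R (x - a))) has_derivative (\<lambda>h. frechet_derivative f (at (r *\<^sub>R (x - a))) (r *\<^sub>R h))) (at x)"
    by (rule has_derivative_compose[rotated])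
  then have D: "((\<lambda>x. c * f (r *\<^sub>R (x - a))) has_derivative (\<lambda>h. c * frechet_derivative f (at (r *\<^sub>R (x - a))) (r *\<^sub>R h))) (at x)"
    by (rule has_derivative_mult_right)
  have "linear (frechet_derivative f (at (r *\<^sub>R (x - a))))"
    using C_infinityD(1)[OF assms] by (rule linear_frechet_derivative)
  then show ?thesis
    by (subst partial_deriv_eq[OF D]) (simp add: partial_deriv_def linear_cmul)
qed

text \<open>
  Vanishing outside some compact subset of \<open>S\<close> is easier to propagate through constructions than a
  condition on the closure of the support.
\<close>

lemma test_functionsI:
  fixes f :: "'a::euclidean_space \<Rightarrow> real"
  assumes "f \<in> C_infinity" "compact K" "K \<subseteq> S" "\<And>x. x \<notin> K \<Longrightarrow> f x = 0"
  shows "f \<in> test_functions S"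
proof -
  have b: "bounded {x. f x \<noteq> 0}"
    by (rule bounded_subset[OF compact_imp_bounded[OF assms(2)]]) (use assms(4) in auto)
  have "closure {x. f x \<noteq> 0} \<subseteq> K"
    by (rule closure_minimal) (use assms in \<open>auto simp: compact_imp_closed\<close>)
  then show ?thesis
    using assms by (auto simp: test_functions_def compact_closure b)
qed

lemma test_functionsE:
  assumes "f \<in> test_functions S"
  obtains K where "f \<in> C_infinity" "compact K" "K \<subseteq> S" "\<And>x. x \<notin> K \<Longrightarrow> f x = 0"
  using assms closure_subset[of "{x. f x \<noteq> 0}"] unfolding test_functions_def by blast

lemma bounded_by_cball:
  assumes "compact K"
  obtains R where "R > 0" "K \<subseteq> cball 0 R"
  using bounded_subset_ballD[OF compact_imp_bounded[OF assms], of 0] ball_subset_cball by (metis order_trans)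

lemma partial_deriv_zero_outside:
  assumes "closed K" "\<And>x. x \<notin> K \<Longrightarrow> f x = 0" "x \<notin> K"
  shows "partial_deriv b f x = 0"
proof -
  have "((\<lambda>_. 0) has_derivative (\<lambda>_. 0)) (at x)" by simp
  then have "(f has_derivative (\<lambda>_. 0)) (at x)"
    by (rule has_derivative_transform_within_open[of _ _ _ _ "-K"]) (use assms in auto)
  from partial_deriv_eq[OF this] show ?thesis .
qed

lemma partial_deriv_test_function:
  assumes "f \<in> test_functions S" "b \<in> Basis"
  shows "partial_deriv b f \<in> test_functions S"
proof -
  from test_functionsE[OF assms(1)] obtain K where K: "f \<in> C_infinity" "compact K" "K \<subseteq> S" "\<And>x. x \<notin> K \<Longrightarrow> f x = 0"
    by metis
  show ?thesis
    using K C_infinityD(2)[OF K(1) assms(2)]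
    by (intro test_functionsI[of _ K]) (auto intro: partial_deriv_zero_outside[OF compact_imp_closed])
qed

lemma test_function_affine:
  fixes f :: "'a::euclidean_space \<Rightarrow> real"
  assumes "f \<in> test_functions S" "r \<noteq> 0" "\<And>x. r *\<^sub>R (x - a) \<in> S \<Longrightarrow> x \<in> S'"
  shows "(\<lambda>x. c * f (r *\<^sub>R (x - a))) \<in> test_functions S'"
proof -
  from test_functionsE[OF assms(1)] obtain K where K: "f \<in> C_infinity" "compact K" "K \<subseteq> S" "\<And>x. x \<notin> K \<Longrightarrow> f x = 0"
    by metis
  let ?K = "(\<lambda>x. a + (1 / r) *\<^sub>R x) ` K"
  have "compact ?K" by (intro compact_continuous_image continuous_intros K)
  moreover have *: "r *\<^sub>R (x - a) \<in> K \<longleftrightarrow> x \<in> ?K" for x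
  proof
    assume "r *\<^sub>R (x - a) \<in> K"
    moreover have "x = a + (1 / r) *\<^sub>R (r *\<^sub>R (x - a))" using \<open>r \<noteq> 0\<close> by simp
    ultimately show "x \<in> ?K" by blast
  qed (use \<open>r \<noteq> 0\<close> in auto)
  moreover have "?K \<subseteq> S'"
    using * assms(3) K(3) by blast
  ultimately show ?thesis
    using K by (intro test_functionsI[of _ ?K] C_infinity_affine) (use K in auto)
qed

lemma test_function_bounded:
  fixes f :: "'a::euclidean_space \<Rightarrow> real"
  assumes "f \<in> test_functions S"
  obtains B R where "B > 0" "R > 0" "\<And>x. \<bar>f x\<bar> \<le> B * indicator (cball 0 R) x" "\<And>x. \<bar>f x\<bar> \<le> B"
proof -
  from test_functionsE[OF assms(1)] obtain K where K: "f \<in> C_infinity" "compact K" "K \<subseteq> S" "\<And>x. x \<notin> K \<Longrightarrow> f x = 0"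
    by metis
  obtain R where R: "R > 0" "K \<subseteq> cball 0 R" using bounded_by_cball[OF K(2)] .
  have "compact (f ` cball 0 R)"
    using C_infinityD(3)[OF K(1)] by (intro compact_continuous_image) (auto intro: continuous_on_subset)
  then obtain B where B: "B > 0" "\<And>x. x \<in> cball 0 R \<Longrightarrow> \<bar>f x\<bar> \<le> B"
    using compact_imp_bounded[THEN bounded_pos[THEN iffD1]] by (metis imageI real_norm_def)
  have *: "\<bar>f x\<bar> \<le> B * indicator (cball 0 R) x" for x
    using B R(2) K(4)[of x] by (cases "x \<in> K"; cases "x \<in> cball 0 R") auto
  moreover have "\<bar>f x\<bar> \<le> B" for x
    using *[of x] B(1) by (cases "x \<in> cball 0 R") auto
  ultimately show ?thesis using that B R by blast
qed

lemma test_function_borel [measurable_dest]: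
  "f \<in> test_functions S \<Longrightarrow> f \<in> borel_measurable borel"
  by (metis C_infinityD(3) borel_measurable_continuous_onI test_functionsE)

lemma test_function_integrable:
  fixes f :: "'a::euclidean_space \<Rightarrow> real"
  assumes "f \<in> test_functions S"
  shows "integrable lborel f"
proof -
  obtain B R where BR: "B > 0" "R > 0" "\<And>x. \<bar>f x\<bar> \<le> B * indicator (cball 0 R) x"
    using test_function_bounded[OF assms] by metis
  have "integrable lborel (\<lambda>x::'a. B * indicator (cball 0 R) x)"
    by (intro integrable_mult_right integrable_real_indicator) (use BR(2) in \<open>auto simp: emeasure_cball\<close>)
  then show ?thesis
    by (rule Bochner_Integration.integrable_bound) (use BR assms in \<open>auto intro!: AE_I2 test_function_borel simp: abs_mult\<close>)
qed

text \<open>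
  The rescaled bump is positive on an open ball, so its integral is positive and can be
  normalised.
\<close>

lemma exists_mollifier:
  fixes a :: "'a::euclidean_space"
  assumes "r > 0"
  obtains \<phi> where "\<phi> \<in> test_functions (cball a r)" "\<And>x. \<phi> x \<ge> 0" "integral\<^sup>L lborel \<phi> = 1"
proof -
  define f :: "'a \<Rightarrow> real" where "f = (\<lambda>x. flat 0 (1 - x \<bullet> x))"
  have fC: "f \<in> C_infinity" unfolding f_def by (intro bump_algebra_C_infinity bump_algebra.intros)
  define g where "g = (\<lambda>x. 1 * f ((1 / r) *\<^sub>R (x - a)))"
  have ft: "f \<in> test_functions (cball 0 1)"
  proof (rule test_functionsI[OF fC])
    fix x :: 'a assume "x \<notin> cball 0 1"
    then have "x \<bullet> x > 1" using real_less_rsqrt[of 1 "x \<bullet> x"]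
      by (metis dist_0_norm linorder_not_less mem_cball norm_eq_sqrt_inner real_sqrt_le_1_iff)
    then show "f x = 0" by (simp add: f_def flat_def)
  qed auto
  have gt: "g \<in> test_functions (cball a r)"
    unfolding g_def
    by (rule test_function_affine[OF ft]) (use assms in \<open>auto simp: dist_norm norm_minus_commute divide_simps simp flip: scaleR_diff_right\<close>)
  have g0: "g x \<ge> 0" for x by (simp add: g_def f_def flat_def)
  have gi: "integrable lborel g" by (rule test_function_integrable[OF gt])
  have "integral\<^sup>L lborel g \<noteq> 0"
  proof
    assume "integral\<^sup>L lborel g = 0"
    then have "AE x in lborel. g x = 0"
      using integral_nonneg_eq_0_iff_AE[OF gi] g0 by auto
    moreover have "g x > 0" if "x \<in> ball a r" for x
    proof -
      have "norm ((1 / r) *\<^sub>R (x - a)) < 1"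
        using that assms by (simp add: dist_norm norm_minus_commute divide_simps flip: scaleR_diff_right)
      then have "((1 / r) *\<^sub>R (x - a)) \<bullet> ((1 / r) *\<^sub>R (x - a)) < 1"
        unfolding dot_square_norm by (simp add: power_less_one_iff abs_square_less_1)
      then show ?thesis by (simp add: g_def f_def flat_def)
    qed
    ultimately have "AE x in lborel. x \<notin> ball a r" by force
    then have "emeasure lborel (ball a r) = 0"
      by (subst (asm) AE_iff_measurable[of "ball a r"]) auto
    then show False using assms unit_ball_vol_pos[of "real DIM('a)"] by (simp add: emeasure_ball)
  qed
  moreover have "integral\<^sup>L lborel g \<ge> 0" using g0 by simp
  ultimately have I: "integral\<^sup>L lborel g > 0" by simp
  have "(\<lambda>x. (1 / integral\<^sup>L lborel g) * g (1 *\<^sub>R (x - 0))) \<in> test_functions (cball a r)"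
    by (rule test_function_affine[OF gt]) auto
  then show ?thesis
    using I g0 gi by (intro that[of "\<lambda>x. (1 / integral\<^sup>L lborel g) * g x"]) auto
qed

section \<open>Masses of p-th powers\<close>

text \<open>
  The \<open>p\<close>-th power of the \<open>L\<^sup>p\<close> norm as an extended number: it is meaningful without
  integrability, Tonelli's theorem applies to it directly, and the triangle inequality with the
  factor \<open>2 powr p\<close> (\<open>Lp_mass_triangle\<close>) replaces Minkowski's inequality.
\<close>

definition Lp_mass :: "'a measure \<Rightarrow> real \<Rightarrow> ('a \<Rightarrow> real) \<Rightarrow> ennreal" where
  "Lp_mass M p f = (\<integral>\<^sup>+x. ennreal (\<bar>f x\<bar> powr p) \<partial>M)"

abbreviation pmass :: "real \<Rightarrow> ('a::euclidean_space \<Rightarrow> real) \<Rightarrow> ennreal" where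
  "pmass \<equiv> Lp_mass lborel"

lemma powr_add_le:
  fixes a b p :: real
  assumes "p \<ge> 0"
  shows "\<bar>a + b\<bar> powr p \<le> 2 powr p * (\<bar>a\<bar> powr p + \<bar>b\<bar> powr p)"
proof -
  have "\<bar>a + b\<bar> powr p \<le> (2 * max \<bar>a\<bar> \<bar>b\<bar>) powr p"
    using assms by (intro powr_mono2) auto
  also have "\<dots> = 2 powr p * (max \<bar>a\<bar> \<bar>b\<bar>) powr p"
    by (simp add: powr_mult)
  also have "\<dots> \<le> 2 powr p * (\<bar>a\<bar> powr p + \<bar>b\<bar> powr p)"
    by (intro mult_left_mono) (auto simp: max_def)
  finally show ?thesis .
qed

lemma Lp_mass_mono:
  "p \<ge> 0 \<Longrightarrow> (AE x in M. \<bar>f x\<bar> \<le> \<bar>g x\<bar>) \<Longrightarrow> Lp_mass M p f \<le> Lp_mass M p g"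
  unfolding Lp_mass_def by (intro nn_integral_mono_AE) (auto intro!: ennreal_leI powr_mono2 elim!: eventually_mono)

lemma Lp_mass_cong_AE: "(AE x in M. f x = g x) \<Longrightarrow> Lp_mass M p f = Lp_mass M p g"
  unfolding Lp_mass_def by (intro nn_integral_cong_AE) (auto elim!: eventually_mono)

lemma Lp_mass_add:
  assumes [measurable]: "f \<in> borel_measurable M" "g \<in> borel_measurable M" and "p \<ge> 0"
  shows "Lp_mass M p (\<lambda>x. f x + g x) \<le> ennreal (2 powr p) * (Lp_mass M p f + Lp_mass M p g)"
proof -
  have "Lp_mass M p (\<lambda>x. f x + g x) \<le> (\<integral>\<^sup>+x. ennreal (2 powr p) * (ennreal (\<bar>f x\<bar> powr p) + ennreal (\<bar>g x\<bar> powr p)) \<partial>M)"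
    unfolding Lp_mass_def
  proof (rule nn_integral_mono)
    fix x
    have "ennreal (\<bar>f x + g x\<bar> powr p) \<le> ennreal (2 powr p * (\<bar>f x\<bar> powr p + \<bar>g x\<bar> powr p))"
      by (intro ennreal_leI powr_add_le assms)
    then show "ennreal (\<bar>f x + g x\<bar> powr p) \<le> ennreal (2 powr p) * (ennreal (\<bar>f x\<bar> powr p) + ennreal (\<bar>g x\<bar> powr p))"
      by (simp add: ennreal_mult)
  qed
  also have "\<dots> = ennreal (2 powr p) * (Lp_mass M p f + Lp_mass M p g)"
    by (simp add: Lp_mass_def nn_integral_cmult nn_integral_add)
  finally show ?thesis .
qed

lemma Lp_mass_uminus: "Lp_mass M p (\<lambda>x. - f x) = Lp_mass M p f"
  by (simp add: Lp_mass_def)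

lemma Lp_mass_diff_commute: "Lp_mass M p (\<lambda>x. f x - g x) = Lp_mass M p (\<lambda>x. g x - f x)"
  by (simp add: Lp_mass_def abs_minus_commute)

lemma Lp_mass_diff:
  assumes [measurable]: "f \<in> borel_measurable M" "g \<in> borel_measurable M" and "p \<ge> 0"
  shows "Lp_mass M p (\<lambda>x. f x - g x) \<le> ennreal (2 powr p) * (Lp_mass M p f + Lp_mass M p g)"
  using Lp_mass_add[of f M "\<lambda>x. - g x" p] assms by (simp add: Lp_mass_uminus)

lemma Lp_mass_triangle:
  assumes [measurable]: "f \<in> borel_measurable M" "g \<in> borel_measurable M" "h \<in> borel_measurable M" and "p \<ge> 0"
  shows "Lp_mass M p (\<lambda>x. f x - h x) \<le> ennreal (2 powr p) * (Lp_mass M p (\<lambda>x. f x - g x) + Lp_mass M p (\<lambda>x. g x - h x))"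
  using Lp_mass_add[of "\<lambda>x. f x - g x" M "\<lambda>x. g x - h x" p] assms by simp

lemma Lp_mass_scale:
  assumes [measurable]: "f \<in> borel_measurable M"
  shows "Lp_mass M p (\<lambda>x. c * f x) = ennreal (\<bar>c\<bar> powr p) * Lp_mass M p f"
  unfolding Lp_mass_def by (subst nn_integral_cmult[symmetric]) (auto simp: abs_mult powr_mult ennreal_mult)

lemma Lp_mass_zero_imp_AE:
  assumes [measurable]: "f \<in> borel_measurable M" and "Lp_mass M p f = 0"
  shows "AE x in M. f x = 0"
  using assms(2) unfolding Lp_mass_def
  by (subst (asm) nn_integral_0_iff_AE) (auto elim!: eventually_mono)

lemma nn_integral_tendsto_0:
  assumes [measurable]: "\<And>i. u i \<in> borel_measurable M" "w \<in> borel_measurable M"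
    and "\<And>j. AE x in M. u j x \<le> w x" "(\<integral>\<^sup>+x. w x \<partial>M) < \<infinity>" "AE x in M. (\<lambda>i. u i x) \<longlonglongrightarrow> 0"
  shows "(\<lambda>i. (\<integral>\<^sup>+x. u i x \<partial>M)) \<longlonglongrightarrow> 0"
  using nn_integral_dominated_convergence[of u M "\<lambda>_. 0" w] assms by simp

lemma ennreal_tendsto_0I:
  fixes X :: "nat \<Rightarrow> ennreal"
  assumes "\<And>e::real. e > 0 \<Longrightarrow> \<forall>\<^sub>F k in sequentially. X k \<le> ennreal e"
  shows "X \<longlonglongrightarrow> 0"
proof (rule order_tendstoI)
  fix a :: ennreal assume "0 < a"
  then obtain b where b: "0 < b" "b < a" using dense by blast
  then obtain e where e: "b = ennreal e" "e > 0" by (cases b) auto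
  show "\<forall>\<^sub>F k in sequentially. X k < a"
    using assms[OF e(2)] by eventually_elim (use b e in auto)
qed auto

lemma ennreal_tendsto_0_approx:
  fixes X :: "nat \<Rightarrow> ennreal"
  assumes "c > 0" "\<And>e::real. e > 0 \<Longrightarrow> \<exists>Y. Y \<longlonglongrightarrow> 0 \<and> (\<forall>k. X k \<le> ennreal c * (ennreal e + Y k))"
  shows "X \<longlonglongrightarrow> 0"
proof (rule ennreal_tendsto_0I)
  fix e :: real assume e: "e > 0"
  define d where "d = e / (2 * c)"
  have d: "d > 0" "c * (2 * d) = e" using e \<open>c > 0\<close> by (auto simp: d_def)
  obtain Y where Y: "Y \<longlonglongrightarrow> 0" "\<And>k. X k \<le> ennreal c * (ennreal d + Y k)" using assms(2)[OF d(1)] by auto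
  have "\<forall>\<^sub>F k in sequentially. Y k < ennreal d"
    using Y(1) by (rule order_tendstoD) (use d in auto)
  then show "\<forall>\<^sub>F k in sequentially. X k \<le> ennreal e"
  proof eventually_elim
    case (elim k)
    have "X k \<le> ennreal c * (ennreal d + ennreal d)"
      using Y(2)[of k] elim by (meson add_left_mono less_imp_le mult_left_mono order_trans zero_le)
    also have "\<dots> = ennreal e"
      using d \<open>c > 0\<close> by (simp add: ennreal_plus[symmetric] ennreal_mult[symmetric] del: ennreal_plus)
    finally show ?case .
  qed
qed

lemma ennreal_tendsto_0_le:
  fixes X :: "nat \<Rightarrow> ennreal"
  assumes "\<And>k. X k \<le> ennreal c * Y k" "Y \<longlonglongrightarrow> 0"
  shows "X \<longlonglongrightarrow> 0"
proof (rule tendsto_sandwich[of "\<lambda>_. 0" _ _ "\<lambda>k. ennreal c * Y k"])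
  show "(\<lambda>k. ennreal c * Y k) \<longlonglongrightarrow> 0"
    using ennreal_tendsto_cmult[of "ennreal c", OF _ assms(2)] by (simp add: less_top[symmetric])
qed (use assms in auto)

text \<open>
  The graph of \<open>x \<mapsto> x powr p\<close> lies above its tangent at \<open>a\<close>; this is Young's inequality for \<open>x\<close>
  and \<open>a powr (p - 1)\<close>.
\<close>

lemma young_tangent:
  fixes x a p :: real
  assumes "x \<ge> 0" "a \<ge> 0" "p \<ge> 1"
  shows "p * x * a powr (p - 1) \<le> x powr p + (p - 1) * a powr p"
proof (cases "p = 1")
  case False
  then have p: "p > 1" using assms by simp
  have "x * a powr (p - 1) \<le> x powr p / p + (a powr (p - 1)) powr (p / (p - 1)) / (p / (p - 1))"
    using p assms by (intro Youngs_inequality) (auto simp: field_simps)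
  also have "(a powr (p - 1)) powr (p / (p - 1)) = a powr p"
    using p by (simp add: powr_powr)
  finally show ?thesis using p by (simp add: field_simps)
qed (use assms in auto)

text \<open>
  Integrating the tangent inequality at \<open>c\<close> against the kernel bounds \<open>p * c powr p\<close> by the
  right-hand side plus \<open>(p - 1) * c powr p\<close>.
\<close>

lemma jensen_powr_nn:
  assumes [measurable]: "f \<in> borel_measurable M" "k \<in> borel_measurable M"
    and k: "\<And>x. k x \<ge> 0" "(\<integral>\<^sup>+x. ennreal (k x) \<partial>M) \<le> 1" and p: "p \<ge> 1"
    and c: "c \<ge> 0" "ennreal c \<le> (\<integral>\<^sup>+x. ennreal (\<bar>f x\<bar> * k x) \<partial>M)"
  shows "ennreal (c powr p) \<le> (\<integral>\<^sup>+x. ennreal (\<bar>f x\<bar> powr p * k x) \<partial>M)" (is "_ \<le> ?R")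
proof (cases "?R = \<infinity>")
  case False
  then obtain R where R: "?R = ennreal R" "R \<ge> 0" by (cases ?R) auto
  define A where "A = p * c powr (p - 1)"
  have A: "A \<ge> 0" using p by (simp add: A_def)
  have "ennreal (A * c) = ennreal A * ennreal c" using A c by (simp add: ennreal_mult)
  also have "\<dots> \<le> ennreal A * (\<integral>\<^sup>+x. ennreal (\<bar>f x\<bar> * k x) \<partial>M)"
    by (intro mult_left_mono c) auto
  also have "\<dots> = (\<integral>\<^sup>+x. ennreal (A * (\<bar>f x\<bar> * k x)) \<partial>M)"
    using A k by (subst nn_integral_cmult[symmetric]) (auto simp: ennreal_mult)
  also have "\<dots> \<le> (\<integral>\<^sup>+x. ennreal (\<bar>f x\<bar> powr p * k x) + ennreal ((p - 1) * c powr p) * ennreal (k x) \<partial>M)"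
  proof (rule nn_integral_mono)
    fix x
    have "A * (\<bar>f x\<bar> * k x) = (p * \<bar>f x\<bar> * c powr (p - 1)) * k x" by (simp add: A_def)
    also have "\<dots> \<le> (\<bar>f x\<bar> powr p + (p - 1) * c powr p) * k x"
      by (intro mult_right_mono young_tangent) (use c p k in auto)
    finally have "ennreal (A * (\<bar>f x\<bar> * k x)) \<le> ennreal (\<bar>f x\<bar> powr p * k x + (p - 1) * c powr p * k x)"
      by (intro ennreal_leI) (simp add: algebra_simps)
    also have "\<dots> = ennreal (\<bar>f x\<bar> powr p * k x) + ennreal ((p - 1) * c powr p) * ennreal (k x)"
      using p k by (subst ennreal_plus) (auto simp: ennreal_mult)
    finally show "ennreal (A * (\<bar>f x\<bar> * k x)) \<le> ennreal (\<bar>f x\<bar> powr p * k x) + ennreal ((p - 1) * c powr p) * ennreal (k x)" .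
  qed
  also have "\<dots> = ?R + ennreal ((p - 1) * c powr p) * (\<integral>\<^sup>+x. ennreal (k x) \<partial>M)"
    by (simp add: nn_integral_add nn_integral_cmult)
  also have "\<dots> \<le> ?R + ennreal ((p - 1) * c powr p) * 1"
    by (intro add_left_mono mult_left_mono k) auto
  also have "\<dots> = ennreal (R + (p - 1) * c powr p)"
    using R p by simp
  finally have "A * c \<le> R + (p - 1) * c powr p"
    using R p by (subst (asm) ennreal_le_iff) auto
  moreover have "A * c = p * c powr p"
    using c p by (cases "c = 0") (auto simp: A_def powr_diff)
  ultimately show ?thesis using R by (auto simp: algebra_simps)
qed simp

lemma jensen_powr:
  assumes [measurable]: "f \<in> borel_measurable M" "k \<in> borel_measurable M"
    and k: "\<And>x. k x \<ge> 0" "(\<integral>\<^sup>+x. ennreal (k x) \<partial>M) \<le> 1" and p: "p \<ge> 1"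
  shows "ennreal (\<bar>LINT x|M. f x * k x\<bar> powr p) \<le> (\<integral>\<^sup>+x. ennreal (\<bar>f x\<bar> powr p * k x) \<partial>M)"
proof (cases "integrable M (\<lambda>x. f x * k x)")
  case True
  have "ennreal \<bar>LINT x|M. f x * k x\<bar> \<le> (\<integral>\<^sup>+x. ennreal (norm (f x * k x)) \<partial>M)"
    using integral_norm_bound_ennreal[OF True] by simp
  also have "\<dots> = (\<integral>\<^sup>+x. ennreal (\<bar>f x\<bar> * k x) \<partial>M)"
    using k by (simp add: abs_mult)
  finally show ?thesis
    by (intro jensen_powr_nn) (use k p in auto)
qed (use p in \<open>simp add: not_integrable_integral_eq\<close>)

section \<open>Translations\<close>

lemma nn_integral_translate:
  fixes c :: "'a::euclidean_space"
  assumes [measurable]: "f \<in> borel_measurable borel"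
  shows "(\<integral>\<^sup>+x. f (x + c) \<partial>lborel) = (\<integral>\<^sup>+x. f x \<partial>lborel)"
proof -
  have "(\<integral>\<^sup>+x. f x \<partial>lborel) = (\<integral>\<^sup>+x. f x \<partial>(distr lborel borel ((+) c)))"
    by (simp add: lborel_distr_plus)
  also have "\<dots> = (\<integral>\<^sup>+x. f (x + c) \<partial>lborel)"
    by (subst nn_integral_distr) (auto simp: add.commute)
  finally show ?thesis by simp
qed

lemma Lp_mass_translate:
  fixes c :: "'a::euclidean_space"
  assumes [measurable]: "f \<in> borel_measurable borel"
  shows "pmass p (\<lambda>x. f (x + c)) = pmass p f"
  unfolding Lp_mass_def by (rule nn_integral_translate) measurable

text \<open>
  A point of an open set remains in it after a small translation, so the integrand tends to \<open>0\<close>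
  pointwise, dominated by the indicator of \<open>U\<close>.
\<close>

lemma open_translation_L1:
  fixes h :: "nat \<Rightarrow> 'a::euclidean_space"
  assumes "open U" "emeasure lborel U < \<infinity>" "h \<longlonglongrightarrow> 0"
  shows "(\<lambda>k. \<integral>\<^sup>+x. indicator U x * indicator (-U) (x + h k) \<partial>lborel) \<longlonglongrightarrow> 0"
proof (rule nn_integral_tendsto_0[where w = "indicator U"])
  have [measurable]: "U \<in> sets borel" using assms by auto
  show "(\<lambda>x. indicator U x * indicator (- U) (x + h i) :: ennreal) \<in> borel_measurable lborel" for i
    by measurable
  show "indicator U \<in> borel_measurable lborel" by simp
  show "AE x in lborel. (\<lambda>i. indicator U x * indicator (- U) (x + h i)::ennreal) \<longlonglongrightarrow> 0"
  proof (rule AE_I2)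
    fix x
    show "(\<lambda>i. indicator U x * indicator (- U) (x + h i)::ennreal) \<longlonglongrightarrow> 0"
    proof (cases "x \<in> U")
      case True
      have "(\<lambda>i. x + h i) \<longlonglongrightarrow> x + 0" by (intro tendsto_intros assms)
      then have "\<forall>\<^sub>F i in sequentially. x + h i \<in> U"
        using True assms(1) by (intro topological_tendstoD) auto
      then have "\<forall>\<^sub>F i in sequentially. indicator U x * indicator (- U) (x + h i) = (0::ennreal)"
        by eventually_elim auto
      then show ?thesis by (rule tendsto_eventually)
    qed auto
  qed
  have [measurable]: "U \<in> sets borel" using assms by auto
  show "(\<integral>\<^sup>+ x. indicator U x \<partial>lborel) < \<infinity>" using assms by simp
qed (auto simp: indicator_def)

text \<open>
  Induction over integrable functions. The indicator of a measurable set is approximated from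
  outside by that of an open set, for which \<open>open_translation_L1\<close> applies to \<open>h\<close> and to \<open>- h\<close>.
\<close>

lemma translation_continuous_L1:
  fixes f :: "'a::euclidean_space \<Rightarrow> real"
  assumes "integrable lborel f"
  shows "\<forall>h. h \<longlonglongrightarrow> 0 \<longrightarrow> (\<lambda>k. \<integral>\<^sup>+x. ennreal \<bar>f (x + h k) - f x\<bar> \<partial>lborel) \<longlonglongrightarrow> 0"
  using assms
proof (induction rule: integrable_induct)
  case (base A c)
  show ?case
  proof (intro allI impI)
    fix h :: "nat \<Rightarrow> 'a" assume h: "h \<longlonglongrightarrow> 0"
    have [measurable]: "A \<in> sets borel" using base by simp
    show "(\<lambda>k. \<integral>\<^sup>+x. ennreal \<bar>indicator A (x + h k) *\<^sub>R c - indicator A x *\<^sub>R c\<bar> \<partial>lborel) \<longlonglongrightarrow> 0"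
    proof (rule ennreal_tendsto_0_approx[of "2 * \<bar>c\<bar> + 1"])
      fix e :: real assume "e > 0"
      then obtain U where U: "open U" "A \<subseteq> U" "emeasure lborel (U - A) < e"
        using outer_regular_lborel[of A e] by auto
      have [measurable]: "U \<in> sets borel" using U by auto
      have "emeasure lborel U = emeasure lborel A + emeasure lborel (U - A)"
        using U by (subst plus_emeasure) (auto intro!: arg_cong[where f="emeasure lborel"])
      then have Uf: "emeasure lborel U < \<infinity>"
      proof -
        have "emeasure lborel (U - A) < \<infinity>" using U(3) by (rule order_less_trans) simp
        moreover have "emeasure lborel A < \<infinity>" using base by simp
        ultimately show ?thesis unfolding \<open>emeasure lborel U = _\<close> by (simp add: less_top[symmetric])
      qed
      define Y where "Y = (\<lambda>k. (\<integral>\<^sup>+x. indicator U x * indicator (-U) (x + h k) \<partial>lborel) +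
          (\<integral>\<^sup>+x. indicator U x * indicator (-U) (x + (- h k)) \<partial>lborel))"
      have "Y \<longlonglongrightarrow> 0 + 0"
        unfolding Y_def by (intro tendsto_add open_translation_L1 U Uf h) (use tendsto_minus[OF h] in simp)
      moreover have "(\<integral>\<^sup>+x. ennreal \<bar>indicator A (x + h k) *\<^sub>R c - indicator A x *\<^sub>R c\<bar> \<partial>lborel) \<le> ennreal (2 * \<bar>c\<bar> + 1) * (ennreal e + Y k)" for k
      proof -
        have "(\<integral>\<^sup>+x. ennreal \<bar>indicator A (x + h k) *\<^sub>R c - indicator A x *\<^sub>R c\<bar> \<partial>lborel)
          \<le> (\<integral>\<^sup>+x. ennreal \<bar>c\<bar> * ((indicator (U - A) (x + h k) + indicator (U - A) x) +
             (indicator U x * indicator (-U) (x + h k) + indicator U (x + h k) * indicator (-U) x)) \<partial>lborel)"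
          using U by (intro nn_integral_mono) (auto simp: indicator_def)
        also have "\<dots> = ennreal \<bar>c\<bar> * (((\<integral>\<^sup>+x. indicator (U - A) (x + h k) \<partial>lborel) + (\<integral>\<^sup>+x. indicator (U - A) x \<partial>lborel)) +
             ((\<integral>\<^sup>+x. indicator U x * indicator (-U) (x + h k) \<partial>lborel) + (\<integral>\<^sup>+x. indicator U (x + h k) * indicator (-U) x \<partial>lborel)))"
          by (simp add: nn_integral_cmult nn_integral_add)
        also have "(\<integral>\<^sup>+x. indicator (U - A) (x + h k) \<partial>lborel) = emeasure lborel (U - A)"
          by (subst nn_integral_translate) auto
        also have "(\<integral>\<^sup>+x. indicator U (x + h k) * indicator (-U) x \<partial>lborel) = (\<integral>\<^sup>+x. indicator U (x + h k + (- h k)) * indicator (-U) (x + (- h k)) \<partial>lborel)"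
          by (subst nn_integral_translate[of "\<lambda>x. indicator U (x + h k) * indicator (-U) x" "- h k", symmetric]) auto
        also have "\<dots> = (\<integral>\<^sup>+x. indicator U x * indicator (-U) (x + (- h k)) \<partial>lborel)" by simp
        also have "ennreal \<bar>c\<bar> * ((emeasure lborel (U - A) + (\<integral>\<^sup>+x. indicator (U - A) x \<partial>lborel)) +
             ((\<integral>\<^sup>+x. indicator U x * indicator (-U) (x + h k) \<partial>lborel) + (\<integral>\<^sup>+x. indicator U x * indicator (-U) (x + (- h k)) \<partial>lborel)))
            \<le> ennreal \<bar>c\<bar> * ((ennreal e + ennreal e) + (Y k + Y k))"
          unfolding Y_def using U by (intro mult_left_mono add_mono) (auto intro: add_increasing)
        also have "\<dots> = ennreal (2 * \<bar>c\<bar>) * (ennreal e + Y k)"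
        proof -
          have "ennreal (2 * \<bar>c\<bar>) = ennreal \<bar>c\<bar> + ennreal \<bar>c\<bar>" by (simp flip: ennreal_plus)
          then show ?thesis by (simp add: algebra_simps)
        qed
        also have "\<dots> \<le> ennreal (2 * \<bar>c\<bar> + 1) * (ennreal e + Y k)"
          by (intro mult_right_mono ennreal_leI) auto
        finally show ?thesis .
      qed
      ultimately show "\<exists>Y. Y \<longlonglongrightarrow> 0 \<and> (\<forall>k. (\<integral>\<^sup>+x. ennreal \<bar>indicator A (x + h k) *\<^sub>R c - indicator A x *\<^sub>R c\<bar> \<partial>lborel) \<le> ennreal (2 * \<bar>c\<bar> + 1) * (ennreal e + Y k))"
        by auto
    qed simp
  qed
next
  case (add f g)
  have [measurable]: "f \<in> borel_measurable borel" "g \<in> borel_measurable borel" using add by auto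
  show ?case
  proof (intro allI impI)
    fix h :: "nat \<Rightarrow> 'a" assume h: "h \<longlonglongrightarrow> 0"
    show "(\<lambda>k. \<integral>\<^sup>+x. ennreal \<bar>f (x + h k) + g (x + h k) - (f x + g x)\<bar> \<partial>lborel) \<longlonglongrightarrow> 0"
    proof (rule ennreal_tendsto_0_le[of _ 1])
      show "(\<lambda>k. (\<integral>\<^sup>+x. ennreal \<bar>f (x + h k) - f x\<bar> \<partial>lborel) + (\<integral>\<^sup>+x. ennreal \<bar>g (x + h k) - g x\<bar> \<partial>lborel)) \<longlonglongrightarrow> 0"
      proof -
        have "(\<lambda>k. \<integral>\<^sup>+x. ennreal \<bar>f (x + h k) - f x\<bar> \<partial>lborel) \<longlonglongrightarrow> 0"
          "(\<lambda>k. \<integral>\<^sup>+x. ennreal \<bar>g (x + h k) - g x\<bar> \<partial>lborel) \<longlonglongrightarrow> 0"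
          using add.IH(1)[rule_format, OF h] add.IH(2)[rule_format, OF h] by simp_all
        from tendsto_add[OF this] show ?thesis by simp
      qed
      show "(\<integral>\<^sup>+x. ennreal \<bar>f (x + h k) + g (x + h k) - (f x + g x)\<bar> \<partial>lborel) \<le>
        ennreal 1 * ((\<integral>\<^sup>+x. ennreal \<bar>f (x + h k) - f x\<bar> \<partial>lborel) + (\<integral>\<^sup>+x. ennreal \<bar>g (x + h k) - g x\<bar> \<partial>lborel))" for k
        by (subst nn_integral_add[symmetric]) (auto simp del: ennreal_plus simp flip: ennreal_plus intro!: nn_integral_mono ennreal_leI)
    qed
  qed
next
  case (lim f s)
  have [measurable]: "f \<in> borel_measurable borel" "\<And>i. s i \<in> borel_measurable borel" using lim by auto
  show ?case
  proof (intro allI impI)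
    fix h :: "nat \<Rightarrow> 'a" assume h: "h \<longlonglongrightarrow> 0"
    show "(\<lambda>k. \<integral>\<^sup>+x. ennreal \<bar>f (x + h k) - f x\<bar> \<partial>lborel) \<longlonglongrightarrow> 0"
    proof (rule ennreal_tendsto_0_approx[of 2])
      fix e :: real assume "e > 0"
      have "(\<lambda>i. \<integral>\<^sup>+x. ennreal \<bar>f x - s i x\<bar> \<partial>lborel) \<longlonglongrightarrow> 0"
      proof (rule nn_integral_tendsto_0[where w = "\<lambda>x. ennreal (3 * \<bar>f x\<bar>)"])
        show "AE x in lborel. ennreal \<bar>f x - s j x\<bar> \<le> ennreal (3 * \<bar>f x\<bar>)" for j
          proof (intro AE_I2 ennreal_leI)
          fix x
          have "\<bar>s j x\<bar> \<le> 2 * \<bar>f x\<bar>" using lim.hyps(3)[of x j] by simp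
          then show "\<bar>f x - s j x\<bar> \<le> 3 * \<bar>f x\<bar>" by linarith
        qed
        have "integrable lborel (\<lambda>x. 3 * \<bar>f x\<bar>)" using lim by auto
        then show "(\<integral>\<^sup>+x. ennreal (3 * \<bar>f x\<bar>) \<partial>lborel) < \<infinity>"
          by (subst nn_integral_eq_integral) auto
        show "AE x in lborel. (\<lambda>i. ennreal \<bar>f x - s i x\<bar>) \<longlonglongrightarrow> 0"
        proof (rule AE_I2)
          fix x
          have "(\<lambda>i. \<bar>f x - s i x\<bar>) \<longlonglongrightarrow> \<bar>f x - f x\<bar>"
            by (intro tendsto_intros lim.hyps) auto
          then show "(\<lambda>i. ennreal \<bar>f x - s i x\<bar>) \<longlonglongrightarrow> 0"
            using tendsto_ennrealI[of "\<lambda>i. \<bar>f x - s i x\<bar>" 0] by simp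
        qed
      qed auto
      then have "\<forall>\<^sub>F i in sequentially. (\<integral>\<^sup>+x. ennreal \<bar>f x - s i x\<bar> \<partial>lborel) < ennreal e"
        by (rule order_tendstoD) (use \<open>e > 0\<close> in auto)
      then obtain i where i: "(\<integral>\<^sup>+x. ennreal \<bar>f x - s i x\<bar> \<partial>lborel) < ennreal e"
        using eventually_happens'[OF sequentially_bot] by blast
      have "(\<integral>\<^sup>+x. ennreal \<bar>f (x + h k) - f x\<bar> \<partial>lborel) \<le> ennreal 2 * (ennreal e + (\<integral>\<^sup>+x. ennreal \<bar>s i (x + h k) - s i x\<bar> \<partial>lborel))" for k
      proof -
        have "(\<integral>\<^sup>+x. ennreal \<bar>f (x + h k) - f x\<bar> \<partial>lborel) \<le>
          (\<integral>\<^sup>+x. ennreal \<bar>f (x + h k) - s i (x + h k)\<bar> + (ennreal \<bar>f x - s i x\<bar> + ennreal \<bar>s i (x + h k) - s i x\<bar>) \<partial>lborel)"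
        proof (rule nn_integral_mono)
          fix x
          have "\<bar>f (x + h k) - f x\<bar> \<le> \<bar>f (x + h k) - s i (x + h k)\<bar> + (\<bar>f x - s i x\<bar> + \<bar>s i (x + h k) - s i x\<bar>)" by linarith
          from ennreal_leI[OF this]
          show "ennreal \<bar>f (x + h k) - f x\<bar> \<le> ennreal \<bar>f (x + h k) - s i (x + h k)\<bar> + (ennreal \<bar>f x - s i x\<bar> + ennreal \<bar>s i (x + h k) - s i x\<bar>)"
            by simp
        qed
        also have "\<dots> = (\<integral>\<^sup>+x. ennreal \<bar>f (x + h k) - s i (x + h k)\<bar> \<partial>lborel) + ((\<integral>\<^sup>+x. ennreal \<bar>f x - s i x\<bar> \<partial>lborel) +
           (\<integral>\<^sup>+x. ennreal \<bar>s i (x + h k) - s i x\<bar> \<partial>lborel))"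
          by (simp add: nn_integral_add)
        also have "(\<integral>\<^sup>+x. ennreal \<bar>f (x + h k) - s i (x + h k)\<bar> \<partial>lborel) = (\<integral>\<^sup>+x. ennreal \<bar>f x - s i x\<bar> \<partial>lborel)"
          by (rule nn_integral_translate) measurable
        also have "\<dots> + (\<dots> + (\<integral>\<^sup>+x. ennreal \<bar>s i (x + h k) - s i x\<bar> \<partial>lborel)) \<le>
           ennreal e + (ennreal e + 2 * (\<integral>\<^sup>+x. ennreal \<bar>s i (x + h k) - s i x\<bar> \<partial>lborel))"
          using less_imp_le[OF i] by (intro add_mono order_refl) (simp_all add: mult_2)
        also have "\<dots> = ennreal 2 * (ennreal e + (\<integral>\<^sup>+x. ennreal \<bar>s i (x + h k) - s i x\<bar> \<partial>lborel))"
          by (simp add: distrib_left mult_2 add.assoc)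
        finally show ?thesis .
      qed
      then show "\<exists>Y. Y \<longlonglongrightarrow> 0 \<and> (\<forall>k. (\<integral>\<^sup>+x. ennreal \<bar>f (x + h k) - f x\<bar> \<partial>lborel) \<le> ennreal 2 * (ennreal e + Y k))"
        using lim.IH[of i] h by (intro exI[of _ "\<lambda>k. \<integral>\<^sup>+x. ennreal \<bar>s i (x + h k) - s i x\<bar> \<partial>lborel"]) simp
    qed simp
  qed
qed

lemma nn_integral_scale:
  fixes t :: "'a::euclidean_space"
  assumes [measurable]: "f \<in> borel_measurable borel" and "e > 0"
  shows "(\<integral>\<^sup>+x. f (t + e *\<^sub>R x) \<partial>lborel) = ennreal (1 / e ^ DIM('a)) * (\<integral>\<^sup>+x. f x \<partial>lborel)"
proof -
  have "(\<integral>\<^sup>+x. f x \<partial>lborel) = ennreal (e ^ DIM('a)) * (\<integral>\<^sup>+x. f (t + e *\<^sub>R x) \<partial>lborel)"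
    using \<open>e > 0\<close> by (subst lborel_affine[of e t]) (auto simp: nn_integral_density nn_integral_distr nn_integral_cmult)
  then show ?thesis
    using \<open>e > 0\<close> by (simp add: mult.assoc[symmetric] ennreal_mult[symmetric])
qed

lemma integral_scale:
  fixes t :: "'a::euclidean_space" and f :: "'a \<Rightarrow> real"
  assumes [measurable]: "f \<in> borel_measurable borel" and "e > 0"
  shows "(LINT x|lborel. f (t + e *\<^sub>R x)) = (1 / e ^ DIM('a)) * (LINT x|lborel. f x)"
proof -
  have "(LINT x|lborel. f x) = e ^ DIM('a) * (LINT x|lborel. f (t + e *\<^sub>R x))"
    using \<open>e > 0\<close> by (subst lborel_affine[of e t]) (auto simp: integral_density integral_distr)
  then show ?thesis
    using \<open>e > 0\<close> by simp
qed

lemma powr_le_scaled_abs: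
  fixes a b M p :: real
  assumes "\<bar>a\<bar> \<le> M" "\<bar>b\<bar> \<le> M" "p \<ge> 1" "M > 0"
  shows "\<bar>a - b\<bar> powr p \<le> (2 * M) powr (p - 1) * \<bar>a - b\<bar>"
proof (cases "a = b")
  case False
  have "\<bar>a - b\<bar> powr p = \<bar>a - b\<bar> powr (p - 1) * \<bar>a - b\<bar>"
    using False by (simp add: powr_diff)
  also have "\<dots> \<le> (2 * M) powr (p - 1) * \<bar>a - b\<bar>"
    by (intro mult_right_mono powr_mono2) (use assms in auto)
  finally show ?thesis .
qed simp

lemma abs_le_1_powr: "p \<ge> 1 \<Longrightarrow> \<bar>a::real\<bar> \<le> 1 + \<bar>a\<bar> powr p"
proof (cases "\<bar>a\<bar> \<le> 1")
  case False
  assume "p \<ge> 1"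
  then have "\<bar>a\<bar> powr 1 \<le> \<bar>a\<bar> powr p" using False by (intro powr_mono) auto
  then show ?thesis using False by simp
qed (simp add: add_increasing2)

text \<open>
  Removing the small and the large values of \<open>f\<close> leaves a bounded integrable function, for which
  continuity in \<open>L\<^sup>p\<close> follows from continuity in \<open>L\<^sup>1\<close>.
\<close>

lemma translation_continuous_Lp:
  fixes f :: "'a::euclidean_space \<Rightarrow> real"
  assumes f[measurable]: "f \<in> borel_measurable borel" and fin: "pmass p f < \<infinity>" and p: "p \<ge> 1" and h: "h \<longlonglongrightarrow> 0"
  shows "(\<lambda>k. pmass p (\<lambda>x. f (x + h k) - f x)) \<longlonglongrightarrow> 0"
proof -
  \<comment> \<open>The lower cut makes \<open>T M\<close> integrable, since \<open>\<bar>f x\<bar>\<close> is there at most a multiple of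
    \<open>\<bar>f x\<bar> powr p\<close>; the upper cut makes it bounded.\<close>
  define T where "T = (\<lambda>(M::nat) x. if 1 / real (Suc M) \<le> \<bar>f x\<bar> \<and> \<bar>f x\<bar> \<le> real (Suc M) then f x else 0)"
  have T[measurable]: "T M \<in> borel_measurable borel" for M unfolding T_def by measurable
  have lim: "(\<lambda>M. pmass p (\<lambda>x. f x - T M x)) \<longlonglongrightarrow> 0"
    unfolding Lp_mass_def
  proof (rule nn_integral_tendsto_0[where w = "\<lambda>x. ennreal (\<bar>f x\<bar> powr p)"])
    show "AE x in lborel. (\<lambda>M. ennreal (\<bar>f x - T M x\<bar> powr p)) \<longlonglongrightarrow> 0"
    proof (rule AE_I2)
      fix x
      have "\<forall>\<^sub>F M in sequentially. T M x = f x"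
      proof (cases "f x = 0")
        case False
        have "(\<lambda>M. 1 / real (Suc M)) \<longlonglongrightarrow> 0" using LIMSEQ_inverse_real_of_nat by (simp add: inverse_eq_divide)
        then have "\<forall>\<^sub>F M in sequentially. 1 / real (Suc M) < \<bar>f x\<bar>"
          by (rule order_tendstoD) (use False in auto)
        moreover have "\<forall>\<^sub>F M in sequentially. \<bar>f x\<bar> \<le> real (Suc M)"
          using filterlim_real_sequentially unfolding filterlim_at_top
          by (auto intro: eventually_mono[where P="\<lambda>M. \<bar>f x\<bar> \<le> real M"])
        ultimately show ?thesis by eventually_elim (auto simp: T_def)
      qed (simp add: T_def)
      then have "\<forall>\<^sub>F M in sequentially. ennreal (\<bar>f x - T M x\<bar> powr p) = 0"
        by eventually_elim auto
      then show "(\<lambda>M. ennreal (\<bar>f x - T M x\<bar> powr p)) \<longlonglongrightarrow> 0" by (rule tendsto_eventually)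
    qed
    show "(\<integral>\<^sup>+ x. ennreal (\<bar>f x\<bar> powr p) \<partial>lborel) < \<infinity>" using fin by (simp add: Lp_mass_def)
  qed (auto simp: T_def)
  show ?thesis
  proof (rule ennreal_tendsto_0_approx[of "2 powr p * 2 powr p * 2"])
    fix e :: real assume "e > 0"
    have "\<forall>\<^sub>F M in sequentially. pmass p (\<lambda>x. f x - T M x) < ennreal e"
      by (rule order_tendstoD[OF lim]) (use \<open>e > 0\<close> in auto)
    then obtain M where M: "pmass p (\<lambda>x. f x - T M x) < ennreal e"
      using eventually_happens'[OF sequentially_bot] by blast
    have Tb: "\<bar>T M x\<bar> \<le> real (Suc M)" for x by (auto simp: T_def)
    have Tle: "\<bar>T M x\<bar> \<le> real (Suc M) powr (p - 1) * \<bar>f x\<bar> powr p" for x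
    proof (cases "T M x = 0")
      case False
      then have *: "1 \<le> real (Suc M) * \<bar>f x\<bar>" "T M x = f x" "f x \<noteq> 0" by (auto simp: T_def field_simps split: if_splits)
      then have "1 powr (p - 1) \<le> (real (Suc M) * \<bar>f x\<bar>) powr (p - 1)" using p by (intro powr_mono2) auto
      then have "1 * \<bar>f x\<bar> \<le> (real (Suc M) * \<bar>f x\<bar>) powr (p - 1) * \<bar>f x\<bar>"
        by (intro mult_right_mono) auto
      also have "\<dots> = real (Suc M) powr (p - 1) * \<bar>f x\<bar> powr p"
        using * by (simp add: powr_mult powr_diff)
      finally show ?thesis using * by simp
    qed auto
    have "integrable lborel (T M)"
    proof (rule integrableI_bounded)
      have "(\<integral>\<^sup>+ x. ennreal (norm (T M x)) \<partial>lborel) \<le> (\<integral>\<^sup>+ x. ennreal (real (Suc M) powr (p - 1)) * ennreal (\<bar>f x\<bar> powr p) \<partial>lborel)"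
        using Tle by (intro nn_integral_mono) (simp add: ennreal_mult[symmetric] del: of_nat_Suc)
      also have "\<dots> < \<infinity>"
        using fin by (simp add: nn_integral_cmult Lp_mass_def ennreal_mult_less_top)
      finally show "(\<integral>\<^sup>+ x. ennreal (norm (T M x)) \<partial>lborel) < \<infinity>" .
    qed simp
    then have L1: "(\<lambda>k. \<integral>\<^sup>+x. ennreal \<bar>T M (x + h k) - T M x\<bar> \<partial>lborel) \<longlonglongrightarrow> 0"
      using translation_continuous_L1 h by blast
    define Y where "Y = (\<lambda>k. pmass p (\<lambda>x. T M (x + h k) - T M x))"
    have "Y \<longlonglongrightarrow> 0"
    proof (rule ennreal_tendsto_0_le[OF _ L1])
      fix k
      have "Y k \<le> (\<integral>\<^sup>+x. ennreal ((2 * real (Suc M)) powr (p - 1)) * ennreal \<bar>T M (x + h k) - T M x\<bar> \<partial>lborel)"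
        unfolding Y_def Lp_mass_def
        using powr_le_scaled_abs[OF Tb Tb p]
        by (intro nn_integral_mono) (simp add: ennreal_mult[symmetric] del: of_nat_Suc)
      then show "Y k \<le> ennreal ((2 * real (Suc M)) powr (p - 1)) * (\<integral>\<^sup>+x. ennreal \<bar>T M (x + h k) - T M x\<bar> \<partial>lborel)"
        by (subst (asm) nn_integral_cmult) auto
    qed
    moreover have "pmass p (\<lambda>x. f (x + h k) - f x) \<le> ennreal (2 powr p * 2 powr p * 2) * (ennreal e + Y k)" for k
    proof -
      let ?D = "pmass p (\<lambda>x. f x - T M x)"
      have 1: "pmass p (\<lambda>x. f (x + h k) - f x) \<le> ennreal (2 powr p) * (pmass p (\<lambda>x. f (x + h k) - T M (x + h k)) +
          pmass p (\<lambda>x. T M (x + h k) - f x))"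
        by (rule Lp_mass_triangle) (use p in auto)
      have 2: "pmass p (\<lambda>x. f (x + h k) - T M (x + h k)) = ?D"
        by (rule Lp_mass_translate) measurable
      have "pmass p (\<lambda>x. T M (x + h k) - f x) \<le> ennreal (2 powr p) * (Y k + pmass p (\<lambda>x. T M x - f x))"
        unfolding Y_def by (rule Lp_mass_triangle) (use p in auto)
      also have "pmass p (\<lambda>x. T M x - f x) = ?D"
        by (rule Lp_mass_diff_commute)
      finally have 3: "pmass p (\<lambda>x. T M (x + h k) - f x) \<le> ennreal (2 powr p) * (Y k + ?D)" .
      have "pmass p (\<lambda>x. f (x + h k) - f x) \<le> ennreal (2 powr p) * (?D + ennreal (2 powr p) * (Y k + ?D))"
        by (rule order_trans[OF 1]) (unfold 2, intro mult_left_mono add_mono order_refl 3, simp)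
      also have "\<dots>
        \<le> ennreal (2 powr p) * (ennreal (2 powr p) * ennreal e + ennreal (2 powr p) * (Y k + ennreal e))"
      proof (intro mult_left_mono add_mono order_refl less_imp_le[OF M])
        have "1 \<le> 2 powr p" using p by (simp add: ge_one_powr_ge_zero)
        then have "1 * ennreal e \<le> ennreal (2 powr p) * ennreal e"
          by (intro mult_right_mono) auto
        then show "pmass p (\<lambda>x. f x - T M x) \<le> ennreal (2 powr p) * ennreal e" using M by simp
      qed auto
      also have "\<dots> \<le> ennreal (2 powr p) * (ennreal (2 powr p) * (2 * (ennreal e + Y k)))"
        unfolding distrib_left[symmetric]
        unfolding mult_2 by (intro mult_left_mono; (rule add_mono)?; simp add: add.commute)
      also have "\<dots> = ennreal (2 powr p * 2 powr p * 2) * (ennreal e + Y k)"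
        by (simp add: ennreal_mult mult.assoc)
      finally show ?thesis .
    qed
    ultimately show "\<exists>Y. Y \<longlonglongrightarrow> 0 \<and> (\<forall>k. pmass p (\<lambda>x. f (x + h k) - f x) \<le> ennreal (2 powr p * 2 powr p * 2) * (ennreal e + Y k))"
      by auto
  qed auto
qed

section \<open>Mollification\<close>

text \<open>
  The argument is \<open>x + e *\<^sub>R w\<close>, not the difference of a convolution, so that the support of \<open>\<phi>\<close>
  shows directly from which side of \<open>x\<close> the values of \<open>f\<close> are taken.
\<close>

definition moll :: "('a::euclidean_space \<Rightarrow> real) \<Rightarrow> real \<Rightarrow> ('a \<Rightarrow> real) \<Rightarrow> 'a \<Rightarrow> real" where
  "moll \<phi> e f x = (LINT w|lborel. f (x + e *\<^sub>R w) * \<phi> w)"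

lemma moll_borel:
  assumes [measurable]: "\<phi> \<in> borel_measurable borel" "f \<in> borel_measurable borel"
  shows "moll \<phi> e f \<in> borel_measurable borel"
proof -
  have "(\<lambda>x. LINT w|lborel. f (x + e *\<^sub>R w) * \<phi> w) \<in> borel_measurable lborel" by measurable
  then show ?thesis by (simp add: moll_def[abs_def])
qed

lemma Lp_bounded_set_integrable:
  fixes f :: "'a \<Rightarrow> real"
  assumes [measurable]: "f \<in> borel_measurable M" "k \<in> borel_measurable M" "A \<in> sets M" and "Lp_mass M p f < \<infinity>" "p \<ge> 1"
    and k: "\<And>x. \<bar>k x\<bar> \<le> B * indicator A x" and A: "emeasure M A < \<infinity>"
  shows "integrable M (\<lambda>x. f x * k x)"
proof (rule integrableI_bounded)
  have B: "\<bar>k x\<bar> \<le> \<bar>B\<bar> * indicator A x" for x using k[of x] by (auto simp: indicator_def split: if_splits)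
  have "(\<integral>\<^sup>+ x. ennreal (norm (f x * k x)) \<partial>M) \<le> (\<integral>\<^sup>+ x. ennreal \<bar>B\<bar> * (indicator A x + ennreal (\<bar>f x\<bar> powr p)) \<partial>M)"
  proof (rule nn_integral_mono)
    fix x
    have "norm (f x * k x) \<le> (1 + \<bar>f x\<bar> powr p) * (\<bar>B\<bar> * indicator A x)"
      unfolding real_norm_def abs_mult using B abs_le_1_powr[OF assms(5)] by (intro mult_mono) auto
    also have "\<dots> \<le> \<bar>B\<bar> * (indicator A x + \<bar>f x\<bar> powr p)" by (auto simp: indicator_def algebra_simps)
    finally have "ennreal (norm (f x * k x)) \<le> ennreal (\<bar>B\<bar> * (indicator A x + \<bar>f x\<bar> powr p))" by (rule ennreal_leI)
    also have "\<dots> = ennreal \<bar>B\<bar> * (indicator A x + ennreal (\<bar>f x\<bar> powr p))"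
      by (simp add: ennreal_mult ennreal_plus indicator_def)
    finally show "ennreal (norm (f x * k x)) \<le> ennreal \<bar>B\<bar> * (indicator A x + ennreal (\<bar>f x\<bar> powr p))" .
  qed
  also have "\<dots> < \<infinity>"
    using assms by (simp add: nn_integral_cmult nn_integral_add Lp_mass_def ennreal_mult_less_top)
  finally show "(\<integral>\<^sup>+ x. ennreal (norm (f x * k x)) \<partial>M) < \<infinity>" .
qed simp

lemma emeasure_cball_fin: "emeasure lborel (cball a r :: 'a::euclidean_space set) < \<infinity>"
  using emeasure_lborel_cbox_finite bounded_subset_cbox_symmetric[OF bounded_cball[of a r]]
  by (metis emeasure_bounded_finite bounded_cball)

lemma Lp_test_integrable:
  fixes f :: "'a::euclidean_space \<Rightarrow> real"
  assumes [measurable]: "f \<in> borel_measurable borel" and fin: "pmass p f < \<infinity>" and p: "p \<ge> 1" and "\<phi> \<in> test_functions S"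
  shows "integrable lborel (\<lambda>x. f x * \<phi> x)"
proof -
  obtain B R where BR: "B > 0" "R > 0" "\<And>x. \<bar>\<phi> x\<bar> \<le> B * indicator (cball 0 R) x" using test_function_bounded[OF assms(4)] by metis
  show ?thesis
    by (rule Lp_bounded_set_integrable[OF _ _ _ _ p BR(3)])
      (use fin emeasure_cball_fin test_function_borel[OF assms(4)] in auto)
qed

locale mollifier =
  fixes \<phi> :: "'a::euclidean_space \<Rightarrow> real" and S :: "'a set"
  assumes test: "\<phi> \<in> test_functions S" and nonneg: "\<And>x. \<phi> x \<ge> 0" and int1: "integral\<^sup>L lborel \<phi> = 1"
begin

lemma borel [measurable]: "\<phi> \<in> borel_measurable borel" by (rule test_function_borel[OF test])

lemma nn_int1: "(\<integral>\<^sup>+x. ennreal (\<phi> x) \<partial>lborel) = 1"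
  using nn_integral_eq_integral[OF test_function_integrable[OF test]] nonneg int1 by simp

text \<open>
  Jensen's inequality for the probability density \<open>\<phi>\<close>, followed by Tonelli and translation
  invariance.
\<close>

lemma moll_mass_le:
  assumes [measurable]: "f \<in> borel_measurable borel" and p: "p \<ge> 1"
  shows "pmass p (moll \<phi> e f) \<le> pmass p f"
proof -
  have "pmass p (moll \<phi> e f) \<le> (\<integral>\<^sup>+x. (\<integral>\<^sup>+w. ennreal (\<bar>f (x + e *\<^sub>R w)\<bar> powr p * \<phi> w) \<partial>lborel) \<partial>lborel)"
    unfolding Lp_mass_def moll_def
    by (intro nn_integral_mono jensen_powr) (use nonneg nn_int1 p in auto)
  also have "\<dots> = (\<integral>\<^sup>+w. (\<integral>\<^sup>+x. ennreal (\<bar>f (x + e *\<^sub>R w)\<bar> powr p * \<phi> w) \<partial>lborel) \<partial>lborel)"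
    by (rule lborel_pair.Fubini') measurable
  also have "\<dots> = (\<integral>\<^sup>+w. ennreal (\<phi> w) * pmass p f \<partial>lborel)"
  proof (rule nn_integral_cong)
    fix w
    have "(\<integral>\<^sup>+x. ennreal (\<bar>f (x + e *\<^sub>R w)\<bar> powr p * \<phi> w) \<partial>lborel) = ennreal (\<phi> w) * pmass p (\<lambda>x. f (x + e *\<^sub>R w))"
      unfolding Lp_mass_def using nonneg by (subst nn_integral_cmult[symmetric]) (auto simp: ennreal_mult mult.commute)
    then show "(\<integral>\<^sup>+x. ennreal (\<bar>f (x + e *\<^sub>R w)\<bar> powr p * \<phi> w) \<partial>lborel) = ennreal (\<phi> w) * pmass p f"
      by (simp add: Lp_mass_translate)
  qed
  also have "\<dots> = pmass p f"
    by (simp add: nn_integral_multc nn_int1)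
  finally show ?thesis .
qed

lemma integrable_translate:
  assumes [measurable]: "f \<in> borel_measurable borel" and fin: "pmass p f < \<infinity>" and p: "p \<ge> 1" and e: "e > 0"
  shows "integrable lborel (\<lambda>w. f (x + e *\<^sub>R w) * \<phi> w)"
proof (rule Lp_test_integrable[OF _ _ p test])
  have "pmass p (\<lambda>w. f (x + e *\<^sub>R w)) = ennreal (1 / e ^ DIM('a)) * pmass p f"
    unfolding Lp_mass_def by (rule nn_integral_scale) (use e in auto)
  then show "pmass p (\<lambda>w. f (x + e *\<^sub>R w)) < \<infinity>" using fin by (simp add: ennreal_mult_less_top)
qed measurable

text \<open>
  By Jensen the error is at most the average with weight \<open>\<phi>\<close> of the translation errors, which tend
  to \<open>0\<close> boundedly.
\<close>

lemma moll_tendsto: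
  assumes [measurable]: "f \<in> borel_measurable borel" and fin: "pmass p f < \<infinity>" and p: "p \<ge> 1"
    and e: "e \<longlonglongrightarrow> 0" "\<And>k. e k > 0"
  shows "(\<lambda>k. pmass p (\<lambda>x. moll \<phi> (e k) f x - f x)) \<longlonglongrightarrow> 0"
proof -
  define G where "G = (\<lambda>k w. ennreal (\<phi> w) * pmass p (\<lambda>x. f (x + e k *\<^sub>R w) - f x))"
  have [measurable]: "G k \<in> borel_measurable lborel" for k
    unfolding G_def Lp_mass_def by measurable
  have bound: "pmass p (\<lambda>x. moll \<phi> (e k) f x - f x) \<le> ennreal 1 * (\<integral>\<^sup>+w. G k w \<partial>lborel)" for k
  proof -
    have "pmass p (\<lambda>x. moll \<phi> (e k) f x - f x) = pmass p (\<lambda>x. LINT w|lborel. (f (x + e k *\<^sub>R w) - f x) * \<phi> w)"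
    proof (rule arg_cong[where f="pmass p"], rule ext)
      fix x
      have "moll \<phi> (e k) f x - f x = (LINT w|lborel. f (x + e k *\<^sub>R w) * \<phi> w) - (LINT w|lborel. f x * \<phi> w)"
        by (simp add: moll_def int1)
      also have "\<dots> = (LINT w|lborel. f (x + e k *\<^sub>R w) * \<phi> w - f x * \<phi> w)"
        by (subst Bochner_Integration.integral_diff)
          (use integrable_translate[OF _ fin p e(2)] test_function_integrable[OF test] in auto)
      finally show "moll \<phi> (e k) f x - f x = (LINT w|lborel. (f (x + e k *\<^sub>R w) - f x) * \<phi> w)"
        by (simp add: algebra_simps)
    qed
    also have "\<dots> \<le> (\<integral>\<^sup>+x. (\<integral>\<^sup>+w. ennreal (\<bar>f (x + e k *\<^sub>R w) - f x\<bar> powr p * \<phi> w) \<partial>lborel) \<partial>lborel)"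
      unfolding Lp_mass_def
      by (intro nn_integral_mono jensen_powr) (use nonneg nn_int1 p in auto)
    also have "\<dots> = (\<integral>\<^sup>+w. (\<integral>\<^sup>+x. ennreal (\<bar>f (x + e k *\<^sub>R w) - f x\<bar> powr p * \<phi> w) \<partial>lborel) \<partial>lborel)"
      by (rule lborel_pair.Fubini') measurable
    also have "\<dots> = (\<integral>\<^sup>+w. G k w \<partial>lborel)"
    proof (rule nn_integral_cong)
      fix w
      show "(\<integral>\<^sup>+x. ennreal (\<bar>f (x + e k *\<^sub>R w) - f x\<bar> powr p * \<phi> w) \<partial>lborel) = G k w"
        unfolding Lp_mass_def G_def using nonneg by (subst nn_integral_cmult[symmetric]) (auto simp: ennreal_mult mult.commute)
    qed
    finally show ?thesis by simp
  qed
  have "(\<lambda>k. \<integral>\<^sup>+w. G k w \<partial>lborel) \<longlonglongrightarrow> 0"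
  proof (rule nn_integral_tendsto_0[where w = "\<lambda>w. ennreal (\<phi> w) * (ennreal (2 powr p) * (pmass p f + pmass p f))"])
    show "AE w in lborel. G k w \<le> ennreal (\<phi> w) * (ennreal (2 powr p) * (pmass p f + pmass p f))" for k
    proof (rule AE_I2)
      fix w
      have "pmass p (\<lambda>x. f (x + e k *\<^sub>R w) - f x) \<le> ennreal (2 powr p) * (pmass p (\<lambda>x. f (x + e k *\<^sub>R w)) + pmass p f)"
        by (rule Lp_mass_diff) (use p in auto)
      then show "G k w \<le> ennreal (\<phi> w) * (ennreal (2 powr p) * (pmass p f + pmass p f))"
        unfolding G_def by (intro mult_left_mono) (simp_all add: Lp_mass_translate)
    qed
    show "(\<integral>\<^sup>+ w. ennreal (\<phi> w) * (ennreal (2 powr p) * (pmass p f + pmass p f)) \<partial>lborel) < \<infinity>"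
      using fin by (simp add: nn_integral_multc nn_int1 ennreal_mult_less_top)
    show "AE w in lborel. (\<lambda>k. G k w) \<longlonglongrightarrow> 0"
    proof (rule AE_I2)
      fix w :: 'a
      have "(\<lambda>k. e k *\<^sub>R w) \<longlonglongrightarrow> 0" by (auto intro!: tendsto_eq_intros e)
      from translation_continuous_Lp[OF assms(1) fin p this]
      show "(\<lambda>k. G k w) \<longlonglongrightarrow> 0"
        unfolding G_def using ennreal_tendsto_cmult[of "ennreal (\<phi> w)" "\<lambda>k. pmass p (\<lambda>x. f (x + e k *\<^sub>R w) - f x)" 0] by simp
    qed
  qed simp_all
  then show ?thesis by (rule ennreal_tendsto_0_le[OF bound])
qed

end

section \<open>Borel representatives extended by zero\<close>

text \<open>
  A Borel representative that vanishes outside \<open>S\<close> turns integrals over \<open>S\<close> with respect to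
  Lebesgue measure into integrals over the whole space with respect to \<open>lborel\<close>, where Fubini and
  the substitution rules are available.
\<close>

definition zrep :: "'a::euclidean_space set \<Rightarrow> ('a \<Rightarrow> real) \<Rightarrow> ('a \<Rightarrow> real) \<Rightarrow> bool" where
  "zrep S u u' \<longleftrightarrow> u' \<in> borel_measurable borel \<and> (\<forall>x. x \<notin> S \<longrightarrow> u' x = 0) \<and> (AE x in lborel. x \<in> S \<longrightarrow> u x = u' x)"

lemma zrepD:
  assumes "zrep S u u'"
  shows "u' \<in> borel_measurable borel" "x \<notin> S \<Longrightarrow> u' x = 0" "AE x in lborel. x \<in> S \<longrightarrow> u x = u' x"
  using assms by (auto simp: zrep_def)

lemma zrep_exists:
  assumes "u \<in> borel_measurable (lebesgue_on S)" and [measurable]: "S \<in> sets borel"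
  obtains u' where "zrep S u u'"
proof -
  have "(\<lambda>x. if x \<in> S then u x else 0) \<in> borel_measurable lebesgue"
    using assms by (intro borel_measurable_if_I) auto
  from completion_ex_borel_measurable_real[OF this]
  obtain g where [measurable]: "g \<in> borel_measurable borel" and g: "AE x in lborel. (if x \<in> S then u x else 0) = g x"
    by auto
  have "zrep S u (\<lambda>x. indicator S x * g x)"
    unfolding zrep_def using g by (auto elim!: eventually_mono)
  then show ?thesis by (rule that)
qed

lemma borel_measurable_lebesgue_cong_AE:
  fixes f g :: "'a::euclidean_space \<Rightarrow> real"
  assumes "f \<in> borel_measurable lborel" "AE x in lborel. f x = g x"
  shows "g \<in> borel_measurable lebesgue"
proof (rule measurableI)
  fix B :: "real set" assume B: "B \<in> sets borel"
  have f: "f \<in> borel_measurable lebesgue" by (intro measurable_completion assms)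
  have 1: "Measurable.pred lebesgue (\<lambda>x. f x \<noteq> g x)" "Measurable.pred lebesgue (\<lambda>x. f x \<noteq> g x \<and> g x \<in> B)"
    using assms(2) by (intro sets_completion_AE; auto elim!: eventually_mono)+
  have 2: "Measurable.pred lebesgue (\<lambda>x. f x \<in> B)"
    using f B by measurable
  have "Measurable.pred lebesgue (\<lambda>x. (f x \<in> B \<and> \<not> (f x \<noteq> g x)) \<or> (f x \<noteq> g x \<and> g x \<in> B))"
    using 1 2 by measurable
  moreover have "((f x \<in> B \<and> \<not> (f x \<noteq> g x)) \<or> (f x \<noteq> g x \<and> g x \<in> B)) \<longleftrightarrow> g x \<in> B" for x by auto
  ultimately show "g -` B \<inter> space lebesgue \<in> sets lebesgue"
    by (simp add: pred_def vimage_def)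
qed simp

lemma zrep_measurable:
  assumes "zrep S u u'" "S \<in> sets borel"
  shows "u \<in> borel_measurable (lebesgue_on S)"
proof (rule borel_measurable_if_D)
  have [measurable]: "u' \<in> borel_measurable borel" using assms by (auto simp: zrep_def)
  show "(\<lambda>x. if x \<in> S then u x else 0) \<in> borel_measurable lebesgue"
    by (rule borel_measurable_lebesgue_cong_AE[of u'])
      (use zrepD[OF assms(1)] in \<open>auto elim!: eventually_mono\<close>)
qed

lemma zrep_integral:
  assumes "zrep S u u'" and S: "S \<in> sets borel"
  shows "(LINT x|lebesgue_on S. u x) = (LINT x|lborel. u' x)"
    "integrable (lebesgue_on S) u \<longleftrightarrow> integrable lborel u'"
proof -
  have [measurable]: "u' \<in> borel_measurable borel" using assms by (auto simp: zrep_def)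
  have S': "S \<inter> space lebesgue \<in> sets lebesgue" using S by auto
  have ae: "AE x in lebesgue. indicator S x *\<^sub>R u x = u' x"
    using zrepD[OF assms(1)] by (intro AE_completion) (auto elim!: eventually_mono simp: indicator_def)
  have m: "(\<lambda>x. indicator S x *\<^sub>R u x) \<in> borel_measurable lebesgue"
  proof -
    have "(\<lambda>x. indicator S x *\<^sub>R u x) = (\<lambda>x. if x \<in> S then u x else 0)" by (auto simp: indicator_def)
    then show ?thesis using borel_measurable_if_I[OF zrep_measurable[OF assms]] S by simp
  qed
  have m': "u' \<in> borel_measurable lebesgue" by (intro measurable_completion) simp
  show "(LINT x|lebesgue_on S. u x) = (LINT x|lborel. u' x)"
    unfolding integral_restrict_space[OF S'] using integral_cong_AE[OF m m' ae] by (simp add: integral_completion)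
  show "integrable (lebesgue_on S) u \<longleftrightarrow> integrable lborel u'"
    unfolding integrable_restrict_space[OF S'] using integrable_cong_AE[OF m m' ae] by (simp add: integrable_completion)
qed

lemma zrep_mass:
  assumes "zrep S u u'" and S: "S \<in> sets borel"
  shows "Lp_mass (lebesgue_on S) p u = pmass p u'"
proof -
  have S': "S \<inter> space lebesgue \<in> sets lebesgue" using S by auto
  have [measurable]: "u' \<in> borel_measurable borel" using assms by (auto simp: zrep_def)
  have "Lp_mass (lebesgue_on S) p u = (\<integral>\<^sup>+x. ennreal (\<bar>u x\<bar> powr p) * indicator S x \<partial>lebesgue)"
    unfolding Lp_mass_def by (rule nn_integral_restrict_space[OF S'])
  also have "\<dots> = (\<integral>\<^sup>+x. ennreal (\<bar>u' x\<bar> powr p) \<partial>lebesgue)"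
    using zrepD[OF assms(1)] by (intro nn_integral_cong_AE AE_completion) (auto elim!: eventually_mono simp: indicator_def)
  finally show ?thesis by (simp add: Lp_mass_def nn_integral_completion)
qed

lemma zrep_comp:
  assumes "zrep S u u'" "k \<in> borel_measurable borel" "k 0 = (0::real)"
  shows "zrep S (\<lambda>x. k (u x)) (\<lambda>x. k (u' x))"
  using assms by (auto simp: zrep_def elim!: eventually_mono)

lemma zrep_mult:
  assumes "zrep S u u'" "k \<in> borel_measurable borel"
  shows "zrep S (\<lambda>x. u x * k x) (\<lambda>x. u' x * k x)"
  using assms by (auto simp: zrep_def elim!: eventually_mono)

lemma zrep_add:
  assumes "zrep S u u'" "zrep S v v'"
  shows "zrep S (\<lambda>x. u x + v x) (\<lambda>x. u' x + v' x)" "zrep S (\<lambda>x. u x - v x) (\<lambda>x. u' x - v' x)"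
  using assms by (auto simp: zrep_def)

lemma zrep_cmult: "zrep S u u' \<Longrightarrow> zrep S (\<lambda>x. c * u x) (\<lambda>x. c * u' x)"
  using zrep_mult[of S u u' "\<lambda>_. c"] by (simp add: mult.commute)

lemma Lp_iff_zrep:
  assumes "S \<in> sets borel" "zrep S u u'"
  shows "u \<in> Lp S p \<longleftrightarrow> pmass p u' < \<infinity>"
proof -
  have [measurable]: "u' \<in> borel_measurable borel" using assms by (auto simp: zrep_def)
  have "zrep S (\<lambda>x. \<bar>u x\<bar> powr p) (\<lambda>x. \<bar>u' x\<bar> powr p)"
    using zrep_comp[OF assms(2), of "\<lambda>t. \<bar>t\<bar> powr p"] by simp
  from zrep_integral(2)[OF this assms(1)] show ?thesis
    using zrep_measurable[OF assms(2,1)] by (simp add: Lp_def Lp_mass_def integrable_iff_bounded)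
qed

lemma Lp_obtain_zrep:
  assumes "S \<in> sets borel" "u \<in> Lp S p"
  obtains u' where "zrep S u u'" "pmass p u' < \<infinity>"
proof -
  have "u \<in> borel_measurable (lebesgue_on S)" using assms by (auto simp: Lp_def)
  then obtain u' where "zrep S u u'" using zrep_exists assms by metis
  with assms Lp_iff_zrep that show ?thesis by metis
qed

lemma ennreal_Lp_norm_powr:
  assumes "u \<in> Lp S p" "p > 0"
  shows "ennreal (Lp_norm S p u powr p) = Lp_mass (lebesgue_on S) p u"
proof -
  have "integrable (lebesgue_on S) (\<lambda>x. \<bar>u x\<bar> powr p)" using assms by (auto simp: Lp_def)
  from nn_integral_eq_integral[OF this]
  have "Lp_mass (lebesgue_on S) p u = ennreal (LINT x|lebesgue_on S. \<bar>u x\<bar> powr p)"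
    by (simp add: Lp_mass_def)
  moreover have "Lp_norm S p u powr p = (LINT x|lebesgue_on S. \<bar>u x\<bar> powr p)"
    unfolding Lp_norm_def powr_powr using assms by simp
  ultimately show ?thesis by simp
qed

section \<open>Differentiation under the integral sign\<close>

text \<open>
  Dominated convergence for the difference quotients; only the kernel is differentiated, and its
  Lipschitz bound \<open>B\<close> supplies the majorant.
\<close>

lemma has_derivative_integral_kernel:
  fixes k :: "'x::euclidean_space \<Rightarrow> 'w \<Rightarrow> real" and g :: "'w \<Rightarrow> real"
  assumes r: "r > 0"
    and der: "\<And>w. ((\<lambda>x. k x w) has_derivative D w) (at x0)"
    and lip: "\<And>x w. x \<in> ball x0 r \<Longrightarrow> \<bar>k x w - k x0 w\<bar> \<le> B w * norm (x - x0)"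
    and Dle: "\<And>w h. \<bar>D w h\<bar> \<le> B w * norm h"
    and B: "\<And>w. B w \<ge> 0" "integrable M (\<lambda>w. g w * B w)"
    and ik: "\<And>x. x \<in> ball x0 r \<Longrightarrow> integrable M (\<lambda>w. g w * k x w)"
    and mD: "\<And>h. (\<lambda>w. g w * D w h) \<in> borel_measurable M"
  shows "((\<lambda>x. LINT w|M. g w * k x w) has_derivative (\<lambda>h. LINT w|M. g w * D w h)) (at x0)"
proof -
  have iB: "integrable M (\<lambda>w. \<bar>g w\<bar> * B w * c)" for c
    using integrable_abs[OF B(2)] B(1) by (simp add: abs_mult)
  have iD: "integrable M (\<lambda>w. g w * D w h)" for h
  proof (rule Bochner_Integration.integrable_bound[OF iB[of "norm h"] mD], rule AE_I2)
    fix w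
    have "\<bar>g w\<bar> * \<bar>D w h\<bar> \<le> \<bar>g w\<bar> * (B w * norm h)" by (intro mult_left_mono Dle) auto
    then show "norm (g w * D w h) \<le> norm (\<bar>g w\<bar> * B w * norm h)"
      using B(1) by (simp add: abs_mult mult.assoc)
  qed
  have lin: "linear (D w)" for w using der[of w] by (rule has_derivative_linear)
  have bl: "bounded_linear (\<lambda>h. LINT w|M. g w * D w h)"
  proof (rule bounded_linear_intro[where K = "LINT w|M. \<bar>g w\<bar> * B w * 1"])
    fix h1 h2 :: 'x and c :: real
    show "(LINT w|M. g w * D w (h1 + h2)) = (LINT w|M. g w * D w h1) + (LINT w|M. g w * D w h2)"
      using iD by (subst Bochner_Integration.integral_add[symmetric]) (auto simp: linear_add[OF lin] algebra_simps)
    show "(LINT w|M. g w * D w (c *\<^sub>R h1)) = c *\<^sub>R (LINT w|M. g w * D w h1)"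
      by (simp add: linear_cmul[OF lin] mult.left_commute)
    have "norm (LINT w|M. g w * D w h1) \<le> (LINT w|M. norm (g w * D w h1))"
      by (rule integral_norm_bound)
    also have "\<dots> \<le> (LINT w|M. \<bar>g w\<bar> * B w * norm h1)"
    proof (rule integral_mono[OF integrable_norm[OF iD] iB])
      fix w
      have "\<bar>g w\<bar> * \<bar>D w h1\<bar> \<le> \<bar>g w\<bar> * (B w * norm h1)" by (intro mult_left_mono Dle) auto
      then show "norm (g w * D w h1) \<le> \<bar>g w\<bar> * B w * norm h1"
        by (simp add: abs_mult mult.assoc)
    qed
    finally have "norm (LINT w|M. g w * D w h1) \<le> (LINT w|M. \<bar>g w\<bar> * B w * norm h1)" .
    then show "norm (LINT w|M. g w * D w h1) \<le> norm h1 * (LINT w|M. \<bar>g w\<bar> * B w * 1)"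
      by (simp add: mult.commute)
  qed
  have "((\<lambda>y. ((LINT w|M. g w * k y w) - (LINT w|M. g w * k x0 w) - (LINT w|M. g w * D w (y - x0))) /\<^sub>R norm (y - x0)) \<longlongrightarrow> 0) (at x0 within ball x0 r)"
    unfolding tendsto_at_iff_sequentially comp_def
  proof (intro allI impI)
    fix X :: "nat \<Rightarrow> 'x" assume X: "\<forall>i. X i \<in> ball x0 r - {x0}" "X \<longlonglongrightarrow> x0"
    define q where "q = (\<lambda>i w. g w * ((k (X i) w - k x0 w - D w (X i - x0)) / norm (X i - x0)))"
    have eq: "((LINT w|M. g w * k (X i) w) - (LINT w|M. g w * k x0 w) - (LINT w|M. g w * D w (X i - x0))) /\<^sub>R norm (X i - x0)
        = (LINT w|M. q i w)" for i
    proof -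
      have "(LINT w|M. q i w) = (LINT w|M. (g w * k (X i) w - g w * k x0 w - g w * D w (X i - x0)) / norm (X i - x0))"
        unfolding q_def by (intro Bochner_Integration.integral_cong) (auto simp: algebra_simps diff_divide_distrib)
      also have "\<dots> = (LINT w|M. (g w * k (X i) w - g w * k x0 w - g w * D w (X i - x0))) / norm (X i - x0)"
        by simp
      also have "(LINT w|M. (g w * k (X i) w - g w * k x0 w - g w * D w (X i - x0))) =
        (LINT w|M. g w * k (X i) w) - (LINT w|M. g w * k x0 w) - (LINT w|M. g w * D w (X i - x0))"
        using ik[of x0] ik[of "X i"] iD X r by simp
      finally show ?thesis by (simp add: divide_inverse mult.commute)
    qed
    have "(\<lambda>i. LINT w|M. q i w) \<longlonglongrightarrow> (LINT w|M. 0)"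
    proof (rule integral_dominated_convergence[where w = "\<lambda>w. \<bar>g w\<bar> * B w * 2"])
      show "q i \<in> borel_measurable M" for i
      proof -
        have "(\<lambda>w. (g w * k (X i) w - g w * k x0 w - g w * D w (X i - x0)) / norm (X i - x0)) \<in> borel_measurable M"
          using ik[of x0] ik[of "X i"] iD X r
          by (intro borel_measurable_divide borel_measurable_diff borel_measurable_integrable) auto
        then show ?thesis unfolding q_def by (simp add: algebra_simps diff_divide_distrib)
      qed
      show "AE w in M. norm (q i w) \<le> \<bar>g w\<bar> * B w * 2" for i
      proof (rule AE_I2)
        fix w
        have n: "norm (X i - x0) > 0" using X by auto
        have "\<bar>k (X i) w - k x0 w - D w (X i - x0)\<bar> \<le> B w * norm (X i - x0) + B w * norm (X i - x0)"
          using lip[of "X i" w] Dle[of w "X i - x0"] X by auto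
        then have "\<bar>(k (X i) w - k x0 w - D w (X i - x0)) / norm (X i - x0)\<bar> \<le> B w * 2"
          using n by (simp add: field_simps)
        from mult_left_mono[OF this, of "\<bar>g w\<bar>"]
        show "norm (q i w) \<le> \<bar>g w\<bar> * B w * 2" by (simp add: q_def abs_mult)
      qed
      show "AE w in M. (\<lambda>i. q i w) \<longlonglongrightarrow> 0"
      proof (rule AE_I2)
        fix w
        have "((\<lambda>y. ((k y w - k x0 w) - D w (y - x0)) /\<^sub>R norm (y - x0)) \<longlongrightarrow> 0) (at x0 within ball x0 r)"
          using has_derivative_at_withinI[OF der] unfolding has_derivative_at_within by blast
        then have "(\<lambda>i. ((k (X i) w - k x0 w) - D w (X i - x0)) /\<^sub>R norm (X i - x0)) \<longlonglongrightarrow> 0"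
          using X unfolding tendsto_at_iff_sequentially comp_def by blast
        from tendsto_mult[OF tendsto_const[of "g w"] this]
        show "(\<lambda>i. q i w) \<longlonglongrightarrow> 0" by (simp add: q_def divide_inverse mult.commute)
      qed
    qed (use iB in auto)
    then show "(\<lambda>i. ((LINT w|M. g w * k (X i) w) - (LINT w|M. g w * k x0 w) - (LINT w|M. g w * D w (X i - x0))) /\<^sub>R norm (X i - x0)) \<longlonglongrightarrow> 0"
      unfolding eq by simp
  qed
  then have "((\<lambda>x. LINT w|M. g w * k x w) has_derivative (\<lambda>h. LINT w|M. g w * D w h)) (at x0 within ball x0 r)"
    unfolding has_derivative_at_within using bl by blast
  then show ?thesis using r by (simp add: at_within_open[of x0 "ball x0 r"])
qed

lemma test_function_derivative:
  fixes \<phi> :: "'a::euclidean_space \<Rightarrow> real"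
  assumes "\<phi> \<in> test_functions S"
  obtains L R where "L > 0" "R > 0" "\<And>y. (\<phi> has_derivative frechet_derivative \<phi> (at y)) (at y)"
    "\<And>y h. \<bar>frechet_derivative \<phi> (at y) h\<bar> \<le> L * norm h * indicator (cball 0 R) y"
    "\<And>y y'. \<bar>\<phi> y - \<phi> y'\<bar> \<le> L * norm (y - y')"
    "\<And>y. \<bar>\<phi> y\<bar> \<le> L * indicator (cball 0 R) y"
proof -
  obtain B0 R0 where BR0: "B0 > 0" "R0 > 0" "\<And>x. \<bar>\<phi> x\<bar> \<le> B0 * indicator (cball 0 R0) x"
    using test_function_bounded[OF assms] by metis
  have "\<forall>b\<in>Basis. \<exists>B. B > 0 \<and> (\<forall>x. \<bar>partial_deriv b \<phi> x\<bar> \<le> B)"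
    using test_function_bounded[OF partial_deriv_test_function[OF assms]] by metis
  then obtain Bf where Bf: "\<And>b. b \<in> Basis \<Longrightarrow> Bf b > 0" "\<And>b x. b \<in> Basis \<Longrightarrow> \<bar>partial_deriv b \<phi> x\<bar> \<le> Bf b" by metis
  define L where "L = B0 + (\<Sum>b\<in>Basis. Bf b)"
  have sn: "(\<Sum>b\<in>Basis. Bf b) \<ge> 0" using Bf(1) by (intro sum_nonneg) (auto simp: less_imp_le)
  have L: "L > 0" unfolding L_def using BR0(1) sn by simp
  obtain K where K: "\<phi> \<in> C_infinity" using test_functionsE[OF assms] by metis
  have d: "(\<phi> has_derivative frechet_derivative \<phi> (at y)) (at y)" for y
    using C_infinityD(1)[OF K] frechet_derivative_works by blast
  have z: "\<phi> x = 0" if "x \<notin> cball 0 R0" for x using BR0(3)[of x] that by simp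
  have b: "\<bar>frechet_derivative \<phi> (at y) h\<bar> \<le> L * norm h * indicator (cball 0 R0) y" for y h
  proof (cases "y \<in> cball 0 R0")
    case True
    have lin: "linear (frechet_derivative \<phi> (at y))" using d has_derivative_linear by blast
    have "frechet_derivative \<phi> (at y) h = frechet_derivative \<phi> (at y) (\<Sum>b\<in>Basis. (h \<bullet> b) *\<^sub>R b)"
      by (simp add: euclidean_representation)
    also have "\<dots> = (\<Sum>b\<in>Basis. (h \<bullet> b) * partial_deriv b \<phi> y)"
      by (simp add: linear_sum[OF lin] linear_cmul[OF lin] partial_deriv_def)
    also have "\<bar>\<dots>\<bar> \<le> (\<Sum>b\<in>Basis. \<bar>(h \<bullet> b) * partial_deriv b \<phi> y\<bar>)" by (rule sum_abs)
    also have "\<dots> \<le> (\<Sum>b\<in>Basis. norm h * Bf b)"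
      by (intro sum_mono) (auto simp: abs_mult Basis_le_norm intro!: mult_mono Bf(2))
    also have "\<dots> = norm h * (\<Sum>b\<in>Basis. Bf b)" by (simp add: sum_distrib_left)
    also have "\<dots> \<le> norm h * L" unfolding L_def using BR0(1) by (intro mult_left_mono) auto
    finally show ?thesis using True by (simp add: mult.commute)
  next
    case False
    have "((\<lambda>_. 0) has_derivative (\<lambda>_. 0)) (at y)" by simp
    then have "(\<phi> has_derivative (\<lambda>_. 0)) (at y)"
      by (rule has_derivative_transform_within_open[of _ _ _ _ "- cball 0 R0"]) (use z False in auto)
    then have "frechet_derivative \<phi> (at y) = (\<lambda>_. 0)" by (rule frechet_derivative_at[symmetric])
    then show ?thesis using L by simp
  qed
  have lip: "\<bar>\<phi> y - \<phi> y'\<bar> \<le> L * norm (y - y')" for y y'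
  proof -
    have "norm (\<phi> y - \<phi> y') \<le> L * norm (y - y')"
    proof (rule differentiable_bound[OF convex_UNIV])
      show "onorm (frechet_derivative \<phi> (at x)) \<le> L" for x
      proof (rule onorm_bound)
        fix h
        show "norm (frechet_derivative \<phi> (at x) h) \<le> L * norm h"
          using b[of x h] L by (cases "x \<in> cball 0 R0") auto
      qed (use L in auto)
    qed (use d in auto)
    then show ?thesis by simp
  qed
  have "\<bar>\<phi> y\<bar> \<le> L * indicator (cball 0 R0) y" for y
    using BR0(3)[of y] sn by (cases "y \<in> cball 0 R0") (auto simp: L_def)
  then show ?thesis using that[OF L BR0(2) d b lip] by blast
qed

lemma cball_shift:
  assumes "norm (x - x0) < 1" "z - x \<in> cball 0 R"
  shows "z \<in> cball 0 (R + norm x0 + 1)"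
proof -
  have "norm z \<le> norm (z - x) + norm (x - x0) + norm x0"
    using norm_triangle_ineq[of "z - x" "x"] norm_triangle_ineq[of "x - x0" x0] by simp
  then show ?thesis using assms by auto
qed

lemma indicator_cball_shift:
  assumes "norm (x - x0) < 1" "R > 0"
  shows "indicator (cball 0 R) (z - x) \<le> (indicator (cball 0 (R + norm x0 + 1)) z :: real)"
proof -
  have "norm z \<le> norm (z - x) + norm (x - x0) + norm x0"
    using norm_triangle_ineq[of "z - x" "x"] norm_triangle_ineq[of "x - x0" x0] by simp
  then show ?thesis using assms by (auto simp: indicator_def)
qed

lemma corr_has_derivative:
  fixes f :: "'a::euclidean_space \<Rightarrow> real"
  assumes f[measurable]: "f \<in> borel_measurable borel" and fin: "pmass p f < \<infinity>" "p \<ge> 1"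
    and \<phi>: "\<phi> \<in> test_functions S"
  shows "((\<lambda>x. LINT z|lborel. f z * \<phi> (z - x)) has_derivative
     (\<lambda>h. LINT z|lborel. f z * (- frechet_derivative \<phi> (at (z - x0)) h))) (at x0)"
proof -
  obtain L R where LR: "L > 0" "R > 0" "\<And>y. (\<phi> has_derivative frechet_derivative \<phi> (at y)) (at y)"
    "\<And>y h. \<bar>frechet_derivative \<phi> (at y) h\<bar> \<le> L * norm h * indicator (cball 0 R) y"
    "\<And>y y'. \<bar>\<phi> y - \<phi> y'\<bar> \<le> L * norm (y - y')"
    "\<And>y. \<bar>\<phi> y\<bar> \<le> L * indicator (cball 0 R) y"
    using test_function_derivative[OF \<phi>] by metis
  define A where "A = cball (0::'a) (R + norm x0 + 1)"
  have [measurable]: "A \<in> sets borel" by (simp add: A_def)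
  have Af: "emeasure lborel A < \<infinity>" unfolding A_def by (rule emeasure_cball_fin)
  have [measurable]: "\<phi> \<in> borel_measurable borel" by (rule test_function_borel[OF \<phi>])
  have [measurable]: "(\<lambda>z. frechet_derivative \<phi> (at (z - x0)) h) \<in> borel_measurable borel" for h
  proof -
    have "frechet_derivative \<phi> (at (z - x0)) h = (\<Sum>b\<in>Basis. (h \<bullet> b) * partial_deriv b \<phi> (z - x0))" for z
    proof -
      have lin: "linear (frechet_derivative \<phi> (at (z - x0)))" using LR(3) has_derivative_linear by blast
      have "frechet_derivative \<phi> (at (z - x0)) h = frechet_derivative \<phi> (at (z - x0)) (\<Sum>b\<in>Basis. (h \<bullet> b) *\<^sub>R b)"
        by (simp add: euclidean_representation)
      then show ?thesis by (simp add: linear_sum[OF lin] linear_cmul[OF lin] partial_deriv_def)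
    qed
    moreover have "(\<lambda>z. \<Sum>b\<in>Basis. (h \<bullet> b) * partial_deriv b \<phi> (z - x0)) \<in> borel_measurable borel"
    proof (intro borel_measurable_sum borel_measurable_times)
      fix b :: 'a assume "b \<in> Basis"
      then have [measurable]: "partial_deriv b \<phi> \<in> borel_measurable borel"
        using partial_deriv_test_function[OF \<phi>] test_function_borel by blast
      show "(\<lambda>z. partial_deriv b \<phi> (z - x0)) \<in> borel_measurable borel" by measurable
    qed auto
    ultimately show ?thesis by simp
  qed
  show ?thesis
  proof (rule has_derivative_integral_kernel[where B = "\<lambda>z. L * indicator A z" and r = 1])
    fix z
    have "((\<lambda>x. z - x) has_derivative (\<lambda>h. - h)) (at x0)" by (auto intro!: derivative_eq_intros)
    from has_derivative_compose[OF this, of \<phi>, OF LR(3)]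
    have "((\<lambda>x. \<phi> (z - x)) has_derivative (\<lambda>h. frechet_derivative \<phi> (at (z - x0)) (- h))) (at x0)" .
    moreover have "linear (frechet_derivative \<phi> (at (z - x0)))" using LR(3) has_derivative_linear by blast
    ultimately show "((\<lambda>x. \<phi> (z - x)) has_derivative (\<lambda>h. - frechet_derivative \<phi> (at (z - x0)) h)) (at x0)"
      by (simp add: linear_neg)
  next
    fix x z assume x: "x \<in> ball x0 1"
    then have nx: "norm (x - x0) < 1" by (simp add: dist_norm norm_minus_commute)
    show "\<bar>\<phi> (z - x) - \<phi> (z - x0)\<bar> \<le> L * indicator A z * norm (x - x0)"
    proof (cases "z \<in> A")
      case True
      then show ?thesis using LR(5)[of "z - x" "z - x0"] by (simp add: norm_minus_commute)
    next
      case False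
      have "z - x \<notin> cball 0 R" "z - x0 \<notin> cball 0 R"
        using cball_shift[OF nx] cball_shift[of x0 x0] False unfolding A_def by auto
      then have "\<phi> (z - x) = 0" "\<phi> (z - x0) = 0"
        using LR(6)[of "z - x"] LR(6)[of "z - x0"] by auto
      then show ?thesis using LR(1) by simp
    qed
  next
    fix z h :: 'a
    have "(indicator (cball 0 R) (z - x0) :: real) \<le> indicator A z"
      unfolding A_def using LR(2) by (intro indicator_cball_shift) auto
    then have "L * norm h * indicator (cball 0 R) (z - x0) \<le> L * norm h * indicator A z"
      using LR(1) by (intro mult_left_mono) auto
    with LR(4)[of "z - x0" h]
    show "\<bar>- frechet_derivative \<phi> (at (z - x0)) h\<bar> \<le> L * indicator A z * norm h"
      by (simp add: mult.commute mult.left_commute)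
  next
    show "integrable lborel (\<lambda>z. f z * (L * indicator A z))"
      by (rule Lp_bounded_set_integrable[where A = A and B = L, OF _ _ _ _ fin(2)]) (use fin LR(1) Af in auto)
  next
    fix x assume x: "x \<in> ball x0 1"
    then have nx: "norm (x - x0) < 1" by (simp add: dist_norm norm_minus_commute)
    show "integrable lborel (\<lambda>z. f z * \<phi> (z - x))"
    proof (rule Lp_bounded_set_integrable[where A = A and B = L, OF _ _ _ _ fin(2)])
      fix z
      have "L * indicator (cball 0 R) (z - x) \<le> L * indicator A z"
        unfolding A_def using nx LR(1,2) by (intro mult_left_mono indicator_cball_shift) auto
      then show "\<bar>\<phi> (z - x)\<bar> \<le> L * indicator A z" using LR(6) order_trans by blast
    qed (use fin Af in auto)
  qed (use LR(1) in auto)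
qed

text \<open>
  Differentiation replaces \<open>\<phi>\<close> by a multiple of one of its partial derivatives, again a test
  function, so the class of these functions is closed under partial derivatives.
\<close>

lemma corr_C_infinity:
  fixes f :: "'a::euclidean_space \<Rightarrow> real"
  assumes f[measurable]: "f \<in> borel_measurable borel" and fin: "pmass p f < \<infinity>" "p \<ge> 1"
    and \<phi>: "\<phi> \<in> test_functions S"
  shows "(\<lambda>x. LINT z|lborel. f z * \<phi> (z - x)) \<in> C_infinity"
    and "partial_deriv b (\<lambda>x. LINT z|lborel. f z * \<phi> (z - x)) x = - (LINT z|lborel. f z * partial_deriv b \<phi> (z - x))"
proof -
  have pd: "partial_deriv b (\<lambda>x. LINT z|lborel. f z * \<psi> (z - x)) x = - (LINT z|lborel. f z * partial_deriv b \<psi> (z - x))"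
    if "\<psi> \<in> test_functions S" for \<psi> b x
    using partial_deriv_eq[OF corr_has_derivative[OF f fin that, of x], of b] by (simp add: partial_deriv_def)
  show "partial_deriv b (\<lambda>x. LINT z|lborel. f z * \<phi> (z - x)) x = - (LINT z|lborel. f z * partial_deriv b \<phi> (z - x))"
    by (rule pd[OF \<phi>])
  show "(\<lambda>x. LINT z|lborel. f z * \<phi> (z - x)) \<in> C_infinity"
  proof (rule C_infinity_coinduct[of _ "{(\<lambda>x. LINT z|lborel. f z * \<psi> (z - x)) |\<psi>. \<psi> \<in> test_functions S}"])
    fix F :: "'a \<Rightarrow> real" and x b :: 'a
    assume "F \<in> {(\<lambda>x. LINT z|lborel. f z * \<psi> (z - x)) |\<psi>. \<psi> \<in> test_functions S}"
    then obtain \<psi> where F: "F = (\<lambda>x. LINT z|lborel. f z * \<psi> (z - x))" and psi: "\<psi> \<in> test_functions S" by auto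
    show "F differentiable (at x)" unfolding F using corr_has_derivative[OF f fin psi] by (auto simp: differentiable_def)
    assume b: "b \<in> Basis"
    have "(\<lambda>z. (-1) * partial_deriv b \<psi> (1 *\<^sub>R (z - 0))) \<in> test_functions S"
      by (rule test_function_affine[OF partial_deriv_test_function[OF psi b]]) auto
    moreover have "partial_deriv b F = (\<lambda>x. LINT z|lborel. f z * ((-1) * partial_deriv b \<psi> (1 *\<^sub>R ((z - x) - 0))))"
      unfolding F using pd[OF psi] by auto
    ultimately show "partial_deriv b F \<in> {(\<lambda>x. LINT z|lborel. f z * \<psi> (z - x)) |\<psi>. \<psi> \<in> test_functions S}"
      by (intro CollectI exI[of _ "\<lambda>z. (-1) * partial_deriv b \<psi> (1 *\<^sub>R (z - 0))"]) simp
  qed (use \<phi> in auto)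
qed

text \<open>The substitution \<open>z = x + e *\<^sub>R w\<close> moves the dependence on \<open>x\<close> and \<open>e\<close> from \<open>f\<close> to the kernel.\<close>

lemma moll_eq_corr:
  fixes f :: "'a::euclidean_space \<Rightarrow> real"
  assumes [measurable]: "f \<in> borel_measurable borel" "\<phi> \<in> borel_measurable borel" and e: "e > 0"
  shows "moll \<phi> e f x = (LINT z|lborel. f z * ((1 / e ^ DIM('a)) * \<phi> ((1 / e) *\<^sub>R (z - x))))"
proof -
  have "moll \<phi> e f x = (LINT w|lborel. (\<lambda>z. f z * \<phi> ((1 / e) *\<^sub>R (z - x))) (x + e *\<^sub>R w))"
    using e by (simp add: moll_def)
  also have "\<dots> = (1 / e ^ DIM('a)) * (LINT z|lborel. f z * \<phi> ((1 / e) *\<^sub>R (z - x)))"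
    by (rule integral_scale) (use e in auto)
  also have "\<dots> = (LINT z|lborel. (1 / e ^ DIM('a)) * (f z * \<phi> ((1 / e) *\<^sub>R (z - x))))"
    by simp
  finally show ?thesis by (simp add: mult.left_commute)
qed

lemma moll_smooth:
  fixes f :: "'a::euclidean_space \<Rightarrow> real"
  assumes f[measurable]: "f \<in> borel_measurable borel" and fin: "pmass p f < \<infinity>" "p \<ge> 1"
    and \<phi>: "\<phi> \<in> test_functions S" and e: "e > 0"
  shows "moll \<phi> e f \<in> C_infinity"
    and "partial_deriv b (moll \<phi> e f) x = - (LINT z|lborel. f z * partial_deriv b (\<lambda>z. (1 / e ^ DIM('a)) * \<phi> ((1 / e) *\<^sub>R (z - x))) z)"
    and "b \<in> Basis \<Longrightarrow> partial_deriv b (moll \<phi> e f) x = - (1 / e) * moll (partial_deriv b \<phi>) e f x"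
proof -
  let ?\<psi> = "\<lambda>z::'a. (1 / e ^ DIM('a)) * \<phi> ((1 / e) *\<^sub>R (z - 0))"
  have psi: "?\<psi> \<in> test_functions UNIV" by (rule test_function_affine[OF \<phi>]) (use e in auto)
  have [measurable]: "\<phi> \<in> borel_measurable borel" by (rule test_function_borel[OF \<phi>])
  have C: "\<phi> \<in> C_infinity" using test_functionsE[OF \<phi>] by metis
  have eq: "moll \<phi> e f = (\<lambda>x. LINT z|lborel. f z * ?\<psi> (z - x))"
    using moll_eq_corr[OF f _ e, of \<phi>] by auto
  show "moll \<phi> e f \<in> C_infinity" unfolding eq by (rule corr_C_infinity(1)[OF f fin psi])
  have pdeq: "partial_deriv b ?\<psi> (z - x) = partial_deriv b (\<lambda>z. (1 / e ^ DIM('a)) * \<phi> ((1 / e) *\<^sub>R (z - x))) z" for x z b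
    unfolding partial_deriv_affine[OF C] by simp
  show 2: "partial_deriv b (moll \<phi> e f) x = - (LINT z|lborel. f z * partial_deriv b (\<lambda>z. (1 / e ^ DIM('a)) * \<phi> ((1 / e) *\<^sub>R (z - x))) z)"
    unfolding eq by (subst corr_C_infinity(2)[OF f fin psi]) (simp only: pdeq)
  assume b: "b \<in> Basis"
  have [measurable]: "partial_deriv b \<phi> \<in> borel_measurable borel"
    using partial_deriv_test_function[OF \<phi> b] test_function_borel by blast
  have "moll (partial_deriv b \<phi>) e f x = (LINT z|lborel. f z * ((1 / e ^ DIM('a)) * partial_deriv b \<phi> ((1 / e) *\<^sub>R (z - x))))"
    by (rule moll_eq_corr[OF f _ e]) simp
  moreover have "(LINT z|lborel. f z * partial_deriv b (\<lambda>z. (1 / e ^ DIM('a)) * \<phi> ((1 / e) *\<^sub>R (z - x))) z)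
     = (LINT z|lborel. (1 / e) * (f z * ((1 / e ^ DIM('a)) * partial_deriv b \<phi> ((1 / e) *\<^sub>R (z - x)))))"
    unfolding partial_deriv_affine[OF C] by (intro Bochner_Integration.integral_cong) auto
  ultimately show "partial_deriv b (moll \<phi> e f) x = - (1 / e) * moll (partial_deriv b \<phi>) e f x"
    unfolding 2 by simp
qed

section \<open>Weak derivatives\<close>

text \<open>
  The integration by parts formula alone, for functions on the whole space that are meant to
  vanish outside \<open>S\<close>; local integrability comes from finiteness of a mass
  (\<open>Lp_integrable_compact\<close>).
\<close>

definition weakd :: "'a::euclidean_space set \<Rightarrow> 'a \<Rightarrow> ('a \<Rightarrow> real) \<Rightarrow> ('a \<Rightarrow> real) \<Rightarrow> bool" where
  "weakd S b u v \<longleftrightarrow> (\<forall>\<phi>\<in>test_functions S. (LINT x|lborel. u x * partial_deriv b \<phi> x) = - (LINT x|lborel. v x * \<phi> x))"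

lemma Lp_mass_1: "Lp_mass M 1 f = (\<integral>\<^sup>+x. ennreal \<bar>f x\<bar> \<partial>M)"
  by (simp add: Lp_mass_def)

lemma locally_integrable_obtain:
  assumes "locally_integrable S v" "compact K" "K \<subseteq> S"
  obtains f where "zrep K v f" "pmass 1 f < \<infinity>"
proof -
  have K: "K \<in> sets borel" using assms(2) by (simp add: compact_imp_closed)
  have "set_integrable lebesgue K v" using assms by (auto simp: locally_integrable_def)
  then have "integrable (lebesgue_on K) v"
    unfolding set_integrable_def using K by (subst integrable_restrict_space) auto
  moreover from this obtain f where f: "zrep K v f" using zrep_exists[OF _ K] by (metis borel_measurable_integrable)
  ultimately have "integrable lborel f" using zrep_integral(2)[OF f K] by simp
  then have "pmass 1 f < \<infinity>" by (simp add: Lp_mass_1 integrable_iff_bounded)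
  with f show ?thesis by (rule that)
qed

lemma locally_integrableI_zrep:
  assumes "zrep S u u'" "S \<in> sets borel" "\<And>K. compact K \<Longrightarrow> K \<subseteq> S \<Longrightarrow> integrable lborel (\<lambda>x. indicator K x * u' x)"
  shows "locally_integrable S u"
  unfolding locally_integrable_def
proof (intro allI impI)
  fix K assume K: "compact K \<and> K \<subseteq> S"
  then have KB: "K \<in> sets borel" by (simp add: compact_imp_closed)
  have "zrep K u (\<lambda>x. indicator K x * u' x)"
    using assms(1) K KB unfolding zrep_def by (auto elim!: eventually_mono)
  from zrep_integral(2)[OF this KB] assms(3) K have "integrable (lebesgue_on K) u" by auto
  then show "u absolutely_integrable_on K"
    unfolding set_integrable_def using KB by (subst (asm) integrable_restrict_space) auto
qed

lemma compact_emeasure_fin: "compact (K::'a::euclidean_space set) \<Longrightarrow> emeasure lborel K < \<infinity>"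
  by (rule emeasure_compact_finite)

lemma Lp_integrable_compact:
  fixes f :: "'a::euclidean_space \<Rightarrow> real"
  assumes "f \<in> borel_measurable borel" "pmass p f < \<infinity>" "p \<ge> 1" "compact K"
  shows "integrable lborel (\<lambda>x. indicator K x * f x)"
  using Lp_bounded_set_integrable[of f lborel "indicator K" K p 1] assms compact_emeasure_fin[OF assms(4)]
  by (auto simp: compact_imp_closed mult.commute)

lemma test_function_restrict:
  assumes "\<phi> \<in> test_functions S" "S \<subseteq> T"
  shows "\<phi> \<in> test_functions T"
  using assms by (auto simp: test_functions_def)

text \<open>
  At scales below \<open>r\<close> and at points of the small ball the mollifications of \<open>f\<close> are integrals
  against test functions on the large ball, hence \<open>0\<close>; they converge to \<open>f\<close> in \<open>L\<^sup>1\<close>.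
\<close>

lemma local_L1_zero:
  fixes f :: "'a::euclidean_space \<Rightarrow> real"
  assumes [measurable]: "f \<in> borel_measurable borel" and fin: "pmass 1 f < \<infinity>"
    and zero: "\<And>\<phi>. \<phi> \<in> test_functions (cball a (2 * r)) \<Longrightarrow> (LINT x|lborel. f x * \<phi> x) = 0" and r: "r > 0"
  shows "AE x in lborel. x \<in> ball a r \<longrightarrow> f x = 0"
proof -
  obtain \<phi> where \<phi>: "\<phi> \<in> test_functions (cball (0::'a) 1)" "\<And>x. \<phi> x \<ge> 0" "integral\<^sup>L lborel \<phi> = 1"
    using exists_mollifier[of 1 "0::'a"] by auto
  interpret mollifier \<phi> "cball 0 1" by unfold_locales (use \<phi> in auto)
  define e where "e = (\<lambda>k. r / real (Suc k))"
  have "(\<lambda>k. r * inverse (real (Suc k))) \<longlonglongrightarrow> r * 0"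
    by (intro tendsto_intros LIMSEQ_inverse_real_of_nat)
  then have e0: "e \<longlonglongrightarrow> 0" by (simp add: e_def divide_inverse)
  have ep: "e k > 0" "e k \<le> r" for k using r by (auto simp: e_def field_simps)
  have lim: "(\<lambda>k. pmass 1 (\<lambda>x. moll \<phi> (e k) f x - f x)) \<longlonglongrightarrow> 0"
    by (rule moll_tendsto[OF _ fin _ e0]) (use ep in auto)
  have mz: "moll \<phi> (e k) f x = 0" if "x \<in> ball a r" for x k
  proof -
    have "(\<lambda>z. (1 / e k ^ DIM('a)) * \<phi> ((1 / e k) *\<^sub>R (z - x))) \<in> test_functions (cball a (2 * r))"
    proof (rule test_function_affine[OF \<phi>(1)])
      fix z assume "(1 / e k) *\<^sub>R (z - x) \<in> cball 0 1"
      then have "norm (z - x) \<le> e k" using ep[of k] by (simp add: divide_simps flip: scaleR_diff_right)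
      then have "dist a z \<le> r + e k" using that dist_triangle[of a z x] by (simp add: dist_norm norm_minus_commute)
      then show "z \<in> cball a (2 * r)" using ep[of k] by simp
    qed (use ep[of k] in auto)
    from zero[OF this] show ?thesis by (subst moll_eq_corr) (use ep in auto)
  qed
  define F where "F = (\<lambda>x. indicator (ball a r) x * f x)"
  have "pmass 1 F \<le> pmass 1 (\<lambda>x. moll \<phi> (e k) f x - f x)" for k
    by (rule Lp_mass_mono) (auto simp: F_def mz indicator_def)
  with lim have "pmass 1 F \<le> 0"
    by (intro LIMSEQ_le_const[OF lim]) auto
  then have "AE x in lborel. F x = 0"
  proof (intro Lp_mass_zero_imp_AE[of _ _ 1])
    have "F \<in> borel_measurable borel" unfolding F_def by (intro borel_measurable_times borel_measurable_indicator assms(1)) simp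
    then show "F \<in> borel_measurable lborel" by simp
  qed simp
  then show ?thesis by eventually_elim (auto simp: F_def)
qed

text \<open>
  The difference vanishes almost everywhere on a ball around each point by \<open>local_L1_zero\<close>, and by
  Lindelof countably many of these balls cover \<open>S\<close>.
\<close>

lemma weak_deriv_unique:
  fixes S :: "'a::euclidean_space set"
  assumes "open S" "has_weak_deriv S b u v" "has_weak_deriv S b u w"
  shows "AE x in lborel. x \<in> S \<longrightarrow> v x = w x"
proof -
  have SB: "S \<in> sets borel" using assms by auto
  have loc: "\<exists>r>0. cball a (2 * r) \<subseteq> S \<and> (AE x in lborel. x \<in> ball a r \<longrightarrow> v x = w x)" if a: "a \<in> S" for a
  proof -
    obtain d where d: "d > 0" "cball a d \<subseteq> S" using assms(1) a open_contains_cball by blast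
    define r where "r = d / 2"
    have r: "r > 0" "cball a (2 * r) \<subseteq> S" using d by (auto simp: r_def)
    let ?K = "cball a (2 * r)"
    have lv: "locally_integrable S v" "locally_integrable S w" using assms by (auto simp: has_weak_deriv_def)
    obtain f where f: "zrep ?K v f" "pmass 1 f < \<infinity>" using locally_integrable_obtain[OF lv(1) _ r(2)] by auto
    obtain g where g: "zrep ?K w g" "pmass 1 g < \<infinity>" using locally_integrable_obtain[OF lv(2) _ r(2)] by auto
    have [measurable]: "f \<in> borel_measurable borel" "g \<in> borel_measurable borel" using zrepD f g by auto
    have "AE x in lborel. x \<in> ball a r \<longrightarrow> f x - g x = 0"
    proof (rule local_L1_zero[OF _ _ _ r(1)])
      have "pmass 1 (\<lambda>x. f x - g x) \<le> ennreal (2 powr 1) * (pmass 1 f + pmass 1 g)"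
        by (rule Lp_mass_diff) auto
      also have "\<dots> < \<infinity>" using f g by (simp add: ennreal_mult_less_top)
      finally show "pmass 1 (\<lambda>x. f x - g x) < \<infinity>" .
      fix \<phi> assume phi: "\<phi> \<in> test_functions ?K"
      then have phiS: "\<phi> \<in> test_functions S" using r(2) by (rule test_function_restrict)
      have pb [measurable]: "\<phi> \<in> borel_measurable borel" using phi by (rule test_function_borel)
      have pz: "\<phi> x = 0" if "x \<notin> ?K" for x using phi that by (metis test_functionsE subsetD)
      have tr: "zrep S (\<lambda>x. v x * \<phi> x) (\<lambda>x. f x * \<phi> x)" if "zrep ?K v f" for v f
      proof -
        have v: "f x = 0" if "x \<notin> ?K" for x by (rule zrepD(2)[OF \<open>zrep ?K v f\<close> that])
        have "AE x in lborel. x \<in> S \<longrightarrow> v x * \<phi> x = f x * \<phi> x"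
          using zrepD(3)[OF that] by eventually_elim (use pz in auto)
        moreover have "f x * \<phi> x = 0" if "x \<notin> S" for x using v[of x] that r(2) by (cases "x \<in> ?K") auto
        ultimately show ?thesis using zrepD(1)[OF that] pb unfolding zrep_def by auto
      qed
      have "(LINT x|lborel. f x * \<phi> x) = (LINT x|lborel. g x * \<phi> x)"
        using assms(2,3) phiS zrep_integral(1)[OF tr[OF f(1)] SB] zrep_integral(1)[OF tr[OF g(1)] SB]
        unfolding has_weak_deriv_def by (metis neg_equal_iff_equal)
      then show "(LINT x|lborel. (f x - g x) * \<phi> x) = 0"
        using Lp_test_integrable[OF _ f(2) _ phi] Lp_test_integrable[OF _ g(2) _ phi]
        by (simp add: left_diff_distrib)
    qed measurable
    with zrepD(3)[OF f(1)] zrepD(3)[OF g(1)] have "AE x in lborel. x \<in> ball a r \<longrightarrow> v x = w x"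
      by eventually_elim (use r in auto)
    with r show ?thesis by blast
  qed
  then obtain r where r: "\<And>a. a \<in> S \<Longrightarrow> r a > 0" "\<And>a. a \<in> S \<Longrightarrow> AE x in lborel. x \<in> ball a (r a) \<longrightarrow> v x = w x"
    by metis
  obtain F where F: "F \<subseteq> (\<lambda>a. ball a (r a)) ` S" "countable F" "\<Union>F = \<Union>((\<lambda>a. ball a (r a)) ` S)"
    using Lindelof[of "(\<lambda>a. ball a (r a)) ` S"] by auto
  have "AE x in lborel. \<forall>B\<in>F. x \<in> B \<longrightarrow> v x = w x"
    using F(1) r(2) by (subst AE_ball_countable[OF F(2)]) auto
  then show ?thesis
  proof eventually_elim
    case (elim x)
    show ?case
    proof
      assume "x \<in> S"
      then have "x \<in> \<Union>F" unfolding F(3) using r(1) by force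
      then show "v x = w x" using elim by auto
    qed
  qed
qed

lemma zrep_weakd_iff:
  assumes "zrep S u u'" "zrep S v v'" "S \<in> sets borel" "b \<in> Basis"
  shows "(\<forall>\<phi>\<in>test_functions S.
        (LINT x|lebesgue_on S. u x * partial_deriv b \<phi> x) = - (LINT x|lebesgue_on S. v x * \<phi> x)) \<longleftrightarrow> weakd S b u' v'"
  unfolding weakd_def
proof (intro ball_cong refl)
  fix \<phi> assume "\<phi> \<in> test_functions S"
  then have m: "\<phi> \<in> borel_measurable borel" "partial_deriv b \<phi> \<in> borel_measurable borel"
    using test_function_borel partial_deriv_test_function[OF _ assms(4)] by blast+
  show "((LINT x|lebesgue_on S. u x * partial_deriv b \<phi> x) = - (LINT x|lebesgue_on S. v x * \<phi> x)) =
    ((LINT x|lborel. u' x * partial_deriv b \<phi> x) = - (LINT x|lborel. v' x * \<phi> x))"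
    using zrep_integral(1)[OF zrep_mult[OF assms(1) m(2)] assms(3)] zrep_integral(1)[OF zrep_mult[OF assms(2) m(1)] assms(3)]
    by simp
qed

text \<open>
  \<open>u'\<close> and \<open>D b\<close> are Borel representatives, extended by zero, of \<open>u\<close> and of its weak derivative in
  direction \<open>b\<close>. All estimates are made for such data.
\<close>

definition W1p_rep :: "'a::euclidean_space set \<Rightarrow> real \<Rightarrow> ('a \<Rightarrow> real) \<Rightarrow> ('a \<Rightarrow> real) \<Rightarrow> ('a \<Rightarrow> 'a \<Rightarrow> real) \<Rightarrow> bool" where
  "W1p_rep S p u u' D \<longleftrightarrow> zrep S u u' \<and> pmass p u' < \<infinity> \<and>
     (\<forall>b\<in>Basis. D b \<in> borel_measurable borel \<and> (\<forall>x. x \<notin> S \<longrightarrow> D b x = 0) \<and> pmass p (D b) < \<infinity> \<and> weakd S b u' (D b))"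

lemma W1p_repD:
  assumes "W1p_rep S p u u' D"
  shows "zrep S u u'" "u' \<in> borel_measurable borel" "x \<notin> S \<Longrightarrow> u' x = 0" "pmass p u' < \<infinity>"
    "b \<in> Basis \<Longrightarrow> D b \<in> borel_measurable borel" "b \<in> Basis \<Longrightarrow> x \<notin> S \<Longrightarrow> D b x = 0"
    "b \<in> Basis \<Longrightarrow> pmass p (D b) < \<infinity>" "b \<in> Basis \<Longrightarrow> weakd S b u' (D b)"
  using assms by (auto simp: W1p_rep_def zrep_def)

lemma W1p_rep_has_weak_deriv:
  assumes "W1p_rep S p u u' D" "S \<in> sets borel" "p \<ge> 1" "b \<in> Basis"
  shows "has_weak_deriv S b u (D b)"
proof -
  note D = W1p_repD[OF assms(1)]
  have z: "zrep S (D b) (D b)" using D(5,6) assms(4) by (auto simp: zrep_def)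
  show ?thesis
    unfolding has_weak_deriv_def zrep_weakd_iff[OF D(1) z assms(2,4)]
    using D(8) assms Lp_integrable_compact[OF D(2,4)] Lp_integrable_compact[OF D(5,7)]
    by (intro conjI locally_integrableI_zrep[OF D(1)] locally_integrableI_zrep[OF z]) auto
qed

lemma W1p_rep_W1p:
  assumes "W1p_rep S p u u' D" "S \<in> sets borel" "p \<ge> 1"
  shows "u \<in> W1p S p"
proof -
  note D = W1p_repD[OF assms(1)]
  have "u \<in> Lp S p" using Lp_iff_zrep[OF assms(2) D(1)] D(4) by simp
  moreover have "D b \<in> Lp S p" if "b \<in> Basis" for b
  proof -
    have z: "zrep S (D b) (D b)" using D(5,6) that by (auto simp: zrep_def)
    show ?thesis using Lp_iff_zrep[OF assms(2) z] D(7) that by simp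
  qed
  ultimately show ?thesis
    using W1p_rep_has_weak_deriv[OF assms] by (auto simp: W1p_def)
qed

lemma W1p_obtain_rep:
  assumes "u \<in> W1p S p" "S \<in> sets borel"
  obtains u' D where "W1p_rep S p u u' D"
proof -
  obtain u' where u': "zrep S u u'" "pmass p u' < \<infinity>"
    using assms Lp_obtain_zrep[OF assms(2), of u p] by (auto simp: W1p_def)
  have "\<forall>b\<in>Basis. \<exists>v'. v' \<in> borel_measurable borel \<and> (\<forall>x. x \<notin> S \<longrightarrow> v' x = 0) \<and> pmass p v' < \<infinity> \<and> weakd S b u' v'"
  proof
    fix b :: 'a assume b: "b \<in> Basis"
    then obtain v where v: "v \<in> Lp S p" "has_weak_deriv S b u v" using assms by (auto simp: W1p_def)
    obtain v' where v': "zrep S v v'" "pmass p v' < \<infinity>" using Lp_obtain_zrep[OF assms(2) v(1)] by auto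
    then show "\<exists>v'. v' \<in> borel_measurable borel \<and> (\<forall>x. x \<notin> S \<longrightarrow> v' x = 0) \<and> pmass p v' < \<infinity> \<and> weakd S b u' v'"
      using v(2) zrep_weakd_iff[OF u'(1) v'(1) assms(2) b] by (auto simp: has_weak_deriv_def zrep_def)
  qed
  then obtain D where "\<forall>b\<in>Basis. D b \<in> borel_measurable borel \<and> (\<forall>x. x \<notin> S \<longrightarrow> D b x = 0) \<and> pmass p (D b) < \<infinity> \<and> weakd S b u' (D b)"
    by metis
  then show ?thesis using u' by (intro that[of u' D]) (auto simp: W1p_rep_def)
qed

lemma W1p_rep_lincomb:
  assumes "W1p_rep S p u u' D" "W1p_rep S p v v' E" "p \<ge> 1"
  shows "W1p_rep S p (\<lambda>x. c * u x + d * v x) (\<lambda>x. c * u' x + d * v' x) (\<lambda>b x. c * D b x + d * E b x)"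
proof -
  note D = W1p_repD[OF assms(1)] and E = W1p_repD[OF assms(2)]
  have fin: "pmass p (\<lambda>x. c * f x + d * g x) < \<infinity>"
    if [measurable]: "f \<in> borel_measurable borel" "g \<in> borel_measurable borel" and "pmass p f < \<infinity>" "pmass p g < \<infinity>" for f g :: "'a \<Rightarrow> real"
  proof -
    have "pmass p (\<lambda>x. c * f x + d * g x) \<le> ennreal (2 powr p) * (pmass p (\<lambda>x. c * f x) + pmass p (\<lambda>x. d * g x))"
      by (rule Lp_mass_add) (use assms(3) in auto)
    also have "\<dots> < \<infinity>" using that by (simp add: Lp_mass_scale ennreal_mult_less_top)
    finally show ?thesis .
  qed
  show ?thesis
    unfolding W1p_rep_def
  proof (intro conjI ballI)
    fix b :: 'a assume b: "b \<in> Basis"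
    show "weakd S b (\<lambda>x. c * u' x + d * v' x) (\<lambda>x. c * D b x + d * E b x)"
      unfolding weakd_def
    proof
      fix \<phi> assume phi: "\<phi> \<in> test_functions S"
      have i: "integrable lborel (\<lambda>x. u' x * partial_deriv b \<phi> x)" "integrable lborel (\<lambda>x. v' x * partial_deriv b \<phi> x)"
        "integrable lborel (\<lambda>x. D b x * \<phi> x)" "integrable lborel (\<lambda>x. E b x * \<phi> x)"
        using Lp_test_integrable[OF D(2,4) assms(3)] Lp_test_integrable[OF E(2,4) assms(3)]
          Lp_test_integrable[OF D(5,7) assms(3) phi] Lp_test_integrable[OF E(5,7) assms(3) phi]
          partial_deriv_test_function[OF phi b] b by blast+
      have "(LINT x|lborel. (c * u' x + d * v' x) * partial_deriv b \<phi> x) =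
          (LINT x|lborel. c * (u' x * partial_deriv b \<phi> x) + d * (v' x * partial_deriv b \<phi> x))"
        by (simp add: algebra_simps)
      also have "\<dots> = c * (LINT x|lborel. u' x * partial_deriv b \<phi> x) + d * (LINT x|lborel. v' x * partial_deriv b \<phi> x)"
        using i by simp
      also have "\<dots> = - (c * (LINT x|lborel. D b x * \<phi> x) + d * (LINT x|lborel. E b x * \<phi> x))"
        using D(8)[OF b] E(8)[OF b] phi by (simp add: weakd_def)
      also have "\<dots> = - (LINT x|lborel. c * (D b x * \<phi> x) + d * (E b x * \<phi> x))"
        using i by simp
      also have "\<dots> = - (LINT x|lborel. (c * D b x + d * E b x) * \<phi> x)"
        by (simp add: algebra_simps)
      finally show "(LINT x|lborel. (c * u' x + d * v' x) * partial_deriv b \<phi> x) = - (LINT x|lborel. (c * D b x + d * E b x) * \<phi> x)" .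
    qed
  next
    show "zrep S (\<lambda>x. c * u x + d * v x) (\<lambda>x. c * u' x + d * v' x)"
      by (intro zrep_add zrep_cmult D E)
  qed (use D E fin in auto)
qed

lemma W1p_rep_diff:
  assumes "W1p_rep S p u u' D" "W1p_rep S p v v' E" "p \<ge> 1"
  shows "W1p_rep S p (u - v) (\<lambda>x. u' x - v' x) (\<lambda>b x. D b x - E b x)"
  using W1p_rep_lincomb[OF assms, of 1 "-1"] by (simp add: fun_diff_def)

lemma W1p_rep_unique:
  assumes "W1p_rep S p u u' D" "W1p_rep S p u v' E" "p \<ge> 1" "open S"
  shows "AE x in lborel. u' x = v' x" "b \<in> Basis \<Longrightarrow> AE x in lborel. D b x = E b x"
proof -
  note D = W1p_repD[OF assms(1)] and E = W1p_repD[OF assms(2)]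
  have S: "S \<in> sets borel" using assms by auto
  show "AE x in lborel. u' x = v' x"
    using zrepD(3)[OF D(1)] zrepD(3)[OF E(1)]
  proof eventually_elim
    case (elim x) then show ?case using D(3)[of x] E(3)[of x] by (cases "x \<in> S") auto
  qed
  assume b: "b \<in> Basis"
  show "AE x in lborel. D b x = E b x"
    using weak_deriv_unique[OF assms(4) W1p_rep_has_weak_deriv[OF assms(1) S assms(3) b] W1p_rep_has_weak_deriv[OF assms(2) S assms(3) b]]
  proof eventually_elim
    case (elim x) then show ?case using D(6)[OF b, of x] E(6)[OF b, of x] by (cases "x \<in> S") auto
  qed
qed

text \<open>The norm refers to a choice of weak derivatives; uniqueness ties this choice to \<open>D\<close>.\<close>

lemma W1p_norm_rep:
  assumes "W1p_rep S p u u' D" "p \<ge> 1" "open S"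
  shows "ennreal (W1p_norm S p u powr p) = pmass p u' + (\<Sum>b\<in>Basis. pmass p (D b))"
proof -
  note D = W1p_repD[OF assms(1)]
  have S: "S \<in> sets borel" using assms by auto
  have u: "u \<in> Lp S p" using Lp_iff_zrep[OF S D(1)] D(4) by simp
  have 1: "ennreal (Lp_norm S p u powr p) = pmass p u'"
    using ennreal_Lp_norm_powr[OF u] assms(2) zrep_mass[OF D(1) S] by simp
  have 2: "ennreal (Lp_norm S p (weak_deriv S b u) powr p) = pmass p (D b)" if b: "b \<in> Basis" for b
  proof -
    have w: "has_weak_deriv S b u (D b)" by (rule W1p_rep_has_weak_deriv[OF assms(1) S assms(2) b])
    then have "has_weak_deriv S b u (weak_deriv S b u)" unfolding weak_deriv_def by (rule someI[of "has_weak_deriv S b u"])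
    from weak_deriv_unique[OF assms(3) this w]
    have z: "zrep S (weak_deriv S b u) (D b)"
      using D(5,6)[OF b] by (auto simp: zrep_def)
    have "weak_deriv S b u \<in> Lp S p" using Lp_iff_zrep[OF S z] D(7)[OF b] by simp
    from ennreal_Lp_norm_powr[OF this] assms(2) zrep_mass[OF z S] show ?thesis by simp
  qed
  have "W1p_norm S p u powr p = Lp_norm S p u powr p + (\<Sum>b\<in>Basis. Lp_norm S p (weak_deriv S b u) powr p)"
    unfolding W1p_norm_def powr_powr using assms(2) by (simp add: add_nonneg_nonneg sum_nonneg)
  then show ?thesis
    using 1 2 by (simp add: ennreal_plus sum_nonneg sum_ennreal[symmetric])
qed

section \<open>Classical derivatives are weak derivatives\<close>

text \<open>
  By translation invariance the difference quotients of \<open>g\<close> have integral \<open>0\<close>, and by the mean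
  value theorem they are bounded, with supports in a fixed ball.
\<close>

lemma integral_directional_derivative_zero:
  fixes g :: "'a::euclidean_space \<Rightarrow> real"
  assumes K: "compact K" and gz: "\<And>x. x \<notin> K \<Longrightarrow> g x = 0" "\<And>x. x \<notin> K \<Longrightarrow> g' x = 0"
    and der: "\<And>x. ((\<lambda>s. g (x + s *\<^sub>R b)) has_real_derivative g' x) (at 0)"
    and c: "continuous_on UNIV g" "continuous_on UNIV g'"
  shows "(LINT x|lborel. g' x) = 0"
proof -
  have [measurable]: "g \<in> borel_measurable borel" "g' \<in> borel_measurable borel"
    using c by (auto intro: borel_measurable_continuous_onI)
  obtain R where R: "R > 0" "K \<subseteq> cball 0 R" using bounded_by_cball[OF K] .
  have "compact (g' ` K)" "compact (g ` K)" using c K by (auto intro!: compact_continuous_image intro: continuous_on_subset)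
  then obtain B0 B1 where B0: "\<And>x. x \<in> K \<Longrightarrow> \<bar>g' x\<bar> \<le> B0" "\<And>x. x \<in> K \<Longrightarrow> \<bar>g x\<bar> \<le> B1"
    using compact_imp_bounded bounded_iff by (metis imageI real_norm_def)
  define B where "B = max 0 (max B0 B1)"
  have B: "\<bar>g' x\<bar> \<le> B" "\<bar>g x\<bar> \<le> B" for x using B0[of x] gz[of x] unfolding B_def by (cases "x \<in> K"; simp; linarith)+
  have B00: "B \<ge> 0" by (simp add: B_def)
  have der': "((\<lambda>s. g (x + s *\<^sub>R b)) has_real_derivative g' (x + t *\<^sub>R b)) (at t)" for x t
    using der[of "x + t *\<^sub>R b"] DERIV_shift[of "\<lambda>s. g (x + s *\<^sub>R b)" "g' (x + t *\<^sub>R b)" 0 t]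
    by (simp add: scaleR_left_distrib add_ac)
  define t where "t = (\<lambda>k. 1 / real (Suc k))"
  have t: "t k > 0" "t k \<le> 1" for k by (auto simp: t_def)
  have tl: "t \<longlonglongrightarrow> 0" using LIMSEQ_inverse_real_of_nat by (simp add: t_def inverse_eq_divide)
  define A where "A = cball (0::'a) (R + norm b)"
  have Af: "emeasure lborel A < \<infinity>" "A \<in> sets borel" unfolding A_def using emeasure_cball_fin by auto
  have gi: "integrable lborel g"
  proof (rule integrableI_bounded_set[where A = A and B = B])
    show "AE x in lborel. x \<in> A \<longrightarrow> norm (g x) \<le> B" using B by auto
    show "AE x in lborel. x \<notin> A \<longrightarrow> g x = 0"
    proof (intro AE_I2 impI gz(1))
      fix x assume "x \<notin> A" then show "x \<notin> K" using R subsetD[OF R(2), of x] norm_ge_zero[of b] by (auto simp: A_def)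
    qed
  qed (use Af in auto)
  have git: "integrable lborel (\<lambda>x. g (x + c))" "(LINT x|lborel. g (x + c)) = (LINT x|lborel. g x)" for c
  proof -
    have *: "integrable (distr lborel borel ((+) c)) g" using gi by (simp add: lborel_distr_plus)
    then show "integrable lborel (\<lambda>x. g (x + c))" by (subst (asm) integrable_distr_eq) (auto simp: add.commute)
    have "(LINT x|lborel. g x) = (LINT x|(distr lborel borel ((+) c)). g x)" by (simp add: lborel_distr_plus)
    then show "(LINT x|lborel. g (x + c)) = (LINT x|lborel. g x)" by (subst (asm) integral_distr) (auto simp: add.commute)
  qed
  have "(\<lambda>k. LINT x|lborel. (g (x + t k *\<^sub>R b) - g x) / t k) \<longlonglongrightarrow> (LINT x|lborel. g' x)"
  proof (rule integral_dominated_convergence[where w = "\<lambda>x. B * indicator A x"])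
    show "integrable lborel (\<lambda>x. B * indicator A x)" using Af by auto
    show "AE x in lborel. (\<lambda>k. (g (x + t k *\<^sub>R b) - g x) / t k) \<longlonglongrightarrow> g' x"
    proof (rule AE_I2)
      fix x
      have "((\<lambda>h. (g (x + h *\<^sub>R b) - g x) / h) \<longlongrightarrow> g' x) (at 0)"
        using der[of x] by (simp add: DERIV_def)
      then show "(\<lambda>k. (g (x + t k *\<^sub>R b) - g x) / t k) \<longlonglongrightarrow> g' x"
        using tl t(1) by (auto simp: tendsto_at_iff_sequentially comp_def less_imp_neq[symmetric] dest: spec[of _ t])
    qed
    show "AE x in lborel. norm ((g (x + t k *\<^sub>R b) - g x) / t k) \<le> B * indicator A x" for k
    proof (rule AE_I2)
      fix x
      have "\<exists>z>0. z < t k \<and> g (x + t k *\<^sub>R b) - g (x + 0 *\<^sub>R b) = (t k - 0) * g' (x + z *\<^sub>R b)"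
        using t[of k] der' by (intro MVT2) auto
      then obtain z where z: "z > 0" "z < t k" "g (x + t k *\<^sub>R b) - g x = t k * g' (x + z *\<^sub>R b)" by auto
      have eq: "(g (x + t k *\<^sub>R b) - g x) / t k = g' (x + z *\<^sub>R b)"
        unfolding z(3) using t(1)[of k] by simp
      show "norm ((g (x + t k *\<^sub>R b) - g x) / t k) \<le> B * indicator A x"
      proof (cases "x \<in> A")
        case False
        have "x + z *\<^sub>R b \<notin> K"
        proof
          assume "x + z *\<^sub>R b \<in> K"
          then have "norm (x + z *\<^sub>R b) \<le> R" using R by auto
          moreover have "norm (z *\<^sub>R b) \<le> 1 * norm b" unfolding norm_scaleR using z t(2)[of k] by (intro mult_right_mono) auto
          ultimately have "norm x \<le> R + norm b" using norm_triangle_ineq4[of "x + z *\<^sub>R b" "z *\<^sub>R b"] by simp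
          with False show False by (simp add: A_def)
        qed
        then show ?thesis unfolding eq using gz(2) B00 by simp
      qed (simp add: eq B)
    qed
  qed auto
  moreover have "(LINT x|lborel. (g (x + t k *\<^sub>R b) - g x) / t k) = 0" for k
    using git gi by simp
  ultimately have "(\<lambda>k. 0::real) \<longlonglongrightarrow> (LINT x|lborel. g' x)" by (simp only:)
  then show ?thesis by (simp add: LIMSEQ_const_iff)
qed

lemma integrable_compact_support:
  fixes h :: "'a::euclidean_space \<Rightarrow> real"
  assumes "compact K" "continuous_on UNIV h" "\<And>x. x \<notin> K \<Longrightarrow> h x = 0"
  shows "integrable lborel h"
proof -
  have "integrable lborel (\<lambda>x. indicator K x *\<^sub>R h x)"
    by (rule borel_integrable_compact[OF assms(1)]) (use assms(2) continuous_on_subset in blast)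
  moreover have "(\<lambda>x. indicator K x *\<^sub>R h x) = h" by (rule ext, case_tac "x \<in> K") (simp_all add: assms(3))
  ultimately show ?thesis by simp
qed

lemma continuous_on_extend_zero:
  fixes f :: "'a::euclidean_space \<Rightarrow> real"
  assumes "open S" "compact K" "K \<subseteq> S" "continuous_on S f" "\<And>x. x \<in> S \<Longrightarrow> x \<notin> K \<Longrightarrow> f x = 0"
  shows "continuous_on UNIV (\<lambda>x. if x \<in> S then f x else 0)"
proof -
  have "continuous_on (S \<union> - K) (\<lambda>x. if x \<in> S then f x else 0)"
  proof (rule continuous_on_open_Un)
    show "continuous_on S (\<lambda>x. if x \<in> S then f x else 0)"
      using assms(4) by (rule continuous_on_eq) simp
    show "continuous_on (- K) (\<lambda>x. if x \<in> S then f x else 0)"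
      using continuous_on_const[of "-K" 0] by (rule continuous_on_eq) (use assms in auto)
  qed (use assms in \<open>auto simp: compact_imp_closed open_Compl\<close>)
  moreover have "S \<union> - K = UNIV" using assms(3) by auto
  ultimately show ?thesis by simp
qed

lemma C_infinity_directional_DERIV:
  assumes "\<phi> \<in> C_infinity"
  shows "((\<lambda>s. \<phi> (x + s *\<^sub>R b)) has_real_derivative partial_deriv b \<phi> x) (at 0)"
proof -
  have "(\<phi> has_derivative frechet_derivative \<phi> (at x)) (at (x + 0 *\<^sub>R b))"
    using C_infinityD(1)[OF assms] frechet_derivative_works by simp blast
  moreover have "((\<lambda>s. x + s *\<^sub>R b) has_derivative (\<lambda>s. s *\<^sub>R b)) (at 0)"
    by (auto intro!: derivative_eq_intros)
  ultimately have "((\<lambda>s. \<phi> (x + s *\<^sub>R b)) has_derivative (\<lambda>s. frechet_derivative \<phi> (at x) (s *\<^sub>R b))) (at 0)"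
    by (rule has_derivative_compose[rotated])
  moreover have "linear (frechet_derivative \<phi> (at x))"
    using C_infinityD(1)[OF assms] by (rule linear_frechet_derivative)
  ultimately show ?thesis
    by (simp add: has_field_derivative_def partial_deriv_def linear_cmul mult_commute_abs)
qed

text \<open>
  The product with a test function, extended by zero, is continuous with compact support, so its
  directional derivative has integral \<open>0\<close>.
\<close>

lemma classical_weakd:
  fixes f :: "'a::euclidean_space \<Rightarrow> real"
  assumes S: "open S" and c: "continuous_on S f" "continuous_on S f'"
    and der: "\<And>x. x \<in> S \<Longrightarrow> ((\<lambda>s. f (x + s *\<^sub>R b)) has_real_derivative f' x) (at 0)" and b: "b \<in> Basis"
  shows "weakd S b (\<lambda>x. indicator S x * f x) (\<lambda>x. indicator S x * f' x)"
  unfolding weakd_def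
proof
  fix \<phi> assume phi: "\<phi> \<in> test_functions S"
  then obtain K where K: "\<phi> \<in> C_infinity" "compact K" "K \<subseteq> S" "\<And>x. x \<notin> K \<Longrightarrow> \<phi> x = 0"
    using test_functionsE by metis
  have pz: "partial_deriv b \<phi> x = 0" if "x \<notin> K" for x
    by (rule partial_deriv_zero_outside[OF compact_imp_closed[OF K(2)] _ that]) (use K(4) in auto)
  have cp: "continuous_on S \<phi>" "continuous_on S (partial_deriv b \<phi>)"
    using C_infinityD(3)[OF K(1)] C_infinityD(3)[OF C_infinityD(2)[OF K(1) b]] continuous_on_subset by blast+
  define g where "g = (\<lambda>x. if x \<in> S then f x * \<phi> x else 0)"
  define g1 where "g1 = (\<lambda>x. if x \<in> S then f x * partial_deriv b \<phi> x else 0)"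
  define g2 where "g2 = (\<lambda>x. if x \<in> S then f' x * \<phi> x else 0)"
  have cg: "continuous_on UNIV g" "continuous_on UNIV g1" "continuous_on UNIV g2"
    unfolding g_def g1_def g2_def
    by (rule continuous_on_extend_zero[OF S K(2,3)]; use c cp K(4) pz in \<open>auto intro!: continuous_intros\<close>)+
  have z: "g x = 0" "g1 x = 0" "g2 x = 0" if "x \<notin> K" for x using that K(4) pz by (auto simp: g_def g1_def g2_def)
  have int: "integrable lborel g1" "integrable lborel g2"
  proof -
    note * = integrable_compact_support[OF K(2)]
    show "integrable lborel g1" "integrable lborel g2" by (intro * cg z; simp)+
  qed
  have "(LINT x|lborel. g1 x + g2 x) = 0"
  proof (rule integral_directional_derivative_zero[OF K(2), of g])
    show "((\<lambda>s. g (x + s *\<^sub>R b)) has_real_derivative g1 x + g2 x) (at 0)" for x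
    proof (cases "x \<in> S")
      case True
      have "((\<lambda>s. f (x + s *\<^sub>R b) * \<phi> (x + s *\<^sub>R b)) has_real_derivative g1 x + g2 x) (at 0)"
        using DERIV_mult[OF der[OF True] C_infinity_directional_DERIV[OF K(1), of x b]] True
        by (simp add: g1_def g2_def mult.commute add.commute)
      moreover have "\<forall>\<^sub>F s in nhds 0. x + s *\<^sub>R b \<in> S"
      proof -
        have "((\<lambda>s. x + s *\<^sub>R b) \<longlongrightarrow> x + 0 *\<^sub>R b) (nhds 0)"
          by (intro tendsto_intros filterlim_ident)
        then show ?thesis using S True by (intro topological_tendstoD) auto
      qed
      then have "\<forall>\<^sub>F s in nhds 0. g (x + s *\<^sub>R b) = f (x + s *\<^sub>R b) * \<phi> (x + s *\<^sub>R b)"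
        by eventually_elim (simp add: g_def)
      ultimately show ?thesis by (subst DERIV_cong_ev[OF refl _ refl]) auto
    next
      case False
      then have "x \<in> - K" using K(3) by auto
      have "\<forall>\<^sub>F s in nhds 0. x + s *\<^sub>R b \<in> - K"
      proof -
        have "((\<lambda>s. x + s *\<^sub>R b) \<longlongrightarrow> x + 0 *\<^sub>R b) (nhds 0)"
          by (intro tendsto_intros filterlim_ident)
        then show ?thesis using K(2) \<open>x \<in> - K\<close> by (intro topological_tendstoD) (auto simp: compact_imp_closed open_Compl)
      qed
      then have "\<forall>\<^sub>F s in nhds 0. g (x + s *\<^sub>R b) = 0"
        by eventually_elim (simp add: z)
      moreover have "g1 x + g2 x = 0" using z \<open>x \<in> - K\<close> by simp
      ultimately show ?thesis by (subst DERIV_cong_ev[OF refl _ refl]) auto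
    qed
  qed (use z cg in \<open>auto intro!: continuous_intros\<close>)
  then have "(LINT x|lborel. g1 x) = - (LINT x|lborel. g2 x)" using int by simp
  moreover have "g1 = (\<lambda>x. indicator S x * f x * partial_deriv b \<phi> x)" "g2 = (\<lambda>x. indicator S x * f' x * \<phi> x)"
    by (auto simp: g1_def g2_def indicator_def)
  ultimately show "(LINT x|lborel. indicator S x * f x * partial_deriv b \<phi> x) = - (LINT x|lborel. indicator S x * f' x * \<phi> x)"
    by simp
qed

lemma classical_W1p_rep:
  fixes f :: "'a::euclidean_space \<Rightarrow> real"
  assumes S: "open S" and c: "continuous_on S f" "\<And>b. b \<in> Basis \<Longrightarrow> continuous_on S (D b)"
    and der: "\<And>x b. x \<in> S \<Longrightarrow> b \<in> Basis \<Longrightarrow> ((\<lambda>s. f (x + s *\<^sub>R b)) has_real_derivative D b x) (at 0)"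
    and fin: "pmass p (\<lambda>x. indicator S x * f x) < \<infinity>" "\<And>b. b \<in> Basis \<Longrightarrow> pmass p (\<lambda>x. indicator S x * D b x) < \<infinity>"
  shows "W1p_rep S p f (\<lambda>x. indicator S x * f x) (\<lambda>b x. indicator S x * D b x)"
proof -
  have m: "(\<lambda>x. indicator S x * h x) \<in> borel_measurable borel" if "continuous_on S h" for h :: "'a \<Rightarrow> real"
    using borel_measurable_continuous_on_indicator[of S h] that S by simp
  show ?thesis
    unfolding W1p_rep_def
    using m c fin classical_weakd[OF S c(1) c(2) der] by (auto simp: zrep_def)
qed

section \<open>The half space\<close>

lemma half_space_iff: "x \<in> half_space \<longleftrightarrow> snd x > 0"
  by (cases x) (auto simp: half_space_def)

lemma open_half_space: "open (half_space :: ('a::euclidean_space \<times> real) set)"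
  unfolding half_space_def by (intro open_Times) auto

lemma half_space_borel [measurable]: "(half_space :: ('a::euclidean_space \<times> real) set) \<in> sets borel"
  by (rule borel_open[OF open_half_space])

lemma closure_half_space: "x \<in> closure (half_space :: ('a::euclidean_space \<times> real) set) \<longleftrightarrow> snd x \<ge> 0"
  unfolding half_space_def closure_Times by (cases x) auto

lemma vertical_Basis: "(0, 1) \<in> (Basis :: ('a::euclidean_space \<times> real) set)"
  by (simp add: Basis_prod_def)

lemma horizontal_Basis: "b \<in> Basis \<Longrightarrow> (b, 0) \<in> (Basis :: ('a::euclidean_space \<times> real) set)"
  by (simp add: Basis_prod_def)

lemma nn_integral_lborel_pair:
  fixes f :: "'a::euclidean_space \<times> 'b::euclidean_space \<Rightarrow> ennreal"
  assumes [measurable]: "f \<in> borel_measurable borel"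
  shows "(\<integral>\<^sup>+x. f x \<partial>lborel) = (\<integral>\<^sup>+y. \<integral>\<^sup>+t. f (y, t) \<partial>lborel \<partial>lborel)"
  unfolding lborel_prod[symmetric]
  by (rule lborel.nn_integral_fst[symmetric]) (simp add: lborel_prod)

lemma AE_lborel_pair:
  fixes P :: "'a::euclidean_space \<times> 'b::euclidean_space \<Rightarrow> bool"
  assumes "AE x in lborel. P x"
  shows "AE y in lborel. AE t in lborel. P (y, t)"
  using assms unfolding lborel_prod[symmetric] by (rule lborel_pair.AE_pair)

lemma borel_pair [measurable_dest]:
  "f \<in> borel_measurable (borel :: ('a::euclidean_space \<times> 'b::euclidean_space) measure) \<Longrightarrow> f \<in> borel_measurable (borel \<Otimes>\<^sub>M borel)"
  by (simp add: borel_prod)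

section \<open>An explicit trace\<close>

text \<open>
  If \<open>v\<close> is the normal derivative of \<open>u\<close>, the integrand is the derivative of
  \<open>- (1 - t) * u (y, t)\<close>, which vanishes at \<open>t = 1\<close>; for \<open>u\<close> smooth up to the boundary the value
  is therefore \<open>u (y, 0)\<close>.
\<close>

definition etr :: "('a::euclidean_space \<times> real \<Rightarrow> real) \<Rightarrow> ('a \<times> real \<Rightarrow> real) \<Rightarrow> 'a \<Rightarrow> real" where
  "etr u v y = (LINT t|lborel. (u (y, t) - (1 - t) * v (y, t)) * indicator {0<..<1} t)"

lemma etr_borel:
  assumes "u \<in> borel_measurable borel" "v \<in> borel_measurable borel"
  shows "etr u v \<in> borel_measurable borel"
proof -
  have [measurable]: "u \<in> borel_measurable (borel \<Otimes>\<^sub>M borel)" "v \<in> borel_measurable (borel \<Otimes>\<^sub>M borel)"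
    using assms by (simp_all add: borel_prod)
  have "(\<lambda>y. LINT t|lborel. (u (y, t) - (1 - t) * v (y, t)) * indicator {0<..<1} t) \<in> borel_measurable lborel"
    by measurable
  then show ?thesis by (simp add: etr_def[abs_def])
qed

lemma nn_indicator_unit: "(\<integral>\<^sup>+t. ennreal (indicator {0<..<1::real} t) \<partial>lborel) = 1"
  by (simp add: ennreal_indicator)

lemma etr_mass:
  assumes m: "u \<in> borel_measurable borel" "v \<in> borel_measurable borel" and p: "p \<ge> 1"
  shows "pmass p (etr u v) \<le> ennreal (2 powr p) * (pmass p u + pmass p v)"
proof -
  have [measurable]: "u \<in> borel_measurable (borel \<Otimes>\<^sub>M borel)" "v \<in> borel_measurable (borel \<Otimes>\<^sub>M borel)"
    using m by (simp_all add: borel_prod)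
  have "pmass p (etr u v) \<le> (\<integral>\<^sup>+y. \<integral>\<^sup>+t. ennreal (\<bar>u (y, t) - (1 - t) * v (y, t)\<bar> powr p * indicator {0<..<1} t) \<partial>lborel \<partial>lborel)"
    unfolding Lp_mass_def etr_def
    by (intro nn_integral_mono jensen_powr) (use nn_indicator_unit p in auto)
  also have "\<dots> \<le> (\<integral>\<^sup>+y. \<integral>\<^sup>+t. ennreal (2 powr p) * (ennreal (\<bar>u (y, t)\<bar> powr p) + ennreal (\<bar>v (y, t)\<bar> powr p)) \<partial>lborel \<partial>lborel)"
  proof (intro nn_integral_mono)
    fix y t
    show "ennreal (\<bar>u (y, t) - (1 - t) * v (y, t)\<bar> powr p * indicator {0<..<1} t) \<le> ennreal (2 powr p) * (ennreal (\<bar>u (y, t)\<bar> powr p) + ennreal (\<bar>v (y, t)\<bar> powr p))"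
    proof (cases "t \<in> {0<..<1}")
      case True
      have "\<bar>(1 - t) * v (y, t)\<bar> \<le> 1 * \<bar>v (y, t)\<bar>" unfolding abs_mult using True by (intro mult_right_mono) auto
      then have "\<bar>(1 - t) * v (y, t)\<bar> powr p \<le> \<bar>v (y, t)\<bar> powr p" using p by (intro powr_mono2) auto
      then have "2 powr p * (\<bar>u (y, t)\<bar> powr p + \<bar>- ((1 - t) * v (y, t))\<bar> powr p) \<le> 2 powr p * (\<bar>u (y, t)\<bar> powr p + \<bar>v (y, t)\<bar> powr p)"
        by (intro mult_left_mono add_left_mono) auto
      with order_trans[OF powr_add_le[of p "u (y, t)" "- ((1 - t) * v (y, t))"]] p
      have "\<bar>u (y, t) - (1 - t) * v (y, t)\<bar> powr p \<le> 2 powr p * (\<bar>u (y, t)\<bar> powr p + \<bar>v (y, t)\<bar> powr p)" by simp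
      then have "ennreal (\<bar>u (y, t) - (1 - t) * v (y, t)\<bar> powr p) \<le> ennreal (2 powr p * (\<bar>u (y, t)\<bar> powr p + \<bar>v (y, t)\<bar> powr p))"
        by (rule ennreal_leI)
      then show ?thesis using True by (simp add: ennreal_mult)
    qed auto
  qed
  also have "\<dots> = (\<integral>\<^sup>+x. ennreal (2 powr p) * (ennreal (\<bar>u x\<bar> powr p) + ennreal (\<bar>v x\<bar> powr p)) \<partial>lborel)"
    using m by (subst nn_integral_lborel_pair) auto
  also have "\<dots> = ennreal (2 powr p) * (pmass p u + pmass p v)"
    using m by (simp add: nn_integral_cmult nn_integral_add Lp_mass_def)
  finally show ?thesis .
qed

lemma slice_integrable:
  fixes u :: "'a::euclidean_space \<times> real \<Rightarrow> real"
  assumes m: "u \<in> borel_measurable borel" and fin: "pmass p u < \<infinity>" and p: "p \<ge> 1"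
  shows "AE y in lborel. integrable lborel (\<lambda>t. u (y, t) * indicator {0<..<1} t)"
proof -
  have [measurable]: "u \<in> borel_measurable (borel \<Otimes>\<^sub>M borel)" using m by (simp add: borel_prod)
  have "pmass p u = (\<integral>\<^sup>+y. \<integral>\<^sup>+t. ennreal (\<bar>u (y, t)\<bar> powr p) \<partial>lborel \<partial>lborel)"
    unfolding Lp_mass_def using m by (subst nn_integral_lborel_pair) auto
  then have "AE y in lborel. (\<integral>\<^sup>+t. ennreal (\<bar>u (y, t)\<bar> powr p) \<partial>lborel) \<noteq> \<infinity>"
    using fin by (intro nn_integral_PInf_AE) auto
  then show ?thesis
  proof eventually_elim
    case (elim y)
    show ?case
      by (rule Lp_bounded_set_integrable[where A = "{0<..<1}" and B = 1 and p = p])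
        (use elim p in \<open>auto simp: Lp_mass_def less_top\<close>)
  qed
qed

lemma etr_lincomb:
  fixes u v :: "'a::euclidean_space \<times> real \<Rightarrow> real"
  assumes "u \<in> borel_measurable borel" "v \<in> borel_measurable borel" "u2 \<in> borel_measurable borel" "v2 \<in> borel_measurable borel"
    "pmass p u < \<infinity>" "pmass p v < \<infinity>" "pmass p u2 < \<infinity>" "pmass p v2 < \<infinity>" "p \<ge> 1"
  shows "AE y in lborel. etr (\<lambda>x. c * u x + d * u2 x) (\<lambda>x. c * v x + d * v2 x) y = c * etr u v y + d * etr u2 v2 y"
proof -
  note sl = slice_integrable[OF assms(1,5,9)] slice_integrable[OF assms(2,6,9)] slice_integrable[OF assms(3,7,9)] slice_integrable[OF assms(4,8,9)]
  have [measurable]: "u \<in> borel_measurable (borel \<Otimes>\<^sub>M borel)" "v \<in> borel_measurable (borel \<Otimes>\<^sub>M borel)"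
    "u2 \<in> borel_measurable (borel \<Otimes>\<^sub>M borel)" "v2 \<in> borel_measurable (borel \<Otimes>\<^sub>M borel)"
    using assms by (simp_all add: borel_prod)
  have key: "integrable lborel (\<lambda>t. (u (y, t) - (1 - t) * v (y, t)) * indicator {0<..<1} t)"
    if u: "integrable lborel (\<lambda>t. u (y, t) * indicator {0<..<1} t)" and v: "integrable lborel (\<lambda>t. v (y, t) * indicator {0<..<1} t)"
    and [measurable]: "u \<in> borel_measurable (borel \<Otimes>\<^sub>M borel)" "v \<in> borel_measurable (borel \<Otimes>\<^sub>M borel)" for y :: 'a and u v :: "'a \<times> real \<Rightarrow> real"
  proof -
    have "integrable lborel (\<lambda>t. (1 - t) * v (y, t) * indicator {0<..<1} t)"
      by (rule Bochner_Integration.integrable_bound[OF v])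
        (auto simp: indicator_def abs_mult intro!: AE_I2 mult_left_le_one_le)
    from Bochner_Integration.integrable_diff[OF u this] show ?thesis by (simp add: left_diff_distrib)
  qed
  show ?thesis
    using sl
  proof eventually_elim
    case (elim y)
    have i: "integrable lborel (\<lambda>t. (u (y, t) - (1 - t) * v (y, t)) * indicator {0<..<1} t)"
      "integrable lborel (\<lambda>t. (u2 (y, t) - (1 - t) * v2 (y, t)) * indicator {0<..<1} t)"
      by (intro key elim; measurable)+
    have "etr (\<lambda>x. c * u x + d * u2 x) (\<lambda>x. c * v x + d * v2 x) y =
      (LINT t|lborel. c * ((u (y, t) - (1 - t) * v (y, t)) * indicator {0<..<1} t) + d * ((u2 (y, t) - (1 - t) * v2 (y, t)) * indicator {0<..<1} t))"
      unfolding etr_def by (simp add: algebra_simps)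
    then show ?case using i by (simp add: etr_def)
  qed
qed

lemma etr_cong_AE:
  fixes u v :: "'a::euclidean_space \<times> real \<Rightarrow> real"
  assumes "AE x in lborel. u x = u2 x" "AE x in lborel. v x = v2 x"
    "u \<in> borel_measurable borel" "v \<in> borel_measurable borel" "u2 \<in> borel_measurable borel" "v2 \<in> borel_measurable borel"
  shows "AE y in lborel. etr u v y = etr u2 v2 y"
proof -
  have [measurable]: "u \<in> borel_measurable (borel \<Otimes>\<^sub>M borel)" "v \<in> borel_measurable (borel \<Otimes>\<^sub>M borel)"
    "u2 \<in> borel_measurable (borel \<Otimes>\<^sub>M borel)" "v2 \<in> borel_measurable (borel \<Otimes>\<^sub>M borel)"
    using assms by (simp_all add: borel_prod)
  show ?thesis
    using AE_lborel_pair[OF assms(1)] AE_lborel_pair[OF assms(2)]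
  proof eventually_elim
    case (elim y)
    show ?case unfolding etr_def
    proof (rule integral_cong_AE)
      show "AE t in lborel. (u (y, t) - (1 - t) * v (y, t)) * indicator {0<..<1} t = (u2 (y, t) - (1 - t) * v2 (y, t)) * indicator {0<..<1} t"
        using elim by eventually_elim simp
    qed measurable
  qed
qed

text \<open>
  The fundamental theorem of calculus on \<open>{d k..1}\<close> gives \<open>(1 - d k) * u (y, d k)\<close>, and \<open>d k\<close>
  tends to \<open>0\<close>.
\<close>

lemma etr_limit:
  fixes u v :: "'a::euclidean_space \<times> real \<Rightarrow> real"
  assumes der: "\<And>t. t > 0 \<Longrightarrow> ((\<lambda>s. u (y, s)) has_real_derivative v (y, t)) (at t)"
    and c: "continuous_on {0<..} (\<lambda>t. v (y, t))"
    and i: "integrable lborel (\<lambda>t. u (y, t) * indicator {0<..<1} t)" "integrable lborel (\<lambda>t. v (y, t) * indicator {0<..<1} t)"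
    and d: "\<And>k. 0 < d k" "\<And>k. d k < 1" "d \<longlonglongrightarrow> 0"
  shows "(\<lambda>k. u (y, d k)) \<longlonglongrightarrow> etr u v y"
proof -
  define f where "f = (\<lambda>t. u (y, t) - (1 - t) * v (y, t))"
  have cu: "continuous_on {0<..} (\<lambda>t. u (y, t))"
    using der by (intro continuous_at_imp_continuous_on) (auto intro: DERIV_isCont)
  have m: "(\<lambda>t. indicator {0<..} t *\<^sub>R f t) \<in> borel_measurable borel"
    unfolding f_def by (intro borel_measurable_continuous_on_indicator continuous_intros c cu) auto
  have dom: "integrable lborel (\<lambda>t. \<bar>u (y, t) * indicator {0<..<1} t\<bar> + \<bar>v (y, t) * indicator {0<..<1} t\<bar>)"
    using i by auto
  have ft: "(LINT t|lborel. f t * indicator {d k..1} t) = (1 - d k) * u (y, d k)" for k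
  proof -
    have "(LINT t|lborel. f t * indicator {d k..1} t) = - (1 - 1) * u (y, 1) - (- (1 - d k) * u (y, d k))"
    proof (rule integral_FTC_Icc_real[where F = "\<lambda>t. - (1 - t) * u (y, t)"])
      show "d k \<le> 1" using d(2)[of k] by simp
      fix t assume t: "d k \<le> t" "t \<le> 1"
      then have t0: "t > 0" using d(1)[of k] by simp
      show "((\<lambda>t. - (1 - t) * u (y, t)) has_real_derivative f t) (at t)"
        unfolding f_def by (auto intro!: derivative_eq_intros der[OF t0] simp: algebra_simps)
      show "isCont f t"
        using c cu t0 unfolding f_def
        by (auto intro!: continuous_intros simp: continuous_on_eq_continuous_at)
    qed
    then show ?thesis by (simp add: algebra_simps)
  qed
  have "(\<lambda>k. LINT t|lborel. f t * indicator {d k..1} t) \<longlonglongrightarrow> (LINT t|lborel. f t * indicator {0<..<1} t)"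
  proof (rule integral_dominated_convergence[OF _ _ dom])
    have "(\<lambda>t. (indicator {0<..} t *\<^sub>R f t) * indicator {0<..<1} t) \<in> borel_measurable lborel" using m by simp
    moreover have "(\<lambda>t. (indicator {0<..} t *\<^sub>R f t) * indicator {0<..<1} t) = (\<lambda>t. f t * indicator {0<..<1} t)" by (auto simp: indicator_def)
    ultimately show "(\<lambda>t. f t * indicator {0<..<1} t) \<in> borel_measurable lborel" by simp
    fix k
    have "(\<lambda>t. (indicator {0<..} t *\<^sub>R f t) * indicator {d k..1} t) \<in> borel_measurable lborel" using m by simp
    moreover have "(\<lambda>t. (indicator {0<..} t *\<^sub>R f t) * indicator {d k..1} t) = (\<lambda>t. f t * indicator {d k..1} t)" using d(1)[of k] by (auto simp: indicator_def)
    ultimately show "(\<lambda>t. f t * indicator {d k..1} t) \<in> borel_measurable lborel" by simp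
    show "AE t in lborel. norm (f t * indicator {d k..1} t) \<le> \<bar>u (y, t) * indicator {0<..<1} t\<bar> + \<bar>v (y, t) * indicator {0<..<1} t\<bar>"
      using AE_lborel_singleton[of 1]
    proof eventually_elim
      case (elim t)
      show ?case
      proof (cases "t \<in> {0<..<1}")
        case True
        have "\<bar>(1 - t) * v (y, t)\<bar> \<le> 1 * \<bar>v (y, t)\<bar>" unfolding abs_mult using True by (intro mult_right_mono) auto
        then show ?thesis using True by (auto simp: f_def indicator_def)
      next
        case False then show ?thesis using elim d(1)[of k] by (auto simp: indicator_def)
      qed
    qed
  next
    show "AE t in lborel. (\<lambda>k. f t * indicator {d k..1} t) \<longlonglongrightarrow> f t * indicator {0<..<1} t"
      using AE_lborel_singleton[of 1]
    proof eventually_elim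
      case (elim t)
      have "\<forall>\<^sub>F k in sequentially. indicator {d k..1} t = (indicator {0<..<1} t :: real)"
      proof (cases "t > 0")
        case True
        have "\<forall>\<^sub>F k in sequentially. d k < t" using d(3) True by (rule order_tendstoD)
        then show ?thesis by eventually_elim (use elim True in \<open>auto simp: indicator_def\<close>)
      next
        case False
        then have "t < d k" for k using d(1)[of k] by simp
        then show ?thesis using False by (auto simp: indicator_def not_le)
      qed
      then have "\<forall>\<^sub>F k in sequentially. f t * indicator {d k..1} t = f t * indicator {0<..<1} t" by eventually_elim simp
      then show ?case by (rule tendsto_eventually)
    qed
  qed
  then have "(\<lambda>k. (1 - d k) * u (y, d k)) \<longlonglongrightarrow> etr u v y"
    unfolding ft by (simp add: etr_def f_def)
  then have "(\<lambda>k. (1 - d k) * u (y, d k) / (1 - d k)) \<longlonglongrightarrow> etr u v y / (1 - 0)"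
    by (intro tendsto_divide tendsto_diff tendsto_const d(3)) auto
  moreover have "(1 - d k) * u (y, d k) / (1 - d k) = u (y, d k)" for k using d(2)[of k] by simp
  ultimately show ?thesis by simp
qed

lemma etr_restrict: "etr (\<lambda>x. indicator half_space x * u x) (\<lambda>x. indicator half_space x * v x) = etr u v"
  unfolding etr_def by (intro ext Bochner_Integration.integral_cong) (auto simp: indicator_def half_space_iff)

lemma etr_classical:
  fixes f v :: "'a::euclidean_space \<times> real \<Rightarrow> real"
  assumes m: "(\<lambda>x. indicator half_space x * f x) \<in> borel_measurable borel" "(\<lambda>x. indicator half_space x * v x) \<in> borel_measurable borel"
    and fin: "pmass p (\<lambda>x. indicator half_space x * f x) < \<infinity>" "pmass p (\<lambda>x. indicator half_space x * v x) < \<infinity>"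
    and p: "p \<ge> 1"
    and c: "continuous_on half_space v"
    and der: "\<And>x. x \<in> half_space \<Longrightarrow> ((\<lambda>s. f (x + s *\<^sub>R (0, 1))) has_real_derivative v x) (at 0)"
  shows "AE y in lborel. \<forall>d. (\<forall>k. 0 < d k \<and> d k < 1) \<longrightarrow> d \<longlonglongrightarrow> 0 \<longrightarrow> (\<lambda>k. f (y, d k)) \<longlonglongrightarrow> etr f v y"
  using slice_integrable[OF m(1) fin(1) p] slice_integrable[OF m(2) fin(2) p]
proof eventually_elim
  case (elim y)
  have r: "indicator half_space (y, t) * g * indicator {0<..<1} t = g * indicator {0<..<1} t" for g t :: real
    by (auto simp: indicator_def half_space_iff)
  show ?case
  proof (intro allI impI)
    fix d :: "nat \<Rightarrow> real" assume d: "\<forall>k. 0 < d k \<and> d k < 1" "d \<longlonglongrightarrow> 0"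
    show "(\<lambda>k. f (y, d k)) \<longlonglongrightarrow> etr f v y"
    proof (rule etr_limit)
      fix t :: real assume t: "t > 0"
      have "((\<lambda>s. f (y, t + s)) has_real_derivative v (y, t)) (at 0)"
        using der[of "(y, t)"] t by (simp add: half_space_iff)
      then show "((\<lambda>s. f (y, s)) has_real_derivative v (y, t)) (at t)"
        using DERIV_shift[of "\<lambda>s. f (y, s)" "v (y, t)" 0 t] by (simp add: add.commute)
    next
      show "continuous_on {0<..} (\<lambda>t. v (y, t))"
        by (rule continuous_on_compose2[OF c]) (auto intro!: continuous_intros simp: half_space_iff)
    qed (use elim d in \<open>simp_all only: r\<close>)
  qed
qed

section \<open>Mollified approximations\<close>

text \<open>
  The ball of radius \<open>1/2\<close> about the point at height \<open>1\<close> lies in the half space. With such a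
  kernel the value of a mollification at a point of the closed half space depends only on values
  in the open half space.
\<close>

lemma half_space_mollifier:
  obtains \<phi> :: "'a::euclidean_space \<times> real \<Rightarrow> real" where "mollifier \<phi> half_space"
proof -
  obtain \<phi> where \<phi>: "\<phi> \<in> test_functions (cball (0::'a, 1::real) (1/2))" "\<And>x. \<phi> x \<ge> 0" "integral\<^sup>L lborel \<phi> = 1"
    using exists_mollifier[of "1/2" "(0::'a, 1::real)"] by auto
  have "cball (0::'a, 1::real) (1/2) \<subseteq> half_space"
  proof
    fix x :: "'a \<times> real" assume "x \<in> cball (0, 1) (1/2)"
    then have "dist 1 (snd x) \<le> 1/2" using dist_snd_le[of "(0, 1)" x] by simp
    then show "x \<in> half_space" by (auto simp: half_space_iff dist_real_def abs_if split: if_splits)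
  qed
  then have "mollifier \<phi> half_space"
    using \<phi> test_function_restrict by (unfold_locales) blast+
  then show ?thesis by (rule that)
qed

text \<open>
  The derivative falls on the kernel, whose translate is a test function on \<open>T\<close>; the definition of
  the weak derivative moves it back to \<open>u'\<close>.
\<close>

lemma (in mollifier) moll_partial_deriv:
  fixes u :: "'a \<Rightarrow> real"
  assumes "W1p_rep T p u u' D" "p \<ge> 1" "b \<in> Basis" "e > 0"
    and T: "\<And>z. (1 / e) *\<^sub>R (z - x) \<in> S \<Longrightarrow> z \<in> T"
  shows "partial_deriv b (moll \<phi> e u') x = moll \<phi> e (D b) x"
proof -
  note D = W1p_repD[OF assms(1)]
  have \<psi>: "(\<lambda>z. (1 / e ^ DIM('a)) * \<phi> ((1 / e) *\<^sub>R (z - x))) \<in> test_functions T"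
    by (rule test_function_affine[OF test]) (use T assms(4) in auto)
  have "partial_deriv b (moll \<phi> e u') x = - (LINT z|lborel. u' z * partial_deriv b (\<lambda>z. (1 / e ^ DIM('a)) * \<phi> ((1 / e) *\<^sub>R (z - x))) z)"
    by (rule moll_smooth(2)[OF D(2,4) assms(2) test assms(4)])
  also have "\<dots> = (LINT z|lborel. D b z * ((1 / e ^ DIM('a)) * \<phi> ((1 / e) *\<^sub>R (z - x))))"
    using D(8)[OF assms(3)] \<psi> unfolding weakd_def by simp
  also have "\<dots> = moll \<phi> e (D b) x"
    by (rule moll_eq_corr[symmetric]) (use D(5) assms borel in auto)
  finally show ?thesis .
qed

lemma half_space_moll_partial_deriv:
  assumes "mollifier \<phi> half_space" "W1p_rep half_space p u u' D" "p \<ge> 1" "b \<in> Basis" "e > 0" "snd x \<ge> 0"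
  shows "partial_deriv b (moll \<phi> e u') x = moll \<phi> e (D b) x"
proof (rule mollifier.moll_partial_deriv[OF assms(1-5)])
  fix z assume "(1 / e) *\<^sub>R (z - x) \<in> half_space"
  then have "0 < snd z - snd x" using assms(5) by (simp add: half_space_iff zero_less_divide_iff)
  then show "z \<in> half_space" using assms(6) by (simp add: half_space_iff)
qed

lemma half_space_moll_rep:
  fixes \<phi> :: "'a::euclidean_space \<times> real \<Rightarrow> real"
  assumes "mollifier \<phi> half_space" "W1p_rep half_space p u u' D" "p \<ge> 1" "e > 0"
  shows "moll \<phi> e u' \<in> C_infinity"
    "W1p_rep half_space p (moll \<phi> e u') (\<lambda>x. indicator half_space x * moll \<phi> e u' x) (\<lambda>b x. indicator half_space x * moll \<phi> e (D b) x)"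
proof -
  interpret mollifier \<phi> half_space by fact
  note D = W1p_repD[OF assms(2)]
  show C: "moll \<phi> e u' \<in> C_infinity" by (rule moll_smooth(1)[OF D(2,4) assms(3) test assms(4)])
  have fin: "pmass p (\<lambda>x. indicator half_space x * moll \<phi> e f x) < \<infinity>"
    if [measurable]: "f \<in> borel_measurable borel" and "pmass p f < \<infinity>" for f :: "'a \<times> real \<Rightarrow> real"
  proof -
    have "pmass p (\<lambda>x. indicator half_space x * moll \<phi> e f x) \<le> pmass p (moll \<phi> e f)"
      by (rule Lp_mass_mono) (use assms(3) in \<open>auto simp: indicator_def\<close>)
    also have "\<dots> \<le> pmass p f" by (rule moll_mass_le) (use assms(3) in auto)
    finally show ?thesis using that by simp
  qed
  show "W1p_rep half_space p (moll \<phi> e u') (\<lambda>x. indicator half_space x * moll \<phi> e u' x) (\<lambda>b x. indicator half_space x * moll \<phi> e (D b) x)"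
  proof (rule classical_W1p_rep[OF open_half_space])
    show "continuous_on half_space (moll \<phi> e u')" using C_infinityD(3)[OF C] continuous_on_subset by blast
    fix b :: "'a \<times> real" assume b: "b \<in> Basis"
    show "continuous_on half_space (moll \<phi> e (D b))"
      using C_infinityD(3)[OF moll_smooth(1)[OF D(5,7) assms(3) test assms(4)]] b continuous_on_subset by blast
    fix x :: "'a \<times> real" assume x: "x \<in> half_space"
    show "((\<lambda>s. moll \<phi> e u' (x + s *\<^sub>R b)) has_real_derivative moll \<phi> e (D b) x) (at 0)"
      using C_infinity_directional_DERIV[OF C, of x b] half_space_moll_partial_deriv[OF assms(1-3) b assms(4), of x] x
      by (simp add: half_space_iff)
  qed (use fin D in auto)
qed

lemma ennreal_tendsto_0_sum:
  fixes f :: "'i \<Rightarrow> nat \<Rightarrow> ennreal"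
  assumes "finite A" "\<And>i. i \<in> A \<Longrightarrow> f i \<longlonglongrightarrow> 0"
  shows "(\<lambda>k. \<Sum>i\<in>A. f i k) \<longlonglongrightarrow> 0"
  using assms
proof (induction A rule: finite_induct)
  case (insert a A)
  then have "(\<lambda>k. f a k + (\<Sum>i\<in>A. f i k)) \<longlonglongrightarrow> 0 + 0" by (intro tendsto_add) auto
  then show ?case using insert by simp
qed simp

lemma half_space_moll_W1p_tendsto:
  fixes \<phi> :: "'a::euclidean_space \<times> real \<Rightarrow> real"
  assumes "mollifier \<phi> half_space" "W1p_rep half_space p u u' D" "p \<ge> 1" "\<And>k. e k > 0" "e \<longlonglongrightarrow> 0"
  shows "(\<lambda>k. ennreal (W1p_norm half_space p (moll \<phi> (e k) u' - u) powr p)) \<longlonglongrightarrow> 0"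
proof -
  interpret mollifier \<phi> half_space by fact
  note D = W1p_repD[OF assms(2)]
  have eq: "ennreal (W1p_norm half_space p (moll \<phi> (e k) u' - u) powr p) =
    pmass p (\<lambda>x. indicator half_space x * moll \<phi> (e k) u' x - u' x) +
    (\<Sum>b\<in>Basis. pmass p (\<lambda>x. indicator half_space x * moll \<phi> (e k) (D b) x - D b x))" for k
    by (rule W1p_norm_rep[OF W1p_rep_diff[OF half_space_moll_rep(2)[OF assms(1-4)] assms(2,3)] assms(3) open_half_space])
  have *: "(\<lambda>k. pmass p (\<lambda>x. indicator half_space x * moll \<phi> (e k) f x - f x)) \<longlonglongrightarrow> 0"
    if "f \<in> borel_measurable borel" "pmass p f < \<infinity>" "\<And>x. x \<notin> half_space \<Longrightarrow> f x = 0" for f :: "'a \<times> real \<Rightarrow> real"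
  proof (rule ennreal_tendsto_0_le[OF _ moll_tendsto[OF that(1,2) assms(3,5,4)]])
    fix k
    show "pmass p (\<lambda>x. indicator half_space x * moll \<phi> (e k) f x - f x) \<le> ennreal 1 * pmass p (\<lambda>x. moll \<phi> (e k) f x - f x)"
      unfolding ennreal_1 mult_1 by (rule Lp_mass_mono) (use assms(3) that(3) in \<open>auto simp: indicator_def\<close>)
  qed
  have "(\<lambda>k. pmass p (\<lambda>x. indicator half_space x * moll \<phi> (e k) u' x - u' x) +
    (\<Sum>b\<in>Basis. pmass p (\<lambda>x. indicator half_space x * moll \<phi> (e k) (D b) x - D b x))) \<longlonglongrightarrow> 0 + 0"
    by (intro tendsto_add ennreal_tendsto_0_sum *) (use D in auto)
  then show ?thesis unfolding eq by simp
qed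

section \<open>The trace operator\<close>

lemma Lp_norm_UNIV:
  assumes "f \<in> borel_measurable borel" "pmass p f < \<infinity>" "p > 0"
  shows "f \<in> Lp UNIV p" "ennreal (Lp_norm UNIV p f powr p) = pmass p f"
proof -
  have z: "zrep UNIV f f" using assms by (auto simp: zrep_def)
  show 1: "f \<in> Lp UNIV p" using Lp_iff_zrep[OF _ z] assms by simp
  show "ennreal (Lp_norm UNIV p f powr p) = pmass p f"
    using ennreal_Lp_norm_powr[OF 1 assms(3)] zrep_mass[OF z] by simp
qed

lemma smooth_continuous_limit:
  assumes "f \<in> C_infinity" "d \<longlonglongrightarrow> 0"
  shows "(\<lambda>k. f (y, d k)) \<longlonglongrightarrow> f (y, 0::real)"
proof -
  have "isCont f (y, 0)" using C_infinityD(3)[OF assms(1)] by (simp add: continuous_on_eq_continuous_at)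
  moreover have "(\<lambda>k. (y, d k)) \<longlonglongrightarrow> (y, 0)" by (intro tendsto_Pair tendsto_const assms)
  ultimately show ?thesis by (rule isCont_tendsto_compose)
qed

text \<open>
  By uniqueness of weak derivatives \<open>D (0, 1)\<close> is the classical normal derivative, so \<open>etr_limit\<close>
  identifies \<open>etr\<close> with the limit of \<open>f\<close> along vertical lines.
\<close>

lemma smooth_up_to_boundary_etr:
  fixes f :: "'a::euclidean_space \<times> real \<Rightarrow> real"
  assumes f: "f \<in> C_infinity" and uf: "\<And>x. x \<in> closure half_space \<Longrightarrow> u x = f x"
    and rep: "W1p_rep half_space p u u' D" and p: "p \<ge> 1"
  shows "AE y in lborel. etr u' (D (0, 1)) y = f (y, 0)"
proof -
  note D = W1p_repD[OF rep]
  let ?n = "(0::'a, 1::real)"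
  let ?I = "indicator half_space :: 'a \<times> real \<Rightarrow> real"
  have cf: "continuous_on half_space f" "continuous_on half_space (partial_deriv ?n f)"
    using C_infinityD(3)[OF f] C_infinityD(3)[OF C_infinityD(2)[OF f vertical_Basis]] continuous_on_subset by blast+
  have m: "(\<lambda>x. ?I x * f x) \<in> borel_measurable borel" "(\<lambda>x. ?I x * partial_deriv ?n f x) \<in> borel_measurable borel"
    using borel_measurable_continuous_on_indicator[OF half_space_borel cf(1)] borel_measurable_continuous_on_indicator[OF half_space_borel cf(2)] by simp_all
  have uh: "u x = f x" if "x \<in> half_space" for x using uf[of x] that by (simp add: closure_half_space half_space_iff)
  have z: "zrep half_space u (\<lambda>x. ?I x * f x)"
    using m uh unfolding zrep_def by auto
  have z2: "zrep half_space (partial_deriv ?n f) (\<lambda>x. ?I x * partial_deriv ?n f x)"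
    using m unfolding zrep_def by auto
  have der: "((\<lambda>s. f (x + s *\<^sub>R ?n)) has_real_derivative partial_deriv ?n f x) (at 0)" for x
    by (rule C_infinity_directional_DERIV[OF f])
  have li: "integrable lborel (\<lambda>x. indicator K x * (?I x * h x))" if "compact K" "K \<subseteq> half_space" "continuous_on half_space h" for K and h :: "'a \<times> real \<Rightarrow> real"
  proof -
    have "integrable lborel (\<lambda>x. indicator K x *\<^sub>R h x)"
      by (rule borel_integrable_compact) (use that continuous_on_subset in blast)+
    moreover have "(\<lambda>x. indicator K x *\<^sub>R h x) = (\<lambda>x. indicator K x * (?I x * h x))"
      by (rule ext, case_tac "x \<in> K") (use that(2) in auto)
    ultimately show ?thesis by simp
  qed
  have "has_weak_deriv half_space ?n u (partial_deriv ?n f)"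
    unfolding has_weak_deriv_def zrep_weakd_iff[OF z z2 half_space_borel vertical_Basis]
    using cf by (intro conjI locally_integrableI_zrep[OF z] locally_integrableI_zrep[OF z2] classical_weakd[OF open_half_space _ _ der vertical_Basis] li) auto
  from weak_deriv_unique[OF open_half_space W1p_rep_has_weak_deriv[OF rep half_space_borel p vertical_Basis] this]
  have aeD: "AE x in lborel. D ?n x = ?I x * partial_deriv ?n f x"
    by eventually_elim (use D(6)[OF vertical_Basis] in \<open>auto simp: indicator_def\<close>)
  have aeu: "AE x in lborel. u' x = ?I x * f x"
    using zrepD(3)[OF D(1)] by eventually_elim (use D(3) uh in \<open>auto simp: indicator_def\<close>)
  have 1: "AE y in lborel. etr u' (D ?n) y = etr f (partial_deriv ?n f) y"
    using etr_cong_AE[OF aeu aeD D(2) D(5)[OF vertical_Basis] m] by (simp add: etr_restrict)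
  have fin: "pmass p (\<lambda>x. ?I x * f x) < \<infinity>" "pmass p (\<lambda>x. ?I x * partial_deriv ?n f x) < \<infinity>"
    using Lp_mass_cong_AE[OF aeu, of p] Lp_mass_cong_AE[OF aeD, of p] D(4) D(7)[OF vertical_Basis] by simp_all
  have d0: "(\<lambda>k. 1 / (real k + 2)) \<longlonglongrightarrow> 0"
    using LIMSEQ_ignore_initial_segment[OF lim_1_over_n, of 2] by (simp add: add.commute)
  from 1 etr_classical[OF m fin p cf(2) der] show ?thesis
  proof eventually_elim
    case (elim y)
    from elim(2)[rule_format, of "\<lambda>k. 1 / (real k + 2)"] d0
    have "(\<lambda>k. f (y, 1 / (real k + 2))) \<longlonglongrightarrow> etr f (partial_deriv ?n f) y" by simp
    with smooth_continuous_limit[OF f d0] have "f (y, 0) = etr f (partial_deriv ?n f) y" by (rule LIMSEQ_unique)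
    with elim(1) show ?case by simp
  qed
qed

text \<open>The choice of the representative \<open>r\<close> matters only on null sets (\<open>explicit_trace_eq\<close>).\<close>

definition explicit_trace :: "real \<Rightarrow> ('a::euclidean_space \<times> real \<Rightarrow> real) \<Rightarrow> 'a \<Rightarrow> real" where
  "explicit_trace p u = (let r = (SOME r. W1p_rep half_space p u (fst r) (snd r)) in etr (fst r) (snd r (0, 1)))"

lemma explicit_trace_rep:
  assumes "W1p_rep half_space p u u' D"
  obtains v' E where "W1p_rep half_space p u v' E" "explicit_trace p u = etr v' (E (0, 1))"
proof -
  let ?r = "SOME r. W1p_rep half_space p u (fst r) (snd r)"
  have "W1p_rep half_space p u (fst ?r) (snd ?r)"
    by (rule someI[of _ "(u', D)"]) (use assms in simp)
  then show ?thesis using that[of "fst ?r" "snd ?r"] by (simp add: explicit_trace_def Let_def)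
qed

lemma explicit_trace_eq:
  assumes "W1p_rep half_space p u u' D" "p \<ge> 1"
  shows "AE y in lborel. explicit_trace p u y = etr u' (D (0, 1)) y"
proof -
  obtain v' E where E: "W1p_rep half_space p u v' E" "explicit_trace p u = etr v' (E (0, 1))"
    using explicit_trace_rep[OF assms(1)] .
  show ?thesis unfolding E(2)
    by (rule etr_cong_AE[OF W1p_rep_unique(1)[OF E(1) assms(1,2) open_half_space] W1p_rep_unique(2)[OF E(1) assms(1,2) open_half_space vertical_Basis]])
      (use W1p_repD[OF E(1)] W1p_repD[OF assms(1)] vertical_Basis in auto)
qed

lemma etr_rep_finite:
  assumes "W1p_rep half_space p u u' D" "p \<ge> 1"
  shows "etr u' (D (0, 1)) \<in> borel_measurable borel" "pmass p (etr u' (D (0, 1))) < \<infinity>"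
    "pmass p (etr u' (D (0, 1))) \<le> ennreal (2 powr p) * ennreal (W1p_norm half_space p u powr p)"
proof -
  note D = W1p_repD[OF assms(1)] and Dn = W1p_repD(5,7)[OF assms(1) vertical_Basis]
  show "etr u' (D (0, 1)) \<in> borel_measurable borel" by (rule etr_borel[OF D(2) Dn(1)])
  have 1: "pmass p (etr u' (D (0, 1))) \<le> ennreal (2 powr p) * (pmass p u' + pmass p (D (0, 1)))"
    by (rule etr_mass[OF D(2) Dn(1) assms(2)])
  also have "\<dots> < \<infinity>" using D(4) Dn(2) by (simp add: ennreal_mult_less_top)
  finally show "pmass p (etr u' (D (0, 1))) < \<infinity>" .
  have "pmass p (D (0, 1)) \<le> (\<Sum>b\<in>Basis. pmass p (D b))"
    by (rule member_le_sum[OF vertical_Basis]) auto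
  then have "ennreal (2 powr p) * (pmass p u' + pmass p (D (0, 1))) \<le> ennreal (2 powr p) * ennreal (W1p_norm half_space p u powr p)"
    unfolding W1p_norm_rep[OF assms open_half_space] by (intro mult_left_mono add_left_mono) auto
  with 1 show "pmass p (etr u' (D (0, 1))) \<le> ennreal (2 powr p) * ennreal (W1p_norm half_space p u powr p)"
    by (rule order_trans)
qed

lemma explicit_trace_lipschitz:
  assumes "u \<in> W1p half_space p" "v \<in> W1p half_space p" "p \<ge> 1"
  shows "explicit_trace p v - explicit_trace p u \<in> Lp UNIV p"
    "Lp_norm UNIV p (explicit_trace p v - explicit_trace p u) \<le> 2 * W1p_norm half_space p (v - u)"
proof -
  obtain u0 D0 where "W1p_rep half_space p u u0 D0" using W1p_obtain_rep[OF assms(1) half_space_borel] .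
  then obtain u' D where D: "W1p_rep half_space p u u' D" "explicit_trace p u = etr u' (D (0, 1))" by (rule explicit_trace_rep)
  obtain v0 E0 where "W1p_rep half_space p v v0 E0" using W1p_obtain_rep[OF assms(2) half_space_borel] .
  then obtain v' E where E: "W1p_rep half_space p v v' E" "explicit_trace p v = etr v' (E (0, 1))" by (rule explicit_trace_rep)
  have rd: "W1p_rep half_space p (v - u) (\<lambda>x. v' x - u' x) (\<lambda>b x. E b x - D b x)"
    by (rule W1p_rep_diff[OF E(1) D(1) assms(3)])
  note Dd = W1p_repD[OF D(1)] and Ed = W1p_repD[OF E(1)]
  let ?d = "explicit_trace p v - explicit_trace p u"
  have mb: "?d \<in> borel_measurable borel"
    unfolding fun_diff_def D(2) E(2) by (intro borel_measurable_diff etr_rep_finite(1)[OF D(1) assms(3)] etr_rep_finite(1)[OF E(1) assms(3)])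
  have "AE y in lborel. etr (\<lambda>x. 1 * v' x + (-1) * u' x) (\<lambda>x. 1 * E (0, 1) x + (-1) * D (0, 1) x) y = 1 * etr v' (E (0,1)) y + (-1) * etr u' (D (0, 1)) y"
    by (rule etr_lincomb[where p = p]) (use Dd Ed vertical_Basis assms in auto)
  then have ae: "AE y in lborel. ?d y = etr (\<lambda>x. v' x - u' x) (\<lambda>x. E (0, 1) x - D (0, 1) x) y"
    by eventually_elim (simp add: D(2) E(2))
  have le: "pmass p ?d \<le> ennreal (2 powr p) * ennreal (W1p_norm half_space p (v - u) powr p)"
    unfolding Lp_mass_cong_AE[OF ae] by (rule etr_rep_finite(3)[OF rd assms(3)])
  then have fin: "pmass p ?d < \<infinity>"
    by (rule order_le_less_trans) (simp add: ennreal_mult_less_top)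
  show "?d \<in> Lp UNIV p" using Lp_norm_UNIV(1)[OF mb fin] assms by simp
  have "ennreal (Lp_norm UNIV p ?d powr p) \<le> ennreal ((2 * W1p_norm half_space p (v - u)) powr p)"
    using le Lp_norm_UNIV(2)[OF mb fin] assms by (simp add: ennreal_mult[symmetric] powr_mult W1p_norm_def)
  then have "Lp_norm UNIV p ?d powr p \<le> (2 * W1p_norm half_space p (v - u)) powr p"
    by (subst (asm) ennreal_le_iff) auto
  moreover have "Lp_norm UNIV p ?d \<ge> 0" "W1p_norm half_space p (v - u) \<ge> 0" by (simp_all add: Lp_norm_def W1p_norm_def)
  ultimately show "Lp_norm UNIV p ?d \<le> 2 * W1p_norm half_space p (v - u)"
    using assms(3) by (smt (verit) powr_less_mono2)
qed

lemma explicit_trace_is_trace: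
  assumes "p \<ge> 1"
  shows "is_trace_operator p (explicit_trace p :: ('a::euclidean_space \<times> real \<Rightarrow> real) \<Rightarrow> _)"
  unfolding is_trace_operator_def
proof (intro conjI ballI allI impI)
  fix u :: "'a \<times> real \<Rightarrow> real" assume u: "u \<in> W1p half_space p"
  then obtain u0 D0 where "W1p_rep half_space p u u0 D0" using W1p_obtain_rep half_space_borel by blast
  then obtain u' D where D: "W1p_rep half_space p u u' D" "explicit_trace p u = etr u' (D (0, 1))" by (rule explicit_trace_rep)
  show "explicit_trace p u \<in> Lp UNIV p"
    unfolding D(2) by (rule Lp_norm_UNIV(1)) (use etr_rep_finite[OF D(1) assms] assms in auto)
  fix e :: real assume e: "e > 0"
  show "\<exists>d>0. \<forall>v\<in>W1p half_space p. W1p_norm half_space p (v - u) < d \<longrightarrow> Lp_norm UNIV p (explicit_trace p v - explicit_trace p u) < e"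
    by (rule exI[of _ "e / 2"]) (use e explicit_trace_lipschitz(2)[OF u _ assms] in fastforce)
next
  fix u :: "'a \<times> real \<Rightarrow> real" assume u: "u \<in> C_infinity_closure half_space \<inter> W1p half_space p"
  then obtain f where f: "f \<in> C_infinity" "\<And>x. x \<in> closure half_space \<Longrightarrow> u x = f x" by (auto simp: C_infinity_closure_def)
  obtain u0 D0 where "W1p_rep half_space p u u0 D0" using W1p_obtain_rep half_space_borel u by blast
  then obtain u' D where D: "W1p_rep half_space p u u' D" "explicit_trace p u = etr u' (D (0, 1))" by (rule explicit_trace_rep)
  have "AE y in lborel. etr u' (D (0, 1)) y = f (y, 0)"
    by (rule smooth_up_to_boundary_etr[OF f(1) _ D(1) assms]) (rule f(2))
  then have "AE y in lborel. explicit_trace p u y = u (y, 0)"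
    unfolding D(2) by eventually_elim (simp add: f(2) closure_half_space)
  then show "AE y in lebesgue. explicit_trace p u y = u (y, 0)" by (rule AE_completion)
qed

lemma Lp_diff:
  assumes "f \<in> Lp UNIV p" "g \<in> Lp UNIV p" "p \<ge> 1"
  shows "f - g \<in> Lp UNIV p"
proof -
  obtain f' where f': "zrep UNIV f f'" "pmass p f' < \<infinity>" using Lp_obtain_zrep[OF _ assms(1)] by auto
  obtain g' where g': "zrep UNIV g g'" "pmass p g' < \<infinity>" using Lp_obtain_zrep[OF _ assms(2)] by auto
  have "pmass p (\<lambda>x. f' x - g' x) \<le> ennreal (2 powr p) * (pmass p f' + pmass p g')"
    using zrepD(1)[OF f'(1)] zrepD(1)[OF g'(1)] assms by (intro Lp_mass_diff) auto
  also have "\<dots> < \<infinity>" using f' g' by (simp add: ennreal_mult_less_top)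
  finally show ?thesis
    using Lp_iff_zrep[OF _ zrep_add(2)[OF f'(1) g'(1)]] by (simp add: fun_diff_def)
qed

text \<open>
  On the mollifications of \<open>u\<close> both operators are the restriction to the boundary; as these
  converge to \<open>u\<close>, continuity gives agreement at \<open>u\<close>.
\<close>

lemma trace_operator_unique:
  fixes T T' :: "('a::euclidean_space \<times> real \<Rightarrow> real) \<Rightarrow> 'a \<Rightarrow> real"
  assumes T: "is_trace_operator p T" "is_trace_operator p T'" and u: "u \<in> W1p half_space p" and p: "p \<ge> 1"
  shows "AE y in lborel. T u y = T' u y"
proof -
  obtain \<phi> :: "'a \<times> real \<Rightarrow> real" where phi: "mollifier \<phi> half_space" using half_space_mollifier .
  obtain u' D where D: "W1p_rep half_space p u u' D" using W1p_obtain_rep[OF u half_space_borel] .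
  define e where "e = (\<lambda>k. 1 / real (Suc k))"
  have e: "e k > 0" "e \<longlonglongrightarrow> 0" for k
    using LIMSEQ_inverse_real_of_nat by (auto simp: e_def inverse_eq_divide)
  define U where "U = (\<lambda>k. moll \<phi> (e k) u')"
  have U: "U k \<in> C_infinity_closure half_space \<inter> W1p half_space p" for k
    using half_space_moll_rep[OF phi D p e(1)] W1p_rep_W1p[OF _ half_space_borel p]
    unfolding U_def C_infinity_closure_def by blast
  have TU: "AE y in lborel. T (U k) y = T' (U k) y" for k
  proof -
    have "AE y in lebesgue. T (U k) y = U k (y, 0)" "AE y in lebesgue. T' (U k) y = U k (y, 0)"
      using T U unfolding is_trace_operator_def by blast+
    then have "AE y in lebesgue. T (U k) y = T' (U k) y" by eventually_elim simp
    then show ?thesis by (simp add: AE_completion_iff)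
  qed
  have close: "\<exists>k. Lp_norm UNIV p (T (U k) - T u) < d \<and> Lp_norm UNIV p (T' (U k) - T' u) < d" if "d > 0" for d
  proof -
    obtain d1 where d1: "d1 > 0" "\<And>v. v \<in> W1p half_space p \<Longrightarrow> W1p_norm half_space p (v - u) < d1 \<Longrightarrow> Lp_norm UNIV p (T v - T u) < d"
      using T(1) u \<open>d > 0\<close> unfolding is_trace_operator_def by meson
    obtain d2 where d2: "d2 > 0" "\<And>v. v \<in> W1p half_space p \<Longrightarrow> W1p_norm half_space p (v - u) < d2 \<Longrightarrow> Lp_norm UNIV p (T' v - T' u) < d"
      using T(2) u \<open>d > 0\<close> unfolding is_trace_operator_def by meson
    have "\<forall>\<^sub>F k in sequentially. ennreal (W1p_norm half_space p (U k - u) powr p) < ennreal (min d1 d2 powr p)"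
      unfolding U_def by (rule order_tendstoD[OF half_space_moll_W1p_tendsto[OF phi D p e]]) (use d1 d2 in auto)
    then obtain k where "ennreal (W1p_norm half_space p (U k - u) powr p) < ennreal (min d1 d2 powr p)"
      using eventually_happens'[OF sequentially_bot] by blast
    then have "W1p_norm half_space p (U k - u) powr p < min d1 d2 powr p"
      by (subst (asm) ennreal_less_iff) auto
    moreover have "W1p_norm half_space p (U k - u) \<ge> 0" by (simp add: W1p_norm_def)
    ultimately have "W1p_norm half_space p (U k - u) < min d1 d2"
      using p powr_mono2[of p "min d1 d2" "W1p_norm half_space p (U k - u)"] d1 d2 by (cases "W1p_norm half_space p (U k - u) < min d1 d2") auto
    then show ?thesis using d1 d2 U by (intro exI[of _ k]) auto
  qed
  have LU: "T (U k) \<in> Lp UNIV p" "T' (U k) \<in> Lp UNIV p" "T u \<in> Lp UNIV p" "T' u \<in> Lp UNIV p" for k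
    using T U u unfolding is_trace_operator_def by blast+
  let ?M = "\<lambda>f :: 'a \<Rightarrow> real. Lp_mass (lebesgue_on UNIV) p f"
  have meas: "f \<in> borel_measurable (lebesgue_on UNIV)" if "f \<in> Lp UNIV p" for f :: "'a \<Rightarrow> real"
    using that by (auto simp: Lp_def)
  have bound: "?M (\<lambda>y. T u y - T' u y) \<le> ennreal (2 powr p * (2 * d powr p))" if "d > 0" for d
  proof -
    obtain k where k: "Lp_norm UNIV p (T (U k) - T u) < d" "Lp_norm UNIV p (T' (U k) - T' u) < d" using close[OF \<open>d > 0\<close>] by auto
    have s: "?M (\<lambda>y. F y - G y) \<le> ennreal (d powr p)" if "Lp_norm UNIV p (F - G) < d" "F \<in> Lp UNIV p" "G \<in> Lp UNIV p" for F G :: "'a \<Rightarrow> real"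
    proof -
      have "?M (F - G) = ennreal (Lp_norm UNIV p (F - G) powr p)"
        using ennreal_Lp_norm_powr[OF Lp_diff[OF that(2,3) p]] p by simp
      also have "\<dots> \<le> ennreal (d powr p)"
        using that p by (intro ennreal_leI powr_mono2) (auto simp: Lp_norm_def)
      finally show ?thesis by (simp add: fun_diff_def)
    qed
    have "?M (\<lambda>y. T u y - T' u y) \<le> ennreal (2 powr p) * (?M (\<lambda>y. T u y - T (U k) y) + ?M (\<lambda>y. T (U k) y - T' u y))"
      by (rule Lp_mass_triangle) (use meas LU p in auto)
    also have "?M (\<lambda>y. T u y - T (U k) y) = ?M (\<lambda>y. T (U k) y - T u y)" by (rule Lp_mass_diff_commute)
    also have "?M (\<lambda>y. T (U k) y - T' u y) = ?M (\<lambda>y. T' (U k) y - T' u y)"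
    proof (rule Lp_mass_cong_AE)
      have "AE y in lebesgue_on UNIV. T (U k) y = T' (U k) y"
        unfolding lebesgue_on_UNIV_eq by (rule AE_completion[OF TU])
      then show "AE y in lebesgue_on UNIV. T (U k) y - T' u y = T' (U k) y - T' u y" by eventually_elim simp
    qed
    also have "ennreal (2 powr p) * (?M (\<lambda>y. T (U k) y - T u y) + ?M (\<lambda>y. T' (U k) y - T' u y)) \<le> ennreal (2 powr p) * (ennreal (d powr p) + ennreal (d powr p))"
      by (intro mult_left_mono add_mono s k LU) auto
    also have "\<dots> = ennreal (2 powr p * (2 * d powr p))"
      by (simp add: ennreal_mult[symmetric] ennreal_plus[symmetric] del: ennreal_plus)
    finally show ?thesis .
  qed
  have "?M (\<lambda>y. T u y - T' u y) \<le> ennreal 0 + ennreal \<delta>" if "\<delta> > 0" for \<delta>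
  proof -
    define d where "d = (\<delta> / (2 powr p * 2)) powr (1 / p)"
    have "d > 0" "2 powr p * (2 * d powr p) = \<delta>" using that p by (auto simp: d_def powr_powr)
    with bound[of d] show ?thesis by simp
  qed
  then have "?M (\<lambda>y. T u y - T' u y) \<le> ennreal 0"
    by (rule ennreal_le_epsilon)
  then have "?M (\<lambda>y. T u y - T' u y) = 0" by simp
  then have "AE y in lebesgue_on UNIV. T u y - T' u y = 0"
    by (rule Lp_mass_zero_imp_AE[OF borel_measurable_diff[OF meas[OF LU(3)] meas[OF LU(4)]]])
  then have "AE y in lebesgue. T u y - T' u y = 0" unfolding lebesgue_on_UNIV_eq .
  then show ?thesis by (simp add: AE_completion_iff)
qed

lemma trace_operator_eq:
  fixes u :: "'a::euclidean_space \<times> real \<Rightarrow> real"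
  assumes "W1p_rep half_space p u u' D" "p \<ge> 1"
  shows "AE y in lborel. trace_operator p u y = etr u' (D (0, 1)) y"
proof -
  have "is_trace_operator p (trace_operator p :: ('a \<times> real \<Rightarrow> real) \<Rightarrow> _)"
    unfolding trace_operator_def by (rule someI[of "is_trace_operator p"]) (rule explicit_trace_is_trace[OF assms(2)])
  from trace_operator_unique[OF this explicit_trace_is_trace[OF assms(2)] W1p_rep_W1p[OF assms(1) half_space_borel assms(2)] assms(2)] explicit_trace_eq[OF assms]
  show ?thesis by eventually_elim simp
qed

text \<open>
  The trace operator is a choice among all trace operators. This characterisation replaces it by
  the explicit formula.
\<close>

lemma trace_image_iff:
  fixes g :: "'a::euclidean_space \<Rightarrow> real"
  assumes p: "p \<ge> 1" and X: "X \<subseteq> W1p half_space p"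
  shows "g \<in> trace_image p X \<longleftrightarrow> (\<exists>u\<in>X. \<exists>u' D. W1p_rep half_space p u u' D \<and> (AE y in lborel. g y = etr u' (D (0, 1)) y))"
proof
  assume "g \<in> trace_image p X"
  then obtain u where u: "u \<in> X" "AE y in lborel. g y = trace_operator p u y" by (auto simp: trace_image_def AE_completion_iff)
  obtain u' D where D: "W1p_rep half_space p u u' D" using W1p_obtain_rep u(1) X half_space_borel by blast
  have "AE y in lborel. g y = etr u' (D (0, 1)) y"
    using u(2) trace_operator_eq[OF D p] by eventually_elim simp
  with u D show "\<exists>u\<in>X. \<exists>u' D. W1p_rep half_space p u u' D \<and> (AE y in lborel. g y = etr u' (D (0, 1)) y)" by blast
next
  assume "\<exists>u\<in>X. \<exists>u' D. W1p_rep half_space p u u' D \<and> (AE y in lborel. g y = etr u' (D (0, 1)) y)"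
  then obtain u u' D where u: "u \<in> X" "W1p_rep half_space p u u' D" and ae: "AE y in lborel. g y = etr u' (D (0, 1)) y" by blast
  have "g \<in> borel_measurable lebesgue"
    by (rule borel_measurable_lebesgue_cong_AE[of "etr u' (D (0, 1))"])
      (use etr_rep_finite(1)[OF u(2) p] ae in \<open>auto elim!: eventually_mono\<close>)
  moreover have "AE y in lborel. g y = trace_operator p u y"
    using ae trace_operator_eq[OF u(2) p] by eventually_elim simp
  ultimately show "g \<in> trace_image p X" using u(1) by (auto simp: trace_image_def AE_completion_iff)
qed

text \<open>
  The way in which all extensions are recognised: a continuously differentiable function on the
  open half space with finite Sobolev norm has as trace its limit along any sequence of heights
  that tends to \<open>0\<close>.
\<close>

lemma etr_rep_classical_limit:
  fixes f :: "'a::euclidean_space \<times> real \<Rightarrow> real"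
  assumes c: "continuous_on half_space f" "\<And>b. b \<in> Basis \<Longrightarrow> continuous_on half_space (D b)"
    and der: "\<And>x b. x \<in> half_space \<Longrightarrow> b \<in> Basis \<Longrightarrow> ((\<lambda>s. f (x + s *\<^sub>R b)) has_real_derivative D b x) (at 0)"
    and fin: "pmass p (\<lambda>x. indicator half_space x * f x) < \<infinity>" "\<And>b. b \<in> Basis \<Longrightarrow> pmass p (\<lambda>x. indicator half_space x * D b x) < \<infinity>"
    and p: "p \<ge> 1" and d: "\<And>k. 0 < d k" "\<And>k. d k < 1" "d \<longlonglongrightarrow> 0" and lim: "AE y in lborel. (\<lambda>k. f (y, d k)) \<longlonglongrightarrow> g y"
    and X: "X \<subseteq> W1p half_space p" "f \<in> W1p half_space p \<Longrightarrow> f \<in> X"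
  shows "g \<in> trace_image p X"
proof -
  note rep = classical_W1p_rep[OF open_half_space c der fin]
  have rp: "W1p_rep half_space p f (\<lambda>x. indicator half_space x * f x) (\<lambda>b x. indicator half_space x * D b x)"
    by (rule rep)
  note R = W1p_repD[OF rp]
  have fX: "f \<in> X" by (intro X W1p_rep_W1p[OF rp half_space_borel p])
  have "AE y in lborel. \<forall>d. (\<forall>k. 0 < d k \<and> d k < 1) \<longrightarrow> d \<longlonglongrightarrow> 0 \<longrightarrow> (\<lambda>k. f (y, d k)) \<longlonglongrightarrow> etr f (D (0, 1)) y"
    by (rule etr_classical[OF R(2) R(5)[OF vertical_Basis] R(4) R(7)[OF vertical_Basis] p c(2)[OF vertical_Basis] der[OF _ vertical_Basis]])
  with lim have "AE y in lborel. g y = etr f (D (0, 1)) y"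
  proof eventually_elim
    case (elim y)
    then have "(\<lambda>k. f (y, d k)) \<longlonglongrightarrow> etr f (D (0, 1)) y" using d by blast
    with elim(1) show ?case by (rule LIMSEQ_unique)
  qed
  then have "AE y in lborel. g y = etr (\<lambda>x. indicator half_space x * f x) (\<lambda>x. indicator half_space x * D (0, 1) x) y"
    by (simp add: etr_restrict)
  then show ?thesis using fX rp trace_image_iff[OF p X(1)] by blast
qed

lemma Lp_mass_subseq_AE:
  assumes [measurable]: "\<And>k. f k \<in> borel_measurable M" and lim: "(\<lambda>k. Lp_mass M p (f k)) \<longlonglongrightarrow> 0" and p: "p > 0"
  shows "\<exists>s::nat\<Rightarrow>nat. strict_mono s \<and> (AE x in M. (\<lambda>k. f (s k) x) \<longlonglongrightarrow> 0)"
proof -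
  have "\<forall>\<^sub>F k in sequentially. Lp_mass M p (f k) < 1"
    by (rule order_tendstoD[OF lim]) simp
  then obtain N where N: "\<And>k. Lp_mass M p (f (k + N)) < 1"
    unfolding eventually_sequentially by (metis le_add2)
  have i: "integrable M (\<lambda>x. \<bar>f (k + N) x\<bar> powr p)" for k
    using N[of k] by (intro integrableI_bounded) (auto simp: Lp_mass_def intro: order_less_trans)
  have e: "Lp_mass M p (f (k + N)) = ennreal (LINT x|M. norm (\<bar>f (k + N) x\<bar> powr p))" for k
    using nn_integral_eq_integral[OF i[of k]] by (simp add: Lp_mass_def)
  have "(\<lambda>k. Lp_mass M p (f (k + N))) \<longlonglongrightarrow> 0" using lim by (rule LIMSEQ_ignore_initial_segment)
  then have "(\<lambda>k. ennreal (LINT x|M. norm (\<bar>f (k + N) x\<bar> powr p))) \<longlonglongrightarrow> ennreal 0" unfolding e by simp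
  then have "(\<lambda>k. LINT x|M. norm (\<bar>f (k + N) x\<bar> powr p)) \<longlonglongrightarrow> 0"
    by (rule tendsto_ennrealD) (auto intro!: integral_nonneg)
  from tendsto_L1_AE_subseq[OF i this] obtain s where s: "strict_mono s" "AE x in M. (\<lambda>k. \<bar>f (s k + N) x\<bar> powr p) \<longlonglongrightarrow> 0" by auto
  have "AE x in M. (\<lambda>k. f (s k + N) x) \<longlonglongrightarrow> 0"
    using s(2)
  proof eventually_elim
    case (elim x)
    have "(\<lambda>k. (\<bar>f (s k + N) x\<bar> powr p) powr (1 / p)) \<longlonglongrightarrow> 0 powr (1 / p)"
      by (rule tendsto_powr'[OF elim tendsto_const]) (use p in auto)
    then have "(\<lambda>k. \<bar>f (s k + N) x\<bar>) \<longlonglongrightarrow> 0" using p by (simp add: powr_powr)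
    then show ?case by (rule tendsto_rabs_zero_cancel)
  qed
  moreover have "strict_mono (\<lambda>k. s k + N)" using s(1) by (simp add: strict_mono_def)
  ultimately show ?thesis by (intro exI[of _ "\<lambda>k. s k + N"]) auto
qed

lemma boundary_slice_borel:
  assumes "(f :: 'a::euclidean_space \<times> real \<Rightarrow> real) \<in> C_infinity"
  shows "(\<lambda>y. f (y, t)) \<in> borel_measurable borel"
  by (intro borel_measurable_continuous_onI continuous_on_compose2[OF C_infinityD(3)[OF assms]]) (auto intro!: continuous_intros)

text \<open>
  Mollifications are smooth up to the boundary and their masses are at most those of \<open>u'\<close> and \<open>D\<close>,
  so estimates for smooth functions pass to traces by Fatou's lemma.
\<close>

lemma trace_approximation:
  fixes u :: "'a::euclidean_space \<times> real \<Rightarrow> real"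
  assumes D: "W1p_rep half_space p u u' D" and p: "p \<ge> 1"
  obtains \<phi> e where "mollifier \<phi> half_space" "\<And>k::nat. e k > 0"
    "AE y in lborel. (\<lambda>k. moll \<phi> (e k) u' (y, 0)) \<longlonglongrightarrow> etr u' (D (0, 1)) y"
proof -
  obtain \<phi> :: "'a \<times> real \<Rightarrow> real" where phi: "mollifier \<phi> half_space" using half_space_mollifier .
  define e where "e = (\<lambda>k. 1 / real (Suc k))"
  have e: "e k > 0" "e \<longlonglongrightarrow> 0" for k
    using LIMSEQ_inverse_real_of_nat by (auto simp: e_def inverse_eq_divide)
  let ?I = "indicator half_space :: 'a \<times> real \<Rightarrow> real"
  let ?n = "(0::'a, 1::real)"
  define U where "U = (\<lambda>k. moll \<phi> (e k) u')"
  have Ueq: "moll \<phi> (e k) u' = U k" for k by (simp add: U_def)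
  note M = half_space_moll_rep[OF phi D p e(1), unfolded Ueq]
  have b: "pmass p (\<lambda>y. U k (y, 0) - etr u' (D ?n) y) \<le> ennreal (2 powr p) * ennreal (W1p_norm half_space p (U k - u) powr p)" for k
  proof -
    note R = W1p_repD[OF M(2)[of k]] and R' = W1p_repD[OF D]
    note n = vertical_Basis
    have 1: "AE y in lborel. etr (\<lambda>x. ?I x * U k x) (\<lambda>x. ?I x * moll \<phi> (e k) (D ?n) x) y = U k (y, 0)"
      using smooth_up_to_boundary_etr[of "U k" "U k", OF M(1)[of k] _ M(2)[of k] p] by simp
    have "AE y in lborel. etr (\<lambda>x. 1 * (?I x * U k x) + (-1) * u' x) (\<lambda>x. 1 * (?I x * moll \<phi> (e k) (D ?n) x) + (-1) * D ?n x) y =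
       1 * etr (\<lambda>x. ?I x * U k x) (\<lambda>x. ?I x * moll \<phi> (e k) (D ?n) x) y + (-1) * etr u' (D ?n) y"
      by (rule etr_lincomb[OF R(2) R(5)[OF n] R'(2) R'(5)[OF n] R(4) R(7)[OF n] R'(4) R'(7)[OF n] p])
    with 1 have "AE y in lborel. U k (y, 0) - etr u' (D ?n) y = etr (\<lambda>x. ?I x * U k x - u' x) (\<lambda>x. ?I x * moll \<phi> (e k) (D ?n) x - D ?n x) y"
      by eventually_elim simp
    from Lp_mass_cong_AE[OF this]
    show ?thesis using etr_rep_finite(3)[OF W1p_rep_diff[OF M(2)[of k] D p] p] by simp
  qed
  have "(\<lambda>k. pmass p (\<lambda>y. U k (y, 0) - etr u' (D ?n) y)) \<longlonglongrightarrow> 0"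
    by (rule ennreal_tendsto_0_le[OF b]) (use half_space_moll_W1p_tendsto[OF phi D p e] in \<open>simp add: U_def\<close>)
  then obtain s where s: "strict_mono s" "AE y in lborel. (\<lambda>k. U (s k) (y, 0) - etr u' (D ?n) y) \<longlonglongrightarrow> 0"
    using Lp_mass_subseq_AE[of "\<lambda>k y. U k (y, 0) - etr u' (D ?n) y" lborel p] boundary_slice_borel[OF M(1)] etr_rep_finite(1)[OF D p] p by auto
  show ?thesis
    by (rule that[of \<phi> "\<lambda>k. e (s k)"]) (use phi e s(2) in \<open>auto simp: U_def LIM_zero_iff\<close>)
qed

lemma Lp_mass_Fatou:
  assumes [measurable]: "\<And>k. f k \<in> borel_measurable M" "g \<in> borel_measurable M"
    and lim: "AE x in M. (\<lambda>k. f k x) \<longlonglongrightarrow> g x" and b: "\<And>k. Lp_mass M p (f k) \<le> C" and p: "p > 0"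
  shows "Lp_mass M p g \<le> C"
proof -
  have "Lp_mass M p g = (\<integral>\<^sup>+x. liminf (\<lambda>k. ennreal (\<bar>f k x\<bar> powr p)) \<partial>M)"
    unfolding Lp_mass_def
  proof (rule nn_integral_cong_AE)
    show "AE x in M. ennreal (\<bar>g x\<bar> powr p) = liminf (\<lambda>k. ennreal (\<bar>f k x\<bar> powr p))"
      using lim
    proof eventually_elim
      case (elim x)
      have "(\<lambda>k. \<bar>f k x\<bar> powr p) \<longlonglongrightarrow> \<bar>g x\<bar> powr p"
        by (rule tendsto_powr'[OF tendsto_rabs[OF elim] tendsto_const]) (use p in auto)
      then have "(\<lambda>k. ennreal (\<bar>f k x\<bar> powr p)) \<longlonglongrightarrow> ennreal (\<bar>g x\<bar> powr p)" by (rule tendsto_ennrealI)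
      from lim_imp_Liminf[OF _ this] show ?case by simp
    qed
  qed
  also have "\<dots> \<le> liminf (\<lambda>k. Lp_mass M p (f k))"
    unfolding Lp_mass_def by (rule nn_integral_liminf) measurable
  also have "\<dots> \<le> C"
    by (rule Liminf_le) (use b in auto)
  finally show ?thesis .
qed

section \<open>Higher integrability of traces\<close>

lemma DERIV_abs_powr:
  fixes r :: real
  assumes r: "r > 1"
  shows "((\<lambda>s. \<bar>s\<bar> powr r) has_real_derivative r * \<bar>s\<bar> powr (r - 1) * sgn s) (at s)"
proof -
  consider "s > 0" | "s < 0" | "s = 0" by linarith
  then show ?thesis
  proof cases
    case 1
    have "((\<lambda>s. s powr r) has_real_derivative r * \<bar>s\<bar> powr (r - 1) * sgn s) (at s)"
      using 1 has_real_derivative_powr[of s r] by simp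
    then show ?thesis
      by (rule DERIV_cong_ev[THEN iffD1, rotated -1])
        (auto simp: 1 intro!: eventually_nhds_in_open[of "{0<..}" s, THEN eventually_mono])
  next
    case 2
    have "((\<lambda>s. (- s) powr r) has_real_derivative r * \<bar>s\<bar> powr (r - 1) * sgn s) (at s)"
      using 2 by (auto intro!: derivative_eq_intros has_real_derivative_powr simp: powr_diff)
    then show ?thesis
      by (rule DERIV_cong_ev[THEN iffD1, rotated -1])
        (auto simp: 2 intro!: eventually_nhds_in_open[of "{..<0}" s, THEN eventually_mono])
  next
    case 3
    have "((\<lambda>h. \<bar>h\<bar> powr (r - 1)) \<longlongrightarrow> \<bar>0\<bar> powr (r - 1)) (at (0::real))"
      by (rule tendsto_powr'[OF tendsto_rabs[OF tendsto_ident_at] tendsto_const]) (use r in auto)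
    then have "((\<lambda>h. \<bar>h\<bar> powr (r - 1)) \<longlongrightarrow> 0) (at (0::real))" using r by simp
    then have "((\<lambda>h. (\<bar>0 + h\<bar> powr r - \<bar>0\<bar> powr r) / h) \<longlongrightarrow> 0) (at (0::real))"
    proof (rule Lim_null_comparison[rotated])
      show "\<forall>\<^sub>F h in at 0. norm ((\<bar>0 + h\<bar> powr r - \<bar>0\<bar> powr r) / h) \<le> \<bar>h\<bar> powr (r - 1)"
        using r by (auto simp: eventually_at_filter powr_diff)
    qed
    then show ?thesis using 3 r by (simp add: DERIV_def)
  qed
qed

lemma isCont_abs_powr: "r > (0::real) \<Longrightarrow> isCont f x \<Longrightarrow> isCont (\<lambda>x. \<bar>f x :: real\<bar> powr r) x"
  unfolding isCont_def by (intro tendsto_powr' tendsto_rabs tendsto_const) auto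

lemma isCont_abs_powr_sgn:
  assumes "r > (0::real)"
  shows "isCont (\<lambda>s. \<bar>s\<bar> powr r * sgn s) (s::real)"
proof (cases "s = 0")
  case True
  have "((\<lambda>s. \<bar>s\<bar> powr r) \<longlongrightarrow> \<bar>0\<bar> powr r) (at (0::real))"
    by (rule tendsto_powr'[OF tendsto_rabs[OF tendsto_ident_at] tendsto_const]) (use assms in auto)
  then have "((\<lambda>s. \<bar>s\<bar> powr r) \<longlongrightarrow> 0) (at (0::real))" using assms by simp
  then have "((\<lambda>s. \<bar>s\<bar> powr r * sgn s) \<longlongrightarrow> 0) (at (0::real))"
    by (rule Lim_null_comparison[rotated]) (auto simp: abs_mult sgn_real_def eventually_at_filter)
  then show ?thesis using True by (simp add: isCont_def)
next
  case False
  have "((\<lambda>s. \<bar>s\<bar> powr r) \<longlongrightarrow> \<bar>s\<bar> powr r) (at s)"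
    by (rule tendsto_powr'[OF tendsto_rabs[OF tendsto_ident_at] tendsto_const]) (use assms in auto)
  moreover have "(sgn \<longlongrightarrow> sgn s) (at s)" using False by (intro tendsto_sgn tendsto_ident_at)
  ultimately show ?thesis unfolding isCont_def by (rule tendsto_mult)
qed

lemma smooth_vertical_DERIV:
  fixes U :: "'a::euclidean_space \<times> real \<Rightarrow> real"
  assumes "U \<in> C_infinity"
  shows "((\<lambda>s. U (y, s)) has_real_derivative partial_deriv (0, 1) U (y, t)) (at t)"
proof -
  have "((\<lambda>s. U (y, t + s)) has_real_derivative partial_deriv (0, 1) U (y, t)) (at 0)"
    using C_infinity_directional_DERIV[OF assms, of "(y, t)" "(0, 1)"] by simp
  then show ?thesis using DERIV_shift[of "\<lambda>s. U (y, s)" "partial_deriv (0, 1) U (y, t)" 0 t] by (simp add: add.commute)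
qed

lemma smooth_vertical_isCont:
  fixes U :: "'a::euclidean_space \<times> real \<Rightarrow> real"
  assumes "U \<in> C_infinity"
  shows "isCont (\<lambda>s. U (y, s)) t"
  using smooth_vertical_DERIV[OF assms] by (rule DERIV_isCont)

text \<open>The formula behind \<open>etr\<close>, applied to \<open>\<bar>U\<bar> powr r\<close> in place of \<open>U\<close>.\<close>

lemma boundary_power_bound:
  fixes U :: "'a::euclidean_space \<times> real \<Rightarrow> real"
  assumes U: "U \<in> C_infinity" and r: "r > 1"
  shows "ennreal (\<bar>U (y, 0)\<bar> powr r) \<le> (\<integral>\<^sup>+t. ennreal ((\<bar>U (y, t)\<bar> powr r + r * \<bar>U (y, t)\<bar> powr (r - 1) * \<bar>partial_deriv (0, 1) U (y, t)\<bar>) * indicator {0..1} t) \<partial>lborel)"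
proof -
  let ?v = "\<lambda>t. partial_deriv (0, 1) U (y, t)"
  define F where "F = (\<lambda>t. - (1 - t) * \<bar>U (y, t)\<bar> powr r)"
  define f where "f = (\<lambda>t. \<bar>U (y, t)\<bar> powr r - (1 - t) * (r * (\<bar>U (y, t)\<bar> powr (r - 1) * sgn (U (y, t))) * ?v t))"
  have cv: "isCont ?v t" for t by (rule smooth_vertical_isCont[OF C_infinityD(2)[OF U vertical_Basis]])
  have FD: "(F has_real_derivative f t) (at t)" for t
  proof -
    have d1: "((\<lambda>t. \<bar>U (y, t)\<bar> powr r) has_real_derivative (r * \<bar>U (y, t)\<bar> powr (r - 1) * sgn (U (y, t))) * ?v t) (at t)"
      by (rule DERIV_chain2[OF DERIV_abs_powr[OF r] smooth_vertical_DERIV[OF U]])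
    have d2: "((\<lambda>t. - (1 - t)) has_real_derivative 1) (at t)" by (auto intro!: derivative_eq_intros)
    show ?thesis unfolding F_def f_def
      by (rule DERIV_cong[OF DERIV_mult[OF d2 d1]]) (simp add: algebra_simps)
  qed
  have fc: "isCont f t" for t
    unfolding f_def using r
    by (intro continuous_intros isCont_abs_powr smooth_vertical_isCont[OF U] cv
        isCont_o2[OF smooth_vertical_isCont[OF U] isCont_abs_powr_sgn]) auto
  have hb: "has_bochner_integral lborel (\<lambda>t. f t * indicator {0..1} t) (F 1 - F 0)"
    by (rule has_bochner_integral_FTC_Icc_real) (use FD fc in auto)
  have "\<bar>U (y, 0)\<bar> powr r = (LINT t|lborel. f t * indicator {0..1} t)"
    using has_bochner_integral_integral_eq[OF hb] by (simp add: F_def)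
  then have "ennreal (\<bar>U (y, 0)\<bar> powr r) = ennreal (norm (LINT t|lborel. f t * indicator {0..1} t))"
    by (metis abs_of_nonneg powr_ge_zero real_norm_def)
  also have "\<dots> \<le> (\<integral>\<^sup>+t. ennreal (norm (f t * indicator {0..1} t)) \<partial>lborel)"
    by (rule integral_norm_bound_ennreal[OF integrable.intros[OF hb]])
  also have "\<dots> \<le> (\<integral>\<^sup>+t. ennreal ((\<bar>U (y, t)\<bar> powr r + r * \<bar>U (y, t)\<bar> powr (r - 1) * \<bar>?v t\<bar>) * indicator {0..1} t) \<partial>lborel)"
  proof (intro nn_integral_mono ennreal_leI)
    fix t
    show "norm (f t * indicator {0..1} t) \<le> (\<bar>U (y, t)\<bar> powr r + r * \<bar>U (y, t)\<bar> powr (r - 1) * \<bar>?v t\<bar>) * indicator {0..1} t"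
    proof (cases "t \<in> {0..1}")
      case True
      define A where "A = \<bar>U (y, t)\<bar> powr (r - 1)"
      have A: "A \<ge> 0" by (simp add: A_def)
      have "\<bar>(1 - t) * (r * (A * sgn (U (y, t))) * ?v t)\<bar> = (1 - t) * \<bar>sgn (U (y, t))\<bar> * (r * A * \<bar>?v t\<bar>)"
        using True r A by (simp add: abs_mult)
      also have "\<dots> \<le> (1 * 1) * (r * A * \<bar>?v t\<bar>)"
        using True r A by (intro mult_right_mono mult_mono) (auto simp: sgn_real_def)
      finally have "\<bar>f t\<bar> \<le> \<bar>U (y, t)\<bar> powr r + r * A * \<bar>?v t\<bar>"
        unfolding f_def A_def[symmetric] using abs_triangle_ineq4[of "\<bar>U (y, t)\<bar> powr r" "(1 - t) * (r * (A * sgn (U (y, t))) * ?v t)"] by simp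
      then show ?thesis using True by (simp add: A_def)
    qed simp
  qed
  finally show ?thesis .
qed

text \<open>
  In \<open>boundary_power_bound\<close> the derivative term is \<open>\<bar>U\<bar> powr (r - 1) * \<bar>V\<bar>\<close> with \<open>V\<close> in \<open>L\<^sup>p\<close>.
  Young's inequality with exponents \<open>p / (p - 1)\<close> and \<open>p\<close> separates the factors, and \<open>r\<close> is chosen
  such that \<open>(r - 1) * p / (p - 1) = q\<close>.
\<close>

lemma trace_power_integrable:
  fixes u :: "'a::euclidean_space \<times> real \<Rightarrow> real"
  assumes D: "W1p_rep half_space p u u' D" and p: "p > 1" and q: "q \<ge> p" and fin: "pmass q u' < \<infinity>"
    and r: "r = 1 + q * (p - 1) / p"
  shows "pmass r (etr u' (D (0, 1))) < \<infinity>"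
proof -
  have r1: "r > 1" using p q r by simp
  have rp: "r \<ge> p" "r \<le> q"
  proof -
    have "p * (p - 1) / p \<le> q * (p - 1) / p" using p q by (intro divide_right_mono mult_right_mono) auto
    then show "r \<ge> p" using p r by simp
    have "1 \<le> q / p" using p q by simp
    moreover have "q * (p - 1) / p = q - q / p" using p by (simp add: field_simps)
    ultimately show "r \<le> q" using r by simp
  qed
  note R = W1p_repD[OF D] and n = vertical_Basis
  obtain \<phi> :: "'a \<times> real \<Rightarrow> real" and e :: "nat \<Rightarrow> real" where phi: "mollifier \<phi> half_space" and e: "\<And>k::nat. e k > 0"
    and lim: "AE y in lborel. (\<lambda>k. moll \<phi> (e k) u' (y, 0)) \<longlonglongrightarrow> etr u' (D (0, 1)) y"
  proof (rule trace_approximation[OF D less_imp_le[OF p]])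
    fix \<phi> and e :: "nat \<Rightarrow> real"
    assume "mollifier \<phi> half_space" "\<And>k. 0 < e k" "AE y in lborel. (\<lambda>k. moll \<phi> (e k) u' (y, 0)) \<longlonglongrightarrow> etr u' (D (0, 1)) y"
    then show thesis by (rule that)
  qed
  define C where "C = pmass p u' + ennreal (1 + r) * pmass q u' + ennreal r * pmass p (D (0, 1))"
  have "C < \<infinity>" using R(4) R(7)[OF n] fin by (simp add: C_def ennreal_mult_less_top)
  have bound: "pmass r (\<lambda>y. moll \<phi> (e k) u' (y, 0)) \<le> C" for k
  proof -
    define U where "U = moll \<phi> (e k) u'"
    define V where "V = moll \<phi> (e k) (D (0, 1))"
    have p1: "p \<ge> 1" using p by simp
    note M = half_space_moll_rep[OF phi D p1 e, of k, folded U_def]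
    have Ub: "U \<in> borel_measurable borel" using C_infinityD(3)[OF M(1)] by (rule borel_measurable_continuous_onI)
    have Vb: "V \<in> borel_measurable borel"
      unfolding V_def by (rule moll_borel) (use mollifier.borel[OF phi] R(5)[OF n] in auto)
    have [measurable]: "U \<in> borel_measurable (borel \<Otimes>\<^sub>M borel)" "V \<in> borel_measurable (borel \<Otimes>\<^sub>M borel)"
      using Ub Vb by (simp_all add: borel_prod)
    have "pmass r (\<lambda>y. U (y, 0)) \<le> (\<integral>\<^sup>+y. \<integral>\<^sup>+t. (ennreal (\<bar>U (y, t)\<bar> powr p) + ennreal (1 + r) * ennreal (\<bar>U (y, t)\<bar> powr q) + ennreal r * ennreal (\<bar>V (y, t)\<bar> powr p)) \<partial>lborel \<partial>lborel)"
      unfolding Lp_mass_def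
    proof (intro nn_integral_mono order_trans[OF boundary_power_bound[OF M(1) r1]])
      fix y t
      show "ennreal ((\<bar>U (y, t)\<bar> powr r + r * \<bar>U (y, t)\<bar> powr (r - 1) * \<bar>partial_deriv (0, 1) U (y, t)\<bar>) * indicator {0..1} t)
        \<le> ennreal (\<bar>U (y, t)\<bar> powr p) + ennreal (1 + r) * ennreal (\<bar>U (y, t)\<bar> powr q) + ennreal r * ennreal (\<bar>V (y, t)\<bar> powr p)"
      proof (cases "t \<in> {0..1}")
        case True
        have pd: "partial_deriv (0, 1) U (y, t) = V (y, t)"
          unfolding U_def V_def by (rule half_space_moll_partial_deriv[OF phi D p1 n e]) (use True in auto)
        define a where "a = \<bar>U (y, t)\<bar>"
        define v where "v = \<bar>V (y, t)\<bar>"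
        have av: "a \<ge> 0" "v \<ge> 0" by (auto simp: a_def v_def)
        \<comment> \<open>\<open>p \<le> r \<le> q\<close>, so one of the two powers dominates according to whether \<open>a \<le> 1\<close>.\<close>
        have 1: "a powr r \<le> a powr p + a powr q"
        proof (cases "a \<le> 1")
          case True
          show ?thesis
          proof (cases "a = 0")
            case False
            have "a powr r \<le> a powr p" using True av False rp by (intro powr_mono') auto
            then show ?thesis by (simp add: add_increasing2)
          qed simp
        next
          case False
          then have "a powr r \<le> a powr q" using rp by (intro powr_mono) auto
          then show ?thesis by (simp add: add_increasing)
        qed
        have "a powr (r - 1) * v \<le> (a powr (r - 1)) powr (p / (p - 1)) / (p / (p - 1)) + v powr p / p"
          using p av by (intro Youngs_inequality) (auto simp: field_simps)
        also have "(a powr (r - 1)) powr (p / (p - 1)) = a powr q"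
          using p r by (simp add: powr_powr)
        also have "a powr q / (p / (p - 1)) + v powr p / p \<le> a powr q + v powr p"
          using p mult_right_mono[of 1 p "v powr p"] by (intro add_mono) (auto simp: field_simps mult_left_le)
        finally have 2: "r * (a powr (r - 1) * v) \<le> r * (a powr q + v powr p)" using r1 by simp
        have "(a powr r + r * a powr (r - 1) * v) \<le> a powr p + (1 + r) * a powr q + r * v powr p"
          using 1 2 by (simp add: algebra_simps)
        then have "ennreal (a powr r + r * a powr (r - 1) * v) \<le> ennreal (a powr p + (1 + r) * a powr q + r * v powr p)"
          by (rule ennreal_leI)
        also have "\<dots> = ennreal (a powr p) + ennreal (1 + r) * ennreal (a powr q) + ennreal r * ennreal (v powr p)"
          using r1 by (subst (1 2) ennreal_plus) (auto simp: ennreal_mult)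
        finally show ?thesis using True by (simp add: pd a_def v_def)
      qed simp
    qed
    also have "\<dots> = (\<integral>\<^sup>+x. (ennreal (\<bar>U x\<bar> powr p) + ennreal (1 + r) * ennreal (\<bar>U x\<bar> powr q) + ennreal r * ennreal (\<bar>V x\<bar> powr p)) \<partial>lborel)"
      using Ub Vb by (subst nn_integral_lborel_pair) auto
    also have "\<dots> = pmass p U + ennreal (1 + r) * pmass q U + ennreal r * pmass p V"
      using Ub Vb by (simp add: nn_integral_add nn_integral_cmult Lp_mass_def)
    also have "\<dots> \<le> C"
      unfolding C_def U_def V_def
      by (intro add_mono mult_left_mono mollifier.moll_mass_le[OF phi]) (use R R(5)[OF n] p q in auto)
    finally show ?thesis by (simp add: U_def)
  qed
  have "pmass r (etr u' (D (0, 1))) \<le> C"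
  proof (rule Lp_mass_Fatou[OF _ _ lim bound])
    show "(\<lambda>y. moll \<phi> (e k) u' (y, 0)) \<in> borel_measurable lborel" for k
      using boundary_slice_borel[OF half_space_moll_rep(1)[OF phi D _ e]] p by simp
  qed (use etr_rep_finite(1)[OF D] p r1 in auto)
  with \<open>C < \<infinity>\<close> show ?thesis by simp
qed

section \<open>The Gagliardo energy\<close>

definition shift_mass :: "real \<Rightarrow> ('a::euclidean_space \<Rightarrow> real) \<Rightarrow> 'a \<Rightarrow> ennreal" where
  "shift_mass p g h = pmass p (\<lambda>x. g (x + h) - g x)"

text \<open>
  The Slobodeckij energy of order \<open>1 - 1 / p\<close> in layer-cake form: the kernel
  \<open>norm h powr - (m + p - 1)\<close>, with \<open>m = DIM('a)\<close>, is \<open>m + p - 1\<close> times the integral of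
  \<open>r powr - (m + p)\<close> over \<open>r > norm h\<close>. The integral over balls of radius \<open>r\<close> is what both
  directions of the trace theorem estimate, with \<open>r\<close> as height above the boundary.
\<close>

definition gag :: "real \<Rightarrow> ('a::euclidean_space \<Rightarrow> real) \<Rightarrow> ennreal" where
  "gag p g = (\<integral>\<^sup>+r. ennreal (r powr - (real DIM('a) + p)) * indicator {0<..} r *
     (\<integral>\<^sup>+h. indicator (ball 0 r) h * shift_mass p g h \<partial>lborel) \<partial>lborel)"

lemma nn_integral_powr_tail:
  fixes a \<beta> :: real
  assumes a: "a > 0" and b: "\<beta> > 1"
  shows "(\<integral>\<^sup>+r. ennreal (r powr - \<beta>) * indicator {a<..} r \<partial>lborel) = ennreal (a powr (1 - \<beta>) / (\<beta> - 1))"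
proof -
  have "(\<integral>\<^sup>+r. ennreal (r powr - \<beta>) * indicator {a<..} r \<partial>lborel) = (\<integral>\<^sup>+r. ennreal (r powr - \<beta>) * indicator {a..} r \<partial>lborel)"
    by (rule nn_integral_cong_AE) (use AE_lborel_singleton[of a] in \<open>auto simp: indicator_def elim!: eventually_mono\<close>)
  also have "\<dots> = ennreal (0 - (- (a powr (1 - \<beta>) / (\<beta> - 1))))"
  proof (rule nn_integral_FTC_atLeast[where F = "\<lambda>r. - (r powr (1 - \<beta>) / (\<beta> - 1))"])
    fix r assume "a \<le> r"
    then have r: "r > 0" using a by simp
    have "((\<lambda>r. r powr (1 - \<beta>)) has_real_derivative (1 - \<beta>) * r powr (1 - \<beta> - 1)) (at r)"
      using r by (rule has_real_derivative_powr)
    then have d: "((\<lambda>r. - (r powr (1 - \<beta>) / (\<beta> - 1))) has_real_derivative - ((1 - \<beta>) * r powr (1 - \<beta> - 1) / (\<beta> - 1))) (at r)"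
      by (intro DERIV_minus DERIV_cdivide)
    have "(1 - \<beta>) * x / (\<beta> - 1) = - x" for x using b by (simp add: divide_simps algebra_simps)
    then show "((\<lambda>r. - (r powr (1 - \<beta>) / (\<beta> - 1))) has_real_derivative r powr - \<beta>) (at r)"
      by (intro DERIV_cong[OF d]) simp
  next
    have "((\<lambda>r. r powr (1 - \<beta>)) \<longlongrightarrow> 0) at_top"
      by (rule tendsto_neg_powr) (use b in \<open>auto intro: filterlim_ident\<close>)
    then have "((\<lambda>r. - (r powr (1 - \<beta>) / (\<beta> - 1))) \<longlongrightarrow> - (0 / (\<beta> - 1))) at_top"
      by (intro tendsto_intros) (use b in auto)
    then show "((\<lambda>r. - (r powr (1 - \<beta>) / (\<beta> - 1))) \<longlongrightarrow> 0) at_top" by simp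
  qed auto
  finally show ?thesis by simp
qed

lemma shift_mass_borel:
  assumes [measurable]: "g \<in> borel_measurable borel"
  shows "shift_mass p g \<in> borel_measurable borel"
proof -
  have "(\<lambda>h. \<integral>\<^sup>+x. ennreal (\<bar>g (x + h) - g x\<bar> powr p) \<partial>lborel) \<in> borel_measurable lborel" by measurable
  then show ?thesis by (simp add: shift_mass_def[abs_def] Lp_mass_def)
qed

lemma indicator_ball_jointly_borel:
  "(\<lambda>(r::real, h::'a::euclidean_space). indicator (ball 0 r) h :: ennreal) \<in> borel_measurable (lborel \<Otimes>\<^sub>M lborel)"
proof -
  have "(\<lambda>(r::real, h::'a). indicator {z::real \<times> 'a. norm (snd z) < fst z} (r, h) :: ennreal) \<in> borel_measurable (lborel \<Otimes>\<^sub>M lborel)"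
    by measurable
  moreover have "(\<lambda>(r::real, h::'a). indicator {z::real \<times> 'a. norm (snd z) < fst z} (r, h) :: ennreal) = (\<lambda>(r, h). indicator (ball 0 r) h)"
    by (auto simp: indicator_def)
  ultimately show ?thesis by simp
qed

text \<open>
  With \<open>y = x + h\<close> the energy becomes an integral over shifts \<open>h\<close>; the layer-cake formula for the
  kernel and Tonelli then give \<open>gag\<close>.
\<close>

lemma gag_eq_Slobodeckij:
  fixes g :: "'a::euclidean_space \<Rightarrow> real"
  assumes [measurable]: "g \<in> borel_measurable borel" and p: "p > 1"
  shows "(\<integral>\<^sup>+z. ennreal (\<bar>g (fst z) - g (snd z)\<bar> powr p / norm (fst z - snd z) powr (real DIM('a) + (p - 1))) \<partial>lborel)
    = ennreal (real DIM('a) + (p - 1)) * gag p g"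
proof -
  define \<gamma> where "\<gamma> = real DIM('a) + (p - 1)"
  have g0: "\<gamma> > 0" using p by (simp add: \<gamma>_def add_pos_pos)
  have sm [measurable]: "shift_mass p g \<in> borel_measurable borel" by (rule shift_mass_borel[OF assms(1)])
  have "(\<integral>\<^sup>+z. ennreal (\<bar>g (fst z) - g (snd z)\<bar> powr p / norm (fst z - snd z) powr \<gamma>) \<partial>lborel)
    = (\<integral>\<^sup>+x. \<integral>\<^sup>+y. ennreal (\<bar>g x - g y\<bar> powr p / norm (x - y) powr \<gamma>) \<partial>lborel \<partial>lborel)"
  proof (subst nn_integral_lborel_pair)
    have "(\<lambda>z::'a \<times> 'a. ennreal (\<bar>g (fst z) - g (snd z)\<bar> powr p / norm (fst z - snd z) powr \<gamma>)) \<in> borel_measurable (borel \<Otimes>\<^sub>M borel)"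
      by measurable
    then show "(\<lambda>z::'a \<times> 'a. ennreal (\<bar>g (fst z) - g (snd z)\<bar> powr p / norm (fst z - snd z) powr \<gamma>)) \<in> borel_measurable borel"
      by (simp add: borel_prod)
  qed simp
  also have "\<dots> = (\<integral>\<^sup>+x. \<integral>\<^sup>+h. ennreal (\<bar>g (x + h) - g x\<bar> powr p / norm h powr \<gamma>) \<partial>lborel \<partial>lborel)"
  proof (rule nn_integral_cong)
    fix x
    have "(\<integral>\<^sup>+y. ennreal (\<bar>g x - g y\<bar> powr p / norm (x - y) powr \<gamma>) \<partial>lborel) = (\<integral>\<^sup>+h. ennreal (\<bar>g x - g (h + x)\<bar> powr p / norm (x - (h + x)) powr \<gamma>) \<partial>lborel)"
      by (rule nn_integral_translate[symmetric]) measurable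
    then show "(\<integral>\<^sup>+y. ennreal (\<bar>g x - g y\<bar> powr p / norm (x - y) powr \<gamma>) \<partial>lborel) = (\<integral>\<^sup>+h. ennreal (\<bar>g (x + h) - g x\<bar> powr p / norm h powr \<gamma>) \<partial>lborel)"
      by (simp add: add.commute abs_minus_commute)
  qed
  also have "\<dots> = (\<integral>\<^sup>+h. \<integral>\<^sup>+x. ennreal (\<bar>g (x + h) - g x\<bar> powr p / norm h powr \<gamma>) \<partial>lborel \<partial>lborel)"
    by (rule lborel_pair.Fubini'[symmetric]) measurable
  also have "\<dots> = (\<integral>\<^sup>+h. \<integral>\<^sup>+r. ennreal \<gamma> * (ennreal (r powr - (real DIM('a) + p)) * indicator {0<..} r * (indicator (ball 0 r) h * shift_mass p g h)) \<partial>lborel \<partial>lborel)"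
  proof (rule nn_integral_cong_AE)
    show "AE h in lborel. (\<integral>\<^sup>+x. ennreal (\<bar>g (x + h) - g x\<bar> powr p / norm h powr \<gamma>) \<partial>lborel) =
      (\<integral>\<^sup>+r. ennreal \<gamma> * (ennreal (r powr - (real DIM('a) + p)) * indicator {0<..} r * (indicator (ball 0 r) h * shift_mass p g h)) \<partial>lborel)"
      using AE_lborel_singleton[of "0::'a"]
    proof eventually_elim
      case (elim h)
      have "(\<integral>\<^sup>+r. ennreal \<gamma> * (ennreal (r powr - (real DIM('a) + p)) * indicator {0<..} r * (indicator (ball 0 r) h * shift_mass p g h)) \<partial>lborel)
         = (\<integral>\<^sup>+r. (ennreal \<gamma> * shift_mass p g h) * (ennreal (r powr - (\<gamma> + 1)) * indicator {norm h<..} r) \<partial>lborel)"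
        by (intro nn_integral_cong) (auto simp: indicator_def \<gamma>_def mult_ac add.commute algebra_simps split: if_splits dest: order_le_less_trans[OF norm_ge_zero])
      also have "\<dots> = (ennreal \<gamma> * shift_mass p g h) * ennreal (norm h powr (1 - (\<gamma> + 1)) / (\<gamma> + 1 - 1))"
      proof (subst nn_integral_cmult)
        show "ennreal \<gamma> * shift_mass p g h * (\<integral>\<^sup>+r. ennreal (r powr - (\<gamma> + 1)) * indicator {norm h<..} r \<partial>lborel) =
          ennreal \<gamma> * shift_mass p g h * ennreal (norm h powr (1 - (\<gamma> + 1)) / (\<gamma> + 1 - 1))"
          by (subst nn_integral_powr_tail) (use elim g0 in auto)
      qed measurable
      also have "\<dots> = shift_mass p g h * (ennreal \<gamma> * ennreal (norm h powr - \<gamma> / \<gamma>))"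
        by (simp add: mult_ac)
      also have "ennreal \<gamma> * ennreal (norm h powr - \<gamma> / \<gamma>) = ennreal (1 / norm h powr \<gamma>)"
        using g0 by (simp add: ennreal_mult[symmetric] powr_minus inverse_eq_divide)
      also have "shift_mass p g h * ennreal (1 / norm h powr \<gamma>) = (\<integral>\<^sup>+x. ennreal (\<bar>g (x + h) - g x\<bar> powr p / norm h powr \<gamma>) \<partial>lborel)"
        unfolding shift_mass_def Lp_mass_def by (subst nn_integral_multc[symmetric]) (auto simp: ennreal_mult[symmetric])
      finally show ?case by simp
    qed
  qed
  also have "\<dots> = (\<integral>\<^sup>+r. \<integral>\<^sup>+h. ennreal \<gamma> * (ennreal (r powr - (real DIM('a) + p)) * indicator {0<..} r * (indicator (ball 0 r) h * shift_mass p g h)) \<partial>lborel \<partial>lborel)"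
  proof (rule lborel_pair.Fubini')
    note [measurable] = indicator_ball_jointly_borel
    show "(\<lambda>(r, h). ennreal \<gamma> * (ennreal (r powr - (real DIM('a) + p)) * indicator {0<..} r * (indicator (ball 0 r) h * shift_mass p g h))) \<in> borel_measurable (lborel \<Otimes>\<^sub>M lborel)"
      by measurable
  qed
  also have "\<dots> = (\<integral>\<^sup>+r. ennreal \<gamma> * (ennreal (r powr - (real DIM('a) + p)) * indicator {0<..} r * (\<integral>\<^sup>+h. indicator (ball 0 r) h * shift_mass p g h \<partial>lborel)) \<partial>lborel)"
  proof (rule nn_integral_cong)
    fix r
    have "(\<lambda>h. indicator (ball 0 r) h * shift_mass p g h) \<in> borel_measurable lborel"
      using sm by (intro borel_measurable_times_ennreal borel_measurable_indicator) auto
    then show "(\<integral>\<^sup>+h. ennreal \<gamma> * (ennreal (r powr - (real DIM('a) + p)) * indicator {0<..} r * (indicator (ball 0 r) h * shift_mass p g h)) \<partial>lborel) =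
      ennreal \<gamma> * (ennreal (r powr - (real DIM('a) + p)) * indicator {0<..} r * (\<integral>\<^sup>+h. indicator (ball 0 r) h * shift_mass p g h \<partial>lborel))"
      by (simp add: nn_integral_cmult)
  qed
  also have "\<dots> = ennreal \<gamma> * gag p g"
    unfolding gag_def
  proof (rule nn_integral_cmult)
    note [measurable] = indicator_ball_jointly_borel
    show "(\<lambda>r. ennreal (r powr - (real DIM('a) + p)) * indicator {0<..} r * (\<integral>\<^sup>+h. indicator (ball 0 r) h * shift_mass p g h \<partial>lborel)) \<in> borel_measurable lborel"
      by measurable
  qed
  finally show ?thesis by (simp add: \<gamma>_def)
qed

section \<open>Hardy's inequality\<close>

lemma nn_integral_powr_head:
  fixes a c :: real
  assumes a: "a > -1" and c: "c > 0"
  shows "(\<integral>\<^sup>+t. ennreal (t powr a) * indicator {0<..<c} t \<partial>lborel) = ennreal (c powr (a + 1) / (a + 1))"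
proof -
  have "(\<integral>\<^sup>+t. ennreal (t powr a) * indicator {0<..<c} t \<partial>lborel) = (\<integral>\<^sup>+t. ennreal (t powr a) * indicator {0..c} t \<partial>lborel)"
  proof (rule nn_integral_cong_AE)
    show "AE t in lborel. ennreal (t powr a) * indicator {0<..<c} t = ennreal (t powr a) * indicator {0..c} t"
      using AE_lborel_singleton[of 0] AE_lborel_singleton[of c] by eventually_elim (auto simp: indicator_def)
  qed
  also have "\<dots> = ennreal (c powr (a + 1) / (a + 1))"
    by (rule nn_integral_has_integral_lebesgue') (use has_integral_powr_from_0[of a c] a c in auto)
  finally show ?thesis .
qed

lemma nn_integral_inv_sqrt:
  assumes r: "r > (0::real)"
  shows "(\<integral>\<^sup>+t. ennreal (t powr (-1/2) * r powr (-1/2) / 2 * indicator {0<..<r} t) \<partial>lborel) = 1"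
proof -
  have "(\<integral>\<^sup>+t. ennreal (t powr (-1/2) * r powr (-1/2) / 2 * indicator {0<..<r} t) \<partial>lborel) =
      (\<integral>\<^sup>+t. ennreal (r powr (-1/2) / 2) * (ennreal (t powr (-1/2)) * indicator {0<..<r} t) \<partial>lborel)"
    by (intro nn_integral_cong) (auto simp: indicator_def ennreal_mult[symmetric] mult_ac)
  also have "\<dots> = ennreal (r powr (-1/2) / 2) * ennreal (r powr (-1/2 + 1) / (-1/2 + 1))"
    by (subst nn_integral_cmult, measurable) (subst nn_integral_powr_head, use r in auto)
  also have "\<dots> = ennreal (r powr (-1/2) * r powr (1/2))"
    by (simp add: ennreal_mult[symmetric])
  also have "r powr (-1/2) * r powr (1/2) = 1" using r by (simp add: powr_add[symmetric])
  finally show ?thesis by simp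
qed

text \<open>
  Jensen's inequality on \<open>{0<..<r}\<close> for the probability density proportional to \<open>t powr (-1/2)\<close>,
  followed by Tonelli. The uniform density would give \<open>r powr - p\<close> against \<open>r powr (p - 1)\<close>, hence
  a divergent integral of \<open>1 / r\<close>; the singular density leaves \<open>r powr - (\<alpha> + 1)\<close> with
  \<open>\<alpha> = (p - 1) / 2 > 0\<close>.
\<close>

lemma hardy:
  fixes a c :: "real \<Rightarrow> real"
  assumes [measurable]: "a \<in> borel_measurable borel" "c \<in> borel_measurable borel" and p: "p > 1"
    and c: "\<And>r. r > 0 \<Longrightarrow> ennreal \<bar>c r\<bar> \<le> (\<integral>\<^sup>+t. ennreal (\<bar>a t\<bar> * indicator {0<..<r} t) \<partial>lborel)"
  shows "(\<integral>\<^sup>+r. ennreal (r powr - p * \<bar>c r\<bar> powr p) * indicator {0<..} r \<partial>lborel) \<le>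
     ennreal (2 powr p / (p - 1)) * (\<integral>\<^sup>+t. ennreal (\<bar>a t\<bar> powr p) * indicator {0<..} t \<partial>lborel)"
proof -
  define \<alpha> where "\<alpha> = (p - 1) / 2"
  have al: "\<alpha> > 0" using p by (simp add: \<alpha>_def)
  define W where "W = (\<lambda>r t. ennreal (2 powr (p - 1)) * (ennreal (\<bar>a t\<bar> powr p * t powr \<alpha>) * indicator {0<..} t) * (ennreal (r powr - (\<alpha> + 1)) * indicator {t<..} r))"
  have pt: "ennreal (r powr - p * \<bar>c r\<bar> powr p) * indicator {0<..} r \<le> (\<integral>\<^sup>+t. W r t \<partial>lborel)" for r
  proof (cases "r > 0")
    case True
    define \<kappa> where "\<kappa> = (\<lambda>t. t powr (-1/2) * r powr (-1/2) / 2 * indicator {0<..<r} t)"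
    \<comment> \<open>On \<open>{0<..<r}\<close> this is \<open>a\<close> divided by the density \<open>\<kappa>\<close>.\<close>
    define f where "f = (\<lambda>t. a t * (2 * t powr (1/2) * r powr (1/2)))"
    have fk: "\<bar>f t\<bar> * \<kappa> t = \<bar>a t\<bar> * indicator {0<..<r} t" for t
      using True by (auto simp: f_def \<kappa>_def indicator_def abs_mult powr_minus field_simps)
    have fkp: "\<bar>f t\<bar> powr p * \<kappa> t = 2 powr (p - 1) * (\<bar>a t\<bar> powr p * t powr \<alpha>) * r powr \<alpha> * indicator {0<..<r} t" for t
    proof (cases "t \<in> {0<..<r}")
      case t: True
      have "\<bar>f t\<bar> powr p * \<kappa> t = \<bar>a t\<bar> powr p * (2 powr p * (t powr (p/2) * r powr (p/2))) * (t powr (-1/2) * r powr (-1/2) / 2)"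
        using t True by (simp add: f_def \<kappa>_def abs_mult powr_mult powr_powr)
      also have "\<dots> = (2 powr p / 2) * (\<bar>a t\<bar> powr p * (t powr (p/2) * t powr (-1/2))) * (r powr (p/2) * r powr (-1/2))" by simp
      also have "t powr (p/2) * t powr (-1/2) = t powr \<alpha>" by (simp add: powr_add[symmetric] \<alpha>_def diff_divide_distrib)
      also have "r powr (p/2) * r powr (-1/2) = r powr \<alpha>" by (simp add: powr_add[symmetric] \<alpha>_def diff_divide_distrib)
      finally show ?thesis using t by (simp add: powr_diff)
    qed (simp add: \<kappa>_def)
    have [measurable]: "f \<in> borel_measurable lborel" "\<kappa> \<in> borel_measurable lborel" unfolding f_def \<kappa>_def by measurable
    have "ennreal (\<bar>c r\<bar> powr p) \<le> (\<integral>\<^sup>+t. ennreal (\<bar>f t\<bar> powr p * \<kappa> t) \<partial>lborel)"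
    proof (rule jensen_powr_nn)
      show "(\<integral>\<^sup>+t. ennreal (\<kappa> t) \<partial>lborel) \<le> 1" unfolding \<kappa>_def using nn_integral_inv_sqrt[OF True] by simp
      show "ennreal \<bar>c r\<bar> \<le> (\<integral>\<^sup>+t. ennreal (\<bar>f t\<bar> * \<kappa> t) \<partial>lborel)" unfolding fk by (rule c[OF True])
    qed (use p True in \<open>auto simp: \<kappa>_def\<close>)
    then have "ennreal (r powr - p) * ennreal (\<bar>c r\<bar> powr p) \<le> ennreal (r powr - p) * (\<integral>\<^sup>+t. ennreal (\<bar>f t\<bar> powr p * \<kappa> t) \<partial>lborel)"
      by (intro mult_left_mono) auto
    also have "\<dots> = (\<integral>\<^sup>+t. ennreal (r powr - p * (\<bar>f t\<bar> powr p * \<kappa> t)) \<partial>lborel)"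
    proof (subst nn_integral_cmult[symmetric])
      have "\<kappa> t \<ge> 0" for t by (simp add: \<kappa>_def)
      then show "(\<integral>\<^sup>+t. ennreal (r powr - p) * ennreal (\<bar>f t\<bar> powr p * \<kappa> t) \<partial>lborel) = (\<integral>\<^sup>+t. ennreal (r powr - p * (\<bar>f t\<bar> powr p * \<kappa> t)) \<partial>lborel)"
        by (intro nn_integral_cong) (simp add: ennreal_mult[symmetric])
    qed measurable
    also have "\<dots> = (\<integral>\<^sup>+t. W r t \<partial>lborel)"
    proof (rule nn_integral_cong)
      fix t
      have rr: "r powr - p * r powr \<alpha> = r powr - (\<alpha> + 1)"
      proof -
        have "- p + \<alpha> = - (\<alpha> + 1)" by (simp add: \<alpha>_def field_simps)
        then show ?thesis by (simp only: powr_add[symmetric])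
      qed
      show "ennreal (r powr - p * (\<bar>f t\<bar> powr p * \<kappa> t)) = W r t"
      proof (cases "t \<in> {0<..<r}")
        case t: True
        have "r powr - p * (\<bar>f t\<bar> powr p * \<kappa> t) = 2 powr (p - 1) * (\<bar>a t\<bar> powr p * t powr \<alpha>) * (r powr - p * r powr \<alpha>)"
          unfolding fkp using t by simp
        then show ?thesis unfolding rr W_def using t by (simp add: ennreal_mult)
      qed (auto simp: W_def fkp indicator_def)
    qed
    finally show ?thesis using True by (simp add: ennreal_mult)
  qed simp
  have "(\<integral>\<^sup>+r. ennreal (r powr - p * \<bar>c r\<bar> powr p) * indicator {0<..} r \<partial>lborel) \<le> (\<integral>\<^sup>+r. \<integral>\<^sup>+t. W r t \<partial>lborel \<partial>lborel)"
    by (rule nn_integral_mono[OF pt])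
  also have "\<dots> = (\<integral>\<^sup>+t. \<integral>\<^sup>+r. W r t \<partial>lborel \<partial>lborel)"
  proof (rule lborel_pair.Fubini')
    have "(\<lambda>(t::real, r::real). indicator {z::real \<times> real. fst z < snd z} (t, r) :: ennreal) \<in> borel_measurable (lborel \<Otimes>\<^sub>M lborel)"
      by measurable
    moreover have "(\<lambda>(t::real, r::real). indicator {z::real \<times> real. fst z < snd z} (t, r) :: ennreal) = (\<lambda>(t, r). indicator {t<..} r)"
      by (auto simp: indicator_def)
    ultimately have [measurable]: "(\<lambda>(t::real, r::real). indicator {t<..} r :: ennreal) \<in> borel_measurable (lborel \<Otimes>\<^sub>M lborel)" by simp
    show "(\<lambda>(t, r). W r t) \<in> borel_measurable (lborel \<Otimes>\<^sub>M lborel)" unfolding W_def by measurable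
  qed
  also have "\<dots> = (\<integral>\<^sup>+t. ennreal (2 powr p / (p - 1)) * (ennreal (\<bar>a t\<bar> powr p) * indicator {0<..} t) \<partial>lborel)"
  proof (rule nn_integral_cong)
    fix t
    show "(\<integral>\<^sup>+r. W r t \<partial>lborel) = ennreal (2 powr p / (p - 1)) * (ennreal (\<bar>a t\<bar> powr p) * indicator {0<..} t)"
    proof (cases "t > 0")
      case True
      have "(\<integral>\<^sup>+r. W r t \<partial>lborel) = (ennreal (2 powr (p - 1)) * ennreal (\<bar>a t\<bar> powr p * t powr \<alpha>)) * ennreal (t powr (1 - (\<alpha> + 1)) / (\<alpha> + 1 - 1))"
        unfolding W_def using True al by (subst nn_integral_cmult) (auto simp: nn_integral_powr_tail[of t "\<alpha> + 1", simplified])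
      also have "\<dots> = ennreal (2 powr (p - 1) * (\<bar>a t\<bar> powr p * t powr \<alpha>) * (t powr - \<alpha> / \<alpha>))"
        using al by (simp add: ennreal_mult[symmetric])
      also have "2 powr (p - 1) * (\<bar>a t\<bar> powr p * t powr \<alpha>) * (t powr - \<alpha> / \<alpha>) = 2 powr (p - 1) / \<alpha> * \<bar>a t\<bar> powr p"
        using True by (simp add: powr_minus field_simps)
      also have "2 powr (p - 1) / \<alpha> = 2 powr p / (p - 1)" using p by (simp add: \<alpha>_def powr_diff field_simps)
      finally show ?thesis using True p by (simp add: ennreal_mult[symmetric])
    qed (simp add: W_def)
  qed
  also have "\<dots> = ennreal (2 powr p / (p - 1)) * (\<integral>\<^sup>+t. ennreal (\<bar>a t\<bar> powr p) * indicator {0<..} t \<partial>lborel)"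
    by (rule nn_integral_cmult) measurable
  finally show ?thesis .
qed

section \<open>Traces have finite Gagliardo energy\<close>

lemma sum_powr_le:
  fixes a :: "'i \<Rightarrow> real"
  assumes "finite A" "\<And>i. i \<in> A \<Longrightarrow> a i \<ge> 0" "p > 0"
  shows "(\<Sum>i\<in>A. a i) powr p \<le> real (card A) powr p * (\<Sum>i\<in>A. a i powr p)"
proof -
  define S where "S = (\<Sum>i\<in>A. a i powr p)"
  have S: "S \<ge> 0" unfolding S_def by (intro sum_nonneg) auto
  have "a i \<le> S powr (1 / p)" if "i \<in> A" for i
  proof -
    have "a i powr p \<le> S" unfolding S_def using assms that by (intro member_le_sum) auto
    then have "(a i powr p) powr (1 / p) \<le> S powr (1 / p)" using assms by (intro powr_mono2) auto
    then show ?thesis using assms(2)[OF that] assms(3) by (simp add: powr_powr)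
  qed
  then have "(\<Sum>i\<in>A. a i) \<le> real (card A) * S powr (1 / p)" by (rule sum_bounded_above)
  then have "(\<Sum>i\<in>A. a i) powr p \<le> (real (card A) * S powr (1 / p)) powr p"
    using assms by (intro powr_mono2 sum_nonneg) auto
  also have "\<dots> = real (card A) powr p * S" using S assms by (simp add: powr_mult powr_powr)
  finally show ?thesis by (simp add: S_def)
qed

lemma smooth_horizontal_DERIV:
  fixes U :: "'a::euclidean_space \<times> real \<Rightarrow> real"
  assumes "U \<in> C_infinity"
  shows "((\<lambda>s. U (y + s *\<^sub>R h, r)) has_real_derivative (\<Sum>b\<in>Basis. (h \<bullet> b) * partial_deriv (b, 0) U (y + t *\<^sub>R h, r))) (at t)"
proof -
  let ?F = "frechet_derivative U (at (y + t *\<^sub>R h, r))"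
  have "(U has_derivative ?F) (at (y + t *\<^sub>R h, r))"
    using C_infinityD(1)[OF assms] frechet_derivative_works by blast
  moreover have "((\<lambda>s. (y + s *\<^sub>R h, r)) has_derivative (\<lambda>s. (s *\<^sub>R h, 0))) (at t)"
    by (auto intro!: derivative_eq_intros)
  ultimately have d: "((\<lambda>s. U (y + s *\<^sub>R h, r)) has_derivative (\<lambda>s. ?F (s *\<^sub>R h, 0))) (at t)"
    by (rule has_derivative_compose[rotated])
  have lin: "linear ?F" using C_infinityD(1)[OF assms] by (rule linear_frechet_derivative)
  have "?F (s *\<^sub>R h, 0) = s * (\<Sum>b\<in>Basis. (h \<bullet> b) * partial_deriv (b, 0) U (y + t *\<^sub>R h, r))" for s
  proof -
    have "(s *\<^sub>R h, 0::real) = s *\<^sub>R (\<Sum>b\<in>Basis. (h \<bullet> b) *\<^sub>R (b, 0))"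
      by (simp add: prod_eq_iff fst_sum snd_sum euclidean_representation)
    then show ?thesis by (simp only: linear_cmul[OF lin] linear_sum[OF lin] partial_deriv_def real_scaleR_def)
  qed
  with d show ?thesis by (simp add: has_field_derivative_def mult_commute_abs)
qed

lemma smooth_horizontal_isCont:
  fixes U :: "'a::euclidean_space \<times> real \<Rightarrow> real"
  assumes "U \<in> C_infinity"
  shows "isCont (\<lambda>s. U (y + s *\<^sub>R h, r)) t"
  using smooth_horizontal_DERIV[OF assms] by (rule DERIV_isCont)

text \<open>
  The fundamental theorem of calculus along the segment from \<open>y\<close> to \<open>y + h\<close>, with Jensen's
  inequality in the parameter of the segment.
\<close>

lemma smooth_horizontal_shift:
  fixes U :: "'a::euclidean_space \<times> real \<Rightarrow> real"
  assumes U: "U \<in> C_infinity" and p: "p \<ge> 1"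
  shows "pmass p (\<lambda>y. U (y + h, r) - U (y, r)) \<le>
    ennreal (norm h powr p * real DIM('a) powr p) * (\<Sum>b\<in>Basis. pmass p (\<lambda>y. partial_deriv (b, 0) U (y, r)))"
proof -
  let ?V = "\<lambda>b y. partial_deriv (b, 0) U (y, r)"
  define C where "C = norm h powr p * real DIM('a) powr p"
  have VC: "partial_deriv (b, 0) U \<in> C_infinity" if "b \<in> Basis" for b using C_infinityD(2)[OF U horizontal_Basis[OF that]] .
  have Vm: "?V b \<in> borel_measurable borel" if "b \<in> Basis" for b by (rule boundary_slice_borel[OF VC[OF that]])
  have pt: "ennreal (\<bar>U (y + h, r) - U (y, r)\<bar> powr p) \<le> (\<integral>\<^sup>+s. (\<Sum>b\<in>Basis. ennreal C * (ennreal (\<bar>?V b (y + s *\<^sub>R h)\<bar> powr p) * indicator {0..1} s)) \<partial>lborel)" for y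
  proof -
    define w where "w = (\<lambda>s. \<Sum>b\<in>Basis. (h \<bullet> b) * ?V b (y + s *\<^sub>R h))"
    have wc: "isCont w s" for s
      unfolding w_def by (intro continuous_intros smooth_horizontal_isCont VC)
    have hb: "has_bochner_integral lborel (\<lambda>s. w s * indicator {0..1} s) (U (y + 1 *\<^sub>R h, r) - U (y + 0 *\<^sub>R h, r))"
      by (rule has_bochner_integral_FTC_Icc_real) (use smooth_horizontal_DERIV[OF U] wc in \<open>auto simp: w_def\<close>)
    have wm: "w \<in> borel_measurable lborel"
      using wc by (simp add: borel_measurable_continuous_onI continuous_at_imp_continuous_on)
    have "ennreal (\<bar>U (y + h, r) - U (y, r)\<bar> powr p) = ennreal (\<bar>LINT s|lborel. w s * indicator {0..1} s\<bar> powr p)"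
      using has_bochner_integral_integral_eq[OF hb] by simp
    also have "\<dots> \<le> (\<integral>\<^sup>+s. ennreal (\<bar>w s\<bar> powr p * indicator {0..1} s) \<partial>lborel)"
      by (rule jensen_powr) (use wm p in \<open>auto simp: ennreal_indicator\<close>)
    also have "\<dots> \<le> (\<integral>\<^sup>+s. (\<Sum>b\<in>Basis. ennreal C * (ennreal (\<bar>?V b (y + s *\<^sub>R h)\<bar> powr p) * indicator {0..1} s)) \<partial>lborel)"
    proof (rule nn_integral_mono)
      fix s
      have "\<bar>w s\<bar> \<le> (\<Sum>b\<in>Basis. \<bar>(h \<bullet> b) * ?V b (y + s *\<^sub>R h)\<bar>)" unfolding w_def by (rule sum_abs)
      also have "\<dots> \<le> (\<Sum>b\<in>Basis. norm h * \<bar>?V b (y + s *\<^sub>R h)\<bar>)"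
        by (intro sum_mono) (auto simp: abs_mult Basis_le_norm intro!: mult_right_mono)
      finally have "\<bar>w s\<bar> powr p \<le> (\<Sum>b\<in>Basis. norm h * \<bar>?V b (y + s *\<^sub>R h)\<bar>) powr p"
        using p by (intro powr_mono2) auto
      also have "\<dots> \<le> real (card (Basis :: 'a set)) powr p * (\<Sum>b\<in>Basis. (norm h * \<bar>?V b (y + s *\<^sub>R h)\<bar>) powr p)"
        by (rule sum_powr_le) (use p in auto)
      also have "\<dots> = C * (\<Sum>b\<in>Basis. \<bar>?V b (y + s *\<^sub>R h)\<bar> powr p)"
        by (simp add: C_def powr_mult sum_distrib_left mult_ac)
      finally have "ennreal (\<bar>w s\<bar> powr p) \<le> ennreal (C * (\<Sum>b\<in>Basis. \<bar>?V b (y + s *\<^sub>R h)\<bar> powr p))" by (rule ennreal_leI)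
      also have "\<dots> = (\<Sum>b\<in>Basis. ennreal C * ennreal (\<bar>?V b (y + s *\<^sub>R h)\<bar> powr p))"
        by (simp add: C_def ennreal_mult sum_nonneg sum_distrib_left[symmetric] sum_ennreal)
      finally show "ennreal (\<bar>w s\<bar> powr p * indicator {0..1} s) \<le> (\<Sum>b\<in>Basis. ennreal C * (ennreal (\<bar>?V b (y + s *\<^sub>R h)\<bar> powr p) * indicator {0..1} s))"
        by (cases "s \<in> {0..1}") auto
    qed
    finally show ?thesis .
  qed
  have m2: "(\<lambda>(y, s). ?V b (y + s *\<^sub>R h)) \<in> borel_measurable (lborel \<Otimes>\<^sub>M lborel)" if "b \<in> Basis" for b
  proof -
    have [measurable]: "?V b \<in> borel_measurable borel" by (rule Vm[OF that])
    show ?thesis by measurable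
  qed
  have "pmass p (\<lambda>y. U (y + h, r) - U (y, r)) \<le> (\<integral>\<^sup>+y. \<integral>\<^sup>+s. (\<Sum>b\<in>Basis. ennreal C * (ennreal (\<bar>?V b (y + s *\<^sub>R h)\<bar> powr p) * indicator {0..1} s)) \<partial>lborel \<partial>lborel)"
    unfolding Lp_mass_def by (intro nn_integral_mono pt)
  also have "\<dots> = (\<integral>\<^sup>+s. \<integral>\<^sup>+y. (\<Sum>b\<in>Basis. ennreal C * (ennreal (\<bar>?V b (y + s *\<^sub>R h)\<bar> powr p) * indicator {0..1} s)) \<partial>lborel \<partial>lborel)"
  proof (rule lborel_pair.Fubini'[symmetric])
    show "(\<lambda>(y, s). \<Sum>b\<in>Basis. ennreal C * (ennreal (\<bar>?V b (y + s *\<^sub>R h)\<bar> powr p) * indicator {0..1} s)) \<in> borel_measurable (lborel \<Otimes>\<^sub>M lborel)"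
      unfolding case_prod_beta'
    proof (intro borel_measurable_sum)
      fix b :: 'a assume "b \<in> Basis"
      then have [measurable]: "(\<lambda>z. ?V b (fst z + snd z *\<^sub>R h)) \<in> borel_measurable (lborel \<Otimes>\<^sub>M lborel)" using m2 by (simp add: case_prod_beta')
      show "(\<lambda>z. ennreal C * (ennreal (\<bar>?V b (fst z + snd z *\<^sub>R h)\<bar> powr p) * indicator {0..1} (snd z))) \<in> borel_measurable (lborel \<Otimes>\<^sub>M lborel)"
        by measurable
    qed
  qed
  also have "\<dots> = (\<integral>\<^sup>+s. (ennreal C * (\<Sum>b\<in>Basis. pmass p (?V b))) * indicator {0..1::real} s \<partial>lborel)"
  proof (rule nn_integral_cong)
    fix s :: real
    have "(\<integral>\<^sup>+y. (\<Sum>b\<in>Basis. ennreal C * (ennreal (\<bar>?V b (y + s *\<^sub>R h)\<bar> powr p) * indicator {0..1} s)) \<partial>lborel)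
      = (\<Sum>b\<in>Basis. \<integral>\<^sup>+y. ennreal C * (ennreal (\<bar>?V b (y + s *\<^sub>R h)\<bar> powr p) * indicator {0..1} s) \<partial>lborel)"
    proof (rule nn_integral_sum)
      fix b :: 'a assume "b \<in> Basis"
      then have [measurable]: "?V b \<in> borel_measurable borel" by (rule Vm)
      show "(\<lambda>y. ennreal C * (ennreal (\<bar>?V b (y + s *\<^sub>R h)\<bar> powr p) * indicator {0..1} s)) \<in> borel_measurable lborel" by measurable
    qed
    also have "\<dots> = (\<Sum>b\<in>Basis. ennreal C * pmass p (?V b) * indicator {0..1} s)"
    proof (rule sum.cong[OF refl])
      fix b :: 'a assume "b \<in> Basis"
      then have m [measurable]: "?V b \<in> borel_measurable borel" by (rule Vm)
      have "(\<integral>\<^sup>+y. ennreal C * (ennreal (\<bar>?V b (y + s *\<^sub>R h)\<bar> powr p) * indicator {0..1} s) \<partial>lborel) =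
        ennreal C * (pmass p (\<lambda>y. ?V b (y + s *\<^sub>R h)) * indicator {0..1} s)"
        unfolding Lp_mass_def by (subst nn_integral_cmult, measurable, subst nn_integral_multc, measurable)
      then show "(\<integral>\<^sup>+y. ennreal C * (ennreal (\<bar>?V b (y + s *\<^sub>R h)\<bar> powr p) * indicator {0..1} s) \<partial>lborel) = ennreal C * pmass p (?V b) * indicator {0..1} s"
        unfolding Lp_mass_translate[OF m] by (simp add: mult.assoc)
    qed
    also have "\<dots> = (ennreal C * (\<Sum>b\<in>Basis. pmass p (?V b))) * indicator {0..1} s"
      by (simp add: sum_distrib_left sum_distrib_right)
    finally show "(\<integral>\<^sup>+y. (\<Sum>b\<in>Basis. ennreal C * (ennreal (\<bar>?V b (y + s *\<^sub>R h)\<bar> powr p) * indicator {0..1} s)) \<partial>lborel) = (ennreal C * (\<Sum>b\<in>Basis. pmass p (?V b))) * indicator {0..1} s" .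
  qed
  also have "\<dots> = ennreal C * (\<Sum>b\<in>Basis. pmass p (?V b))"
    by (subst nn_integral_cmult) auto
  finally show ?thesis by (simp add: C_def)
qed

text \<open>Hardy's inequality on every vertical line.\<close>

lemma smooth_vertical_hardy:
  fixes U :: "'a::euclidean_space \<times> real \<Rightarrow> real"
  assumes U: "U \<in> C_infinity" and p: "p > 1"
  shows "(\<integral>\<^sup>+r. ennreal (r powr - p) * indicator {0<..} r * pmass p (\<lambda>y. U (y, r) - U (y, 0)) \<partial>lborel) \<le>
    ennreal (2 powr p / (p - 1)) * (\<integral>\<^sup>+t. indicator {0<..} t * pmass p (\<lambda>y. partial_deriv (0, 1) U (y, t)) \<partial>lborel)"
proof -
  let ?V = "partial_deriv (0, 1) U"
  have VC: "?V \<in> C_infinity" by (rule C_infinityD(2)[OF U vertical_Basis])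
  have "U \<in> borel_measurable borel" "?V \<in> borel_measurable borel"
    using C_infinityD(3)[OF U] C_infinityD(3)[OF VC] by (auto intro: borel_measurable_continuous_onI)
  then have [measurable]: "U \<in> borel_measurable (borel \<Otimes>\<^sub>M borel)" "?V \<in> borel_measurable (borel \<Otimes>\<^sub>M borel)" by (simp_all add: borel_prod)
  have "(\<integral>\<^sup>+r. ennreal (r powr - p) * indicator {0<..} r * pmass p (\<lambda>y. U (y, r) - U (y, 0)) \<partial>lborel)
    = (\<integral>\<^sup>+r. \<integral>\<^sup>+y. ennreal (r powr - p * \<bar>U (y, r) - U (y, 0)\<bar> powr p) * indicator {0<..} r \<partial>lborel \<partial>lborel)"
  proof (rule nn_integral_cong)
    fix r :: real
    show "ennreal (r powr - p) * indicator {0<..} r * pmass p (\<lambda>y. U (y, r) - U (y, 0)) = (\<integral>\<^sup>+y. ennreal (r powr - p * \<bar>U (y, r) - U (y, 0)\<bar> powr p) * indicator {0<..} r \<partial>lborel)"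
      unfolding Lp_mass_def by (subst nn_integral_cmult[symmetric]) (auto simp: ennreal_mult mult_ac)
  qed
  also have "\<dots> = (\<integral>\<^sup>+y. \<integral>\<^sup>+r. ennreal (r powr - p * \<bar>U (y, r) - U (y, 0)\<bar> powr p) * indicator {0<..} r \<partial>lborel \<partial>lborel)"
    by (rule lborel_pair.Fubini') measurable
  also have "\<dots> \<le> (\<integral>\<^sup>+y. ennreal (2 powr p / (p - 1)) * (\<integral>\<^sup>+t. ennreal (\<bar>?V (y, t)\<bar> powr p) * indicator {0<..} t \<partial>lborel) \<partial>lborel)"
  proof (rule nn_integral_mono)
    fix y
    show "(\<integral>\<^sup>+r. ennreal (r powr - p * \<bar>U (y, r) - U (y, 0)\<bar> powr p) * indicator {0<..} r \<partial>lborel) \<le> ennreal (2 powr p / (p - 1)) * (\<integral>\<^sup>+t. ennreal (\<bar>?V (y, t)\<bar> powr p) * indicator {0<..} t \<partial>lborel)"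
    proof (rule hardy[OF _ _ p])
      fix r :: real assume r: "r > 0"
      have hb: "has_bochner_integral lborel (\<lambda>s. ?V (y, s) * indicator {0..r} s) (U (y, r) - U (y, 0))"
        by (rule has_bochner_integral_FTC_Icc_real) (use smooth_vertical_DERIV[OF U] smooth_vertical_isCont[OF VC] r in auto)
      have "ennreal \<bar>U (y, r) - U (y, 0)\<bar> = ennreal (norm (LINT s|lborel. ?V (y, s) * indicator {0..r} s))"
        using has_bochner_integral_integral_eq[OF hb] by simp
      also have "\<dots> \<le> (\<integral>\<^sup>+s. ennreal (norm (?V (y, s) * indicator {0..r} s)) \<partial>lborel)"
        by (rule integral_norm_bound_ennreal[OF integrable.intros[OF hb]])
      also have "\<dots> = (\<integral>\<^sup>+s. ennreal (\<bar>?V (y, s)\<bar> * indicator {0<..<r} s) \<partial>lborel)"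
      proof (rule nn_integral_cong_AE)
        show "AE s in lborel. ennreal (norm (?V (y, s) * indicator {0..r} s)) = ennreal (\<bar>?V (y, s)\<bar> * indicator {0<..<r} s)"
          using AE_lborel_singleton[of 0] AE_lborel_singleton[of r]
          by eventually_elim (auto simp: indicator_def)
      qed
      finally show "ennreal \<bar>U (y, r) - U (y, 0)\<bar> \<le> (\<integral>\<^sup>+s. ennreal (\<bar>?V (y, s)\<bar> * indicator {0<..<r} s) \<partial>lborel)" .
    qed measurable
  qed
  also have "\<dots> = ennreal (2 powr p / (p - 1)) * (\<integral>\<^sup>+y. \<integral>\<^sup>+t. ennreal (\<bar>?V (y, t)\<bar> powr p) * indicator {0<..} t \<partial>lborel \<partial>lborel)"
    by (rule nn_integral_cmult) measurable
  also have "(\<integral>\<^sup>+y. \<integral>\<^sup>+t. ennreal (\<bar>?V (y, t)\<bar> powr p) * indicator {0<..} t \<partial>lborel \<partial>lborel) = (\<integral>\<^sup>+t. \<integral>\<^sup>+y. ennreal (\<bar>?V (y, t)\<bar> powr p) * indicator {0<..} t \<partial>lborel \<partial>lborel)"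
    by (rule lborel_pair.Fubini'[symmetric]) measurable
  also have "\<dots> = (\<integral>\<^sup>+t. indicator {0<..} t * pmass p (\<lambda>y. ?V (y, t)) \<partial>lborel)"
    unfolding Lp_mass_def by (intro nn_integral_cong, subst nn_integral_multc) (auto simp: mult.commute)
  finally show ?thesis .
qed

lemma half_space_mass_slices:
  fixes V :: "'a::euclidean_space \<times> real \<Rightarrow> real"
  assumes m: "(\<lambda>x. indicator half_space x * V x) \<in> borel_measurable borel"
  shows "pmass p (\<lambda>x. indicator half_space x * V x) = (\<integral>\<^sup>+t. indicator {0<..} t * pmass p (\<lambda>y. V (y, t)) \<partial>lborel)"
proof -
  let ?W = "\<lambda>x. indicator half_space x * V x"
  have [measurable]: "?W \<in> borel_measurable (borel \<Otimes>\<^sub>M borel)" using m by (simp add: borel_prod)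
  have "pmass p ?W = (\<integral>\<^sup>+y. \<integral>\<^sup>+t. ennreal (\<bar>?W (y, t)\<bar> powr p) \<partial>lborel \<partial>lborel)"
    unfolding Lp_mass_def using m by (subst nn_integral_lborel_pair) auto
  also have "\<dots> = (\<integral>\<^sup>+t. \<integral>\<^sup>+y. ennreal (\<bar>?W (y, t)\<bar> powr p) \<partial>lborel \<partial>lborel)"
    by (rule lborel_pair.Fubini'[symmetric]) measurable
  also have "\<dots> = (\<integral>\<^sup>+t. indicator {0<..} t * pmass p (\<lambda>y. V (y, t)) \<partial>lborel)"
  proof (rule nn_integral_cong)
    fix t :: real
    show "(\<integral>\<^sup>+y. ennreal (\<bar>?W (y, t)\<bar> powr p) \<partial>lborel) = indicator {0<..} t * pmass p (\<lambda>y. V (y, t))"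
      by (cases "t > 0") (auto simp: Lp_mass_def half_space_iff)
  qed
  finally show ?thesis .
qed

text \<open>
  From \<open>(y, 0)\<close> up to \<open>(y, r)\<close>, across to \<open>(y + h, r)\<close> and down to \<open>(y + h, 0)\<close>, where
  \<open>norm h < r\<close>. Integrated over the ball of radius \<open>r\<close> and against \<open>r powr - (m + p)\<close>, the
  vertical pieces leave the weight \<open>r powr - p\<close> of Hardy's inequality, and the horizontal one
  leaves the weight \<open>1\<close>.
\<close>

lemma gagliardo_smooth:
  fixes U :: "'a::euclidean_space \<times> real \<Rightarrow> real"
  assumes U: "U \<in> C_infinity" and p: "p > 1"
  shows "gag p (\<lambda>y. U (y, 0)) \<le> ennreal (unit_ball_vol (real DIM('a)) * (2 powr p * 2 powr p)) *
     (ennreal (2 * (2 powr p / (p - 1))) * pmass p (\<lambda>x. indicator half_space x * partial_deriv (0, 1) U x)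
      + ennreal (real DIM('a) powr p) * (\<Sum>b\<in>Basis. pmass p (\<lambda>x. indicator half_space x * partial_deriv (b, 0) U x)))"
proof -
  let ?m = "DIM('a)"
  define w where "w = unit_ball_vol (real ?m)"
  define mc where "mc = (\<lambda>r. pmass p (\<lambda>y. U (y, r) - U (y, 0)))"
  define K where "K = (\<lambda>r. \<Sum>b\<in>Basis. pmass p (\<lambda>y. partial_deriv (b, 0) U (y, r)))"
  have w: "w \<ge> 0" by (simp add: w_def)
  have sm: "(\<lambda>y. U (y, r)) \<in> borel_measurable borel" for r by (rule boundary_slice_borel[OF U])
  have VC: "partial_deriv b U \<in> C_infinity" if "b \<in> Basis" for b using C_infinityD(2)[OF U that] .
  have Vb: "partial_deriv b U \<in> borel_measurable borel" if "b \<in> Basis" for b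
    using C_infinityD(3)[OF VC[OF that]] by (rule borel_measurable_continuous_onI)
  have mcm [measurable]: "mc \<in> borel_measurable borel"
  proof -
    have "U \<in> borel_measurable borel" using C_infinityD(3)[OF U] by (rule borel_measurable_continuous_onI)
    then have [measurable]: "U \<in> borel_measurable (borel \<Otimes>\<^sub>M borel)" by (simp add: borel_prod)
    have "mc \<in> borel_measurable lborel" unfolding mc_def Lp_mass_def by measurable
    then show ?thesis by simp
  qed
  have Lm: "(\<lambda>r. pmass p (\<lambda>y. partial_deriv (b, 0) U (y, r))) \<in> borel_measurable lborel" if "b \<in> Basis" for b
  proof -
    have [measurable]: "partial_deriv (b, 0) U \<in> borel_measurable (borel \<Otimes>\<^sub>M borel)" using Vb[OF horizontal_Basis[OF that]] by (simp add: borel_prod)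
    show ?thesis unfolding Lp_mass_def by measurable
  qed
  have Km [measurable]: "K \<in> borel_measurable borel"
    using borel_measurable_sum[of Basis "\<lambda>b r. pmass p (\<lambda>y. partial_deriv (b, 0) U (y, r))" lborel] Lm by (simp add: K_def)
  have sh: "shift_mass p (\<lambda>y. U (y, 0)) h \<le> ennreal (2 powr p * 2 powr p) * (2 * mc r + ennreal (r powr p * real ?m powr p) * K r)"
    if h: "norm h < r" for h :: 'a and r
  proof -
    have p0: "p \<ge> 0" "p \<ge> 1" using p by auto
    have mm: "(\<lambda>y. U (y + h, r)) \<in> borel_measurable lborel" for r
      using measurable_compose[OF _ sm[of r], of "\<lambda>y. y + h" lborel] by simp
    have t1: "shift_mass p (\<lambda>y. U (y, 0)) h \<le> ennreal (2 powr p) * (pmass p (\<lambda>y. U (y + h, 0) - U (y + h, r)) + pmass p (\<lambda>y. U (y + h, r) - U (y, 0)))"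
      unfolding shift_mass_def by (rule Lp_mass_triangle) (use mm sm p0 in auto)
    have t2: "pmass p (\<lambda>y. U (y + h, 0) - U (y + h, r)) = mc r"
    proof -
      have "pmass p (\<lambda>y. U (y + h, 0) - U (y + h, r)) = pmass p (\<lambda>y. U (y, 0) - U (y, r))"
        by (rule Lp_mass_translate[of "\<lambda>y. U (y, 0) - U (y, r)"]) (intro borel_measurable_diff sm)
      then show ?thesis unfolding mc_def by (rule trans[OF _ Lp_mass_diff_commute])
    qed
    have t3: "pmass p (\<lambda>y. U (y + h, r) - U (y, 0)) \<le> ennreal (2 powr p) * (pmass p (\<lambda>y. U (y + h, r) - U (y, r)) + mc r)"
      unfolding mc_def by (rule Lp_mass_triangle) (use mm sm p0 in auto)
    have "pmass p (\<lambda>y. U (y + h, r) - U (y, r)) \<le> ennreal (norm h powr p * real ?m powr p) * K r"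
      unfolding K_def by (rule smooth_horizontal_shift[OF U p0(2)])
    also have "\<dots> \<le> ennreal (r powr p * real ?m powr p) * K r"
      using h p0 by (intro mult_right_mono ennreal_leI powr_mono2) auto
    finally have t4: "pmass p (\<lambda>y. U (y + h, r) - U (y, r)) \<le> ennreal (r powr p * real ?m powr p) * K r" .
    have one: "1 \<le> ennreal (2 powr p)" using p0 by (simp add: ge_one_powr_ge_zero)
    have t5: "mc r \<le> ennreal (2 powr p) * mc r" using mult_right_mono[OF one, of "mc r"] by simp
    have "shift_mass p (\<lambda>y. U (y, 0)) h \<le> ennreal (2 powr p) * (ennreal (2 powr p) * mc r + ennreal (2 powr p) * (ennreal (r powr p * real ?m powr p) * K r + mc r))"
      using t1 unfolding t2
    proof (rule order_trans)
      show "ennreal (2 powr p) * (mc r + pmass p (\<lambda>y. U (y + h, r) - U (y, 0))) \<le> ennreal (2 powr p) * (ennreal (2 powr p) * mc r + ennreal (2 powr p) * (ennreal (r powr p * real ?m powr p) * K r + mc r))"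
        by (rule mult_left_mono[OF add_mono[OF t5 order_trans[OF t3 mult_left_mono[OF add_right_mono[OF t4]]]]]) auto
    qed
    also have "\<dots> = ennreal (2 powr p * 2 powr p) * (2 * mc r + ennreal (r powr p * real ?m powr p) * K r)"
      by (simp add: ennreal_mult distrib_left mult_2 mult.assoc add_ac)
    finally show ?thesis .
  qed
  let ?C = "ennreal (2 powr p * 2 powr p)"
  have slice: "ennreal (r powr - (real ?m + p)) * indicator {0<..} r * (\<integral>\<^sup>+h. indicator (ball 0 r) h * shift_mass p (\<lambda>y. U (y, 0)) h \<partial>lborel)
    \<le> ennreal w * ?C * (2 * (ennreal (r powr - p) * indicator {0<..} r * mc r) + ennreal (real ?m powr p) * (indicator {0<..} r * K r))" for r
  proof (cases "r > 0")
    case True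
    let ?X = "?C * (2 * mc r + ennreal (r powr p * real ?m powr p) * K r)"
    have "(\<integral>\<^sup>+h. indicator (ball 0 r) h * shift_mass p (\<lambda>y. U (y, 0)) h \<partial>lborel) \<le> (\<integral>\<^sup>+h. ?X * indicator (ball (0::'a) r) h \<partial>lborel)"
    proof (rule nn_integral_mono)
      fix h :: 'a
      show "indicator (ball 0 r) h * shift_mass p (\<lambda>y. U (y, 0)) h \<le> ?X * indicator (ball 0 r) h"
        using sh[of h r] by (cases "h \<in> ball 0 r") auto
    qed
    also have "\<dots> = ?X * ennreal (w * r ^ ?m)"
      using True by (subst nn_integral_cmult_indicator) (auto simp: emeasure_ball w_def)
    finally have "ennreal (r powr - (real ?m + p)) * (\<integral>\<^sup>+h. indicator (ball 0 r) h * shift_mass p (\<lambda>y. U (y, 0)) h \<partial>lborel) \<le> ennreal (r powr - (real ?m + p)) * (?X * ennreal (w * r ^ ?m))"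
      by (intro mult_left_mono) auto
    also have "\<dots> = ennreal (w * r powr - p) * ?X"
    proof -
      have "r powr - (real ?m + p) * (w * r ^ ?m) = w * r powr - p"
        using True by (simp add: powr_realpow[symmetric] powr_add[symmetric])
      then have "ennreal (r powr - (real ?m + p)) * ennreal (w * r ^ ?m) = ennreal (w * r powr - p)"
        using True w by (subst ennreal_mult[symmetric]) auto
      moreover have "a * (b * c) = (a * c) * b" for a b c :: ennreal by (simp only: mult_ac)
      ultimately show ?thesis by simp
    qed
    also have "\<dots> = ennreal w * ?C * (2 * (ennreal (r powr - p) * mc r) + (ennreal (r powr - p) * ennreal (r powr p * real ?m powr p)) * K r)"
    proof -
      have "ennreal (w * r powr - p) = ennreal w * ennreal (r powr - p)" using w by (simp add: ennreal_mult)
      moreover have "a * b * (c * (2 * d + f * g)) = a * c * (2 * (b * d) + (b * f) * g)" for a b c d f g :: ennreal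
        by (simp only: distrib_left mult_ac)
      ultimately show ?thesis by simp
    qed
    also have "ennreal (r powr - p) * ennreal (r powr p * real ?m powr p) = ennreal (real ?m powr p)"
      using True by (simp add: ennreal_mult[symmetric] powr_minus)
    finally show ?thesis using True by simp
  qed simp
  have "gag p (\<lambda>y. U (y, 0)) \<le> (\<integral>\<^sup>+r. ennreal w * ?C * (2 * (ennreal (r powr - p) * indicator {0<..} r * mc r) + ennreal (real ?m powr p) * (indicator {0<..} r * K r)) \<partial>lborel)"
    unfolding gag_def by (rule nn_integral_mono[OF slice])
  also have "\<dots> = ennreal w * ?C * (2 * (\<integral>\<^sup>+r. ennreal (r powr - p) * indicator {0<..} r * mc r \<partial>lborel) + ennreal (real ?m powr p) * (\<integral>\<^sup>+r. indicator {0<..} r * K r \<partial>lborel))"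
    by (simp add: nn_integral_cmult nn_integral_add)
  also have "\<dots> \<le> ennreal w * ?C * (2 * (ennreal (2 powr p / (p - 1)) * pmass p (\<lambda>x. indicator half_space x * partial_deriv (0, 1) U x)) +
       ennreal (real ?m powr p) * (\<Sum>b\<in>Basis. pmass p (\<lambda>x. indicator half_space x * partial_deriv (b, 0) U x)))"
  proof (intro mult_left_mono add_mono)
    have "(\<lambda>x. indicator half_space x * partial_deriv (0, 1) U x) \<in> borel_measurable borel"
      using Vb[OF vertical_Basis] by (intro borel_measurable_times borel_measurable_indicator) auto
    from half_space_mass_slices[OF this]
    show "(\<integral>\<^sup>+r. ennreal (r powr - p) * indicator {0<..} r * mc r \<partial>lborel) \<le> ennreal (2 powr p / (p - 1)) * pmass p (\<lambda>x. indicator half_space x * partial_deriv (0, 1) U x)"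
      unfolding mc_def using smooth_vertical_hardy[OF U p] by simp
    have "(\<integral>\<^sup>+r. indicator {0<..} r * K r \<partial>lborel) = (\<integral>\<^sup>+r. (\<Sum>b\<in>Basis. indicator {0<..} r * pmass p (\<lambda>y. partial_deriv (b, 0) U (y, r))) \<partial>lborel)"
      by (simp add: K_def sum_distrib_left)
    also have "\<dots> = (\<Sum>b\<in>Basis. \<integral>\<^sup>+r. indicator {0<..} r * pmass p (\<lambda>y. partial_deriv (b, 0) U (y, r)) \<partial>lborel)"
      by (intro nn_integral_sum borel_measurable_times_ennreal Lm) auto
    also have "\<dots> = (\<Sum>b\<in>Basis. pmass p (\<lambda>x. indicator half_space x * partial_deriv (b, 0) U x))"
    proof (rule sum.cong[OF refl])
      fix b :: 'a assume "b \<in> Basis"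
      then have "(\<lambda>x. indicator half_space x * partial_deriv (b, 0) U x) \<in> borel_measurable borel"
        using Vb[OF horizontal_Basis] by (intro borel_measurable_times borel_measurable_indicator) auto
      from half_space_mass_slices[OF this]
      show "(\<integral>\<^sup>+r. indicator {0<..} r * pmass p (\<lambda>y. partial_deriv (b, 0) U (y, r)) \<partial>lborel) = pmass p (\<lambda>x. indicator half_space x * partial_deriv (b, 0) U x)" by simp
    qed
    finally show "(\<integral>\<^sup>+r. indicator {0<..} r * K r \<partial>lborel) \<le> (\<Sum>b\<in>Basis. pmass p (\<lambda>x. indicator half_space x * partial_deriv (b, 0) U x))" by simp
  qed auto
  finally have fin: "gag p (\<lambda>y. U (y, 0)) \<le> ennreal w * ?C * (2 * (ennreal (2 powr p / (p - 1)) * pmass p (\<lambda>x. indicator half_space x * partial_deriv (0, 1) U x)) +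
       ennreal (real ?m powr p) * (\<Sum>b\<in>Basis. pmass p (\<lambda>x. indicator half_space x * partial_deriv (b, 0) U x)))" .
  have e1: "ennreal w * ?C = ennreal (w * (2 powr p * 2 powr p))" using w by (simp add: ennreal_mult)
  have e2: "2 * (ennreal x * L) = ennreal (2 * x) * L" if "x \<ge> 0" for x L
    using that by (simp add: ennreal_mult mult.assoc)
  have e3: "2 powr p / (p - 1) \<ge> 0" using p by simp
  from fin show ?thesis
    unfolding e1 e2[OF e3] unfolding w_def .
qed

lemma AE_lborel_fst_snd:
  fixes P :: "'a::euclidean_space \<Rightarrow> bool"
  assumes "AE x in lborel. P x"
  shows "AE z in lborel. P (fst (z :: 'a \<times> 'a))" "AE z in lborel. P (snd (z :: 'a \<times> 'a))"
proof -
  obtain N where N: "{x. \<not> P x} \<subseteq> N" "emeasure lborel N = 0" "N \<in> sets borel"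
    using AE_E[OF assms] by auto
  have [measurable]: "N \<in> sets borel" by fact
  have "(\<lambda>z::'a \<times> 'a. indicator N (fst z) :: ennreal) \<in> borel_measurable (borel \<Otimes>\<^sub>M borel)" "(\<lambda>z::'a \<times> 'a. indicator N (snd z) :: ennreal) \<in> borel_measurable (borel \<Otimes>\<^sub>M borel)" by measurable
  then have m: "(\<lambda>z::'a \<times> 'a. indicator N (fst z) :: ennreal) \<in> borel_measurable borel" "(\<lambda>z::'a \<times> 'a. indicator N (snd z) :: ennreal) \<in> borel_measurable borel" by (simp_all add: borel_prod)
  have "(\<integral>\<^sup>+z. indicator N (fst (z::'a \<times> 'a)) \<partial>lborel) = 0" "(\<integral>\<^sup>+z. indicator N (snd (z::'a \<times> 'a)) \<partial>lborel) = 0"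
    using N(2) m by (simp_all add: nn_integral_lborel_pair nn_integral_multc)
  then have ae: "AE z in lborel. indicator N (fst (z::'a \<times> 'a)) = (0::ennreal)" "AE z in lborel. indicator N (snd (z::'a \<times> 'a)) = (0::ennreal)"
    using m by (simp_all add: nn_integral_0_iff_AE)
  have N': "P x" if "indicator N x = (0::ennreal)" for x
    using that N(1) by (auto simp: indicator_def split: if_splits)
  show "AE z in lborel. P (fst (z :: 'a \<times> 'a))" "AE z in lborel. P (snd (z :: 'a \<times> 'a))"
    by (rule eventually_mono[OF ae(1)], erule N') (rule eventually_mono[OF ae(2)], erule N')
qed

text \<open>
  The energy is the mass of the difference quotients as functions of pairs of points, and these
  converge almost everywhere.
\<close>

lemma gag_Fatou:
  fixes g :: "'a::euclidean_space \<Rightarrow> real"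
  assumes [measurable]: "\<And>k. f k \<in> borel_measurable borel" "g \<in> borel_measurable borel"
    and lim: "AE x in lborel. (\<lambda>k. f k x) \<longlonglongrightarrow> g x" and b: "\<And>k. gag p (f k) \<le> C" and p: "p > 1"
  shows "gag p g \<le> C"
proof -
  define F where "F = (\<lambda>f (z :: 'a \<times> 'a). (\<bar>f (fst z) - f (snd z)\<bar> / norm (fst z - snd z) powr ((real DIM('a) + (p - 1)) / p)))"
  have Fp: "pmass p (F f) = ennreal (real DIM('a) + (p - 1)) * gag p f" if "f \<in> borel_measurable borel" for f :: "'a \<Rightarrow> real"
  proof -
    have "pmass p (F f) = (\<integral>\<^sup>+z. ennreal (\<bar>f (fst z) - f (snd z)\<bar> powr p / norm (fst z - snd z) powr (real DIM('a) + (p - 1))) \<partial>lborel)"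
      unfolding Lp_mass_def F_def using p by (intro nn_integral_cong) (simp add: powr_divide powr_powr)
    then show ?thesis using gag_eq_Slobodeckij[OF that p] by simp
  qed
  have Fm: "F f \<in> borel_measurable lborel" if [measurable]: "f \<in> borel_measurable borel" for f :: "'a \<Rightarrow> real"
  proof -
    have "F f \<in> borel_measurable (borel \<Otimes>\<^sub>M borel)" unfolding F_def by measurable
    then show ?thesis by (simp add: borel_prod)
  qed
  define c where "c = real DIM('a) + (p - 1)"
  have c: "c > 0" using p by (simp add: c_def add_pos_pos)
  have "pmass p (F g) \<le> ennreal c * C"
  proof (rule Lp_mass_Fatou[of "\<lambda>k. F (f k)"])
    note P = AE_lborel_fst_snd(1)[OF lim] and Q = AE_lborel_fst_snd(2)[OF lim]
    show "AE z in lborel. (\<lambda>k. F (f k) z) \<longlonglongrightarrow> F g z"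
      using P Q
    proof eventually_elim
      case (elim z)
      show ?case unfolding F_def divide_inverse by (intro tendsto_intros elim)
    qed
    show "pmass p (F (f k)) \<le> ennreal c * C" for k
      unfolding Fp[OF assms(1)] c_def[symmetric] by (intro mult_left_mono b) auto
  qed (use Fm p in auto)
  then have "ennreal c * gag p g \<le> ennreal c * C" unfolding Fp[OF assms(2)] c_def[symmetric] .
  then have le: "ennreal (1 / c) * (ennreal c * gag p g) \<le> ennreal (1 / c) * (ennreal c * C)" by (rule mult_left_mono) simp
  have "ennreal (1 / c) * ennreal c = 1" using c by (simp add: ennreal_mult[symmetric])
  then have k: "ennreal (1 / c) * (ennreal c * x) = x" for x by (simp only: mult.assoc[symmetric] mult_1)
  show ?thesis using le unfolding k .
qed

lemma trace_gag_finite: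
  fixes u :: "'a::euclidean_space \<times> real \<Rightarrow> real"
  assumes D: "W1p_rep half_space p u u' D" and p: "p > 1"
  shows "gag p (etr u' (D (0, 1))) < \<infinity>"
proof -
  have p1: "p \<ge> 1" using p by simp
  note R = W1p_repD[OF D] and n = vertical_Basis
  obtain \<phi> :: "'a \<times> real \<Rightarrow> real" and e :: "nat \<Rightarrow> real" where phi: "mollifier \<phi> half_space" and e: "\<And>k::nat. e k > 0"
    and lim: "AE y in lborel. (\<lambda>k. moll \<phi> (e k) u' (y, 0)) \<longlonglongrightarrow> etr u' (D (0, 1)) y"
  proof (rule trace_approximation[OF D p1])
    fix \<phi> and e :: "nat \<Rightarrow> real"
    assume "mollifier \<phi> half_space" "\<And>k. 0 < e k" "AE y in lborel. (\<lambda>k. moll \<phi> (e k) u' (y, 0)) \<longlonglongrightarrow> etr u' (D (0, 1)) y"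
    then show thesis by (rule that)
  qed
  let ?A = "ennreal (unit_ball_vol (real DIM('a)) * (2 powr p * 2 powr p))" and ?B = "ennreal (2 * (2 powr p / (p - 1)))" and ?E = "ennreal (real DIM('a) powr p)"
  define C where "C = ?A * (?B * pmass p (D (0, 1)) + ?E * (\<Sum>b\<in>Basis. pmass p (D (b, 0))))"
  have "C < \<infinity>"
    using R(7)[OF n] R(7)[OF horizontal_Basis] by (simp add: C_def ennreal_mult_less_top)
  have bound: "gag p (\<lambda>y. moll \<phi> (e k) u' (y, 0)) \<le> C" for k
  proof -
    have m: "pmass p (\<lambda>x. indicator half_space x * partial_deriv b (moll \<phi> (e k) u') x) \<le> pmass p (D b)" if b: "b \<in> Basis" for b
    proof -
      have "pmass p (\<lambda>x. indicator half_space x * partial_deriv b (moll \<phi> (e k) u') x) \<le> pmass p (moll \<phi> (e k) (D b))"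
        by (rule Lp_mass_mono) (use p half_space_moll_partial_deriv[OF phi D p1 b e] in \<open>auto simp: indicator_def half_space_iff\<close>)
      also have "\<dots> \<le> pmass p (D b)" by (rule mollifier.moll_mass_le[OF phi R(5)[OF b] p1])
      finally show ?thesis .
    qed
    show ?thesis
      unfolding C_def
      by (rule order_trans[OF gagliardo_smooth[OF half_space_moll_rep(1)[OF phi D p1 e] p]])
        (intro mult_left_mono add_mono sum_mono m n horizontal_Basis, auto)
  qed
  have "gag p (etr u' (D (0, 1))) \<le> C"
    by (rule gag_Fatou[OF _ _ lim bound p]) (use boundary_slice_borel[OF half_space_moll_rep(1)[OF phi D p1 e]] etr_rep_finite(1)[OF D p1] in auto)
  with \<open>C < \<infinity>\<close> show ?thesis by simp
qed

section \<open>A cutoff in the normal direction\<close>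

text \<open>One continuous derivative suffices for a cutoff that only enters classical first derivatives.\<close>

definition sqp :: "real \<Rightarrow> real" where "sqp t = (max 0 t)\<^sup>2"

lemma DERIV_sqp: "(sqp has_real_derivative 2 * max 0 t) (at t)"
proof -
  consider "t > 0" | "t < 0" | "t = 0" by linarith
  then show ?thesis
  proof cases
    case 1
    have "((\<lambda>t. t\<^sup>2) has_real_derivative 2 * max 0 t) (at t)"
      using 1 by (auto intro!: derivative_eq_intros)
    then show ?thesis
      by (rule DERIV_cong_ev[THEN iffD1, rotated -1])
        (auto simp: sqp_def 1 intro!: eventually_nhds_in_open[of "{0<..}" t, THEN eventually_mono])
  next
    case 2
    have "((\<lambda>t. 0) has_real_derivative 2 * max 0 t) (at t)" using 2 by auto
    then show ?thesis
      by (rule DERIV_cong_ev[THEN iffD1, rotated -1])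
        (auto simp: sqp_def 2 intro!: eventually_nhds_in_open[of "{..<0}" t, THEN eventually_mono])
  next
    case 3
    have "((\<lambda>h. (sqp (0 + h) - sqp 0) / h) \<longlongrightarrow> 0) (at 0)"
    proof (rule Lim_null_comparison)
      show "\<forall>\<^sub>F h in at 0. norm ((sqp (0 + h) - sqp 0) / h) \<le> \<bar>h\<bar>"
        by (auto simp: eventually_at_filter sqp_def max_def power2_eq_square)
      show "((\<lambda>h. \<bar>h\<bar>) \<longlongrightarrow> (0::real)) (at 0)" by (rule tendsto_rabs_zero) (rule tendsto_ident_at)
    qed
    then show ?thesis using 3 by (simp add: DERIV_def)
  qed
qed

lemma isCont_sqp: "isCont sqp t" using DERIV_sqp by (rule DERIV_isCont)

definition cutoff :: "real \<Rightarrow> real" where "cutoff t = sqp (1 - sqp (2 * t - 1))"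

definition cutoff' :: "real \<Rightarrow> real" where "cutoff' t = - 8 * max 0 (1 - sqp (2 * t - 1)) * max 0 (2 * t - 1)"

lemma DERIV_cutoff: "(cutoff has_real_derivative cutoff' t) (at t)"
proof -
  have 1: "((\<lambda>t. sqp (2 * t - 1)) has_real_derivative (2 * max 0 (2 * t - 1)) * 2) (at t)"
    by (rule DERIV_chain2[OF DERIV_sqp]) (auto intro!: derivative_eq_intros)
  have "((\<lambda>t. 1 - sqp (2 * t - 1)) has_real_derivative - ((2 * max 0 (2 * t - 1)) * 2)) (at t)"
    using DERIV_diff[OF DERIV_const 1] by simp
  from DERIV_chain2[OF DERIV_sqp this]
  have "((\<lambda>t. sqp (1 - sqp (2 * t - 1))) has_real_derivative (2 * max 0 (1 - sqp (2 * t - 1))) * (- ((2 * max 0 (2 * t - 1)) * 2))) (at t)" .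
  then show ?thesis unfolding cutoff_def[abs_def] cutoff'_def by (rule DERIV_cong) simp
qed

lemma isCont_cutoff: "isCont cutoff t" using DERIV_cutoff by (rule DERIV_isCont)

lemma isCont_cutoff': "isCont cutoff' t"
  unfolding cutoff'_def by (intro continuous_intros isCont_o2[OF _ isCont_sqp])

lemma continuous_on_cutoff: "continuous_on UNIV cutoff" "continuous_on UNIV cutoff'"
  using isCont_cutoff isCont_cutoff' by (simp_all add: continuous_at_imp_continuous_on)

lemma sqp_bounds: "sqp t \<ge> 0" "t \<le> 1 \<Longrightarrow> sqp t \<le> 1" "t \<ge> 1 \<Longrightarrow> sqp t \<ge> 1" "t \<le> 0 \<Longrightarrow> sqp t = 0"
  by (auto simp: sqp_def max_def power_le_one one_le_power)

lemma cutoff_bounds: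
  "cutoff t \<ge> 0" "cutoff t \<le> 1" "t \<le> 1/2 \<Longrightarrow> cutoff t = 1" "t \<ge> 1 \<Longrightarrow> cutoff t = 0"
  "\<bar>cutoff' t\<bar> \<le> 8" "t \<ge> 1 \<Longrightarrow> cutoff' t = 0"
proof -
  show "cutoff t \<ge> 0" by (simp add: cutoff_def sqp_bounds)
  show "cutoff t \<le> 1" unfolding cutoff_def by (rule sqp_bounds(2)) (simp add: sqp_bounds)
  show "t \<le> 1/2 \<Longrightarrow> cutoff t = 1" by (simp add: cutoff_def sqp_bounds(4)) (simp add: sqp_def)
  show "t \<ge> 1 \<Longrightarrow> cutoff t = 0" using sqp_bounds(3)[of "2 * t - 1"] by (simp add: cutoff_def sqp_bounds(4))
  show z: "t \<ge> 1 \<Longrightarrow> cutoff' t = 0" using sqp_bounds(3)[of "2 * t - 1"] by (simp add: cutoff'_def)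
  show "\<bar>cutoff' t\<bar> \<le> 8"
  proof (cases "t \<ge> 1")
    case False
    have "max 0 (1 - sqp (2 * t - 1)) * max 0 (2 * t - 1) \<le> 1 * 1"
      using False sqp_bounds(1)[of "2 * t - 1"] by (intro mult_mono) auto
    moreover have "max 0 (1 - sqp (2 * t - 1)) * max 0 (2 * t - 1) \<ge> 0" by simp
    ultimately show ?thesis by (simp add: cutoff'_def abs_mult)
  qed (use z in simp)
qed

lemma cutoff_le_indicator: "t > 0 \<Longrightarrow> \<bar>cutoff t\<bar> \<le> indicator {0<..<1} t" "t > 0 \<Longrightarrow> \<bar>cutoff' t\<bar> \<le> 8 * indicator {0<..<1} t"
  using cutoff_bounds[of t] by (auto simp: indicator_def)

section \<open>Kernels at variable scale\<close>

text \<open>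
  Written with the kernel as in \<open>moll_eq_corr\<close>, only the continuous kernel depends on the point,
  and near a given point of the half space it is bounded by a multiple of the indicator of a fixed
  ball.
\<close>

lemma moll_jointly_continuous:
  fixes g :: "'a::euclidean_space \<Rightarrow> real"
  assumes [measurable]: "g \<in> borel_measurable borel" and fin: "pmass p g < \<infinity>" and p: "p \<ge> 1"
    and \<psi>: "continuous_on UNIV \<psi>" "\<And>w. \<bar>\<psi> w\<bar> \<le> B * indicator (cball 0 1) w"
  shows "continuous_on half_space (\<lambda>x. moll \<psi> (snd x) g (fst x))"
  unfolding continuous_on_sequentially comp_def
proof (intro allI ballI impI)
  fix X :: "nat \<Rightarrow> 'a \<times> real" and x assume x: "x \<in> half_space" and X0: "(\<forall>n. X n \<in> half_space) \<and> X \<longlonglongrightarrow> x"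
  define y where "y = fst x"
  define t where "t = snd x"
  have t: "t > 0" using x by (simp add: half_space_iff t_def)
  have lim: "(\<lambda>n. fst (X n)) \<longlonglongrightarrow> y" "(\<lambda>n. snd (X n)) \<longlonglongrightarrow> t" using X0 by (auto simp: y_def t_def intro: tendsto_fst tendsto_snd)
  have [measurable]: "\<psi> \<in> borel_measurable borel" using \<psi>(1) by (rule borel_measurable_continuous_onI)
  have B: "B \<ge> 0" using \<psi>(2)[of 0] by simp
  have "\<forall>\<^sub>F n in sequentially. t / 2 < snd (X n)" "\<forall>\<^sub>F n in sequentially. snd (X n) < 2 * t" "\<forall>\<^sub>F n in sequentially. dist (fst (X n)) y < 1"
    using order_tendstoD[OF lim(2), of "t/2"] order_tendstoD[OF lim(2), of "2 * t"] tendstoD[OF lim(1), of 1] t by auto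
  then have "\<forall>\<^sub>F n in sequentially. t / 2 < snd (X n) \<and> snd (X n) < 2 * t \<and> dist (fst (X n)) y < 1"
    by eventually_elim simp
  then obtain N where N: "\<And>n. n \<ge> N \<Longrightarrow> t / 2 < snd (X n) \<and> snd (X n) < 2 * t \<and> dist (fst (X n)) y < 1"
    by (auto simp: eventually_sequentially)
  define Y where "Y = (\<lambda>n. X (n + N))"
  have Y: "t / 2 < snd (Y n)" "snd (Y n) < 2 * t" "dist (fst (Y n)) y < 1" for n using N[of "n + N"] by (auto simp: Y_def)
  have Yp: "snd (Y n) > 0" for n using Y(1)[of n] t by simp
  have Yl: "(\<lambda>n. fst (Y n)) \<longlonglongrightarrow> y" "(\<lambda>n. snd (Y n)) \<longlonglongrightarrow> t"
    using LIMSEQ_ignore_initial_segment[OF lim(1), of N] LIMSEQ_ignore_initial_segment[OF lim(2), of N] by (simp_all add: Y_def)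
  let ?k = "\<lambda>y t z. g z * ((1 / t ^ DIM('a)) * \<psi> ((1 / t) *\<^sub>R (z - y)))"
  let ?A = "cball y (2 * t + 1)"
  let ?C = "(2 / t) ^ DIM('a) * B"
  have "(\<lambda>n. LINT z|lborel. ?k (fst (Y n)) (snd (Y n)) z) \<longlonglongrightarrow> (LINT z|lborel. ?k y t z)"
  proof (rule integral_dominated_convergence[where w = "\<lambda>z. \<bar>g z * (?C * indicator ?A z)\<bar>"])
    have "integrable lborel (\<lambda>z. g z * (?C * indicator ?A z))"
      by (rule Lp_bounded_set_integrable[where A = ?A and B = ?C, OF _ _ _ _ p]) (use fin B t emeasure_cball_fin in \<open>auto intro!: borel_measurable_times borel_measurable_indicator\<close>)
    then show "integrable lborel (\<lambda>z. \<bar>g z * (?C * indicator ?A z)\<bar>)" by (rule integrable_abs)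
    show "AE z in lborel. (\<lambda>n. ?k (fst (Y n)) (snd (Y n)) z) \<longlonglongrightarrow> ?k y t z"
    proof (intro AE_I2)
      fix z
      have "isCont \<psi> ((1 / t) *\<^sub>R (z - y))" using \<psi>(1) by (simp add: continuous_on_eq_continuous_at)
      moreover have "(\<lambda>n. (1 / snd (Y n)) *\<^sub>R (z - fst (Y n))) \<longlonglongrightarrow> (1 / t) *\<^sub>R (z - y)"
        using t by (intro tendsto_intros Yl) auto
      ultimately have "(\<lambda>n. \<psi> ((1 / snd (Y n)) *\<^sub>R (z - fst (Y n)))) \<longlonglongrightarrow> \<psi> ((1 / t) *\<^sub>R (z - y))"
        by (rule isCont_tendsto_compose)
      then show "(\<lambda>n. ?k (fst (Y n)) (snd (Y n)) z) \<longlonglongrightarrow> ?k y t z"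
        using t by (intro tendsto_intros Yl) auto
    qed
    show "AE z in lborel. norm (?k (fst (Y n)) (snd (Y n)) z) \<le> \<bar>g z * (?C * indicator ?A z)\<bar>" for n
    proof (intro AE_I2)
      fix z
      let ?w = "(1 / snd (Y n)) *\<^sub>R (z - fst (Y n))"
      have "indicator (cball 0 1) ?w \<le> (indicator ?A z :: real)"
      proof (cases "?w \<in> cball 0 1")
        case True
        then have "norm (z - fst (Y n)) \<le> snd (Y n)" using Yp[of n] by (simp add: divide_simps flip: scaleR_diff_right)
        then have "dist y z \<le> 2 * t + 1" using Y(2,3)[of n] dist_triangle[of y z "fst (Y n)"] by (simp add: dist_norm norm_minus_commute)
        then show ?thesis by (auto simp: indicator_def)
      qed simp
      then have "B * indicator (cball 0 1) ?w \<le> B * indicator ?A z" using B by (rule mult_left_mono)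
      then have a: "\<bar>\<psi> ?w\<bar> \<le> B * indicator ?A z" using \<psi>(2)[of ?w] by linarith
      have "1 / snd (Y n) \<le> 2 / t" using Y(1)[of n] Yp[of n] t by (simp add: divide_simps)
      then have b: "(1 / snd (Y n)) ^ DIM('a) \<le> (2 / t) ^ DIM('a)" using Yp[of n] by (intro power_mono) auto
      have "(1 / snd (Y n)) ^ DIM('a) * \<bar>\<psi> ?w\<bar> \<le> (2 / t) ^ DIM('a) * (B * indicator ?A z)"
        using a b t by (intro mult_mono) auto
      then have "\<bar>g z\<bar> * ((1 / snd (Y n)) ^ DIM('a) * \<bar>\<psi> ?w\<bar>) \<le> \<bar>g z\<bar> * (?C * indicator ?A z)"
        by (intro mult_left_mono) (simp_all add: mult.assoc)
      then show "norm (?k (fst (Y n)) (snd (Y n)) z) \<le> \<bar>g z * (?C * indicator ?A z)\<bar>"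
        using Yp[of n] B t by (simp add: abs_mult power_one_over)
    qed
  qed measurable
  moreover have "moll \<psi> (snd (Y n)) g (fst (Y n)) = (LINT z|lborel. ?k (fst (Y n)) (snd (Y n)) z)" for n
    by (rule moll_eq_corr) (use Yp in auto)
  moreover have "moll \<psi> t g y = (LINT z|lborel. ?k y t z)" by (rule moll_eq_corr) (use t in auto)
  ultimately have "(\<lambda>n. moll \<psi> (snd (Y n)) g (fst (Y n))) \<longlonglongrightarrow> moll \<psi> (snd x) g (fst x)" by (simp add: y_def t_def)
  then show "(\<lambda>n. moll \<psi> (snd (X n)) g (fst (X n))) \<longlonglongrightarrow> moll \<psi> (snd x) g (fst x)"
    unfolding Y_def by (rule LIMSEQ_offset)
qed

text \<open>
  The divergence of \<open>w \<mapsto> \<phi> w *\<^sub>R w\<close>. It arises from differentiating dilations of \<open>\<phi>\<close> in the scale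
  (\<open>dilation_DERIV\<close>), and as a divergence it has mean zero.
\<close>

definition radial_kernel :: "('a::euclidean_space \<Rightarrow> real) \<Rightarrow> 'a \<Rightarrow> real" where
  "radial_kernel \<phi> w = real DIM('a) * \<phi> w + (\<Sum>b\<in>Basis. (w \<bullet> b) * partial_deriv b \<phi> w)"

lemma frechet_derivative_basis:
  assumes "\<phi> differentiable (at x)"
  shows "frechet_derivative \<phi> (at x) h = (\<Sum>b\<in>Basis. (h \<bullet> b) * partial_deriv b \<phi> x)"
proof -
  have lin: "linear (frechet_derivative \<phi> (at x))" using assms by (rule linear_frechet_derivative)
  have "frechet_derivative \<phi> (at x) h = frechet_derivative \<phi> (at x) (\<Sum>b\<in>Basis. (h \<bullet> b) *\<^sub>R b)"
    by (simp add: euclidean_representation)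
  then show ?thesis by (simp add: linear_sum[OF lin] linear_cmul[OF lin] partial_deriv_def)
qed

lemma dilation_DERIV:
  fixes \<phi> :: "'a::euclidean_space \<Rightarrow> real"
  assumes "\<phi> \<in> C_infinity" "s > 0"
  shows "((\<lambda>s. (1 / s ^ DIM('a)) * \<phi> ((1 / s) *\<^sub>R v)) has_real_derivative
     - (1 / s) * ((1 / s ^ DIM('a)) * radial_kernel \<phi> ((1 / s) *\<^sub>R v))) (at s)"
proof -
  let ?w = "(1 / s) *\<^sub>R v"
  have df: "\<phi> differentiable (at ?w)" by (rule C_infinityD(1)[OF assms(1)])
  then have "(\<phi> has_derivative frechet_derivative \<phi> (at ?w)) (at ?w)" using frechet_derivative_works by blast
  moreover have "((\<lambda>s. (1 / s) *\<^sub>R v) has_derivative (\<lambda>h. (- (1 / s) * (h / s)) *\<^sub>R v)) (at s)"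
    using assms(2) by (auto intro!: derivative_eq_intros simp: field_simps)
  ultimately have "((\<lambda>s. \<phi> ((1 / s) *\<^sub>R v)) has_derivative (\<lambda>h. frechet_derivative \<phi> (at ?w) ((- (1 / s) * (h / s)) *\<^sub>R v))) (at s)"
    by (rule has_derivative_compose[rotated])
  moreover have "frechet_derivative \<phi> (at ?w) ((- (1 / s) * (h / s)) *\<^sub>R v) = - (1 / s) * (\<Sum>b\<in>Basis. (?w \<bullet> b) * partial_deriv b \<phi> ?w) * h" for h
    unfolding frechet_derivative_basis[OF df] by (simp add: sum_distrib_left sum_distrib_right mult_ac sum_negf)
  ultimately have 1: "((\<lambda>s. \<phi> ((1 / s) *\<^sub>R v)) has_real_derivative - (1 / s) * (\<Sum>b\<in>Basis. (?w \<bullet> b) * partial_deriv b \<phi> ?w)) (at s)"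
    by (simp only: has_field_derivative_def)
  have 2: "((\<lambda>s. 1 / s ^ DIM('a)) has_real_derivative - (real DIM('a) / s) * (1 / s ^ DIM('a))) (at s)"
  proof -
    have "((\<lambda>s. inverse (s ^ DIM('a))) has_real_derivative - (inverse (s ^ DIM('a)) * (real DIM('a) * s ^ (DIM('a) - 1)) * inverse (s ^ DIM('a)))) (at s)"
      by (rule DERIV_cong[OF DERIV_inverse'[OF DERIV_pow]]) (use assms(2) in auto)
    moreover have "s ^ DIM('a) = s * s ^ (DIM('a) - 1)" by (metis DIM_positive power_eq_if less_numeral_extra(3))
    ultimately show ?thesis
      using assms(2) by (simp add: inverse_eq_divide field_simps)
  qed
  show ?thesis
    by (rule DERIV_cong[OF DERIV_mult[OF 2 1]]) (use assms(2) in \<open>simp add: radial_kernel_def field_simps\<close>)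
qed

lemma radial_kernel_props:
  fixes \<phi> :: "'a::euclidean_space \<Rightarrow> real"
  assumes "\<phi> \<in> test_functions (cball 0 1)"
  obtains B where "B > 0" "continuous_on UNIV (radial_kernel \<phi>)" "\<And>w. \<bar>radial_kernel \<phi> w\<bar> \<le> B * indicator (cball 0 1) w"
    "integral\<^sup>L lborel (radial_kernel \<phi>) = 0"
proof -
  obtain K where K: "\<phi> \<in> C_infinity" "compact K" "K \<subseteq> cball 0 1" "\<And>x. x \<notin> K \<Longrightarrow> \<phi> x = 0" using test_functionsE[OF assms] by metis
  have pd: "partial_deriv b \<phi> x = 0" if "x \<notin> K" for b x
    by (rule partial_deriv_zero_outside[OF compact_imp_closed[OF K(2)] _ that]) (use K(4) in auto)
  have c: "continuous_on UNIV \<phi>" "b \<in> Basis \<Longrightarrow> continuous_on UNIV (partial_deriv b \<phi>)" for b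
    using C_infinityD(3)[OF K(1)] C_infinityD(3)[OF C_infinityD(2)[OF K(1)]] by auto
  have rc: "continuous_on UNIV (radial_kernel \<phi>)"
    unfolding radial_kernel_def[abs_def] by (intro continuous_intros c)
  have rz: "radial_kernel \<phi> x = 0" if "x \<notin> K" for x using K(4)[OF that] pd[OF that] by (simp add: radial_kernel_def)
  have "compact (radial_kernel \<phi> ` cball 0 1)" by (intro compact_continuous_image continuous_on_subset[OF rc]) auto
  then obtain B where B: "B > 0" "\<And>x. x \<in> cball 0 1 \<Longrightarrow> \<bar>radial_kernel \<phi> x\<bar> \<le> B"
    using compact_imp_bounded[THEN bounded_pos[THEN iffD1]] by (metis imageI real_norm_def)
  have Bi: "\<bar>radial_kernel \<phi> w\<bar> \<le> B * indicator (cball 0 1) w" for w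
    using B(2)[of w] rz[of w] subsetD[OF K(3), of w] by (cases "w \<in> cball 0 1") auto
  note int = integrable_compact_support[OF K(2)]
  have "(LINT w|lborel. \<phi> w + (w \<bullet> b) * partial_deriv b \<phi> w) = 0" if b: "b \<in> Basis" for b
  proof (rule integral_directional_derivative_zero[OF K(2), of "\<lambda>w. (w \<bullet> b) * \<phi> w"])
    fix x
    have "((\<lambda>s. (x + s *\<^sub>R b) \<bullet> b) has_real_derivative 1) (at 0)"
      using b by (auto intro!: derivative_eq_intros simp: inner_add_left)
    from DERIV_mult[OF this C_infinity_directional_DERIV[OF K(1), of x b]]
    show "((\<lambda>s. (x + s *\<^sub>R b) \<bullet> b * \<phi> (x + s *\<^sub>R b)) has_real_derivative \<phi> x + x \<bullet> b * partial_deriv b \<phi> x) (at 0)"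
      by (simp add: mult.commute)
  qed (use K(4) pd c b in \<open>auto intro!: continuous_intros\<close>)
  then have "(\<Sum>b\<in>Basis. LINT w|lborel. \<phi> w + (w \<bullet> b) * partial_deriv b \<phi> w) = 0" by simp
  moreover have "(\<Sum>b\<in>Basis. LINT w|lborel. \<phi> w + (w \<bullet> b) * partial_deriv b \<phi> w) = (LINT w|lborel. (\<Sum>b\<in>Basis. \<phi> w + (w \<bullet> b) * partial_deriv b \<phi> w))"
    by (subst Bochner_Integration.integral_sum) (use c K(4) pd in \<open>auto intro!: int continuous_intros\<close>)
  moreover have "(\<lambda>w. \<Sum>b\<in>Basis. \<phi> w + (w \<bullet> b) * partial_deriv b \<phi> w) = radial_kernel \<phi>"
    by (auto simp: radial_kernel_def sum.distrib)
  ultimately have "integral\<^sup>L lborel (radial_kernel \<phi>) = 0" by simp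
  with B(1) rc Bi show ?thesis by (rule that)
qed

lemma partial_kernel_props:
  fixes \<phi> :: "'a::euclidean_space \<Rightarrow> real"
  assumes "\<phi> \<in> test_functions (cball 0 1)" "b \<in> Basis"
  obtains B where "B > 0" "continuous_on UNIV (partial_deriv b \<phi>)" "\<And>w. \<bar>partial_deriv b \<phi> w\<bar> \<le> B * indicator (cball 0 1) w"
    "integral\<^sup>L lborel (partial_deriv b \<phi>) = 0"
proof -
  obtain K where K: "\<phi> \<in> C_infinity" "compact K" "K \<subseteq> cball 0 1" "\<And>x. x \<notin> K \<Longrightarrow> \<phi> x = 0" using test_functionsE[OF assms(1)] by metis
  have pd: "partial_deriv b \<phi> x = 0" if "x \<notin> K" for x
    by (rule partial_deriv_zero_outside[OF compact_imp_closed[OF K(2)] _ that]) (use K(4) in auto)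
  have c: "continuous_on UNIV \<phi>" "continuous_on UNIV (partial_deriv b \<phi>)"
    using C_infinityD(3)[OF K(1)] C_infinityD(3)[OF C_infinityD(2)[OF K(1) assms(2)]] by auto
  obtain B R where B: "B > 0" "\<And>x. \<bar>partial_deriv b \<phi> x\<bar> \<le> B"
    using test_function_bounded[OF partial_deriv_test_function[OF assms]] by metis
  have Bi: "\<bar>partial_deriv b \<phi> w\<bar> \<le> B * indicator (cball 0 1) w" for w
    using B(2)[of w] pd[of w] subsetD[OF K(3), of w] by (cases "w \<in> cball 0 1") auto
  have "integral\<^sup>L lborel (partial_deriv b \<phi>) = 0"
    by (rule integral_directional_derivative_zero[OF K(2) K(4) pd C_infinity_directional_DERIV[OF K(1)] c])
  with B(1) c(2) Bi show ?thesis by (rule that)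
qed

lemma moll_vertical_DERIV:
  fixes g :: "'a::euclidean_space \<Rightarrow> real"
  assumes g[measurable]: "g \<in> borel_measurable borel" and fin: "pmass p g < \<infinity>" and p: "p \<ge> 1"
    and \<phi>: "\<phi> \<in> test_functions (cball 0 1)" and t: "t > 0"
  shows "((\<lambda>s. moll \<phi> s g y) has_real_derivative - (1 / t) * moll (radial_kernel \<phi>) t g y) (at t)"
proof -
  obtain B where B: "B > 0" "continuous_on UNIV (radial_kernel \<phi>)" "\<And>w. \<bar>radial_kernel \<phi> w\<bar> \<le> B * indicator (cball 0 1) w"
    using radial_kernel_props[OF \<phi>] by metis
  have C: "\<phi> \<in> C_infinity" using test_functionsE[OF \<phi>] by metis
  have [measurable]: "\<phi> \<in> borel_measurable borel" by (rule test_function_borel[OF \<phi>])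
  have [measurable]: "radial_kernel \<phi> \<in> borel_measurable borel" using B(2) by (rule borel_measurable_continuous_onI)
  let ?k = "\<lambda>s z. (1 / s ^ DIM('a)) * \<phi> ((1 / s) *\<^sub>R (z - y))"
  let ?d = "\<lambda>s z. - (1 / s) * ((1 / s ^ DIM('a)) * radial_kernel \<phi> ((1 / s) *\<^sub>R (z - y)))"
  let ?A = "cball y (2 * t)"
  define E where "E = (2 / t) * (2 / t) ^ DIM('a) * B"
  have E: "E \<ge> 0" using t B(1) by (simp add: E_def)
  have dle: "\<bar>?d s z\<bar> \<le> E * indicator ?A z" if s: "s \<in> ball t (t / 2)" for s z
  proof -
    have s': "t / 2 < s" "s < 2 * t" using s by (auto simp: dist_real_def abs_if split: if_splits)
    have sp: "s > 0" using s' t by simp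
    let ?w = "(1 / s) *\<^sub>R (z - y)"
    have "indicator (cball 0 1) ?w \<le> (indicator ?A z :: real)"
    proof (cases "?w \<in> cball 0 1")
      case True
      then have "norm (z - y) \<le> s" using sp by (simp add: divide_simps flip: scaleR_diff_right)
      then show ?thesis using s' by (auto simp: indicator_def dist_norm norm_minus_commute)
    qed simp
    then have "B * indicator (cball 0 1) ?w \<le> B * indicator ?A z" using B(1) by (intro mult_left_mono) auto
    then have a: "\<bar>radial_kernel \<phi> ?w\<bar> \<le> B * indicator ?A z" using B(3)[of ?w] by linarith
    have b: "1 / s \<le> 2 / t" using s' sp t by (simp add: divide_simps)
    then have b': "(1 / s) ^ DIM('a) \<le> (2 / t) ^ DIM('a)" using sp by (intro power_mono) auto
    have "(1 / s) * ((1 / s) ^ DIM('a) * \<bar>radial_kernel \<phi> ?w\<bar>) \<le> (2 / t) * ((2 / t) ^ DIM('a) * (B * indicator ?A z))"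
      using a b b' t sp by (intro mult_mono) auto
    then show ?thesis using sp by (simp add: abs_mult power_one_over E_def mult.assoc)
  qed
  have D: "((\<lambda>s. ?k s z) has_real_derivative ?d s z) (at s)" if "s > 0" for s z
    by (rule dilation_DERIV[OF C that])
  have "((\<lambda>s. LINT z|lborel. g z * ?k s z) has_derivative (\<lambda>h. LINT z|lborel. g z * (?d t z * h))) (at t)"
  proof (rule has_derivative_integral_kernel[where r = "t / 2" and B = "\<lambda>z. E * indicator ?A z"])
    show "((\<lambda>s. ?k s z) has_derivative (\<lambda>h. ?d t z * h)) (at t)" for z
      using D[OF t, of z] unfolding has_field_derivative_def .
    show "\<bar>?k s z - ?k t z\<bar> \<le> E * indicator ?A z * norm (s - t)" if s: "s \<in> ball t (t / 2)" for s z
    proof -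
      have "norm (?k s z - ?k t z) \<le> E * indicator ?A z * norm (s - t)"
      proof (rule field_differentiable_bound[OF convex_ball[of t "t / 2"]])
        fix s assume "s \<in> ball t (t / 2)"
        then have "s > 0" using t by (auto simp: dist_real_def abs_if split: if_splits)
        from D[OF this, of z] show "((\<lambda>s. ?k s z) has_real_derivative ?d s z) (at s within ball t (t / 2))"
          by (rule has_field_derivative_at_within)
      qed (use dle s t in auto)
      then show ?thesis by simp
    qed
    show "\<bar>?d t z * h\<bar> \<le> E * indicator ?A z * norm h" for z h
      unfolding abs_mult[of _ h] real_norm_def by (rule mult_right_mono[OF dle]) (use t in auto)
    show "integrable lborel (\<lambda>z. g z * (E * indicator ?A z))"
      by (rule Lp_bounded_set_integrable[where A = ?A and B = E, OF _ _ _ _ p]) (use fin E emeasure_cball_fin in \<open>auto intro!: borel_measurable_times borel_measurable_indicator\<close>)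
    show "integrable lborel (\<lambda>z. g z * ?k s z)" if "s \<in> ball t (t / 2)" for s
    proof (rule Lp_test_integrable[OF g fin p])
      have "s > 0" using that t by (auto simp: dist_real_def abs_if split: if_splits)
      then show "(\<lambda>z. ?k s z) \<in> test_functions UNIV" by (intro test_function_affine[OF \<phi>]) auto
    qed
    show "(\<lambda>z. g z * (?d t z * h)) \<in> borel_measurable lborel" for h by measurable
  qed (use t E in auto)
  moreover have "(LINT z|lborel. g z * (?d t z * h)) = (- (1 / t) * moll (radial_kernel \<phi>) t g y) * h" for h
  proof -
    have "(LINT z|lborel. g z * (?d t z * h)) = (LINT z|lborel. (- (1 / t) * h) * (g z * ((1 / t ^ DIM('a)) * radial_kernel \<phi> ((1 / t) *\<^sub>R (z - y)))))"
      by (intro Bochner_Integration.integral_cong) (auto simp: mult_ac)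
    also have "\<dots> = (- (1 / t) * h) * moll (radial_kernel \<phi>) t g y"
      by (subst moll_eq_corr[OF g _ t]) auto
    finally show ?thesis by simp
  qed
  ultimately have d: "((\<lambda>s. LINT z|lborel. g z * ?k s z) has_real_derivative - (1 / t) * moll (radial_kernel \<phi>) t g y) (at t)"
    by (simp only: has_field_derivative_def)
  have "\<forall>\<^sub>F s in nhds t. moll \<phi> s g y = (LINT z|lborel. g z * ?k s z)"
  proof (rule eventually_mono[OF eventually_nhds_in_open[of "{0<..}" t]])
    fix s :: real assume "s \<in> {0<..}"
    then show "moll \<phi> s g y = (LINT z|lborel. g z * ?k s z)" by (intro moll_eq_corr) auto
  qed (use t in auto)
  then show ?thesis using d by (subst DERIV_cong_ev[OF refl _ refl]) auto
qed

text \<open>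
  Since \<open>\<psi>\<close> has mean zero, \<open>g y\<close> can be subtracted from \<open>g (y + t *\<^sub>R x)\<close> under the integral.
  Jensen's inequality for the uniform distribution on the unit ball then leaves the mean of the
  shift masses over the ball of radius \<open>t\<close>.
\<close>

lemma moll_mean_zero_mass:
  fixes g :: "'a::euclidean_space \<Rightarrow> real"
  assumes g[measurable]: "g \<in> borel_measurable borel" and fin: "pmass p g < \<infinity>" and p: "p \<ge> 1"
    and \<psi>[measurable]: "\<psi> \<in> borel_measurable borel" and b: "\<And>w. \<bar>\<psi> w\<bar> \<le> B * indicator (cball 0 1) w" and z: "integral\<^sup>L lborel \<psi> = 0" and t: "t > 0"
  shows "pmass p (moll \<psi> t g) \<le> ennreal ((B * unit_ball_vol (real DIM('a))) powr p / unit_ball_vol (real DIM('a))) *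
    (ennreal (1 / t ^ DIM('a)) * (\<integral>\<^sup>+h. indicator (ball 0 t) h * shift_mass p g h \<partial>lborel))"
proof -
  define w where "w = unit_ball_vol (real DIM('a))"
  have w: "w > 0" by (simp add: w_def)
  let ?A = "cball (0::'a) 1"
  have B: "B \<ge> 0" using b[of 0] by simp
  have Af: "emeasure lborel ?A = ennreal w" by (simp add: emeasure_cball w_def)
  define C where "C = (B * w) powr p / w"
  have C: "C \<ge> 0" using w by (simp add: C_def)
  define \<kappa> where "\<kappa> = (\<lambda>x::'a. indicator ?A x / w)"
  have \<kappa>m [measurable]: "\<kappa> \<in> borel_measurable lborel" unfolding \<kappa>_def by (intro borel_measurable_divide borel_measurable_indicator) auto
  have \<kappa>1: "(\<integral>\<^sup>+x. ennreal (\<kappa> x) \<partial>lborel) = 1"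
  proof -
    have "(\<integral>\<^sup>+x. ennreal (\<kappa> x) \<partial>lborel) = (\<integral>\<^sup>+x. ennreal (1 / w) * indicator ?A x \<partial>lborel)"
      by (intro nn_integral_cong) (auto simp: \<kappa>_def indicator_def)
    also have "\<dots> = ennreal (1 / w) * ennreal w" using Af by (subst nn_integral_cmult_indicator) auto
    also have "\<dots> = 1" using w by (simp add: ennreal_mult[symmetric])
    finally show ?thesis .
  qed
  have i\<psi>: "integrable lborel \<psi>"
  proof (rule integrableI_bounded_set[where A = ?A and B = B])
    show "AE x in lborel. x \<in> ?A \<longrightarrow> norm (\<psi> x) \<le> B" using b by (auto intro!: AE_I2) (metis (full_types) indicator_simps(1) mem_cball_0 mult.right_neutral)
    show "AE x in lborel. x \<notin> ?A \<longrightarrow> \<psi> x = 0"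
    proof (intro AE_I2 impI)
      fix x :: 'a assume "x \<notin> ?A"
      then show "\<psi> x = 0" using b[of x] by simp
    qed
  qed (use Af in auto)
  have pt: "ennreal (\<bar>moll \<psi> t g y\<bar> powr p) \<le> (\<integral>\<^sup>+x. ennreal C * (ennreal (\<bar>g (y + t *\<^sub>R x) - g y\<bar> powr p) * indicator ?A x) \<partial>lborel)" for y
  proof -
    have i1: "integrable lborel (\<lambda>x. g (y + t *\<^sub>R x) * \<psi> x)"
    proof (rule Lp_bounded_set_integrable[where A = ?A and B = B, OF _ _ _ _ p b])
      have "pmass p (\<lambda>x. g (y + t *\<^sub>R x)) = ennreal (1 / t ^ DIM('a)) * pmass p g"
        unfolding Lp_mass_def by (rule nn_integral_scale) (use t in auto)
      then show "pmass p (\<lambda>x. g (y + t *\<^sub>R x)) < \<infinity>" using fin by (simp add: ennreal_mult_less_top)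
    qed (use Af in auto)
    have "moll \<psi> t g y = (LINT x|lborel. g (y + t *\<^sub>R x) * \<psi> x) - (LINT x|lborel. g y * \<psi> x)"
      using z by (simp add: moll_def)
    also have "\<dots> = (LINT x|lborel. g (y + t *\<^sub>R x) * \<psi> x - g y * \<psi> x)" using i1 i\<psi> by simp
    also have "\<dots> = (LINT x|lborel. ((g (y + t *\<^sub>R x) - g y) * \<psi> x * w) * \<kappa> x)"
    proof (rule Bochner_Integration.integral_cong[OF refl])
      fix x
      show "g (y + t *\<^sub>R x) * \<psi> x - g y * \<psi> x = ((g (y + t *\<^sub>R x) - g y) * \<psi> x * w) * \<kappa> x"
        using w b[of x] by (cases "x \<in> ?A") (auto simp: \<kappa>_def algebra_simps)
    qed
    finally have "ennreal (\<bar>moll \<psi> t g y\<bar> powr p) = ennreal (\<bar>LINT x|lborel. ((g (y + t *\<^sub>R x) - g y) * \<psi> x * w) * \<kappa> x\<bar> powr p)" by simp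
    also have "\<dots> \<le> (\<integral>\<^sup>+x. ennreal (\<bar>(g (y + t *\<^sub>R x) - g y) * \<psi> x * w\<bar> powr p * \<kappa> x) \<partial>lborel)"
    proof (rule jensen_powr)
      show "\<kappa> x \<ge> 0" for x using w by (simp add: \<kappa>_def)
    qed (use \<kappa>1 p \<kappa>m in auto)
    also have "\<dots> \<le> (\<integral>\<^sup>+x. ennreal C * (ennreal (\<bar>g (y + t *\<^sub>R x) - g y\<bar> powr p) * indicator ?A x) \<partial>lborel)"
    proof (rule nn_integral_mono)
      fix x
      show "ennreal (\<bar>(g (y + t *\<^sub>R x) - g y) * \<psi> x * w\<bar> powr p * \<kappa> x) \<le> ennreal C * (ennreal (\<bar>g (y + t *\<^sub>R x) - g y\<bar> powr p) * indicator ?A x)"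
      proof (cases "x \<in> ?A")
        case True
        have "\<bar>(g (y + t *\<^sub>R x) - g y) * \<psi> x * w\<bar> \<le> \<bar>g (y + t *\<^sub>R x) - g y\<bar> * (B * w)"
          using b[of x] True w by (simp add: abs_mult mult_left_mono mult_right_mono mult.assoc)
        then have "\<bar>(g (y + t *\<^sub>R x) - g y) * \<psi> x * w\<bar> powr p \<le> (\<bar>g (y + t *\<^sub>R x) - g y\<bar> * (B * w)) powr p"
          using p by (intro powr_mono2) auto
        also have "\<dots> = \<bar>g (y + t *\<^sub>R x) - g y\<bar> powr p * (B * w) powr p" using B w by (simp add: powr_mult)
        finally have "\<bar>(g (y + t *\<^sub>R x) - g y) * \<psi> x * w\<bar> powr p * (1 / w) \<le> (\<bar>g (y + t *\<^sub>R x) - g y\<bar> powr p * (B * w) powr p) * (1 / w)"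
          using w by (intro mult_right_mono) auto
        then have "ennreal (\<bar>(g (y + t *\<^sub>R x) - g y) * \<psi> x * w\<bar> powr p * (1 / w)) \<le> ennreal (C * \<bar>g (y + t *\<^sub>R x) - g y\<bar> powr p)"
          by (intro ennreal_leI) (simp add: C_def mult_ac)
        then show ?thesis using True C by (simp add: \<kappa>_def ennreal_mult)
      qed (simp add: \<kappa>_def)
    qed
    finally show ?thesis .
  qed
  have indm [measurable]: "(indicator ?A :: 'a \<Rightarrow> ennreal) \<in> borel_measurable borel" by (rule borel_measurable_indicator) auto
  have "pmass p (moll \<psi> t g) \<le> (\<integral>\<^sup>+y. \<integral>\<^sup>+x. ennreal C * (ennreal (\<bar>g (y + t *\<^sub>R x) - g y\<bar> powr p) * indicator ?A x) \<partial>lborel \<partial>lborel)"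
    unfolding Lp_mass_def by (intro nn_integral_mono pt)
  also have "\<dots> = (\<integral>\<^sup>+x. \<integral>\<^sup>+y. ennreal C * (ennreal (\<bar>g (y + t *\<^sub>R x) - g y\<bar> powr p) * indicator ?A x) \<partial>lborel \<partial>lborel)"
    by (rule lborel_pair.Fubini') measurable
  also have "\<dots> = (\<integral>\<^sup>+x. ennreal C * (indicator ?A x * shift_mass p g (t *\<^sub>R x)) \<partial>lborel)"
  proof (rule nn_integral_cong)
    fix x :: 'a
    have "(\<integral>\<^sup>+y. ennreal C * (ennreal (\<bar>g (y + t *\<^sub>R x) - g y\<bar> powr p) * indicator ?A x) \<partial>lborel) = ennreal C * ((\<integral>\<^sup>+y. ennreal (\<bar>g (y + t *\<^sub>R x) - g y\<bar> powr p) \<partial>lborel) * indicator ?A x)"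
      by (simp add: nn_integral_cmult nn_integral_multc)
    then show "(\<integral>\<^sup>+y. ennreal C * (ennreal (\<bar>g (y + t *\<^sub>R x) - g y\<bar> powr p) * indicator ?A x) \<partial>lborel) = ennreal C * (indicator ?A x * shift_mass p g (t *\<^sub>R x))"
      by (simp add: shift_mass_def Lp_mass_def mult.commute)
  qed
  also have "\<dots> = (\<integral>\<^sup>+x. ennreal C * (indicator (cball 0 t) (0 + t *\<^sub>R x) * shift_mass p g (0 + t *\<^sub>R x)) \<partial>lborel)"
    using t by (intro nn_integral_cong) (auto simp: indicator_def)
  also have "\<dots> = ennreal (1 / t ^ DIM('a)) * (\<integral>\<^sup>+h. ennreal C * (indicator (cball 0 t) h * shift_mass p g h) \<partial>lborel)"
  proof (rule nn_integral_scale[OF _ t])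
    have [measurable]: "shift_mass p g \<in> borel_measurable borel" by (rule shift_mass_borel[OF g])
    have [measurable]: "(indicator (cball 0 t) :: 'a \<Rightarrow> ennreal) \<in> borel_measurable borel" by (rule borel_measurable_indicator) auto
    show "(\<lambda>h. ennreal C * (indicator (cball 0 t) h * shift_mass p g h)) \<in> borel_measurable borel" by measurable
  qed
  also have "(\<integral>\<^sup>+h. ennreal C * (indicator (cball 0 t) h * shift_mass p g h) \<partial>lborel) = (\<integral>\<^sup>+h. ennreal C * (indicator (ball 0 t) h * shift_mass p g h) \<partial>lborel)"
  proof (rule nn_integral_cong_AE)
    have "emeasure lborel (sphere (0::'a) t) = 0"
      using negligible_sphere[of "0::'a" t] by (simp add: negligible_iff_null_sets null_sets_completion_iff null_sets_def)
    then have "AE h in lborel. h \<notin> sphere (0::'a) t" by (intro AE_not_in) (auto simp: null_sets_def)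
    then show "AE h in lborel. ennreal C * (indicator (cball 0 t) h * shift_mass p g h) = ennreal C * (indicator (ball 0 t) h * shift_mass p g h)"
      by eventually_elim (auto simp: indicator_def)
  qed
  also have "(\<integral>\<^sup>+h. ennreal C * (indicator (ball 0 t) h * shift_mass p g h) \<partial>lborel) = ennreal C * (\<integral>\<^sup>+h. indicator (ball 0 t) h * shift_mass p g h \<partial>lborel)"
  proof (rule nn_integral_cmult)
    have [measurable]: "shift_mass p g \<in> borel_measurable borel" by (rule shift_mass_borel[OF g])
    have [measurable]: "(indicator (ball 0 t) :: 'a \<Rightarrow> ennreal) \<in> borel_measurable borel" by (rule borel_measurable_indicator) auto
    show "(\<lambda>h. indicator (ball 0 t) h * shift_mass p g h) \<in> borel_measurable lborel" by measurable
  qed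
  finally show ?thesis by (simp add: C_def w_def mult.left_commute)
qed

section \<open>Extension from the boundary\<close>

lemma Basis_pair_cases:
  assumes "e \<in> (Basis :: ('a::euclidean_space \<times> real) set)"
  obtains b where "b \<in> Basis" "e = (b, 0)" | "e = (0, 1)"
  using assms by (auto simp: Basis_prod_def)

lemma continuous_half_space_borel:
  fixes V :: "'a::euclidean_space \<times> real \<Rightarrow> real"
  assumes "continuous_on half_space V"
  shows "(\<lambda>x. indicator half_space x * V x) \<in> borel_measurable borel"
  using borel_measurable_continuous_on_indicator[OF half_space_borel assms] by simp

lemma cutoff_mass_finite:
  fixes V :: "'a::euclidean_space \<times> real \<Rightarrow> real"
  assumes V: "continuous_on half_space V" and c: "continuous_on UNIV c" "\<And>t. t > 0 \<Longrightarrow> \<bar>c t\<bar> \<le> K * indicator {0<..<1} t"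
    and m: "\<And>t. t > 0 \<Longrightarrow> pmass p (\<lambda>y. V (y, t)) \<le> M" and p: "p > 0" and M: "M < \<infinity>"
  shows "pmass p (\<lambda>x. indicator half_space x * (c (snd x) * V x)) < \<infinity>"
proof -
  have "continuous_on half_space (\<lambda>x. c (snd x) * V x)"
    by (intro continuous_intros V continuous_on_compose2[OF c(1)]) auto
  then have "pmass p (\<lambda>x. indicator half_space x * (c (snd x) * V x)) = (\<integral>\<^sup>+t. indicator {0<..} t * pmass p (\<lambda>y. c t * V (y, t)) \<partial>lborel)"
    by (subst half_space_mass_slices[OF continuous_half_space_borel]) simp_all
  also have "\<dots> \<le> (\<integral>\<^sup>+t. (ennreal (\<bar>K\<bar> powr p) * M) * indicator {0<..<1::real} t \<partial>lborel)"
  proof (rule nn_integral_mono)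
    fix t :: real
    show "indicator {0<..} t * pmass p (\<lambda>y. c t * V (y, t)) \<le> (ennreal (\<bar>K\<bar> powr p) * M) * indicator {0<..<1} t"
    proof (cases "t > 0")
      case True
      have vm: "(\<lambda>y. V (y, t)) \<in> borel_measurable borel"
        by (intro borel_measurable_continuous_onI continuous_on_compose2[OF V]) (auto intro!: continuous_intros simp: half_space_iff True)
      have "pmass p (\<lambda>y. c t * V (y, t)) = ennreal (\<bar>c t\<bar> powr p) * pmass p (\<lambda>y. V (y, t))"
        using vm by (subst Lp_mass_scale) auto
      also have "\<dots> \<le> ennreal (\<bar>K\<bar> powr p * indicator {0<..<1} t) * M"
      proof (intro mult_mono m True ennreal_leI)
        have "\<bar>c t\<bar> \<le> \<bar>K\<bar> * indicator {0<..<1} t" using c(2)[OF True] by (auto simp: indicator_def split: if_splits)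
        then have "\<bar>c t\<bar> powr p \<le> (\<bar>K\<bar> * indicator {0<..<1} t) powr p" using p by (intro powr_mono2) auto
        then show "\<bar>c t\<bar> powr p \<le> \<bar>K\<bar> powr p * indicator {0<..<1} t" by (auto simp: indicator_def split: if_splits)
      qed auto
      finally show ?thesis using True by (auto simp: indicator_def split: if_splits)
    qed simp
  qed
  also have "\<dots> = ennreal (\<bar>K\<bar> powr p) * M" by (subst nn_integral_cmult_indicator) auto
  also have "\<dots> < \<infinity>" using M by (simp add: ennreal_mult_less_top)
  finally show ?thesis .
qed

text \<open>
  At height \<open>t\<close> the mass is at most \<open>t powr - p\<close> times the bound of \<open>moll_mean_zero_mass\<close>; this is
  a multiple of the integrand of \<open>gag\<close> at \<open>r = t\<close>.
\<close>

lemma kernel_derivative_mass_finite: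
  fixes g :: "'a::euclidean_space \<Rightarrow> real"
  assumes g: "g \<in> borel_measurable borel" and fin: "pmass p g < \<infinity>" "gag p g < \<infinity>" and p: "p > 1"
    and \<psi>: "continuous_on UNIV \<psi>" "\<And>w. \<bar>\<psi> w\<bar> \<le> B * indicator (cball 0 1) w" "integral\<^sup>L lborel \<psi> = 0"
  shows "continuous_on half_space (\<lambda>x. cutoff (snd x) * (- (1 / snd x) * moll \<psi> (snd x) g (fst x)))"
    "pmass p (\<lambda>x. indicator half_space x * (cutoff (snd x) * (- (1 / snd x) * moll \<psi> (snd x) g (fst x)))) < \<infinity>"
proof -
  have p1: "p \<ge> 1" using p by simp
  note cc = continuous_on_cutoff(1)
  show c: "continuous_on half_space (\<lambda>x. cutoff (snd x) * (- (1 / snd x) * moll \<psi> (snd x) g (fst x)))"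
    by (intro continuous_intros moll_jointly_continuous[OF g fin(1) p1 \<psi>(1,2)] continuous_on_compose2[OF cc]) (auto simp: half_space_iff)
  have \<psi>m: "\<psi> \<in> borel_measurable borel" using \<psi>(1) by (rule borel_measurable_continuous_onI)
  let ?C = "ennreal ((B * unit_ball_vol (real DIM('a))) powr p / unit_ball_vol (real DIM('a)))"
  let ?I = "\<lambda>t. (\<integral>\<^sup>+h. indicator (ball 0 t) h * shift_mass p g h \<partial>lborel)"
  have "pmass p (\<lambda>x. indicator half_space x * (cutoff (snd x) * (- (1 / snd x) * moll \<psi> (snd x) g (fst x)))) =
     (\<integral>\<^sup>+t. indicator {0<..} t * pmass p (\<lambda>y. cutoff t * (- (1 / t) * moll \<psi> t g y)) \<partial>lborel)"
    using half_space_mass_slices[OF continuous_half_space_borel[OF c]] by simp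
  also have "\<dots> \<le> (\<integral>\<^sup>+t. ?C * (ennreal (t powr - (real DIM('a) + p)) * indicator {0<..} t * ?I t) \<partial>lborel)"
  proof (rule nn_integral_mono)
    fix t :: real
    show "indicator {0<..} t * pmass p (\<lambda>y. cutoff t * (- (1 / t) * moll \<psi> t g y)) \<le> ?C * (ennreal (t powr - (real DIM('a) + p)) * indicator {0<..} t * ?I t)"
    proof (cases "t > 0")
      case True
      have "pmass p (\<lambda>y. cutoff t * (- (1 / t) * moll \<psi> t g y)) \<le> pmass p (\<lambda>y. (1 / t) * moll \<psi> t g y)"
        by (rule Lp_mass_mono) (use p True cutoff_bounds(1,2)[of t] in \<open>auto simp: abs_mult intro!: divide_right_mono mult_left_le_one_le\<close>)
      also have "\<dots> = ennreal ((1 / t) powr p) * pmass p (moll \<psi> t g)"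
        using moll_borel[OF \<psi>m g, of t] True by (subst Lp_mass_scale) auto
      also have "\<dots> \<le> ennreal ((1 / t) powr p) * (?C * (ennreal (1 / t ^ DIM('a)) * ?I t))"
        by (intro mult_left_mono moll_mean_zero_mass[OF g fin(1) p1 \<psi>m \<psi>(2,3) True]) auto
      also have "\<dots> = ?C * ((ennreal ((1 / t) powr p) * ennreal (1 / t ^ DIM('a))) * ?I t)"
        by (simp only: mult_ac)
      also have "ennreal ((1 / t) powr p) * ennreal (1 / t ^ DIM('a)) = ennreal (t powr - (real DIM('a) + p))"
      proof -
        have "(1 / t) powr p = t powr - p" using True by (simp add: powr_divide powr_minus inverse_eq_divide)
        moreover have "1 / t ^ DIM('a) = t powr - real DIM('a)" using True by (simp add: powr_minus powr_realpow inverse_eq_divide)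
        ultimately have "(1 / t) powr p * (1 / t ^ DIM('a)) = t powr (- p + - real DIM('a))" by (simp only: powr_add)
        then have "(1 / t) powr p * (1 / t ^ DIM('a)) = t powr - (real DIM('a) + p)" by (simp add: add.commute)
        then show ?thesis using True by (simp add: ennreal_mult[symmetric])
      qed
      finally show ?thesis using True by simp
    qed simp
  qed
  also have "\<dots> = ?C * gag p g"
    unfolding gag_def
  proof (rule nn_integral_cmult)
    have [measurable]: "shift_mass p g \<in> borel_measurable borel" by (rule shift_mass_borel[OF g])
    note [measurable] = indicator_ball_jointly_borel
    show "(\<lambda>r. ennreal (r powr - (real DIM('a) + p)) * indicator {0<..} r * ?I r) \<in> borel_measurable lborel"
      by measurable
  qed
  also have "\<dots> < \<infinity>" using fin(2) by (simp add: ennreal_mult_less_top)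
  finally show "pmass p (\<lambda>x. indicator half_space x * (cutoff (snd x) * (- (1 / snd x) * moll \<psi> (snd x) g (fst x)))) < \<infinity>" .
qed

text \<open>
  Mollification at scale \<open>t\<close> as extension to height \<open>t\<close>. Horizontal derivatives produce the
  kernels \<open>partial_deriv b \<phi>\<close>, the vertical one \<open>radial_kernel \<phi>\<close>, each with a factor \<open>1 / t\<close>.
  Derivatives of the cutoff occur only at heights between \<open>1/2\<close> and \<open>1\<close>, where the mass of \<open>g\<close>
  suffices.
\<close>

lemma gagliardo_extension:
  fixes g :: "'a::euclidean_space \<Rightarrow> real"
  assumes g: "g \<in> borel_measurable borel" and fin: "pmass p g < \<infinity>" "gag p g < \<infinity>" and p: "p > 1"
  shows "g \<in> trace_image p (W1p half_space p)"
proof -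
  have p1: "p \<ge> 1" using p by simp
  obtain \<phi> where phi: "\<phi> \<in> test_functions (cball (0::'a) 1)" "\<And>x. \<phi> x \<ge> 0" "integral\<^sup>L lborel \<phi> = 1"
    using exists_mollifier[of 1 "0::'a"] by auto
  interpret mollifier \<phi> "cball 0 1" by unfold_locales (use phi in auto)
  have C: "\<phi> \<in> C_infinity" using test_functionsE[OF phi(1)] by metis
  have \<phi>c: "continuous_on UNIV \<phi>" using C_infinityD(3)[OF C] .
  obtain K where K: "K \<subseteq> cball 0 1" "\<And>x. x \<notin> K \<Longrightarrow> \<phi> x = 0" using test_functionsE[OF phi(1)] by metis
  obtain B0 R0 where B0: "B0 > 0" "\<And>x. \<bar>\<phi> x\<bar> \<le> B0" using test_function_bounded[OF phi(1)] by metis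
  have \<phi>b: "\<bar>\<phi> w\<bar> \<le> B0 * indicator (cball 0 1) w" for w
    using B0(2)[of w] K(2)[of w] subsetD[OF K(1), of w] by (cases "w \<in> cball 0 1") auto
  obtain Br where Br: "continuous_on UNIV (radial_kernel \<phi>)" "\<And>w. \<bar>radial_kernel \<phi> w\<bar> \<le> Br * indicator (cball 0 1) w" "integral\<^sup>L lborel (radial_kernel \<phi>) = 0"
    using radial_kernel_props[OF phi(1)] by metis
  define F where "F = (\<lambda>x. moll \<phi> (snd x) g (fst x))"
  have Fc: "continuous_on half_space F" unfolding F_def by (rule moll_jointly_continuous[OF g fin(1) p1 \<phi>c \<phi>b])
  have Fm: "pmass p (\<lambda>y. F (y, t)) \<le> pmass p g" for t
    unfolding F_def using moll_mass_le[OF g p1, of t] by simp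
  note cc = continuous_on_cutoff
  have ccs: "continuous_on A (\<lambda>x. cutoff (snd x))" "continuous_on A (\<lambda>x. cutoff' (snd x))" for A :: "('a \<times> real) set"
    by (intro continuous_on_compose2[OF cc(1)] continuous_on_compose2[OF cc(2)] continuous_intros; simp)+
  define f where "f = (\<lambda>x. cutoff (snd x) * F x)"
  define D where "D = (\<lambda>(e :: 'a \<times> real) x. if snd e = 0 then cutoff (snd x) * (- (1 / snd x) * moll (partial_deriv (fst e) \<phi>) (snd x) g (fst x))
     else cutoff' (snd x) * F x + cutoff (snd x) * (- (1 / snd x) * moll (radial_kernel \<phi>) (snd x) g (fst x)))"
  have Dc: "continuous_on half_space (D e)" and Dfin: "pmass p (\<lambda>x. indicator half_space x * D e x) < \<infinity>" if "e \<in> Basis" for e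
  proof -
    have "continuous_on half_space (D e) \<and> pmass p (\<lambda>x. indicator half_space x * D e x) < \<infinity>"
    using that proof (cases e rule: Basis_pair_cases)
      case (1 b)
      obtain B where B: "continuous_on UNIV (partial_deriv b \<phi>)" "\<And>w. \<bar>partial_deriv b \<phi> w\<bar> \<le> B * indicator (cball 0 1) w" "integral\<^sup>L lborel (partial_deriv b \<phi>) = 0"
        using partial_kernel_props[OF phi(1) 1(1)] by metis
      show ?thesis using kernel_derivative_mass_finite[OF g fin p B] 1 by (simp add: D_def)
    next
      case 2
      let ?X = "\<lambda>x. cutoff' (snd x) * F x" and ?Y = "\<lambda>x. cutoff (snd x) * (- (1 / snd x) * moll (radial_kernel \<phi>) (snd x) g (fst x))"
      note Y = kernel_derivative_mass_finite[OF g fin p Br]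
      have X: "continuous_on half_space ?X" by (intro continuous_intros Fc ccs)
      have Xf: "pmass p (\<lambda>x. indicator half_space x * ?X x) < \<infinity>"
        by (rule cutoff_mass_finite[OF Fc cc(2) cutoff_le_indicator(2) Fm]) (use p fin in auto)
      have "pmass p (\<lambda>x. indicator half_space x * ?X x + indicator half_space x * ?Y x) \<le> ennreal (2 powr p) *
        (pmass p (\<lambda>x. indicator half_space x * ?X x) + pmass p (\<lambda>x. indicator half_space x * ?Y x))"
        by (rule Lp_mass_add) (use continuous_half_space_borel[OF X] continuous_half_space_borel[OF Y(1)] p in auto)
      also have "\<dots> < \<infinity>" using Xf Y(2) by (simp add: ennreal_mult_less_top)
      finally have "pmass p (\<lambda>x. indicator half_space x * (?X x + ?Y x)) < \<infinity>" by (simp only: distrib_left)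
      moreover have "continuous_on half_space (\<lambda>x. ?X x + ?Y x)" by (rule continuous_on_add[OF X Y(1)])
      ultimately show ?thesis using 2 by (simp add: D_def)
    qed
    then show "continuous_on half_space (D e)" "pmass p (\<lambda>x. indicator half_space x * D e x) < \<infinity>" by auto
  qed
  have der: "((\<lambda>s. f (x + s *\<^sub>R e)) has_real_derivative D e x) (at 0)" if x: "x \<in> half_space" and e: "e \<in> Basis" for x e
  proof -
    obtain y t where xy: "x = (y, t)" by (cases x)
    have t: "t > 0" using x by (simp add: xy half_space_iff)
    show ?thesis
      using e
    proof (cases e rule: Basis_pair_cases)
      case (1 b)
      have "((\<lambda>s. moll \<phi> t g (y + s *\<^sub>R b)) has_real_derivative partial_deriv b (moll \<phi> t g) y) (at 0)"
        by (rule C_infinity_directional_DERIV[OF moll_smooth(1)[OF g fin(1) p1 phi(1) t]])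
      then have "((\<lambda>s. moll \<phi> t g (y + s *\<^sub>R b)) has_real_derivative - (1 / t) * moll (partial_deriv b \<phi>) t g y) (at 0)"
        unfolding moll_smooth(3)[OF g fin(1) p1 phi(1) t 1(1)] .
      then have "((\<lambda>s. cutoff t * moll \<phi> t g (y + s *\<^sub>R b)) has_real_derivative cutoff t * (- (1 / t) * moll (partial_deriv b \<phi>) t g y)) (at 0)"
        by (rule DERIV_cmult)
      then show ?thesis using 1 by (simp add: f_def F_def D_def xy)
    next
      case 2
      have "((\<lambda>s. cutoff s * moll \<phi> s g y) has_real_derivative cutoff' t * moll \<phi> t g y + (- (1 / t) * moll (radial_kernel \<phi>) t g y) * cutoff t) (at t)"
        by (rule DERIV_mult[OF DERIV_cutoff moll_vertical_DERIV[OF g fin(1) p1 phi(1) t]])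
      then have "((\<lambda>s. cutoff (t + s) * moll \<phi> (t + s) g y) has_real_derivative cutoff' t * moll \<phi> t g y + cutoff t * (- (1 / t) * moll (radial_kernel \<phi>) t g y)) (at 0)"
        using DERIV_shift[of "\<lambda>s. cutoff s * moll \<phi> s g y" _ 0 t] by (simp add: mult.commute add.commute)
      then show ?thesis using 2 by (simp add: f_def F_def D_def xy)
    qed
  qed
  have fc: "continuous_on half_space f" unfolding f_def by (intro continuous_intros Fc ccs)
  have ffin: "pmass p (\<lambda>x. indicator half_space x * f x) < \<infinity>"
    unfolding f_def by (rule cutoff_mass_finite[where K = 1, OF Fc cc(1) _ Fm]) (use p fin cutoff_le_indicator(1) in auto)
  define e where "e = (\<lambda>k. 1 / (real k + 2))"
  have e0: "e \<longlonglongrightarrow> 0"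
    using LIMSEQ_ignore_initial_segment[OF lim_1_over_n, of 2] by (simp add: e_def add.commute)
  have e: "e k > 0" "e k \<le> 1 / 2" for k by (auto simp: e_def field_simps)
  obtain s where s: "strict_mono s" "AE y in lborel. (\<lambda>k. moll \<phi> (e (s k)) g y - g y) \<longlonglongrightarrow> 0"
    using Lp_mass_subseq_AE[of "\<lambda>k y. moll \<phi> (e k) g y - g y" lborel p] moll_tendsto[OF g fin(1) p1 e0 e(1)] moll_borel[OF borel g] g p by auto
  show ?thesis
  proof (rule etr_rep_classical_limit[OF fc Dc der ffin Dfin p1, where d = "\<lambda>k. e (s k)"])
    show "0 < e (s k)" for k by (rule e)
    show "e (s k) < 1" for k using e(2)[of "s k"] by simp
    show "(\<lambda>k. e (s k)) \<longlonglongrightarrow> 0" using LIMSEQ_subseq_LIMSEQ[OF e0 s(1)] by (simp add: comp_def)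
    show "AE y in lborel. (\<lambda>k. f (y, e (s k))) \<longlonglongrightarrow> g y"
      using s(2)
    proof eventually_elim
      case (elim y)
      have "f (y, e (s k)) = moll \<phi> (e (s k)) g y" for k using cutoff_bounds(3)[OF e(2)] by (simp add: f_def F_def)
      then show ?case using elim by (simp add: LIM_zero_iff)
    qed
  qed auto
qed

lemma Wsp_iff:
  fixes g :: "'a::euclidean_space \<Rightarrow> real"
  assumes z: "zrep UNIV g g'" and p: "p > 1"
  shows "g \<in> Wsp (1 - 1 / p) p \<longleftrightarrow> pmass p g' < \<infinity> \<and> gag p g' < \<infinity>"
proof -
  have g' [measurable]: "g' \<in> borel_measurable borel" and ae: "AE x in lborel. g x = g' x" using z by (auto simp: zrep_def)
  have sp: "(1 - 1 / p) * p = p - 1" using p by (simp add: left_diff_distrib)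
  define F where "F = (\<lambda>h (z :: 'a \<times> 'a). \<bar>h (fst z) - h (snd z)\<bar> powr p / norm (fst z - snd z) powr (real DIM('a) + (p - 1)))"
  have Fm: "F g' \<in> borel_measurable borel"
  proof -
    have "F g' \<in> borel_measurable (borel \<Otimes>\<^sub>M borel)" unfolding F_def by measurable
    then show ?thesis by (simp add: borel_prod)
  qed
  have "AE z in lborel. F g z = F g' z"
    using AE_lborel_fst_snd(1)[OF ae] AE_lborel_fst_snd(2)[OF ae] by eventually_elim (simp add: F_def)
  then have "zrep UNIV (F g) (F g')" using Fm by (simp add: zrep_def)
  from zrep_integral(2)[OF this] have i: "integrable lebesgue (F g) \<longleftrightarrow> integrable lborel (F g')" unfolding lebesgue_on_UNIV_eq by simp
  have F0: "F g' z \<ge> 0" for z by (simp add: F_def)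
  have "(\<integral>\<^sup>+z. ennreal (norm (F g' z)) \<partial>lborel) = ennreal (real DIM('a) + (p - 1)) * gag p g'"
    using gag_eq_Slobodeckij[OF g' p] F0 by (simp add: F_def)
  then have j: "integrable lborel (F g') \<longleftrightarrow> gag p g' < \<infinity>"
    using Fm p by (simp add: integrable_iff_bounded ennreal_mult_less_top) auto
  have "(\<lambda>(x, y). \<bar>g x - g y\<bar> powr p / norm (x - y) powr (real DIM('a) + (1 - 1 / p) * p)) = F g"
    by (auto simp: F_def sp)
  then show ?thesis
    unfolding Wsp_def using i j Lp_iff_zrep[OF _ z, of p] by simp
qed

lemma trace_image_cong_AE:
  assumes "g' \<in> trace_image p X" "AE y in lborel. g y = g' y" "X \<subseteq> W1p half_space p" "p \<ge> 1"
  shows "g \<in> trace_image p X"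
proof -
  obtain u u' D where u: "u \<in> X" "W1p_rep half_space p u u' D" "AE y in lborel. g' y = etr u' (D (0, 1)) y"
    using assms(1) unfolding trace_image_iff[OF assms(4,3)] by blast
  have "AE y in lborel. g y = etr u' (D (0, 1)) y" using assms(2) u(3) by eventually_elim simp
  with u show ?thesis unfolding trace_image_iff[OF assms(4,3)] by blast
qed

theorem trace_image_W1p_eq_Wsp:
  assumes p: "p > 1"
  shows "trace_image p (W1p half_space p) = (Wsp (1 - 1 / p) p :: ('a::euclidean_space \<Rightarrow> real) set)"
proof (intro set_eqI iffI)
  have p1: "p \<ge> 1" using p by simp
  fix g :: "'a \<Rightarrow> real"
  {
    assume "g \<in> trace_image p (W1p half_space p)"
    then obtain u u' D where u: "W1p_rep half_space p u u' D" "AE y in lborel. g y = etr u' (D (0, 1)) y"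
      unfolding trace_image_iff[OF p1 order_refl] by blast
    have "zrep UNIV g (etr u' (D (0, 1)))" using u(2) etr_rep_finite(1)[OF u(1) p1] by (simp add: zrep_def)
    then show "g \<in> Wsp (1 - 1 / p) p"
      using Wsp_iff[OF _ p] etr_rep_finite(2)[OF u(1) p1] trace_gag_finite[OF u(1) p] by blast
  next
    assume g: "g \<in> Wsp (1 - 1 / p) p"
    then have "g \<in> Lp UNIV p" by (simp add: Wsp_def)
    then obtain g' where z: "zrep UNIV g g'" using Lp_obtain_zrep[of UNIV g p] by auto
    have "g' \<in> trace_image p (W1p half_space p)"
      using g Wsp_iff[OF z p] zrepD(1)[OF z] p by (intro gagliardo_extension) auto
    then show "g \<in> trace_image p (W1p half_space p)"
      by (rule trace_image_cong_AE[OF _ _ order_refl p1]) (use z in \<open>simp add: zrep_def\<close>)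
  }
qed

section \<open>Layered extensions of integrable functions\<close>

text \<open>
  Each summand is at most \<open>S powr (1 / q) * (1 / 2) ^ k\<close> for the weighted sum \<open>S\<close>. The weights
  \<open>2 ^ k\<close> are harmless for layers, whose widths can be prescribed.
\<close>

lemma geometric_sum_powr:
  fixes a :: "nat \<Rightarrow> real"
  assumes q: "q > 0"
  shows "\<bar>\<Sum>k<N. a k\<bar> powr q \<le> 2 powr q * (\<Sum>k<N. (2 ^ k) powr q * \<bar>a k\<bar> powr q)"
proof -
  define S where "S = (\<Sum>k<N. (2 ^ k) powr q * \<bar>a k\<bar> powr q)"
  have S: "S \<ge> 0" unfolding S_def by (intro sum_nonneg) auto
  have le: "\<bar>a k\<bar> \<le> S powr (1 / q) * (1 / 2) ^ k" if "k < N" for k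
  proof -
    have "(2 ^ k) powr q * \<bar>a k\<bar> powr q \<le> S" unfolding S_def using that by (intro member_le_sum) auto
    then have "(2 ^ k * \<bar>a k\<bar>) powr q \<le> S" by (simp add: powr_mult)
    then have "((2 ^ k * \<bar>a k\<bar>) powr q) powr (1 / q) \<le> S powr (1 / q)" using q by (intro powr_mono2) auto
    then have "2 ^ k * \<bar>a k\<bar> \<le> S powr (1 / q)" using q by (simp add: powr_powr)
    then show ?thesis by (simp add: power_one_over field_simps)
  qed
  have "\<bar>\<Sum>k<N. a k\<bar> \<le> (\<Sum>k<N. \<bar>a k\<bar>)" by (rule sum_abs)
  also have "\<dots> \<le> (\<Sum>k<N. S powr (1 / q) * (1 / 2) ^ k)" using le by (intro sum_mono) auto
  also have "\<dots> = S powr (1 / q) * (\<Sum>k<N. (1 / 2) ^ k)" by (simp add: sum_distrib_left)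
  also have "\<dots> \<le> S powr (1 / q) * 2"
    by (intro mult_left_mono) (simp_all add: geometric_sum)
  finally have "\<bar>\<Sum>k<N. a k\<bar> powr q \<le> (S powr (1 / q) * 2) powr q" using q by (intro powr_mono2) auto
  also have "\<dots> = 2 powr q * S" using q S by (simp add: powr_mult powr_powr)
  finally show ?thesis by (simp add: S_def)
qed

locale layers =
  fixes \<tau> :: "nat \<Rightarrow> real"
  assumes pos: "\<And>k. \<tau> k > 0" and halving: "\<And>k. \<tau> (Suc k) \<le> \<tau> k / 2"
begin

lemma decreasing: "j \<le> k \<Longrightarrow> \<tau> k \<le> \<tau> j"
proof (induction k)
  case (Suc k)
  have "\<tau> (Suc k) \<le> \<tau> k" using halving[of k] pos[of k] by simp
  then show ?case using Suc by (cases "j = Suc k") auto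
qed simp

lemma geometric: "\<tau> k \<le> \<tau> 0 / 2 ^ k"
proof (induction k)
  case (Suc k)
  then show ?case using halving[of k] by simp
qed simp

lemma tendsto_0: "\<tau> \<longlonglongrightarrow> 0"
proof (rule tendsto_sandwich[of "\<lambda>_. 0"])
  have "(\<lambda>k. \<tau> 0 * (1 / 2) ^ k) \<longlonglongrightarrow> \<tau> 0 * 0" by (intro tendsto_intros LIMSEQ_power_zero) auto
  then show "(\<lambda>k. \<tau> 0 / 2 ^ k) \<longlonglongrightarrow> 0" by (simp add: power_one_over)
qed (use pos geometric in \<open>auto intro!: always_eventually less_imp_le\<close>)

lemma eventually_below:
  assumes "t > 0" obtains N where "\<tau> N < t"
  using order_tendstoD(2)[OF tendsto_0 assms] by (auto simp: eventually_sequentially)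

text \<open>
  The profile \<open>h k\<close> is switched off above height \<open>\<tau> k\<close>. At every positive height only finitely
  many profiles are active (\<open>layered_eq\<close>), so that regularity is that of finite sums.
\<close>

definition layered :: "(nat \<Rightarrow> 'a \<Rightarrow> real) \<Rightarrow> (real \<Rightarrow> real) \<Rightarrow> 'a \<times> real \<Rightarrow> real" where
  "layered h c x = (\<Sum>k. h k (fst x) * c (snd x / \<tau> k))"

lemma layered_eq:
  assumes "\<And>t. t \<ge> 1 \<Longrightarrow> c t = 0" "\<tau> N \<le> snd x"
  shows "layered h c x = (\<Sum>k<N. h k (fst x) * c (snd x / \<tau> k))"
  unfolding layered_def
proof (rule suminf_finite)
  fix k assume "k \<notin> {..<N}"
  then have "\<tau> k \<le> snd x" using decreasing[of N k] assms(2) by simp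
  then have "c (snd x / \<tau> k) = 0" using pos[of k] by (intro assms(1)) simp
  then show "h k (fst x) * c (snd x / \<tau> k) = 0" by simp
qed simp

lemma layered_isCont:
  fixes h :: "nat \<Rightarrow> 'a::euclidean_space \<Rightarrow> real"
  assumes c: "\<And>t. t \<ge> 1 \<Longrightarrow> c t = 0" "continuous_on UNIV c" and h: "\<And>k. continuous_on UNIV (h k)"
  shows "continuous_on half_space (layered h c)"
proof (rule continuous_at_imp_continuous_on, rule ballI)
  fix x :: "'a \<times> real" assume "x \<in> half_space"
  then have "snd x > 0" by (simp add: half_space_iff)
  then obtain N where N: "\<tau> N < snd x" by (rule eventually_below)
  let ?U = "{x :: 'a \<times> real. \<tau> N < snd x}"
  have U: "open ?U" by (intro open_Collect_less continuous_intros)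
  have "continuous_on ?U (\<lambda>x. \<Sum>k<N. h k (fst x) * c (snd x / \<tau> k))"
    by (intro continuous_intros continuous_on_compose2[OF h] continuous_on_compose2[OF c(2)]) (use pos in \<open>auto simp: less_imp_neq[symmetric]\<close>)
  then have "continuous_on ?U (layered h c)"
    by (rule continuous_on_eq) (rule layered_eq[OF c(1), symmetric], auto)
  then show "isCont (layered h c) x" using U N by (cases x) (simp add: continuous_on_eq_continuous_at)
qed

lemma layered_DERIV:
  fixes h :: "nat \<Rightarrow> 'a::euclidean_space \<Rightarrow> real"
  assumes c: "\<And>t. t \<ge> 1 \<Longrightarrow> c t = 0" and c': "\<And>t. t \<ge> 1 \<Longrightarrow> c' t = 0" and x: "x \<in> half_space"
    and d: "\<And>k. ((\<lambda>s. h k (fst (x + s *\<^sub>R e)) * c (snd (x + s *\<^sub>R e) / \<tau> k)) has_real_derivative h' k (fst x) * c' (snd x / \<tau> k)) (at 0)"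
  shows "((\<lambda>s. layered h c (x + s *\<^sub>R e)) has_real_derivative layered h' c' x) (at 0)"
proof -
  have "snd x > 0" using x by (simp add: half_space_iff)
  then obtain N where N: "\<tau> N < snd x" by (rule eventually_below)
  have "((\<lambda>s. \<Sum>k<N. h k (fst (x + s *\<^sub>R e)) * c (snd (x + s *\<^sub>R e) / \<tau> k)) has_real_derivative (\<Sum>k<N. h' k (fst x) * c' (snd x / \<tau> k))) (at 0)"
    by (rule DERIV_sum) (rule d)
  then have 1: "((\<lambda>s. \<Sum>k<N. h k (fst (x + s *\<^sub>R e)) * c (snd (x + s *\<^sub>R e) / \<tau> k)) has_real_derivative layered h' c' x) (at 0)"
    using layered_eq[where N = N and x = x and h = h', OF c' less_imp_le[OF N]] by simp
  have "((\<lambda>s. snd (x + s *\<^sub>R e)) \<longlongrightarrow> snd (x + 0 *\<^sub>R e)) (nhds 0)"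
    by (intro tendsto_intros filterlim_ident)
  then have "\<forall>\<^sub>F s in nhds 0. \<tau> N < snd (x + s *\<^sub>R e)"
    using N by (intro order_tendstoD) auto
  then have "\<forall>\<^sub>F s in nhds 0. layered h c (x + s *\<^sub>R e) = (\<Sum>k<N. h k (fst (x + s *\<^sub>R e)) * c (snd (x + s *\<^sub>R e) / \<tau> k))"
    by eventually_elim (rule layered_eq[OF c], auto)
  then show ?thesis using 1 by (subst DERIV_cong_ev[OF refl _ refl]) auto
qed

text \<open>The \<open>k\<close>-th layer has width \<open>\<tau> k\<close>, and \<open>geometric_sum_powr\<close> separates the layers.\<close>

lemma layered_mass:
  fixes h :: "nat \<Rightarrow> 'a::euclidean_space \<Rightarrow> real"
  assumes c: "\<And>t. t \<ge> 1 \<Longrightarrow> c t = 0" "continuous_on UNIV c" "\<And>t. t > 0 \<Longrightarrow> \<bar>c t\<bar> \<le> K * indicator {0<..<1} t"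
    and h: "\<And>k. continuous_on UNIV (h k)" and q: "q > 0" and K: "K \<ge> 0"
  shows "pmass q (\<lambda>x. indicator half_space x * layered h c x) \<le>
    (\<Sum>k. ennreal (2 powr q * K powr q) * (ennreal ((2 ^ k) powr q * \<tau> k) * pmass q (h k)))"
proof -
  define W where "W = (\<lambda>k y t. ennreal (2 powr q * K powr q * (2 ^ k) powr q) * (ennreal (\<bar>h k y\<bar> powr q) * indicator {0<..<\<tau> k} t))"
  have hm [measurable]: "h k \<in> borel_measurable borel" for k using h by (rule borel_measurable_continuous_onI)
  have lc: "continuous_on half_space (layered h c)" by (rule layered_isCont[OF c(1,2) h])
  have pt: "indicator {0<..} t * ennreal (\<bar>layered h c (y, t)\<bar> powr q) \<le> (\<Sum>k. W k y t)" for y t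
  proof (cases "t > 0")
    case True
    then obtain N where N: "\<tau> N < t" by (rule eventually_below)
    have "\<bar>layered h c (y, t)\<bar> powr q = \<bar>\<Sum>k<N. h k y * c (t / \<tau> k)\<bar> powr q"
      using layered_eq[where N = N and x = "(y, t)" and h = h, OF c(1)] N by simp
    also have "\<dots> \<le> 2 powr q * (\<Sum>k<N. (2 ^ k) powr q * \<bar>h k y * c (t / \<tau> k)\<bar> powr q)"
      by (rule geometric_sum_powr[OF q])
    also have "\<dots> \<le> 2 powr q * (\<Sum>k<N. (2 ^ k) powr q * (\<bar>h k y\<bar> powr q * (K powr q * indicator {0<..<\<tau> k} t)))"
    proof (intro mult_left_mono sum_mono)
      fix k
      have "\<bar>c (t / \<tau> k)\<bar> \<le> K * indicator {0<..<1} (t / \<tau> k)" using c(3)[of "t / \<tau> k"] True pos[of k] by simp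
      also have "\<dots> = K * indicator {0<..<\<tau> k} t" using True pos[of k] by (auto simp: indicator_def)
      finally have "\<bar>c (t / \<tau> k)\<bar> powr q \<le> (K * indicator {0<..<\<tau> k} t) powr q" using q by (intro powr_mono2) auto
      also have "\<dots> = K powr q * indicator {0<..<\<tau> k} t" by (auto simp: indicator_def)
      finally show "\<bar>h k y * c (t / \<tau> k)\<bar> powr q \<le> \<bar>h k y\<bar> powr q * (K powr q * indicator {0<..<\<tau> k} t)"
        unfolding abs_mult powr_mult by (intro mult_left_mono) auto
    qed auto
    also have "\<dots> = (\<Sum>k<N. 2 powr q * K powr q * (2 ^ k) powr q * (\<bar>h k y\<bar> powr q * indicator {0<..<\<tau> k} t))"
      unfolding sum_distrib_left by (intro sum.cong refl) (simp only: mult_ac)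
    finally have "ennreal (\<bar>layered h c (y, t)\<bar> powr q) \<le> ennreal (\<Sum>k<N. 2 powr q * K powr q * (2 ^ k) powr q * (\<bar>h k y\<bar> powr q * indicator {0<..<\<tau> k} t))"
      by (rule ennreal_leI)
    also have "\<dots> = (\<Sum>k<N. W k y t)"
    proof -
      have "W k y t = ennreal (2 powr q * K powr q * (2 ^ k) powr q * (\<bar>h k y\<bar> powr q * indicator {0<..<\<tau> k} t))" for k
        by (cases "t \<in> {0<..<\<tau> k}") (auto simp: W_def ennreal_mult)
      then show ?thesis by (subst sum_ennreal[symmetric]) auto
    qed
    also have "\<dots> \<le> (\<Sum>k. W k y t)"
      by (rule sum_le_suminf) auto
    finally show ?thesis using True by simp
  qed simp
  have "pmass q (\<lambda>x. indicator half_space x * layered h c x) = (\<integral>\<^sup>+t. indicator {0<..} t * pmass q (\<lambda>y. layered h c (y, t)) \<partial>lborel)"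
    by (rule half_space_mass_slices[OF continuous_half_space_borel[OF lc]])
  also have "\<dots> \<le> (\<integral>\<^sup>+t. \<integral>\<^sup>+y. (\<Sum>k. W k y t) \<partial>lborel \<partial>lborel)"
  proof (rule nn_integral_mono)
    fix t :: real
    show "indicator {0<..} t * pmass q (\<lambda>y. layered h c (y, t)) \<le> (\<integral>\<^sup>+y. (\<Sum>k. W k y t) \<partial>lborel)"
    proof (cases "t > 0")
      case True
      then have "indicator {0<..} t * pmass q (\<lambda>y. layered h c (y, t)) = (\<integral>\<^sup>+y. indicator {0<..} t * ennreal (\<bar>layered h c (y, t)\<bar> powr q) \<partial>lborel)"
        by (simp add: Lp_mass_def)
      also have "\<dots> \<le> (\<integral>\<^sup>+y. (\<Sum>k. W k y t) \<partial>lborel)" by (rule nn_integral_mono[OF pt])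
      finally show ?thesis .
    qed simp
  qed
  also have "\<dots> = (\<Sum>k. \<integral>\<^sup>+t. \<integral>\<^sup>+y. W k y t \<partial>lborel \<partial>lborel)"
  proof -
    have [measurable]: "(\<lambda>y. W k y t) \<in> borel_measurable lborel" for k t unfolding W_def by measurable
    have [measurable]: "(\<lambda>t. \<integral>\<^sup>+y. W k y t \<partial>lborel) \<in> borel_measurable lborel" for k unfolding W_def by measurable
    show ?thesis by (subst nn_integral_suminf[symmetric], measurable) (intro nn_integral_cong nn_integral_suminf, measurable)
  qed
  also have "\<dots> = (\<Sum>k. ennreal (2 powr q * K powr q) * (ennreal ((2 ^ k) powr q * \<tau> k) * pmass q (h k)))"
  proof (intro suminf_cong)
    fix k
    let ?c = "ennreal (2 powr q * K powr q * (2 ^ k) powr q)"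
    have "(\<integral>\<^sup>+t. \<integral>\<^sup>+y. W k y t \<partial>lborel \<partial>lborel) = (\<integral>\<^sup>+t. ?c * pmass q (h k) * indicator {0<..<\<tau> k} t \<partial>lborel)"
      unfolding W_def Lp_mass_def by (intro nn_integral_cong) (simp add: nn_integral_cmult nn_integral_multc mult.assoc)
    also have "\<dots> = ?c * pmass q (h k) * ennreal (\<tau> k)"
      using pos[of k] by (subst nn_integral_cmult_indicator) auto
    also have "\<dots> = ennreal (2 powr q * K powr q) * (ennreal ((2 ^ k) powr q * \<tau> k) * pmass q (h k))"
      using pos[of k] by (simp add: ennreal_mult mult_ac)
    finally show "(\<integral>\<^sup>+t. \<integral>\<^sup>+y. W k y t \<partial>lborel \<partial>lborel) = ennreal (2 powr q * K powr q) * (ennreal ((2 ^ k) powr q * \<tau> k) * pmass q (h k))" .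
  qed
  finally show ?thesis .
qed

lemma layered_mass_finite:
  fixes h :: "nat \<Rightarrow> 'a::euclidean_space \<Rightarrow> real"
  assumes c: "\<And>t. t \<ge> 1 \<Longrightarrow> c t = 0" "continuous_on UNIV c" "\<And>t. t > 0 \<Longrightarrow> \<bar>c t\<bar> \<le> K * indicator {0<..<1} t"
    and h: "\<And>k. continuous_on UNIV (h k)" and q: "q > 0" and K: "K \<ge> 0"
    and b: "\<And>k. ennreal ((2 ^ k) powr q * \<tau> k) * pmass q (h k) \<le> ennreal (A * (1 / 2) ^ k)" and A: "A \<ge> 0"
  shows "pmass q (\<lambda>x. indicator half_space x * layered h c x) < \<infinity>"
proof -
  have "pmass q (\<lambda>x. indicator half_space x * layered h c x) \<le> (\<Sum>k. ennreal (2 powr q * K powr q) * (ennreal ((2 ^ k) powr q * \<tau> k) * pmass q (h k)))"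
    by (rule layered_mass[OF c h q K])
  also have "\<dots> \<le> (\<Sum>k. ennreal (2 powr q * K powr q) * ennreal (A * (1 / 2) ^ k))"
    by (intro suminf_le mult_left_mono b) auto
  also have "\<dots> = (\<Sum>k. ennreal (2 powr q * K powr q * A * (1 / 2) ^ k))"
    using A by (simp add: ennreal_mult[symmetric] mult.assoc)
  also have "\<dots> = ennreal (\<Sum>k. 2 powr q * K powr q * A * (1 / 2) ^ k)"
    by (rule suminf_ennreal2) (use A in \<open>auto intro!: summable_mult summable_geometric\<close>)
  also have "\<dots> < \<infinity>" by simp
  finally show ?thesis .
qed

end

lemma moll_L1_finite:
  fixes g :: "'a::euclidean_space \<Rightarrow> real"
  assumes [measurable]: "g \<in> borel_measurable borel" and fin: "pmass 1 g < \<infinity>"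
    and \<psi>: "\<psi> \<in> test_functions S"
  shows "pmass 1 (moll \<psi> e g) < \<infinity>"
proof -
  have [measurable]: "\<psi> \<in> borel_measurable borel" by (rule test_function_borel[OF \<psi>])
  have "pmass 1 (moll \<psi> e g) \<le> (\<integral>\<^sup>+x. \<integral>\<^sup>+w. ennreal \<bar>g (x + e *\<^sub>R w)\<bar> * ennreal \<bar>\<psi> w\<bar> \<partial>lborel \<partial>lborel)"
    unfolding Lp_mass_1
  proof (rule nn_integral_mono)
    fix x
    show "ennreal \<bar>moll \<psi> e g x\<bar> \<le> (\<integral>\<^sup>+w. ennreal \<bar>g (x + e *\<^sub>R w)\<bar> * ennreal \<bar>\<psi> w\<bar> \<partial>lborel)"
    proof (cases "integrable lborel (\<lambda>w. g (x + e *\<^sub>R w) * \<psi> w)")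
      case True
      from integral_norm_bound_ennreal[OF this] show ?thesis by (simp add: moll_def abs_mult ennreal_mult)
    qed (simp add: moll_def not_integrable_integral_eq)
  qed
  also have "\<dots> = (\<integral>\<^sup>+w. \<integral>\<^sup>+x. ennreal \<bar>g (x + e *\<^sub>R w)\<bar> * ennreal \<bar>\<psi> w\<bar> \<partial>lborel \<partial>lborel)"
    by (rule lborel_pair.Fubini') measurable
  also have "\<dots> = (\<integral>\<^sup>+w. pmass 1 g * ennreal \<bar>\<psi> w\<bar> \<partial>lborel)"
  proof (rule nn_integral_cong)
    fix w
    have "(\<integral>\<^sup>+x. ennreal \<bar>g (x + e *\<^sub>R w)\<bar> * ennreal \<bar>\<psi> w\<bar> \<partial>lborel) = pmass 1 (\<lambda>x. g (x + e *\<^sub>R w)) * ennreal \<bar>\<psi> w\<bar>"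
      unfolding Lp_mass_1 by (rule nn_integral_multc) measurable
    then show "(\<integral>\<^sup>+x. ennreal \<bar>g (x + e *\<^sub>R w)\<bar> * ennreal \<bar>\<psi> w\<bar> \<partial>lborel) = pmass 1 g * ennreal \<bar>\<psi> w\<bar>"
      by (simp add: Lp_mass_translate)
  qed
  also have "\<dots> = pmass 1 g * (\<integral>\<^sup>+w. ennreal \<bar>\<psi> w\<bar> \<partial>lborel)" by (rule nn_integral_cmult) measurable
  also have "\<dots> < \<infinity>"
    using fin test_function_integrable[OF \<psi>] by (simp add: ennreal_mult_less_top integrable_iff_bounded)
  finally show ?thesis .
qed

lemma moll_L1_bounded:
  fixes g :: "'a::euclidean_space \<Rightarrow> real"
  assumes g[measurable]: "g \<in> borel_measurable borel" and fin: "pmass 1 g < \<infinity>"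
    and \<psi>: "\<psi> \<in> test_functions S" and e: "e > 0"
  obtains M where "M > 0" "\<And>x. \<bar>moll \<psi> e g x\<bar> \<le> M"
proof -
  obtain B where B: "B > 0" "\<And>x. \<bar>\<psi> x\<bar> \<le> B" using test_function_bounded[OF \<psi>] by metis
  have [measurable]: "\<psi> \<in> borel_measurable borel" by (rule test_function_borel[OF \<psi>])
  have gi: "integrable lborel g" using fin by (simp add: Lp_mass_1 integrable_iff_bounded)
  define M where "M = (1 / e ^ DIM('a)) * B * (LINT z|lborel. \<bar>g z\<bar>)"
  have "\<bar>moll \<psi> e g x\<bar> \<le> M" for x
  proof -
    have "moll \<psi> e g x = (LINT z|lborel. g z * ((1 / e ^ DIM('a)) * \<psi> ((1 / e) *\<^sub>R (z - x))))"
      by (rule moll_eq_corr) (use e in auto)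
    also have "\<bar>\<dots>\<bar> \<le> (LINT z|lborel. \<bar>g z * ((1 / e ^ DIM('a)) * \<psi> ((1 / e) *\<^sub>R (z - x)))\<bar>)"
      by (rule integral_abs_bound)
    also have "\<dots> \<le> (LINT z|lborel. (1 / e ^ DIM('a)) * B * \<bar>g z\<bar>)"
    proof (rule integral_mono)
      have "(\<lambda>z. (1 / e ^ DIM('a)) * \<psi> ((1 / e) *\<^sub>R (z - x))) \<in> test_functions UNIV"
        by (rule test_function_affine[OF \<psi>]) (use e in auto)
      from Lp_test_integrable[OF g fin order_refl this]
      show "integrable lborel (\<lambda>z. \<bar>g z * ((1 / e ^ DIM('a)) * \<psi> ((1 / e) *\<^sub>R (z - x)))\<bar>)" by (rule integrable_abs)
      show "integrable lborel (\<lambda>z. (1 / e ^ DIM('a)) * B * \<bar>g z\<bar>)" using gi by simp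
      fix z
      have "(1 / e ^ DIM('a)) * \<bar>\<psi> ((1 / e) *\<^sub>R (z - x))\<bar> \<le> (1 / e ^ DIM('a)) * B" using B e by (intro mult_left_mono) auto
      then have 1: "\<bar>g z\<bar> * ((1 / e ^ DIM('a)) * \<bar>\<psi> ((1 / e) *\<^sub>R (z - x))\<bar>) \<le> \<bar>g z\<bar> * ((1 / e ^ DIM('a)) * B)" by (rule mult_left_mono) simp
      have 2: "\<bar>g z * ((1 / e ^ DIM('a)) * \<psi> ((1 / e) *\<^sub>R (z - x)))\<bar> = \<bar>g z\<bar> * ((1 / e ^ DIM('a)) * \<bar>\<psi> ((1 / e) *\<^sub>R (z - x))\<bar>)"
        using e by (simp add: abs_mult)
      show "\<bar>g z * ((1 / e ^ DIM('a)) * \<psi> ((1 / e) *\<^sub>R (z - x)))\<bar> \<le> (1 / e ^ DIM('a)) * B * \<bar>g z\<bar>"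
        unfolding 2 using 1 by (simp only: mult.commute)
    qed
    finally show ?thesis by (simp add: M_def)
  qed
  then have "\<bar>moll \<psi> e g x\<bar> \<le> max 1 M" for x by (simp add: le_max_iff_disj)
  then show ?thesis by (intro that[of "max 1 M"]) auto
qed

lemma bounded_L1_imp_Lq:
  assumes "\<And>x. \<bar>f x\<bar> \<le> M" "M > 0" "q \<ge> 1" "Lp_mass M1 1 f < \<infinity>" and [measurable]: "f \<in> borel_measurable M1"
  shows "Lp_mass M1 q f < \<infinity>"
proof -
  have "Lp_mass M1 q f \<le> (\<integral>\<^sup>+x. ennreal (M powr (q - 1)) * ennreal \<bar>f x\<bar> \<partial>M1)"
    unfolding Lp_mass_def
  proof (rule nn_integral_mono)
    fix x
    have "\<bar>f x\<bar> powr q \<le> M powr (q - 1) * \<bar>f x\<bar>"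
    proof (cases "f x = 0")
      case False
      then have "\<bar>f x\<bar> powr q = \<bar>f x\<bar> powr (q - 1) * \<bar>f x\<bar>" by (simp add: powr_diff)
      also have "\<dots> \<le> M powr (q - 1) * \<bar>f x\<bar>" using assms by (intro mult_right_mono powr_mono2) auto
      finally show ?thesis .
    qed simp
    then show "ennreal (\<bar>f x\<bar> powr q) \<le> ennreal (M powr (q - 1)) * ennreal \<bar>f x\<bar>"
      by (simp add: ennreal_mult[symmetric] ennreal_leI)
  qed
  also have "\<dots> = ennreal (M powr (q - 1)) * Lp_mass M1 1 f" by (simp add: nn_integral_cmult Lp_mass_1)
  also have "\<dots> < \<infinity>" using assms by (simp add: ennreal_mult_less_top)
  finally show ?thesis .
qed

text \<open>
  The layers carry the increments of mollifications \<open>G k\<close> of \<open>g\<close>. At height \<open>\<tau> n / 2\<close> the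
  increments up to \<open>n\<close> are fully switched on and the later ones are off, so the extension equals
  \<open>G n\<close> there and has trace \<open>g\<close>.
\<close>

lemma L1_extension:
  fixes g :: "'a::euclidean_space \<Rightarrow> real"
  assumes g[measurable]: "g \<in> borel_measurable borel" and fin: "pmass 1 g < \<infinity>" and q: "q \<ge> 1"
  shows "g \<in> trace_image 1 (W1p half_space 1 \<inter> Lp half_space q)"
proof -
  obtain \<phi> where phi: "\<phi> \<in> test_functions (cball (0::'a) 1)" "\<And>x. \<phi> x \<ge> 0" "integral\<^sup>L lborel \<phi> = 1"
    using exists_mollifier[of 1 "0::'a"] by auto
  interpret mollifier \<phi> "cball 0 1" by unfold_locales (use phi in auto)
  define e0 where "e0 = (\<lambda>k. 1 / real (Suc k))"
  have e0: "e0 k > 0" "e0 \<longlonglongrightarrow> 0" for k using LIMSEQ_inverse_real_of_nat by (auto simp: e0_def inverse_eq_divide)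
  have "\<exists>j. pmass 1 (\<lambda>x. moll \<phi> (e0 j) g x - g x) < ennreal ((1 / 4) ^ k)" for k
    using order_tendstoD(2)[OF moll_tendsto[OF g fin _ e0(2,1)], of "ennreal ((1 / 4) ^ k)"] eventually_happens'[OF sequentially_bot] by fastforce
  then obtain j where j: "\<And>k. pmass 1 (\<lambda>x. moll \<phi> (e0 (j k)) g x - g x) < ennreal ((1 / 4) ^ k)" by metis
  define G where "G = (\<lambda>k. moll \<phi> (e0 (j k)) g)"
  have GC: "G k \<in> C_infinity" for k unfolding G_def by (rule moll_smooth(1)[OF g fin _ phi(1) e0(1)]) simp
  have Gm [measurable]: "G k \<in> borel_measurable borel" for k unfolding G_def by (rule moll_borel) measurable
  have Gg: "pmass 1 (\<lambda>x. G k x - g x) \<le> ennreal ((1 / 4) ^ k)" for k using j[of k] by (simp add: G_def)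
  have G1: "pmass 1 (G k) < \<infinity>" for k unfolding G_def by (rule moll_L1_finite[OF g fin phi(1)])
  have Gq: "pmass q (G k) < \<infinity>" for k
  proof -
    obtain M where "M > 0" "\<And>x. \<bar>G k x\<bar> \<le> M" unfolding G_def using moll_L1_bounded[OF g fin phi(1) e0(1)] by metis
    then show ?thesis using bounded_L1_imp_Lq[of "G k" M q lborel] q G1 by simp
  qed
  have Gb1: "pmass 1 (partial_deriv b (G k)) < \<infinity>" if b: "b \<in> Basis" for b k
  proof -
    have "partial_deriv b (G k) = (\<lambda>x. - (1 / e0 (j k)) * moll (partial_deriv b \<phi>) (e0 (j k)) g x)"
      unfolding G_def by (rule ext, rule moll_smooth(3)[OF g fin _ phi(1) e0(1) b]) simp
    moreover have "moll (partial_deriv b \<phi>) (e0 (j k)) g \<in> borel_measurable borel"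
      by (rule moll_borel[OF test_function_borel[OF partial_deriv_test_function[OF phi(1) b]] g])
    moreover have "pmass 1 (moll (partial_deriv b \<phi>) (e0 (j k)) g) < \<infinity>"
      by (rule moll_L1_finite[OF g fin partial_deriv_test_function[OF phi(1) b]])
    ultimately show ?thesis using Lp_mass_scale[of "moll (partial_deriv b \<phi>) (e0 (j k)) g" lborel 1 "- (1 / e0 (j k))"]
      by (simp add: ennreal_mult_less_top)
  qed
  \<comment> \<open>Increments, with \<open>H 0\<close> as the first one; they telescope (\<open>difsum\<close>).\<close>
  define dif where "dif = (\<lambda>(H :: nat \<Rightarrow> 'a \<Rightarrow> real) k y. if k = 0 then H 0 y else H k y - H (k - 1) y)"
  have difm: "dif H k \<in> borel_measurable borel" if "\<And>k. H k \<in> borel_measurable borel" for H k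
    using that by (cases k) (auto simp: dif_def[abs_def])
  have difc: "continuous_on UNIV (dif H k)" if "\<And>k. continuous_on UNIV (H k)" for H k
    using that by (cases k) (auto simp: dif_def[abs_def] intro!: continuous_intros)
  have diffin: "pmass r (dif H k) < \<infinity>" if "\<And>k. H k \<in> borel_measurable borel" "\<And>k. pmass r (H k) < \<infinity>" "r \<ge> 0" for H k r
  proof (cases k)
    case 0 then show ?thesis using that by (simp add: dif_def[abs_def])
  next
    case (Suc i)
    have "pmass r (\<lambda>y. H k y - H (k - 1) y) \<le> ennreal (2 powr r) * (pmass r (H k) + pmass r (H (k - 1)))"
      by (rule Lp_mass_diff) (use that in auto)
    also have "\<dots> < \<infinity>" using that by (simp add: ennreal_mult_less_top)
    finally show ?thesis using Suc by (simp add: dif_def[abs_def])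
  qed
  have difsum: "(\<Sum>k<Suc n. dif H k y) = H n y" for H n y
    by (induction n) (auto simp: dif_def)
  define d where "d = dif G"
  define E where "E = (\<lambda>b. dif (\<lambda>k. partial_deriv b (G k)))"
  have PC: "partial_deriv b (G k) \<in> C_infinity" if "b \<in> Basis" for b k using C_infinityD(2)[OF GC that] .
  have dc: "continuous_on UNIV (d k)" for k unfolding d_def by (intro difc C_infinityD(3)[OF GC])
  have Ec: "continuous_on UNIV (E b k)" if "b \<in> Basis" for b k unfolding E_def by (intro difc C_infinityD(3)[OF PC[OF that]])
  have dfin: "pmass 1 (d k) < \<infinity>" "pmass q (d k) < \<infinity>" for k
    unfolding d_def using q by (intro diffin Gm G1 Gq; simp)+
  have Efin: "pmass 1 (E b k) < \<infinity>" if "b \<in> Basis" for b k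
    unfolding E_def by (intro diffin borel_measurable_continuous_onI C_infinityD(3)[OF PC[OF that]] Gb1[OF that]) simp
  have dE: "((\<lambda>s. d k (y + s *\<^sub>R b)) has_real_derivative E b k y) (at 0)" if "b \<in> Basis" for b k y
    unfolding d_def E_def dif_def
    using C_infinity_directional_DERIV[OF GC] by (cases k) (auto intro!: derivative_intros)
  \<comment> \<open>\<open>pmass 1 (d k)\<close> decays like \<open>(1 / 4) ^ k\<close>, faster than the weights \<open>2 ^ k\<close> grow; \<open>a\<close> takes
    care of \<open>k = 0\<close>.\<close>
  obtain A0 where A0: "A0 \<ge> 0" "\<And>k. pmass 1 (d k) \<le> ennreal (A0 * (1 / 4) ^ k)"
  proof -
    obtain a where a: "pmass 1 (d 0) = ennreal a" "a \<ge> 0" using dfin(1)[of 0] by (cases "pmass 1 (d 0)") auto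
    have "pmass 1 (d k) \<le> ennreal ((a + 16) * (1 / 4) ^ k)" for k
    proof (cases k)
      case 0 then show ?thesis using a by (simp add: ennreal_leI del: ennreal_plus)
    next
      case (Suc i)
      have "pmass 1 (d k) = pmass 1 (\<lambda>x. G k x - G i x)" using Suc by (simp add: d_def dif_def[abs_def])
      also have "\<dots> \<le> ennreal (2 powr 1) * (pmass 1 (\<lambda>x. G k x - g x) + pmass 1 (\<lambda>x. g x - G i x))"
        by (rule Lp_mass_triangle) auto
      also have "\<dots> \<le> ennreal (2 powr 1) * (ennreal ((1 / 4) ^ k) + ennreal ((1 / 4) ^ i))"
        using Gg[of k] Gg[of i] by (intro mult_left_mono add_mono) (auto simp: Lp_mass_diff_commute[of _ _ g])
      also have "\<dots> = ennreal (2 * ((1 / 4) ^ k + (1 / 4) ^ i))"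
      proof -
        have "ennreal (2 powr 1) * ennreal z = ennreal (2 * z)" if "z \<ge> 0" for z
          using that by (subst ennreal_mult[symmetric]) auto
        moreover have "ennreal ((1 / 4) ^ k) + ennreal ((1 / 4) ^ i) = ennreal ((1 / 4) ^ k + (1 / 4) ^ i)" by simp
        ultimately show ?thesis by (simp only:) simp
      qed
      also have "\<dots> \<le> ennreal ((a + 16) * (1 / 4) ^ k)"
        using Suc a(2) by (intro ennreal_leI) (auto simp: algebra_simps)
      finally show ?thesis .
    qed
    then show ?thesis using that[of "a + 16"] a(2) by simp
  qed
  \<comment> \<open>\<open>c k\<close> collects the masses that have to be compensated by the width of the \<open>k\<close>-th layer. The
    normal derivative makes no demand on the width, which cancels there.\<close>
  define c where "c = (\<lambda>k. 2 ^ k * enn2real (pmass 1 (d k)) + (\<Sum>b\<in>Basis. 2 ^ k * enn2real (pmass 1 (E b k))) + (2 ^ k) powr q * enn2real (pmass q (d k)))"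
  have cnn: "c k \<ge> 0" for k unfolding c_def by (intro add_nonneg_nonneg sum_nonneg) auto
  \<comment> \<open>The product gives both halving and \<open>\<tau> k * c k \<le> (1 / 2) ^ k\<close>.\<close>
  define \<tau> where "\<tau> = (\<lambda>k. \<Prod>i\<le>k. 1 / (2 * (1 + c i)))"
  have \<tau>p: "\<tau> k > 0" for k unfolding \<tau>_def using cnn by (intro prod_pos) (auto intro: add_pos_nonneg)
  have \<tau>le: "\<tau> k \<le> (1 / 2) ^ k * (1 / (1 + c k))" for k
  proof -
    have "(\<Prod>i<k. 1 / (2 * (1 + c i))) \<le> (\<Prod>i<k. 1 / 2)"
      using cnn by (intro prod_mono) (auto simp: field_simps add_pos_nonneg intro: add_nonneg_nonneg)
    then have a: "(\<Prod>i<k. 1 / (2 * (1 + c i))) \<le> (1 / 2) ^ k" by simp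
    have "\<tau> k = (\<Prod>i<k. 1 / (2 * (1 + c i))) * (1 / (2 * (1 + c k)))"
      unfolding \<tau>_def lessThan_Suc_atMost[symmetric] by simp
    also have "\<dots> \<le> (1 / 2) ^ k * (1 / (1 + c k))"
      using a cnn[of k] by (intro mult_mono) (auto simp: divide_simps)
    finally show ?thesis .
  qed
  have \<tau>S: "\<tau> (Suc k) \<le> \<tau> k / 2" for k
  proof -
    have "\<tau> (Suc k) = \<tau> k * (1 / (2 * (1 + c (Suc k))))" unfolding \<tau>_def by simp
    also have "\<dots> \<le> \<tau> k * (1 / 2)" using cnn[of "Suc k"] \<tau>p[of k] by (intro mult_left_mono) (auto simp: divide_simps)
    finally show ?thesis by simp
  qed
  interpret layers \<tau> by unfold_locales (use \<tau>p \<tau>S in auto)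
  have \<tau>c: "\<tau> k * c k \<le> (1 / 2) ^ k" for k
  proof -
    have "\<tau> k * c k \<le> ((1 / 2) ^ k * (1 / (1 + c k))) * c k" using \<tau>le[of k] cnn[of k] by (intro mult_right_mono) auto
    also have "\<dots> = (1 / 2) ^ k * (c k / (1 + c k))" by simp
    also have "\<dots> \<le> (1 / 2) ^ k * 1" using cnn[of k] by (intro mult_left_mono) (auto simp: divide_simps)
    finally show ?thesis by simp
  qed
  have bnd: "ennreal (w * \<tau> k) * L \<le> ennreal (1 * (1 / 2) ^ k)" if "w * enn2real L \<le> c k" "L < \<infinity>" "w \<ge> 0" for w L k
  proof -
    have L: "L = ennreal (enn2real L)" using that(2) by (simp add: less_top)
    have "ennreal (w * \<tau> k) * L = ennreal (w * \<tau> k) * ennreal (enn2real L)" using L by simp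
    also have "\<dots> = ennreal (w * \<tau> k * enn2real L)" using that(3) \<tau>p[of k] by (subst ennreal_mult) auto
    also have "\<dots> \<le> ennreal (1 * (1 / 2) ^ k)"
    proof (rule ennreal_leI)
      have "w * \<tau> k * enn2real L = \<tau> k * (w * enn2real L)" by simp
      also have "\<dots> \<le> \<tau> k * c k" using that(1) \<tau>p[of k] by (intro mult_left_mono) auto
      finally show "w * \<tau> k * enn2real L \<le> 1 * (1 / 2) ^ k" using \<tau>c[of k] by simp
    qed
    finally show ?thesis .
  qed
  note cc = continuous_on_cutoff
  have ci: "\<And>t. t > 0 \<Longrightarrow> \<bar>cutoff t\<bar> \<le> 1 * indicator {0<..<1} t" using cutoff_le_indicator(1) by simp
  have c1: "2 ^ k * enn2real (pmass 1 (d k)) \<le> c k" "(2 ^ k) powr q * enn2real (pmass q (d k)) \<le> c k" for k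
    unfolding c_def by (auto intro!: sum_nonneg add_nonneg_nonneg)
  have c2: "2 ^ k * enn2real (pmass 1 (E b k)) \<le> c k" if "b \<in> Basis" for b k
  proof -
    have "2 ^ k * enn2real (pmass 1 (E b k)) \<le> (\<Sum>b\<in>Basis. 2 ^ k * enn2real (pmass 1 (E b k)))"
      by (rule member_le_sum[OF that]) auto
    also have "\<dots> \<le> c k" unfolding c_def by simp
    finally show ?thesis .
  qed
  define f where "f = layered d cutoff"
  define D where "D = (\<lambda>(e :: 'a \<times> real). if snd e = 0 then layered (E (fst e)) cutoff else layered (\<lambda>k y. d k y / \<tau> k) cutoff')"
  have ffin: "pmass 1 (\<lambda>x. indicator half_space x * f x) < \<infinity>"
    unfolding f_def
    by (rule layered_mass_finite[OF cutoff_bounds(4) cc(1) ci dc, where A = 1]) (use bnd[OF c1(1) dfin(1)] in auto)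
  have ffinq: "pmass q (\<lambda>x. indicator half_space x * f x) < \<infinity>"
    unfolding f_def
    by (rule layered_mass_finite[OF cutoff_bounds(4) cc(1) ci dc, where A = 1]) (use bnd[OF c1(2) dfin(2)] q in auto)
  have fc: "continuous_on half_space f" unfolding f_def by (rule layered_isCont[OF cutoff_bounds(4) cc(1) dc])
  have dtc: "continuous_on UNIV (\<lambda>y. d k y / \<tau> k)" for k by (intro continuous_intros dc) (simp add: less_imp_neq[OF \<tau>p, symmetric])
  have Dc: "continuous_on half_space (D e)" and Dfin: "pmass 1 (\<lambda>x. indicator half_space x * D e x) < \<infinity>" if "e \<in> Basis" for e
  proof -
    have "continuous_on half_space (D e) \<and> pmass 1 (\<lambda>x. indicator half_space x * D e x) < \<infinity>"
    using that proof (cases e rule: Basis_pair_cases)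
      case (1 b)
      have "pmass 1 (\<lambda>x. indicator half_space x * layered (E b) cutoff x) < \<infinity>"
        by (rule layered_mass_finite[OF cutoff_bounds(4) cc(1) ci Ec[OF 1(1)], where A = 1]) (use bnd[OF c2[OF 1(1)] Efin[OF 1(1)]] in auto)
      then show ?thesis using layered_isCont[OF cutoff_bounds(4) cc(1) Ec[OF 1(1)]] 1 by (simp add: D_def)
    next
      case 2
      have "pmass 1 (\<lambda>x. indicator half_space x * layered (\<lambda>k y. d k y / \<tau> k) cutoff' x) < \<infinity>"
      proof (rule layered_mass_finite[OF cutoff_bounds(6) cc(2) cutoff_le_indicator(2) dtc, where A = A0])
        fix k
        have dm: "d k \<in> borel_measurable borel" using dc by (rule borel_measurable_continuous_onI)
        have "pmass 1 (\<lambda>y. d k y / \<tau> k) = ennreal (1 / \<tau> k) * pmass 1 (d k)"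
          using Lp_mass_scale[of "d k" lborel 1 "1 / \<tau> k"] dm \<tau>p[of k] by simp
        then have "ennreal ((2 ^ k) powr 1 * \<tau> k) * pmass 1 (\<lambda>y. d k y / \<tau> k) = (ennreal (2 ^ k * \<tau> k) * ennreal (1 / \<tau> k)) * pmass 1 (d k)"
          by (simp add: mult.assoc)
        \<comment> \<open>The width of the layer cancels against the slope of the cutoff.\<close>
        also have "ennreal (2 ^ k * \<tau> k) * ennreal (1 / \<tau> k) = ennreal (2 ^ k)"
          using \<tau>p[of k] by (subst ennreal_mult[symmetric]) auto
        also have "ennreal (2 ^ k) * pmass 1 (d k) \<le> ennreal (2 ^ k) * ennreal (A0 * (1 / 4) ^ k)"
          by (intro mult_left_mono A0(2)) auto
        also have "\<dots> = ennreal (2 ^ k * (A0 * (1 / 4) ^ k))" using A0(1) by (subst ennreal_mult) auto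
        also have "2 ^ k * (A0 * (1 / 4) ^ k) = A0 * (1 / 2) ^ k"
        proof -
          have "(2::real) ^ k * (1 / 4) ^ k = (1 / 2) ^ k" by (simp add: power_mult_distrib[symmetric])
          then show ?thesis by (metis mult.left_commute)
        qed
        finally show "ennreal ((2 ^ k) powr 1 * \<tau> k) * pmass 1 (\<lambda>y. d k y / \<tau> k) \<le> ennreal (A0 * (1 / 2) ^ k)" .
      qed (use A0 in auto)
      then show ?thesis using layered_isCont[OF cutoff_bounds(6) cc(2) dtc] 2 by (simp add: D_def)
    qed
    then show "continuous_on half_space (D e)" "pmass 1 (\<lambda>x. indicator half_space x * D e x) < \<infinity>" by auto
  qed
  have der: "((\<lambda>s. f (x + s *\<^sub>R e)) has_real_derivative D e x) (at 0)" if x: "x \<in> half_space" and e: "e \<in> Basis" for x e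
    using e
  proof (cases e rule: Basis_pair_cases)
    case (1 b)
    have "((\<lambda>s. layered d cutoff (x + s *\<^sub>R (b, 0))) has_real_derivative layered (E b) cutoff x) (at 0)"
    proof (rule layered_DERIV[OF cutoff_bounds(4) cutoff_bounds(4) x])
      fix k
      show "((\<lambda>s. d k (fst (x + s *\<^sub>R (b, 0))) * cutoff (snd (x + s *\<^sub>R (b, 0)) / \<tau> k)) has_real_derivative E b k (fst x) * cutoff (snd x / \<tau> k)) (at 0)"
        using DERIV_cmult_right[OF dE[OF 1(1), of k "fst x"], of "cutoff (snd x / \<tau> k)"] by simp
    qed
    then show ?thesis using 1 by (simp add: f_def D_def)
  next
    case 2
    have "((\<lambda>s. layered d cutoff (x + s *\<^sub>R (0, 1))) has_real_derivative layered (\<lambda>k y. d k y / \<tau> k) cutoff' x) (at 0)"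
    proof (rule layered_DERIV[OF cutoff_bounds(4) cutoff_bounds(6) x])
      fix k
      have "((\<lambda>s. (snd x + s) / \<tau> k) has_real_derivative 1 / \<tau> k) (at 0)"
        using \<tau>p[of k] by (auto intro!: derivative_eq_intros)
      from DERIV_chain2[OF DERIV_cutoff this]
      have "((\<lambda>s. cutoff ((snd x + s) / \<tau> k)) has_real_derivative cutoff' (snd x / \<tau> k) * (1 / \<tau> k)) (at 0)" by simp
      from DERIV_cmult[OF this, of "d k (fst x)"]
      show "((\<lambda>s. d k (fst (x + s *\<^sub>R (0, 1))) * cutoff (snd (x + s *\<^sub>R (0, 1)) / \<tau> k)) has_real_derivative d k (fst x) / \<tau> k * cutoff' (snd x / \<tau> k)) (at 0)"
        by simp
    qed
    then show ?thesis using 2 by (simp add: f_def D_def)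
  qed
  have lim0: "(\<lambda>k. pmass 1 (\<lambda>y. G k y - g y)) \<longlonglongrightarrow> 0"
  proof (rule tendsto_sandwich[of "\<lambda>_. 0" _ _ "\<lambda>k. ennreal ((1 / 4) ^ k)"])
    have "(\<lambda>k. (1 / 4 :: real) ^ k) \<longlonglongrightarrow> 0" by (rule LIMSEQ_power_zero) simp
    from tendsto_ennrealI[OF this] show "(\<lambda>k. ennreal ((1 / 4) ^ k)) \<longlonglongrightarrow> 0" by simp
  qed (use Gg in auto)
  obtain s where s: "strict_mono s" "AE y in lborel. (\<lambda>k. G (s k) y - g y) \<longlonglongrightarrow> 0"
    using Lp_mass_subseq_AE[of "\<lambda>k y. G k y - g y" lborel 1] lim0 Gm g by auto
  have fG: "f (y, \<tau> n / 2) = G n y" for y n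
  proof -
    have "f (y, \<tau> n / 2) = (\<Sum>k<Suc n. d k y * cutoff (\<tau> n / 2 / \<tau> k))"
      using layered_eq[where N = "Suc n" and x = "(y, \<tau> n / 2)" and h = d, OF cutoff_bounds(4)] \<tau>S[of n] by (simp add: f_def)
    also have "\<dots> = (\<Sum>k<Suc n. d k y)"
    proof (rule sum.cong[OF refl])
      fix k assume "k \<in> {..<Suc n}"
      then have "\<tau> n \<le> \<tau> k" by (intro decreasing) auto
      then have "\<tau> n / 2 / \<tau> k \<le> 1 / 2" using \<tau>p[of k] by (simp add: divide_simps)
      then show "d k y * cutoff (\<tau> n / 2 / \<tau> k) = d k y" by (simp add: cutoff_bounds(3))
    qed
    also have "\<dots> = G n y" unfolding d_def by (rule difsum)
    finally show ?thesis .
  qed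
  have z: "zrep half_space f (\<lambda>x. indicator half_space x * f x)"
    using continuous_half_space_borel[OF fc] by (auto simp: zrep_def)
  show ?thesis
  proof (rule etr_rep_classical_limit[OF fc Dc der ffin Dfin, where d = "\<lambda>k. \<tau> (s k) / 2"])
    show "0 < \<tau> (s k) / 2" for k using \<tau>p by simp
    show "\<tau> (s k) / 2 < 1" for k
    proof -
      have "\<tau> (s k) \<le> (1 / 2) ^ s k * (1 / (1 + c (s k)))" by (rule \<tau>le)
      also have "\<dots> \<le> 1 * 1" using cnn[of "s k"] by (intro mult_mono) (auto simp: power_le_one divide_simps)
      finally show ?thesis by simp
    qed
    have "(\<lambda>k. \<tau> (s k)) \<longlonglongrightarrow> 0" using LIMSEQ_subseq_LIMSEQ[OF tendsto_0 s(1)] by (simp add: comp_def)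
    then show "(\<lambda>k. \<tau> (s k) / 2) \<longlonglongrightarrow> 0" using tendsto_divide[OF _ tendsto_const, of _ 0 _ "2::real"] by simp
    show "AE y in lborel. (\<lambda>k. f (y, \<tau> (s k) / 2)) \<longlonglongrightarrow> g y"
      unfolding fG using s(2) by (simp add: LIM_zero_iff)
    show "f \<in> W1p half_space 1 \<Longrightarrow> f \<in> W1p half_space 1 \<inter> Lp half_space q"
      using Lp_iff_zrep[OF half_space_borel z] ffinq by simp
  qed auto
qed

section \<open>Radial powers\<close>

text \<open>
  \<open>norm x powr - \<beta>\<close> is \<open>\<beta>\<close> times the integral of \<open>r powr - (\<beta> + 1)\<close> over \<open>r > norm x\<close>, and by
  Tonelli the volume of balls reduces the claim to powers of one variable.
\<close>

lemma radial_power_integrable: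
  assumes b: "0 < \<beta>" "\<beta> < real DIM('a::euclidean_space)"
  shows "(\<integral>\<^sup>+x. ennreal (norm (x::'a) powr - \<beta>) * indicator (ball 0 1) x \<partial>lborel) < \<infinity>"
proof -
  let ?m = "DIM('a)"
  define w where "w = unit_ball_vol (real ?m)"
  have w: "w \<ge> 0" by (simp add: w_def)
  define W where "W = (\<lambda>r (x::'a). ennreal (r powr - (\<beta> + 1)) * (indicator {z::real \<times> 'a. norm (snd z) < fst z \<and> norm (snd z) < 1} (r, x)))"
  have Wm: "(\<lambda>(r, x). W r x) \<in> borel_measurable (lborel \<Otimes>\<^sub>M lborel)" unfolding W_def by measurable
  have "(\<integral>\<^sup>+x. ennreal (norm (x::'a) powr - \<beta>) * indicator (ball 0 1) x \<partial>lborel) = (\<integral>\<^sup>+x. ennreal \<beta> * (\<integral>\<^sup>+r. W r x \<partial>lborel) \<partial>lborel)"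
  proof (rule nn_integral_cong_AE)
    show "AE x in lborel. ennreal (norm x powr - \<beta>) * indicator (ball 0 1) (x::'a) = ennreal \<beta> * (\<integral>\<^sup>+r. W r x \<partial>lborel)"
      using AE_lborel_singleton[of "0::'a"]
    proof eventually_elim
      case (elim x)
      have "(\<integral>\<^sup>+r. W r x \<partial>lborel) = (\<integral>\<^sup>+r. ennreal (r powr - (\<beta> + 1)) * indicator {norm x<..} r * indicator (ball 0 1) x \<partial>lborel)"
        unfolding W_def by (intro nn_integral_cong) (auto simp: indicator_def)
      also have "\<dots> = (\<integral>\<^sup>+r. ennreal (r powr - (\<beta> + 1)) * indicator {norm x<..} r \<partial>lborel) * indicator (ball 0 1) x"
        by (rule nn_integral_multc) measurable
      also have "(\<integral>\<^sup>+r. ennreal (r powr - (\<beta> + 1)) * indicator {norm x<..} r \<partial>lborel) = ennreal (norm x powr (1 - (\<beta> + 1)) / (\<beta> + 1 - 1))"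
        by (rule nn_integral_powr_tail) (use elim b in auto)
      finally have "ennreal \<beta> * (\<integral>\<^sup>+r. W r x \<partial>lborel) = (ennreal \<beta> * ennreal (norm x powr - \<beta> / \<beta>)) * indicator (ball 0 1) x"
        by (simp add: mult.assoc)
      also have "ennreal \<beta> * ennreal (norm x powr - \<beta> / \<beta>) = ennreal (norm x powr - \<beta>)"
        using b by (simp add: ennreal_mult[symmetric])
      finally show ?case by simp
    qed
  qed
  also have "\<dots> = ennreal \<beta> * (\<integral>\<^sup>+x. \<integral>\<^sup>+r. W r x \<partial>lborel \<partial>lborel)"
  proof (rule nn_integral_cmult)
    show "(\<lambda>x. \<integral>\<^sup>+r. W r x \<partial>lborel) \<in> borel_measurable lborel" unfolding W_def by measurable
  qed
  also have "(\<integral>\<^sup>+x. \<integral>\<^sup>+r. W r x \<partial>lborel \<partial>lborel) = (\<integral>\<^sup>+r. \<integral>\<^sup>+x. W r x \<partial>lborel \<partial>lborel)"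
    by (rule lborel_pair.Fubini'[OF Wm])
  also have "\<dots> \<le> (\<integral>\<^sup>+r. ennreal w * (ennreal (r powr (real ?m - \<beta> - 1)) * indicator {0<..<2} r) + ennreal w * (ennreal (r powr - (\<beta> + 1)) * indicator {1<..} r) \<partial>lborel)"
  proof (rule nn_integral_mono)
    fix r :: real
    show "(\<integral>\<^sup>+x. W r x \<partial>lborel) \<le> ennreal w * (ennreal (r powr (real ?m - \<beta> - 1)) * indicator {0<..<2} r) + ennreal w * (ennreal (r powr - (\<beta> + 1)) * indicator {1<..} r)"
    proof (cases "r > 0")
      case r: True
      have "(\<integral>\<^sup>+x. W r x \<partial>lborel) = (\<integral>\<^sup>+x. ennreal (r powr - (\<beta> + 1)) * indicator (ball (0::'a) (min r 1)) x \<partial>lborel)"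
        unfolding W_def by (intro nn_integral_cong) (auto simp: indicator_def)
      also have "\<dots> = ennreal (r powr - (\<beta> + 1)) * ennreal (w * min r 1 ^ ?m)"
        using r by (subst nn_integral_cmult_indicator) (auto simp: emeasure_ball w_def)
      also have "\<dots> \<le> ennreal w * (ennreal (r powr (real ?m - \<beta> - 1)) * indicator {0<..<2} r) + ennreal w * (ennreal (r powr - (\<beta> + 1)) * indicator {1<..} r)"
      proof (cases "r \<le> 1")
        case True
        have "r powr - (\<beta> + 1) * (w * r ^ ?m) = w * r powr (real ?m - \<beta> - 1)"
        proof -
          have "r powr - (\<beta> + 1) * r powr real ?m = r powr (- (\<beta> + 1) + real ?m)" by (rule powr_add[symmetric])
          also have "- (\<beta> + 1) + real ?m = real ?m - \<beta> - 1" by simp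
          finally show ?thesis using r by (simp add: powr_realpow)
        qed
        then have "ennreal (r powr - (\<beta> + 1)) * ennreal (w * r ^ ?m) = ennreal w * ennreal (r powr (real ?m - \<beta> - 1))"
          using r w by (simp add: ennreal_mult[symmetric])
        then show ?thesis using r True by (simp add: min_def)
      next
        case False
        then show ?thesis by (simp add: min_def mult.commute add_increasing)
      qed
      finally show ?thesis .
    next
      case False
      then have "W r x = 0" for x unfolding W_def using order_le_less_trans[OF norm_ge_zero, of x r] by (auto simp: indicator_def)
      then show ?thesis by simp
    qed
  qed
  also have "\<dots> = ennreal w * ennreal (2 powr (real ?m - \<beta> - 1 + 1) / (real ?m - \<beta> - 1 + 1)) + ennreal w * ennreal (1 powr (1 - (\<beta> + 1)) / (\<beta> + 1 - 1))"
  proof (subst nn_integral_add)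
    have 1: "(\<integral>\<^sup>+r. ennreal (r powr (real ?m - \<beta> - 1)) * indicator {0<..<2} r \<partial>lborel) = ennreal (2 powr (real ?m - \<beta> - 1 + 1) / (real ?m - \<beta> - 1 + 1))"
      by (rule nn_integral_powr_head) (use b in auto)
    have 2: "(\<integral>\<^sup>+r. ennreal (r powr - (\<beta> + 1)) * indicator {1<..} r \<partial>lborel) = ennreal (1 powr (1 - (\<beta> + 1)) / (\<beta> + 1 - 1))"
      by (rule nn_integral_powr_tail) (use b in auto)
    have 3: "(\<integral>\<^sup>+r. ennreal w * (ennreal (r powr (real ?m - \<beta> - 1)) * indicator {0<..<2} r) \<partial>lborel) = ennreal w * (\<integral>\<^sup>+r. ennreal (r powr (real ?m - \<beta> - 1)) * indicator {0<..<2} r \<partial>lborel)"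
      by (rule nn_integral_cmult) measurable
    have 4: "(\<integral>\<^sup>+r. ennreal w * (ennreal (r powr - (\<beta> + 1)) * indicator {1<..} r) \<partial>lborel) = ennreal w * (\<integral>\<^sup>+r. ennreal (r powr - (\<beta> + 1)) * indicator {1<..} r \<partial>lborel)"
      by (rule nn_integral_cmult) measurable
    show "(\<integral>\<^sup>+r. ennreal w * (ennreal (r powr (real ?m - \<beta> - 1)) * indicator {0<..<2} r) \<partial>lborel) + (\<integral>\<^sup>+r. ennreal w * (ennreal (r powr - (\<beta> + 1)) * indicator {1<..} r) \<partial>lborel) =
      ennreal w * ennreal (2 powr (real ?m - \<beta> - 1 + 1) / (real ?m - \<beta> - 1 + 1)) + ennreal w * ennreal (1 powr (1 - (\<beta> + 1)) / (\<beta> + 1 - 1))"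
      unfolding 1 2 3 4 by (rule refl)
  qed measurable
  finally have "(\<integral>\<^sup>+x. ennreal (norm (x::'a) powr - \<beta>) * indicator (ball 0 1) x \<partial>lborel) \<le> ennreal \<beta> * (ennreal w * ennreal (2 powr (real ?m - \<beta> - 1 + 1) / (real ?m - \<beta> - 1 + 1)) + ennreal w * ennreal (1 powr (1 - (\<beta> + 1)) / (\<beta> + 1 - 1)))"
    by (simp add: mult_left_mono)
  also have "\<dots> < \<infinity>" by (simp add: ennreal_mult_less_top)
  finally show ?thesis .
qed

text \<open>
  The integral is invariant under dilations. If it were finite, its part over the annulus between
  the radii \<open>1/4\<close> and \<open>1/2\<close> would be \<open>0\<close>.
\<close>

lemma critical_radial_power_infinite:
  "(\<integral>\<^sup>+y. ennreal (norm (y::'a::euclidean_space) powr - real DIM('a)) * indicator (ball 0 (1 / 2)) y \<partial>lborel) = \<infinity>"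
proof (rule ccontr)
  let ?m = "DIM('a)"
  define F where "F = (\<lambda>R (y::'a). ennreal (norm y powr - real ?m) * indicator (ball 0 R) y)"
  have indm: "(indicator (ball (0::'a) R) :: 'a \<Rightarrow> ennreal) \<in> borel_measurable borel" for R by (rule borel_measurable_indicator) auto
  have Fm [measurable]: "F R \<in> borel_measurable borel" for R unfolding F_def by (intro borel_measurable_times_ennreal indm) measurable
  assume "(\<integral>\<^sup>+y. ennreal (norm (y::'a) powr - real ?m) * indicator (ball 0 (1 / 2)) y \<partial>lborel) \<noteq> \<infinity>"
  then have fin: "(\<integral>\<^sup>+y. F (1/2) y \<partial>lborel) \<noteq> \<infinity>" by (simp add: F_def)
  have "(\<integral>\<^sup>+y. F (1/4) (0 + (1/2) *\<^sub>R y) \<partial>lborel) = ennreal (1 / (1/2) ^ ?m) * (\<integral>\<^sup>+y. F (1/4) y \<partial>lborel)"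
    by (rule nn_integral_scale) auto
  moreover have "F (1/4) (0 + (1/2) *\<^sub>R y) = ennreal (1 / (1/2) ^ ?m) * F (1/2) y" for y
  proof -
    have "(norm y / 2) powr - real ?m = 2 ^ ?m * norm y powr - real ?m"
      by (simp add: powr_divide powr_minus powr_realpow divide_simps)
    then have "ennreal ((norm y / 2) powr - real ?m) = ennreal (2 ^ ?m) * ennreal (norm y powr - real ?m)" by (simp add: ennreal_mult)
    then show ?thesis by (auto simp: F_def indicator_def power_one_over)
  qed
  ultimately have "ennreal (1 / (1/2) ^ ?m) * (\<integral>\<^sup>+y. F (1/2) y \<partial>lborel) = ennreal (1 / (1/2) ^ ?m) * (\<integral>\<^sup>+y. F (1/4) y \<partial>lborel)"
    by (simp add: nn_integral_cmult)
  then have eq: "(\<integral>\<^sup>+y. F (1/2) y \<partial>lborel) = (\<integral>\<^sup>+y. F (1/4) y \<partial>lborel)"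
    by (subst (asm) ennreal_mult_cancel_left) auto
  let ?A = "ball (0::'a) (1/2) - ball 0 (1/4)"
  have "(\<integral>\<^sup>+y. F (1/2) y \<partial>lborel) = (\<integral>\<^sup>+y. F (1/4) y + F (1/2) y * indicator ?A y \<partial>lborel)"
    by (intro nn_integral_cong) (auto simp: F_def indicator_def)
  also have "\<dots> = (\<integral>\<^sup>+y. F (1/4) y \<partial>lborel) + (\<integral>\<^sup>+y. F (1/2) y * indicator ?A y \<partial>lborel)"
    by (rule nn_integral_add) (auto intro!: borel_measurable_times_ennreal borel_measurable_indicator)
  finally have "(\<integral>\<^sup>+y. F (1/2) y * indicator ?A y \<partial>lborel) = 0"
    using fin unfolding eq[symmetric] by (metis add.right_neutral ennreal_add_left_cancel infinity_ennreal_def)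
  then have "AE y in lborel. F (1/2) y * indicator ?A y = 0"
    by (subst (asm) nn_integral_0_iff_AE) (auto intro!: borel_measurable_times_ennreal borel_measurable_indicator)
  then have "AE y in lborel. y \<notin> ?A"
    by eventually_elim (auto simp: F_def indicator_def split: if_splits)
  then have "emeasure lborel ?A = 0"
    by (subst (asm) AE_iff_measurable[of ?A]) auto
  moreover have "emeasure lborel ?A = emeasure lborel (ball (0::'a) (1/2)) - emeasure lborel (ball (0::'a) (1/4))"
    by (rule emeasure_Diff) (auto simp: emeasure_ball)
  moreover have "emeasure lborel (ball (0::'a) (1/4)) < emeasure lborel (ball (0::'a) (1/2))"
  proof -
    have "(1 / 4 :: real) ^ ?m < (1 / 2) ^ ?m" by (rule power_strict_mono) auto
    then have "unit_ball_vol (real ?m) * (1 / 4) ^ ?m < unit_ball_vol (real ?m) * (1 / 2) ^ ?m"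
      using unit_ball_vol_pos[of "real ?m"] by (intro mult_strict_left_mono) auto
    then show ?thesis by (simp add: emeasure_ball ennreal_less_iff)
  qed
  ultimately show False by (auto simp: diff_eq_0_iff_ennreal)
qed

section \<open>A trace that is not integrable enough\<close>

text \<open>
  For \<open>s = x \<bullet> x\<close> this is \<open>norm x powr - \<alpha>\<close> near the origin. As a function of the square it is
  handled by the chain rule in any dimension, and \<open>spike'\<close> is its derivative.
\<close>

definition spike :: "real \<Rightarrow> real \<Rightarrow> real" where "spike \<alpha> s = cutoff s * s powr (- \<alpha> / 2)"

definition spike' :: "real \<Rightarrow> real \<Rightarrow> real" where
  "spike' \<alpha> s = cutoff' s * s powr (- \<alpha> / 2) + cutoff s * ((- \<alpha> / 2) * s powr (- \<alpha> / 2 - 1))"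

lemma DERIV_spike: "s > 0 \<Longrightarrow> (spike \<alpha> has_real_derivative spike' \<alpha> s) (at s)"
  unfolding spike_def[abs_def] spike'_def
  by (rule DERIV_cong[OF DERIV_mult[OF DERIV_cutoff has_real_derivative_powr]]) (auto simp: mult.commute)

lemma spike_bounds:
  assumes s: "s > 0" and a: "\<alpha> > 0"
  shows "\<bar>spike \<alpha> s\<bar> \<le> s powr (- \<alpha> / 2) * indicator {0<..<1} s"
    "\<bar>spike' \<alpha> s\<bar> \<le> (8 + \<alpha>) * s powr (- \<alpha> / 2 - 1) * indicator {0<..<1} s"
proof -
  show "\<bar>spike \<alpha> s\<bar> \<le> s powr (- \<alpha> / 2) * indicator {0<..<1} s"
    using mult_right_mono[OF cutoff_le_indicator(1)[OF s], of "s powr (- \<alpha> / 2)"] by (simp add: spike_def abs_mult mult.commute)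
  show "\<bar>spike' \<alpha> s\<bar> \<le> (8 + \<alpha>) * s powr (- \<alpha> / 2 - 1) * indicator {0<..<1} s"
  proof (cases "s < 1")
    case True
    have "s powr (- \<alpha> / 2) = s powr (- \<alpha> / 2 - 1) * s" using s by (simp add: powr_diff)
    also have "\<dots> \<le> s powr (- \<alpha> / 2 - 1) * 1" using True s by (intro mult_left_mono) auto
    finally have 1: "s powr (- \<alpha> / 2) \<le> s powr (- \<alpha> / 2 - 1)" by simp
    have 2: "\<bar>cutoff' s * s powr (- \<alpha> / 2)\<bar> \<le> 8 * s powr (- \<alpha> / 2 - 1)"
      unfolding abs_mult using 1 cutoff_bounds(5)[of s] by (intro mult_mono) auto
    have "\<bar>cutoff s * ((- \<alpha> / 2) * s powr (- \<alpha> / 2 - 1))\<bar> = cutoff s * (\<alpha> / 2 * s powr (- \<alpha> / 2 - 1))"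
      using a cutoff_bounds(1)[of s] by (simp add: abs_mult)
    also have "\<dots> \<le> 1 * (\<alpha> * s powr (- \<alpha> / 2 - 1))"
      using a cutoff_bounds(1,2)[of s] by (intro mult_mono) auto
    finally have 3: "\<bar>cutoff s * ((- \<alpha> / 2) * s powr (- \<alpha> / 2 - 1))\<bar> \<le> \<alpha> * s powr (- \<alpha> / 2 - 1)" by simp
    have "\<bar>spike' \<alpha> s\<bar> \<le> 8 * s powr (- \<alpha> / 2 - 1) + \<alpha> * s powr (- \<alpha> / 2 - 1)"
      unfolding spike'_def by (rule order_trans[OF abs_triangle_ineq add_mono[OF 2 3]])
    then show ?thesis using True s by (simp add: distrib_right)
  next
    case False
    then show ?thesis using cutoff_bounds(4,6)[of s] by (simp add: spike'_def)
  qed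
qed

lemma radial_mass_finite:
  fixes V :: "'b::euclidean_space \<Rightarrow> real"
  assumes V: "\<And>x. x \<noteq> 0 \<Longrightarrow> \<bar>V x\<bar> \<le> K * norm x powr - \<gamma> * indicator (ball 0 1) x" and p: "p > 0" and K: "K \<ge> 0"
    and g: "\<gamma> > 0" "\<gamma> * p < real DIM('b)"
  shows "pmass p V < \<infinity>"
proof -
  have "pmass p V \<le> (\<integral>\<^sup>+x. ennreal (K powr p) * (ennreal (norm (x::'b) powr - (\<gamma> * p)) * indicator (ball 0 1) x) \<partial>lborel)"
    unfolding Lp_mass_def
  proof (rule nn_integral_mono_AE)
    show "AE x in lborel. ennreal (\<bar>V x\<bar> powr p) \<le> ennreal (K powr p) * (ennreal (norm x powr - (\<gamma> * p)) * indicator (ball 0 1) x)"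
      using AE_lborel_singleton[of "0::'b"]
    proof eventually_elim
      case (elim x)
      have "\<bar>V x\<bar> powr p \<le> (K * norm x powr - \<gamma> * indicator (ball 0 1) x) powr p" using V[OF elim] p by (intro powr_mono2) auto
      also have "\<dots> = K powr p * (norm x powr - (\<gamma> * p)) * indicator (ball 0 1) x"
        using K p by (auto simp: powr_mult powr_powr indicator_def)
      finally have "ennreal (\<bar>V x\<bar> powr p) \<le> ennreal (K powr p * (norm x powr - (\<gamma> * p)) * indicator (ball 0 1) x)" by (rule ennreal_leI)
      then show ?case by (auto simp: ennreal_mult indicator_def split: if_splits)
    qed
  qed
  also have "\<dots> = ennreal (K powr p) * (\<integral>\<^sup>+x. ennreal (norm (x::'b) powr - (\<gamma> * p)) * indicator (ball 0 1) x \<partial>lborel)"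
  proof (rule nn_integral_cmult)
    have "(indicator (ball (0::'b) 1) :: 'b \<Rightarrow> ennreal) \<in> borel_measurable borel" by (rule borel_measurable_indicator) auto
    then show "(\<lambda>x::'b. ennreal (norm x powr - (\<gamma> * p)) * indicator (ball 0 1) x) \<in> borel_measurable lborel" by measurable
  qed
  also have "\<dots> < \<infinity>"
    using radial_power_integrable[of "\<gamma> * p", where 'a = 'b] p g by (simp add: ennreal_mult_less_top)
  finally show ?thesis .
qed

lemma norm_powr_square: "x \<noteq> 0 \<Longrightarrow> (x \<bullet> x) powr a = norm (x :: 'b::euclidean_space) powr (2 * a)"
  using powr_powr[of "norm x" 2 a] by (simp add: dot_square_norm)

lemma square_less_1_iff: "x \<bullet> x < 1 \<longleftrightarrow> (x :: 'b::euclidean_space) \<in> ball 0 1"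
  unfolding dot_square_norm by (simp add: abs_square_less_1)

text \<open>
  The gradient of \<open>norm x powr - \<alpha>\<close> is of size \<open>norm x powr - (\<alpha> + 1)\<close>, whose \<open>p\<close>-th power is
  integrable near the origin of a space of dimension \<open>DIM('a) + 1\<close>. Away from the origin the
  function is continuous up to the boundary.
\<close>

lemma spike_trace:
  fixes p \<alpha> :: real
  assumes p: "p > 1" and a: "\<alpha> > 0" "(\<alpha> + 1) * p < real DIM('a::euclidean_space) + 1"
  shows "(\<lambda>y::'a. spike \<alpha> (y \<bullet> y)) \<in> trace_image p (W1p half_space p)"
proof -
  define f where "f = (\<lambda>x::'a \<times> real. spike \<alpha> (x \<bullet> x))"
  define D where "D = (\<lambda>e x::'a \<times> real. spike' \<alpha> (x \<bullet> x) * (2 * (x \<bullet> e)))"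
  have nz: "x \<noteq> 0" "x \<bullet> x > 0" if "x \<in> half_space" for x :: "'a \<times> real" using that by (auto simp: half_space_iff)
  note cc = continuous_on_cutoff
  have cs: "continuous_on {0<..} (spike \<alpha>)" "continuous_on {0<..} (spike' \<alpha>)"
    unfolding spike_def[abs_def] spike'_def[abs_def]
    by (intro continuous_intros continuous_on_subset[OF cc(1)] continuous_on_subset[OF cc(2)]; auto)+
  have fc: "continuous_on (- {0}) f"
    unfolding f_def
  proof (rule continuous_on_compose2[OF cs(1)])
    show "(\<lambda>x::'a \<times> real. x \<bullet> x) ` (- {0}) \<subseteq> {0<..}" by (simp only: image_subset_iff Compl_iff singleton_iff greaterThan_iff inner_gt_zero_iff) simp
  qed (intro continuous_intros)
  have sub: "(half_space :: ('a \<times> real) set) \<subseteq> - {0}" using nz(1) by blast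
  have Dc: "continuous_on half_space (D e)" for e
    unfolding D_def
  proof (intro continuous_intros continuous_on_compose2[OF cs(2)])
    show "(\<lambda>x::'a \<times> real. x \<bullet> x) ` half_space \<subseteq> {0<..}" using nz(2) by (simp only: image_subset_iff greaterThan_iff) blast
  qed
  have der: "((\<lambda>s. f (x + s *\<^sub>R e)) has_real_derivative D e x) (at 0)" if x: "x \<in> half_space" for x e
  proof -
    have "((\<lambda>s. (x + s *\<^sub>R e) \<bullet> (x + s *\<^sub>R e)) has_real_derivative 2 * (x \<bullet> e)) (at 0)"
    proof -
      have e: "(x + s *\<^sub>R e) \<bullet> (x + s *\<^sub>R e) = x \<bullet> x + 2 * s * (x \<bullet> e) + s\<^sup>2 * (e \<bullet> e)" for s
        by (simp add: inner_add_left inner_add_right inner_commute[of e x] power2_eq_square algebra_simps del: inner_Pair)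
      show ?thesis unfolding e by (auto intro!: derivative_eq_intros)
    qed
    moreover have "(spike \<alpha> has_real_derivative spike' \<alpha> (x \<bullet> x)) (at ((x + 0 *\<^sub>R e) \<bullet> (x + 0 *\<^sub>R e)))"
      using DERIV_spike[OF nz(2)[OF x]] by simp
    ultimately show ?thesis unfolding f_def D_def by (rule DERIV_chain2[rotated])
  qed
  have ap: "\<alpha> * p < real DIM('a \<times> real)" "(\<alpha> + 1) * p < real DIM('a \<times> real)"
    using a p by (auto simp: distrib_right)
  have ind: "indicator {0<..<1} (x \<bullet> x) = (indicator (ball 0 1) x :: real)" if "x \<noteq> 0" for x :: "'a \<times> real"
    using that square_less_1_iff[of x] by (simp add: indicator_def)
  have ffin: "pmass p (\<lambda>x. indicator half_space x * f x) < \<infinity>"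
  proof (rule radial_mass_finite[of _ 1 \<alpha>])
    fix x :: "'a \<times> real" assume x: "x \<noteq> 0"
    have "\<bar>f x\<bar> \<le> (x \<bullet> x) powr (- \<alpha> / 2) * indicator {0<..<1} (x \<bullet> x)"
      unfolding f_def by (rule spike_bounds(1)) (use x a in auto)
    also have "\<dots> = norm x powr - \<alpha> * indicator (ball 0 1) x" unfolding ind[OF x] norm_powr_square[OF x] by simp
    finally have "\<bar>f x\<bar> \<le> norm x powr - \<alpha> * indicator (ball 0 1) x" .
    then show "\<bar>indicator half_space x * f x\<bar> \<le> 1 * norm x powr - \<alpha> * indicator (ball 0 1) x"
      by (cases "x \<in> half_space") auto
  qed (use p a ap in auto)
  have Dfin: "pmass p (\<lambda>x. indicator half_space x * D e x) < \<infinity>" if e: "e \<in> Basis" for e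
  proof (rule radial_mass_finite[of _ "2 * (8 + \<alpha>)" "\<alpha> + 1"])
    fix x :: "'a \<times> real" assume x: "x \<noteq> 0"
    have "\<bar>D e x\<bar> \<le> ((8 + \<alpha>) * (x \<bullet> x) powr (- \<alpha> / 2 - 1) * indicator {0<..<1} (x \<bullet> x)) * (2 * norm x)"
      unfolding D_def abs_mult using spike_bounds(2)[of "x \<bullet> x" \<alpha>] x a Basis_le_norm[OF e, of x] by (intro mult_mono) auto
    also have "\<dots> = 2 * (8 + \<alpha>) * (norm x powr (2 * (- \<alpha> / 2 - 1)) * norm x) * indicator (ball 0 1) x"
      unfolding ind[OF x] norm_powr_square[OF x] by simp
    also have "norm x powr (2 * (- \<alpha> / 2 - 1)) * norm x = norm x powr - (\<alpha> + 1)"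
    proof -
      have "norm x powr (2 * (- \<alpha> / 2 - 1)) * norm x powr 1 = norm x powr (2 * (- \<alpha> / 2 - 1) + 1)" by (rule powr_add[symmetric])
      then show ?thesis using x by (simp add: algebra_simps)
    qed
    finally show "\<bar>indicator half_space x * D e x\<bar> \<le> 2 * (8 + \<alpha>) * norm x powr - (\<alpha> + 1) * indicator (ball 0 1) x"
      using a by (cases "x \<in> half_space") auto
  qed (use p a ap in auto)
  define d where "d = (\<lambda>k. 1 / (real k + 2))"
  have d0: "d \<longlonglongrightarrow> 0"
    using LIMSEQ_ignore_initial_segment[OF lim_1_over_n, of 2] by (simp add: d_def add.commute)
  have p1: "p \<ge> 1" using p by simp
  show ?thesis
  proof (rule etr_rep_classical_limit[OF continuous_on_subset[OF fc sub] Dc der ffin Dfin p1 _ _ d0])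
    show "0 < d k" "d k < 1" for k by (auto simp: d_def)
    show "AE y in lborel. (\<lambda>k. f (y, d k)) \<longlonglongrightarrow> spike \<alpha> (y \<bullet> y)"
      using AE_lborel_singleton[of "0::'a"]
    proof eventually_elim
      case (elim y)
      have "isCont f (y, 0)"
        using fc elim by (auto simp: continuous_on_eq_continuous_at open_Compl prod_eq_iff)
      moreover have "(\<lambda>k. (y, d k)) \<longlonglongrightarrow> (y, 0)" by (intro tendsto_Pair tendsto_const d0)
      ultimately have "(\<lambda>k. f (y, d k)) \<longlonglongrightarrow> f (y, 0)" by (rule isCont_tendsto_compose)
      then show ?case by (simp add: f_def)
    qed
  qed auto
qed

text \<open>For this exponent the \<open>r\<close>-th power is \<open>norm y powr - DIM('a)\<close> near the origin.\<close>

lemma spike_not_Lr: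
  fixes r :: real
  assumes r: "r > 0"
  shows "pmass r (\<lambda>y::'a::euclidean_space. spike (real DIM('a) / r) (y \<bullet> y)) = \<infinity>"
proof -
  let ?m = "real DIM('a)"
  have "(\<integral>\<^sup>+y. ennreal (norm (y::'a) powr - ?m) * indicator (ball 0 (1 / 2)) y \<partial>lborel) \<le> pmass r (\<lambda>y::'a. spike (?m / r) (y \<bullet> y))"
    unfolding Lp_mass_def
  proof (rule nn_integral_mono_AE)
    show "AE y in lborel. ennreal (norm (y::'a) powr - ?m) * indicator (ball 0 (1 / 2)) y \<le> ennreal (\<bar>spike (?m / r) (y \<bullet> y)\<bar> powr r)"
      using AE_lborel_singleton[of "0::'a"]
    proof eventually_elim
      case (elim y)
      show ?case
      proof (cases "y \<in> ball 0 (1 / 2)")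
        case True
        have "norm y * norm y \<le> 1 / 2 * 1" using True by (intro mult_mono) auto
        then have "cutoff (y \<bullet> y) = 1" by (intro cutoff_bounds(3)) (simp add: dot_square_norm power2_eq_square)
        then have "spike (?m / r) (y \<bullet> y) = norm y powr - (?m / r)"
          unfolding spike_def norm_powr_square[OF elim] by simp
        then have "\<bar>spike (?m / r) (y \<bullet> y)\<bar> powr r = norm y powr - ?m" using r by (simp add: powr_powr)
        then show ?thesis by (simp add: indicator_def)
      qed simp
    qed
  qed
  then show ?thesis unfolding critical_radial_power_infinite by (simp add: top.extremum_unique)
qed

section \<open>The theorem\<close>

lemma trace_image_mono: "X \<subseteq> Y \<Longrightarrow> trace_image p X \<subseteq> trace_image p Y"
  unfolding trace_image_def by blast

lemma trace_image_lincomb: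
  assumes p: "p \<ge> 1" and X: "X \<subseteq> W1p half_space p"
    and cl: "\<And>u v c d. u \<in> X \<Longrightarrow> v \<in> X \<Longrightarrow> (\<lambda>x. c * u x + d * v x) \<in> X"
    and g: "g \<in> trace_image p X" "h \<in> trace_image p X"
  shows "(\<lambda>y. c * g y + d * h y) \<in> trace_image p X"
proof -
  obtain u u' D where u: "u \<in> X" "W1p_rep half_space p u u' D" "AE y in lborel. g y = etr u' (D (0, 1)) y"
    using g(1) unfolding trace_image_iff[OF p X] by blast
  obtain v v' E where v: "v \<in> X" "W1p_rep half_space p v v' E" "AE y in lborel. h y = etr v' (E (0, 1)) y"
    using g(2) unfolding trace_image_iff[OF p X] by blast
  note U = W1p_repD[OF u(2)] and V = W1p_repD[OF v(2)]
  have "AE y in lborel. etr (\<lambda>x. c * u' x + d * v' x) (\<lambda>x. c * D (0, 1) x + d * E (0, 1) x) y = c * etr u' (D (0, 1)) y + d * etr v' (E (0, 1)) y"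
    by (rule etr_lincomb[OF U(2) U(5)[OF vertical_Basis] V(2) V(5)[OF vertical_Basis] U(4) U(7)[OF vertical_Basis] V(4) V(7)[OF vertical_Basis] p])
  with u(3) v(3) have ae: "AE y in lborel. c * g y + d * h y = etr (\<lambda>x. c * u' x + d * v' x) (\<lambda>x. c * D (0, 1) x + d * E (0, 1) x) y"
    by eventually_elim simp
  show ?thesis
    unfolding trace_image_iff[OF p X]
    by (rule bexI[OF _ cl[OF u(1) v(1)]], rule exI, rule exI, rule conjI[OF W1p_rep_lincomb[OF u(2) v(2) p]]) (rule ae)
qed

lemma Lp_lincomb:
  assumes "S \<in> sets borel" "u \<in> Lp S q" "v \<in> Lp S q" "q \<ge> 0"
  shows "(\<lambda>x. c * u x + d * v x) \<in> Lp S q"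
proof -
  obtain u' where u': "zrep S u u'" "pmass q u' < \<infinity>" using Lp_obtain_zrep[OF assms(1,2)] .
  obtain v' where v': "zrep S v v'" "pmass q v' < \<infinity>" using Lp_obtain_zrep[OF assms(1,3)] .
  have [measurable]: "u' \<in> borel_measurable borel" "v' \<in> borel_measurable borel" using zrepD(1) u' v' by auto
  have "pmass q (\<lambda>x. c * u' x + d * v' x) \<le> ennreal (2 powr q) * (pmass q (\<lambda>x. c * u' x) + pmass q (\<lambda>x. d * v' x))"
    by (rule Lp_mass_add) (use assms in auto)
  also have "\<dots> < \<infinity>" using u' v' by (simp add: Lp_mass_scale ennreal_mult_less_top)
  finally show ?thesis
    using Lp_iff_zrep[OF assms(1) zrep_add(1)[OF zrep_cmult[OF u'(1)] zrep_cmult[OF v'(1)]]] by simp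
qed

lemma W1p_lincomb:
  assumes "u \<in> W1p half_space p" "v \<in> W1p half_space p" "p \<ge> 1"
  shows "(\<lambda>x. c * u x + d * v x) \<in> W1p (half_space :: ('a::euclidean_space \<times> real) set) p"
proof -
  obtain u' D where u: "W1p_rep half_space p u u' D" using W1p_obtain_rep[OF assms(1) half_space_borel] .
  obtain v' E where v: "W1p_rep half_space p v v' E" using W1p_obtain_rep[OF assms(2) half_space_borel] .
  show ?thesis by (rule W1p_rep_W1p[OF W1p_rep_lincomb[OF u v assms(3)] half_space_borel assms(3)])
qed

lemma zero_W1p_rep: "W1p_rep S p (\<lambda>x. 0) (\<lambda>x. 0) (\<lambda>b x. 0)"
  by (auto simp: W1p_rep_def zrep_def weakd_def Lp_mass_def)

lemma trace_image_W1p_Lq_subspace: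
  assumes p: "p \<ge> 1" and q: "q \<ge> 0"
  shows "fun_subspace (trace_image p (W1p half_space p \<inter> Lp half_space q) :: ('a::euclidean_space \<Rightarrow> real) set)"
proof -
  let ?X = "W1p (half_space :: ('a \<times> real) set) p \<inter> Lp half_space q"
  have X: "?X \<subseteq> W1p half_space p" by simp
  have cl: "(\<lambda>x. c * u x + d * v x) \<in> ?X" if "u \<in> ?X" "v \<in> ?X" for u v c d
    using that W1p_lincomb[OF _ _ p, of u v c d] Lp_lincomb[OF half_space_borel _ _ q, of u v c d] by auto
  note lc = trace_image_lincomb[OF p X cl]
  have m: "module (\<lambda>(c::real) f (x::'a). c * f x)"
    by unfold_locales (auto simp: algebra_simps fun_eq_iff)
  have zX: "(\<lambda>x. 0) \<in> ?X"
  proof -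
    have z: "zrep half_space (\<lambda>x::'a \<times> real. 0) (\<lambda>x. 0)" by (auto simp: zrep_def)
    show ?thesis
      using W1p_rep_W1p[OF zero_W1p_rep half_space_borel p] Lp_iff_zrep[OF half_space_borel z, of q] by (simp add: Lp_mass_def)
  qed
  have z: "0 \<in> trace_image p ?X"
    unfolding trace_image_iff[OF p X]
    by (rule bexI[OF _ zX], rule exI, rule exI, rule conjI[OF zero_W1p_rep]) (simp add: etr_def)
  show ?thesis
    unfolding module.subspace_def[OF m]
  proof (intro conjI ballI allI)
    show "0 \<in> trace_image p ?X" by (rule z)
  next
    fix g h assume gh: "g \<in> trace_image p ?X" "h \<in> trace_image p ?X"
    have "(\<lambda>y. 1 * g y + 1 * h y) \<in> trace_image p ?X" by (rule lc[OF _ _ gh])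
    then show "g + h \<in> trace_image p ?X" by (simp add: plus_fun_def)
  next
    fix c g assume g: "g \<in> trace_image p ?X"
    have "(\<lambda>y. c * g y + 0 * g y) \<in> trace_image p ?X" by (rule lc[OF _ _ g g])
    then show "(\<lambda>y. c * g y) \<in> trace_image p ?X" by simp
  qed
qed

text \<open>
  The hypothesis on \<open>q\<close> says that \<open>r > p * m / (n - p)\<close>, where \<open>m = DIM('a)\<close>; the spike with
  exponent \<open>\<alpha> = m / r\<close> is then a trace of a function in \<open>W\<close>, and not in \<open>L\<^sup>r\<close>.
\<close>

lemma trace_image_W1p_Lq_proper:
  fixes p q n :: real
  assumes n: "n = real DIM('a::euclidean_space) + 1" and p: "1 < p" "p < n" and q: "n * p / (n - p) < q"
  shows "trace_image p (W1p half_space p \<inter> Lp half_space q) \<subset> (trace_image p (W1p half_space p) :: ('a \<Rightarrow> real) set)"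
proof -
  let ?m = "real DIM('a)"
  have p1: "p \<ge> 1" using p by simp
  have np: "n - p > 0" using p by simp
  have m0: "?m > 0" by simp
  have qp: "q \<ge> p"
  proof -
    have "p * (n - p) \<le> n * p" using p by (simp add: algebra_simps)
    then have "p \<le> n * p / (n - p)" using np by (simp add: pos_le_divide_eq)
    then show ?thesis using q by simp
  qed
  define r where "r = 1 + q * (p - 1) / p"
  \<comment> \<open>The Sobolev trace exponent is the value of \<open>r\<close> at the critical \<open>q = n * p / (n - p)\<close>.\<close>
  have rbig: "p * ?m / (n - p) < r"
  proof -
    have "(n * p / (n - p)) * (p - 1) / p = n * (p - 1) / (n - p)" using p by simp
    moreover have "1 + n * (p - 1) / (n - p) = (n - p + n * (p - 1)) / (n - p)" using np by (simp add: add_divide_distrib)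
    moreover have "n - p + n * (p - 1) = p * ?m" using n by (simp add: algebra_simps)
    ultimately have "p * ?m / (n - p) = 1 + (n * p / (n - p)) * (p - 1) / p" by simp
    also have "\<dots> < 1 + q * (p - 1) / p"
      using q p by (intro add_strict_left_mono divide_strict_right_mono mult_strict_right_mono) auto
    finally show ?thesis by (simp add: r_def)
  qed
  have r0: "r > 0" using rbig p np m0 by (smt (verit) divide_nonneg_pos mult_nonneg_nonneg)
  define \<alpha> where "\<alpha> = ?m / r"
  have a0: "\<alpha> > 0" using r0 m0 by (simp add: \<alpha>_def)
  have "p * ?m < r * (n - p)" using rbig np by (simp add: pos_divide_less_eq)
  then have "\<alpha> * p < n - p" using r0 by (simp add: \<alpha>_def pos_divide_less_eq mult.commute)
  then have a1: "(\<alpha> + 1) * p < ?m + 1" using n by (simp add: distrib_right)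
  let ?g = "\<lambda>y::'a. spike \<alpha> (y \<bullet> y)"
  have gin: "?g \<in> trace_image p (W1p half_space p)" by (rule spike_trace[OF p(1) a0 a1])
  have X: "W1p half_space p \<inter> Lp half_space q \<subseteq> W1p (half_space :: ('a \<times> real) set) p" by simp
  have "?g \<notin> trace_image p (W1p half_space p \<inter> Lp half_space q)"
  proof
    assume "?g \<in> trace_image p (W1p half_space p \<inter> Lp half_space q)"
    then obtain u u' D where u: "u \<in> Lp half_space q" "W1p_rep half_space p u u' D" "AE y in lborel. ?g y = etr u' (D (0, 1)) y"
      unfolding trace_image_iff[OF p1 X] by blast
    have "pmass q u' < \<infinity>" using u(1) Lp_iff_zrep[OF half_space_borel W1p_repD(1)[OF u(2)]] by simp
    from trace_power_integrable[OF u(2) p(1) qp this r_def]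
    have "pmass r ?g < \<infinity>" unfolding Lp_mass_cong_AE[OF u(3)] .
    with spike_not_Lr[OF r0, where 'a = 'a] show False by (simp add: \<alpha>_def)
  qed
  with gin trace_image_mono[OF X, of p] show ?thesis by blast
qed

text \<open>The inclusions between \<open>L\<^sup>1\<close>, the smaller and the larger image form a cycle.\<close>

lemma trace_image_W11:
  fixes q :: real
  assumes q: "q \<ge> 1"
  shows "trace_image 1 (W1p half_space 1 \<inter> Lp half_space q) = (Lp UNIV 1 :: ('a::euclidean_space \<Rightarrow> real) set)"
    and "trace_image 1 (W1p half_space 1) = (Lp UNIV 1 :: ('a \<Rightarrow> real) set)"
proof -
  let ?X = "W1p (half_space :: ('a \<times> real) set) 1 \<inter> Lp half_space q"
  have X: "?X \<subseteq> W1p half_space 1" by simp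
  have 1: "Lp UNIV 1 \<subseteq> trace_image 1 ?X"
  proof
    fix g :: "'a \<Rightarrow> real" assume "g \<in> Lp UNIV 1"
    then obtain g' where g': "zrep UNIV g g'" "pmass 1 g' < \<infinity>" using Lp_obtain_zrep[of UNIV g 1] by auto
    have "g' \<in> trace_image 1 ?X" by (rule L1_extension[OF zrepD(1)[OF g'(1)] g'(2) q])
    then show "g \<in> trace_image 1 ?X"
      by (rule trace_image_cong_AE[OF _ _ X]) (use g'(1) in \<open>auto simp: zrep_def\<close>)
  qed
  have 2: "trace_image 1 (W1p half_space 1) \<subseteq> (Lp UNIV 1 :: ('a \<Rightarrow> real) set)"
  proof
    fix g :: "'a \<Rightarrow> real" assume "g \<in> trace_image 1 (W1p half_space 1)"
    then obtain u u' D where u: "W1p_rep half_space 1 u u' D" "AE y in lborel. g y = etr u' (D (0, 1)) y"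
      unfolding trace_image_iff[OF order_refl order_refl] by blast
    have "zrep UNIV g (etr u' (D (0, 1)))" using u(2) etr_rep_finite(1)[OF u(1) order_refl] by (simp add: zrep_def)
    then show "g \<in> Lp UNIV 1" using Lp_iff_zrep[of UNIV g _ 1] etr_rep_finite(2)[OF u(1) order_refl] by simp
  qed
  show "trace_image 1 ?X = Lp UNIV 1" "trace_image 1 (W1p half_space 1) = (Lp UNIV 1 :: ('a \<Rightarrow> real) set)"
    using 1 2 trace_image_mono[OF X, of 1] by auto
qed

theorem theorem1p4:
  fixes n :: nat
    and \<Omega> :: "((real ^ 'm) \<times> real) set"
  assumes n: "n = CARD('m) + 1"
    and \<Omega>: "\<Omega> = half_space"
  shows "(\<forall>q::real. 1 \<le> q \<longrightarrow>
            trace_image 1 (W1p \<Omega> 1 \<inter> Lp \<Omega> q) = trace_image 1 (W1p \<Omega> 1)) \<and>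
         trace_image 1 (W1p \<Omega> 1) = Lp UNIV 1 \<and>
         (\<forall>p::real. 1 < p \<and> p < real n \<longrightarrow>
            trace_image p (W1p \<Omega> p) = Wsp (1 - 1 / p) p \<and>
            (\<forall>q::real. real n * p / (real n - p) < q \<longrightarrow>
               fun_subspace (trace_image p (W1p \<Omega> p \<inter> Lp \<Omega> q)) \<and>
               trace_image p (W1p \<Omega> p \<inter> Lp \<Omega> q) \<subset> trace_image p (W1p \<Omega> p)))"
proof (intro conjI allI impI)
  have dim: "real n = real DIM(real ^ 'm) + 1" using n by simp
  show "trace_image 1 (W1p \<Omega> 1 \<inter> Lp \<Omega> q) = trace_image 1 (W1p \<Omega> 1)" if "1 \<le> q" for q
    unfolding \<Omega> by (simp only: trace_image_W11[OF that])
  show "trace_image 1 (W1p \<Omega> 1) = Lp UNIV 1"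
    unfolding \<Omega> by (rule trace_image_W11(2)[OF order_refl])
  fix p :: real assume p: "1 < p \<and> p < real n"
  show "trace_image p (W1p \<Omega> p) = Wsp (1 - 1 / p) p"
    unfolding \<Omega> by (rule trace_image_W1p_eq_Wsp) (use p in simp)
  fix q :: real assume q: "real n * p / (real n - p) < q"
  have "0 \<le> real n * p / (real n - p)" using p by simp
  with q have "0 \<le> q" by simp
  then show "fun_subspace (trace_image p (W1p \<Omega> p \<inter> Lp \<Omega> q))"
    unfolding \<Omega> using p by (intro trace_image_W1p_Lq_subspace) auto
  show "trace_image p (W1p \<Omega> p \<inter> Lp \<Omega> q) \<subset> trace_image p (W1p \<Omega> p)"
    unfolding \<Omega> by (rule trace_image_W1p_Lq_proper[OF dim]) (use p q in auto)
qed

end
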